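(* Let $F=\mathbf{C}$, let $G\subseteq GL(2,F)$ be a finite subgroup containing no pseudo-reflections, acting naturally on $A=F[x,y]$, and let $X=\operatorname{Spec}(A^G)$ be the corresponding 2-dimensional quotient singularity. Let $\rho:G\to GL(V)$ be a finite-dimensional representation over $F$ and let $W_\rho=(V\otimes_F A)^G$ be the associated maximal Cohen-Macaulay $A^G$-module. Then $c_1(W_\rho)=0$ in $\operatorname{H}^2(\mathbf{V}_{W_\rho}|_U,\mathcal{O}_U)$, where $U\subseteq X$ is the open subset where $W_\rho$ is locally free.
   Context: The group $G$ acts on $V\otimes_F A$ by $g(v\otimes a)=\rho(g)v\otimes ga$, and $W_\rho$ is the $A^G$-module of invariants. It is maximal Cohen-Macaulay over $A^G$, and by the McKay correspondence in dimension two the maximal Cohen-Macaulay modules on $A^G$ are those of this form. Let $B=A^G$ and $W$ a finitely presented $B$-module. Linear Lie-Rinehart algebra. $\mathbf{V}_W\subseteq\operatorname{Der}_F(B)$ is the kernel of the Kodaira-Spencer map $\operatorname{Der}_F(B)\to \operatorname{Ext}^1_B(W,W)=\operatorname{HH}^1(B,\operatorname{End}_F(W))$ sending $\delta$ to the class of the derivation $C(\delta)(b)(w)=\delta(b)w$ modulo the inner derivations $b\mapsto\varphi b-b\varphi$, $\varphi\in\operatorname{End}_F(W)$, where $(b\varphi)(w)=b\varphi(w)$ and $(\varphi b)(w)=\varphi(bw)$. It is a $B$-submodule and Lie subalgebra of $\operatorname{Der}_F(B)$. A $\mathbf{V}_W$-connection on $W$ is a $B$-linear map $\nabla:\mathbf{V}_W\to\operatorname{End}_F(W)$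 with $\nabla_\delta(bw)=b\nabla_\delta(w)+\delta(b)w$; its curvature is $R_\nabla(\delta\wedge\eta)=[\nabla_\delta,\nabla_\eta]-\nabla_{[\delta,\eta]}$. First Chern class. Let $U\subseteq\operatorname{Spec}(B)$ be the open subset where $W$ is locally free. $\mathbf{V}_W|_U$ is the restriction to $U$ of the quasi-coherent sheaf associated to $\mathbf{V}_W$, with the Lie-Rinehart structure obtained by localization. The Chevalley-Hochschild complex is $\operatorname{C}^p(\mathbf{V}_W|_U,\mathcal{O}_U)=\operatorname{Hom}_{\mathcal{O}_U}(\wedge^p\mathbf{V}_W|_U,\mathcal{O}_U)$ (global homomorphisms of sheaves) with $$d^p\phi(g_1\wedge\cdots\wedge g_{p+1})=\sum_{i}(-1)^{i+1}g_i\,\phi(g_1\wedge\cdots\widehat{g_i}\cdots\wedge g_{p+1})+\sum_{i<j}(-1)^{i+j}\phi([g_i,g_j]\wedge\cdots\widehat{g_i}\cdots\widehat{g_j}\cdots\wedge g_{p+1}),$$ and $\operatorname{H}^i(\mathbf{V}_W|_U,\mathcal{O}_U)$ is its cohomology. If $W$ admits a $\mathbf{V}_W$-connection $\nabla$, then $c_1(W)\in\operatorname{H}^2(\mathbf{V}_W|_U,\mathcal{O}_U)$ is the class of the 2-cocycle $\operatorname{trace}\circ R_\nabla|_U$; it does not depend on $\nabla$. The modules $W_\rho$ admit $\mathbf{V}_{W_\rho}$-connections, so $c_1(W_\rho)$ is defined. *)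

theory Defs
  imports
    Complex_Main
    "HOL-Algebra.QuotRing"
    "Jordan_Normal_Form.Matrix_Kernel"
begin

section \<open>Localization of modules\<close>

definition regular_module :: "'a ring \<Rightarrow> ('a, 'a) module" where
  "regular_module R =
     \<lparr>carrier = carrier R, mult = mult R, one = one R,
      zero = zero R, add = add R, smult = mult R\<rparr>"

definition frac_rel :: "'a ring \<Rightarrow> 'a set \<Rightarrow> ('a, 'm) module \<Rightarrow> (('m \<times> 'a) \<times> ('m \<times> 'a)) set" where
  "frac_rel R S M =
     {((m, s), (n, t)). m \<in> carrier M \<and> n \<in> carrier M \<and> s \<in> S \<and> t \<in> S \<and>
        (\<exists>u\<in>S. u \<odot>\<^bsub>M\<^esub> (t \<odot>\<^bsub>M\<^esub> m) = u \<odot>\<^bsub>M\<^esub> (s \<odot>\<^bsub>M\<^esub> n))}"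

definition fraction :: "'a ring \<Rightarrow> 'a set \<Rightarrow> ('a, 'm) module \<Rightarrow> 'm \<Rightarrow> 'a \<Rightarrow> ('m \<times> 'a) set" where
  "fraction R S M m s = frac_rel R S M `` {(m, s)}"

text \<open>
  The operations on fractions are given on representatives: a union over all representatives of a
  class-valued expression that does not depend on the choice is that class
  (as in \<open>UN_equiv_class\<close>). Localizations of modules carry no multiplication, so the fields
  \<open>mult\<close> and \<open>one\<close> are left unspecified.
\<close>

definition localization :: "'a ring \<Rightarrow> 'a set \<Rightarrow> ('a, 'm) module \<Rightarrow> (('a \<times> 'a) set, ('m \<times> 'a) set) module" where
  "localization R S M =
     \<lparr>carrier = (carrier M \<times> S) // frac_rel R S M,
      mult = undefined, one = undefined,
      zero = fraction R S M \<zero>\<^bsub>M\<^esub> \<one>\<^bsub>R\<^esub>,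
      add = (\<lambda>x y. \<Union>(m, s)\<in>x. \<Union>(n, t)\<in>y.
               fraction R S M (t \<odot>\<^bsub>M\<^esub> m \<oplus>\<^bsub>M\<^esub> s \<odot>\<^bsub>M\<^esub> n) (s \<otimes>\<^bsub>R\<^esub> t)),
      smult = (\<lambda>a x. \<Union>(b, s)\<in>a. \<Union>(m, t)\<in>x. fraction R S M (b \<odot>\<^bsub>M\<^esub> m) (s \<otimes>\<^bsub>R\<^esub> t))\<rparr>"

definition localization_ring :: "'a ring \<Rightarrow> 'a set \<Rightarrow> ('a \<times> 'a) set ring" where
  "localization_ring R S =
     (let L = localization R S (regular_module R) in
       \<lparr>carrier = carrier L, mult = smult L, one = fraction R S (regular_module R) \<one>\<^bsub>R\<^esub> \<one>\<^bsub>R\<^esub>,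
        zero = zero L, add = add L\<rparr>)"

section \<open>The spectrum and quasi-coherent sheaves\<close>

definition Spec :: "'a ring \<Rightarrow> 'a set set" where
  "Spec R = {P. primeideal P R}"

definition zariski_open :: "'a ring \<Rightarrow> 'a set set \<Rightarrow> bool" where
  "zariski_open R V \<longleftrightarrow> (\<exists>E \<subseteq> carrier R. V = {P \<in> Spec R. \<not> E \<subseteq> P})"

abbreviation frac_at :: "'a ring \<Rightarrow> ('a, 'm) module \<Rightarrow> 'a set \<Rightarrow> 'm \<Rightarrow> 'a \<Rightarrow> ('m \<times> 'a) set" where
  "frac_at R M P \<equiv> fraction R (carrier R - P) M"

definition stalk :: "'a ring \<Rightarrow> ('a, 'm) module \<Rightarrow> 'a set \<Rightarrow> (('a \<times> 'a) set, ('m \<times> 'a) set) module" where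
  "stalk R M P = localization R (carrier R - P) M"

definition stalk_ring :: "'a ring \<Rightarrow> 'a set \<Rightarrow> ('a \<times> 'a) set ring" where
  "stalk_ring R P = localization_ring R (carrier R - P)"

text \<open>
  Sections over \<open>V\<close> of the quasi-coherent sheaf associated to \<open>M\<close>: functions with values in the
  stalks which are locally given by a single fraction.
\<close>

definition sections :: "'a ring \<Rightarrow> ('a, 'm) module \<Rightarrow> 'a set set \<Rightarrow> ('a set \<Rightarrow> ('m \<times> 'a) set) set" where
  "sections R M V =
     {f \<in> (\<Pi>\<^sub>E P\<in>V. carrier (stalk R M P)).
        \<forall>P\<in>V. \<exists>N m t. zariski_open R N \<and> P \<in> N \<and> N \<subseteq> V \<and> m \<in> carrier M \<and> t \<in> carrier R \<and>
          (\<forall>Q\<in>N. t \<notin> Q \<and> f Q = frac_at R M Q m t)}"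

definition section_module :: "'a ring \<Rightarrow> ('a, 'm) module \<Rightarrow> 'a set set \<Rightarrow>
    ('a set \<Rightarrow> ('a \<times> 'a) set, 'a set \<Rightarrow> ('m \<times> 'a) set) module" where
  "section_module R M V =
     \<lparr>carrier = sections R M V, mult = undefined, one = undefined,
      zero = (\<lambda>P\<in>V. \<zero>\<^bsub>stalk R M P\<^esub>),
      add = (\<lambda>f g. \<lambda>P\<in>V. f P \<oplus>\<^bsub>stalk R M P\<^esub> g P),
      smult = (\<lambda>a f. \<lambda>P\<in>V. a P \<odot>\<^bsub>stalk R M P\<^esub> f P)\<rparr>"

definition section_ring :: "'a ring \<Rightarrow> 'a set set \<Rightarrow> ('a set \<Rightarrow> ('a \<times> 'a) set) ring" where
  "section_ring R V =
     \<lparr>carrier = sections R (regular_module R) V,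
      mult = (\<lambda>f g. \<lambda>P\<in>V. f P \<otimes>\<^bsub>stalk_ring R P\<^esub> g P),
      one = (\<lambda>P\<in>V. \<one>\<^bsub>stalk_ring R P\<^esub>),
      zero = (\<lambda>P\<in>V. \<zero>\<^bsub>stalk_ring R P\<^esub>),
      add = (\<lambda>f g. \<lambda>P\<in>V. f P \<oplus>\<^bsub>stalk_ring R P\<^esub> g P)\<rparr>"

definition opens_in :: "'a ring \<Rightarrow> 'a set set \<Rightarrow> 'a set set set" where
  "opens_in R U = {V. zariski_open R V \<and> V \<subseteq> U}"

section \<open>Bases, traces and local freeness\<close>

definition is_basis :: "'r ring \<Rightarrow> ('r, 'm) module \<Rightarrow> nat \<Rightarrow> (nat \<Rightarrow> 'm) \<Rightarrow> bool" where
  "is_basis R M n e \<longleftrightarrow>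
     (\<forall>i<n. e i \<in> carrier M) \<and>
     (\<forall>x\<in>carrier M. \<exists>!c. c \<in> {..<n} \<rightarrow>\<^sub>E carrier R \<and> x = (\<Oplus>\<^bsub>M\<^esub>i\<in>{..<n}. c i \<odot>\<^bsub>M\<^esub> e i))"

definition coordinates :: "'r ring \<Rightarrow> ('r, 'm) module \<Rightarrow> nat \<Rightarrow> (nat \<Rightarrow> 'm) \<Rightarrow> 'm \<Rightarrow> nat \<Rightarrow> 'r" where
  "coordinates R M n e x =
     (THE c. c \<in> {..<n} \<rightarrow>\<^sub>E carrier R \<and> x = (\<Oplus>\<^bsub>M\<^esub>i\<in>{..<n}. c i \<odot>\<^bsub>M\<^esub> e i))"

text \<open>Over a commutative ring the trace does not depend on the chosen basis.\<close>

definition module_trace :: "'r ring \<Rightarrow> ('r, 'm) module \<Rightarrow> ('m \<Rightarrow> 'm) \<Rightarrow> 'r" where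
  "module_trace R M \<phi> =
     (let (n, e) = SOME (n, e). is_basis R M n e in
       \<Oplus>\<^bsub>R\<^esub>i\<in>{..<n}. coordinates R M n e (\<phi> (e i)) i)"

text \<open>
  The union of all open \<open>V\<close> on which the sheaf of \<open>M\<close> is isomorphic to \<open>\<O>\<^sub>V\<^sup>n\<close> for some \<open>n\<close>;
  the isomorphism is given by the sections \<open>e\<close>.
\<close>

definition locally_free_locus :: "'a ring \<Rightarrow> ('a, 'm) module \<Rightarrow> 'a set set" where
  "locally_free_locus R M =
     \<Union>{V. zariski_open R V \<and>
          (\<exists>n e. (\<forall>i<n. e i \<in> sections R M V) \<and>
             (\<forall>V'\<in>opens_in R V.
                is_basis (section_ring R V') (section_module R M V') n (\<lambda>i. restrict (e i) V')))}"

section \<open>Derivations and the Kodaira-Spencer kernel\<close>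

text \<open>
  The ground field \<open>F\<close> is a subset of the carrier of the algebra \<open>R\<close>. Maps are extensional, so that
  equality of maps is equality on the carrier.
\<close>

definition derivations :: "'a set \<Rightarrow> 'a ring \<Rightarrow> ('a \<Rightarrow> 'a) set" where
  "derivations F R =
     {\<delta> \<in> carrier R \<rightarrow>\<^sub>E carrier R.
        (\<forall>a\<in>carrier R. \<forall>b\<in>carrier R. \<delta> (a \<oplus>\<^bsub>R\<^esub> b) = \<delta> a \<oplus>\<^bsub>R\<^esub> \<delta> b) \<and>
        (\<forall>c\<in>F. \<forall>a\<in>carrier R. \<delta> (c \<otimes>\<^bsub>R\<^esub> a) = c \<otimes>\<^bsub>R\<^esub> \<delta> a) \<and>
        (\<forall>a\<in>carrier R. \<forall>b\<in>carrier R. \<delta> (a \<otimes>\<^bsub>R\<^esub> b) = a \<otimes>\<^bsub>R\<^esub> \<delta> b \<oplus>\<^bsub>R\<^esub> \<delta> a \<otimes>\<^bsub>R\<^esub> b)}"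

definition derivation_module :: "'a set \<Rightarrow> 'a ring \<Rightarrow> ('a, 'a \<Rightarrow> 'a) module" where
  "derivation_module F R =
     \<lparr>carrier = derivations F R, mult = undefined, one = undefined,
      zero = (\<lambda>b\<in>carrier R. \<zero>\<^bsub>R\<^esub>),
      add = (\<lambda>\<delta> \<eta>. \<lambda>b\<in>carrier R. \<delta> b \<oplus>\<^bsub>R\<^esub> \<eta> b),
      smult = (\<lambda>a \<delta>. \<lambda>b\<in>carrier R. a \<otimes>\<^bsub>R\<^esub> \<delta> b)\<rparr>"

definition lie_bracket :: "'a ring \<Rightarrow> ('a \<Rightarrow> 'a) \<Rightarrow> ('a \<Rightarrow> 'a) \<Rightarrow> 'a \<Rightarrow> 'a" where
  "lie_bracket R \<delta> \<eta> = (\<lambda>b\<in>carrier R. \<delta> (\<eta> b) \<ominus>\<^bsub>R\<^esub> \<eta> (\<delta> b))"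

definition linear_endos :: "'a set \<Rightarrow> ('a, 'm) module \<Rightarrow> ('m \<Rightarrow> 'm) set" where
  "linear_endos F W =
     {\<phi> \<in> carrier W \<rightarrow>\<^sub>E carrier W.
        (\<forall>v\<in>carrier W. \<forall>w\<in>carrier W. \<phi> (v \<oplus>\<^bsub>W\<^esub> w) = \<phi> v \<oplus>\<^bsub>W\<^esub> \<phi> w) \<and>
        (\<forall>c\<in>F. \<forall>w\<in>carrier W. \<phi> (c \<odot>\<^bsub>W\<^esub> w) = c \<odot>\<^bsub>W\<^esub> \<phi> w)}"

text \<open>
  The additive group \<open>Der\<^sub>F(R, End\<^sub>F(W))\<close> for the bimodule structure \<open>(b \<phi>) w = b (\<phi> w)\<close>,
  \<open>(\<phi> b) w = \<phi> (b w)\<close>. Here and for cochains below, an additive group is written as a monoid record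
  in order to use quotients of groups.
\<close>

definition endo_derivations :: "'a set \<Rightarrow> 'a ring \<Rightarrow> ('a, 'm) module \<Rightarrow> ('a \<Rightarrow> 'm \<Rightarrow> 'm) monoid" where
  "endo_derivations F R W =
     \<lparr>carrier =
        {D \<in> carrier R \<rightarrow>\<^sub>E linear_endos F W.
           (\<forall>a\<in>carrier R. \<forall>b\<in>carrier R. \<forall>w\<in>carrier W.
              D (a \<oplus>\<^bsub>R\<^esub> b) w = D a w \<oplus>\<^bsub>W\<^esub> D b w) \<and>
           (\<forall>c\<in>F. \<forall>a\<in>carrier R. \<forall>w\<in>carrier W. D (c \<otimes>\<^bsub>R\<^esub> a) w = c \<odot>\<^bsub>W\<^esub> D a w) \<and>
           (\<forall>a\<in>carrier R. \<forall>b\<in>carrier R. \<forall>w\<in>carrier W.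
              D (a \<otimes>\<^bsub>R\<^esub> b) w = a \<odot>\<^bsub>W\<^esub> D b w \<oplus>\<^bsub>W\<^esub> D a (b \<odot>\<^bsub>W\<^esub> w))},
      mult = (\<lambda>D E. \<lambda>b\<in>carrier R. \<lambda>w\<in>carrier W. D b w \<oplus>\<^bsub>W\<^esub> E b w),
      one = (\<lambda>b\<in>carrier R. \<lambda>w\<in>carrier W. \<zero>\<^bsub>W\<^esub>)\<rparr>"

definition inner_derivations :: "'a set \<Rightarrow> 'a ring \<Rightarrow> ('a, 'm) module \<Rightarrow> ('a \<Rightarrow> 'm \<Rightarrow> 'm) set" where
  "inner_derivations F R W =
     (\<lambda>\<phi>. \<lambda>b\<in>carrier R. \<lambda>w\<in>carrier W. \<phi> (b \<odot>\<^bsub>W\<^esub> w) \<ominus>\<^bsub>W\<^esub> b \<odot>\<^bsub>W\<^esub> \<phi> w) ` linear_endos F W"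

definition HH1 :: "'a set \<Rightarrow> 'a ring \<Rightarrow> ('a, 'm) module \<Rightarrow> ('a \<Rightarrow> 'm \<Rightarrow> 'm) set monoid" where
  "HH1 F R W = endo_derivations F R W Mod inner_derivations F R W"

definition kodaira_spencer :: "'a set \<Rightarrow> 'a ring \<Rightarrow> ('a, 'm) module \<Rightarrow> ('a \<Rightarrow> 'a) \<Rightarrow> ('a \<Rightarrow> 'm \<Rightarrow> 'm) set" where
  "kodaira_spencer F R W \<delta> =
     inner_derivations F R W #>\<^bsub>endo_derivations F R W\<^esub>
       (\<lambda>b\<in>carrier R. \<lambda>w\<in>carrier W. \<delta> b \<odot>\<^bsub>W\<^esub> w)"

definition linear_lie_rinehart :: "'a set \<Rightarrow> 'a ring \<Rightarrow> ('a, 'm) module \<Rightarrow> ('a, 'a \<Rightarrow> 'a) module" where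
  "linear_lie_rinehart F R W =
     (derivation_module F R)
       \<lparr>carrier := Coset.kernel (add_monoid (derivation_module F R)) (HH1 F R W) (kodaira_spencer F R W)\<rparr>"

section \<open>Connections and curvature\<close>

definition is_connection :: "'a set \<Rightarrow> 'a ring \<Rightarrow> ('a, 'm) module \<Rightarrow> (('a \<Rightarrow> 'a) \<Rightarrow> 'm \<Rightarrow> 'm) \<Rightarrow> bool" where
  "is_connection F R W nabla \<longleftrightarrow>
     (let L = linear_lie_rinehart F R W in
       nabla \<in> carrier L \<rightarrow> linear_endos F W \<and>
       (\<forall>\<delta>\<in>carrier L. \<forall>\<eta>\<in>carrier L. \<forall>w\<in>carrier W. nabla (\<delta> \<oplus>\<^bsub>L\<^esub> \<eta>) w = nabla \<delta> w \<oplus>\<^bsub>W\<^esub> nabla \<eta> w) \<and>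
       (\<forall>a\<in>carrier R. \<forall>\<delta>\<in>carrier L. \<forall>w\<in>carrier W. nabla (a \<odot>\<^bsub>L\<^esub> \<delta>) w = a \<odot>\<^bsub>W\<^esub> nabla \<delta> w) \<and>
       (\<forall>\<delta>\<in>carrier L. \<forall>b\<in>carrier R. \<forall>w\<in>carrier W.
          nabla \<delta> (b \<odot>\<^bsub>W\<^esub> w) = b \<odot>\<^bsub>W\<^esub> nabla \<delta> w \<oplus>\<^bsub>W\<^esub> \<delta> b \<odot>\<^bsub>W\<^esub> w))"

definition curvature :: "'a ring \<Rightarrow> ('a, 'm) module \<Rightarrow> (('a \<Rightarrow> 'a) \<Rightarrow> 'm \<Rightarrow> 'm) \<Rightarrow>
    ('a \<Rightarrow> 'a) \<Rightarrow> ('a \<Rightarrow> 'a) \<Rightarrow> 'm \<Rightarrow> 'm" where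
  "curvature R W nabla \<delta> \<eta> =
     (\<lambda>w\<in>carrier W. (nabla \<delta> (nabla \<eta> w) \<ominus>\<^bsub>W\<^esub> nabla \<eta> (nabla \<delta> w)) \<ominus>\<^bsub>W\<^esub> nabla (lie_bracket R \<delta> \<eta>) w)"

section \<open>The localized Lie-Rinehart structure\<close>

text \<open>
  For a module \<open>L\<close> of derivations of \<open>R\<close>, the action on a stalk is the quotient rule
  \<open>(\<delta>/s)(b/t) = (t \<delta>(b) - b \<delta>(t)) / (s t\<^sup>2)\<close>.
\<close>

definition stalk_action :: "'a ring \<Rightarrow> 'a set \<Rightarrow> (('a \<Rightarrow> 'a) \<times> 'a) set \<Rightarrow> ('a \<times> 'a) set \<Rightarrow> ('a \<times> 'a) set" where
  "stalk_action R P x a =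
     (\<Union>(\<delta>, s)\<in>x. \<Union>(b, t)\<in>a.
        frac_at R (regular_module R) P
          (t \<otimes>\<^bsub>R\<^esub> \<delta> b \<ominus>\<^bsub>R\<^esub> b \<otimes>\<^bsub>R\<^esub> \<delta> t) (s \<otimes>\<^bsub>R\<^esub> (t \<otimes>\<^bsub>R\<^esub> t)))"

text \<open>
  The bracket is forced by \<open>[a\<delta>, b\<eta>] = ab[\<delta>, \<eta>] + a\<delta>(b)\<eta> - b\<eta>(a)\<delta>\<close>:
  \<open>[\<delta>/s, \<eta>/t] = (st [\<delta>, \<eta>] - s \<delta>(t) \<eta> + t \<eta>(s) \<delta>) / (s\<^sup>2 t\<^sup>2)\<close>.
\<close>

definition stalk_bracket :: "'a ring \<Rightarrow> ('a, 'a \<Rightarrow> 'a) module \<Rightarrow> 'a set \<Rightarrow>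
    (('a \<Rightarrow> 'a) \<times> 'a) set \<Rightarrow> (('a \<Rightarrow> 'a) \<times> 'a) set \<Rightarrow> (('a \<Rightarrow> 'a) \<times> 'a) set" where
  "stalk_bracket R L P x y =
     (\<Union>(\<delta>, s)\<in>x. \<Union>(\<eta>, t)\<in>y.
        frac_at R L P
          (((s \<otimes>\<^bsub>R\<^esub> t) \<odot>\<^bsub>L\<^esub> lie_bracket R \<delta> \<eta> \<ominus>\<^bsub>L\<^esub> (s \<otimes>\<^bsub>R\<^esub> \<delta> t) \<odot>\<^bsub>L\<^esub> \<eta>) \<oplus>\<^bsub>L\<^esub> (t \<otimes>\<^bsub>R\<^esub> \<eta> s) \<odot>\<^bsub>L\<^esub> \<delta>)
          ((s \<otimes>\<^bsub>R\<^esub> s) \<otimes>\<^bsub>R\<^esub> (t \<otimes>\<^bsub>R\<^esub> t)))"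

text \<open>The \<open>\<O>\<close>-linear extension of the curvature to the stalks.\<close>

definition stalk_curvature :: "'a ring \<Rightarrow> ('a, 'm) module \<Rightarrow> (('a \<Rightarrow> 'a) \<Rightarrow> 'm \<Rightarrow> 'm) \<Rightarrow> 'a set \<Rightarrow>
    (('a \<Rightarrow> 'a) \<times> 'a) set \<Rightarrow> (('a \<Rightarrow> 'a) \<times> 'a) set \<Rightarrow> ('m \<times> 'a) set \<Rightarrow> ('m \<times> 'a) set" where
  "stalk_curvature R W nabla P x y =
     (\<lambda>z\<in>carrier (stalk R W P).
        \<Union>(\<delta>, s)\<in>x. \<Union>(\<eta>, t)\<in>y. \<Union>(w, u)\<in>z.
          frac_at R W P (curvature R W nabla \<delta> \<eta> w) ((s \<otimes>\<^bsub>R\<^esub> t) \<otimes>\<^bsub>R\<^esub> u))"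

section \<open>The Chevalley-Hochschild complex on an open set\<close>

type_synonym 'a der_section = "'a set \<Rightarrow> (('a \<Rightarrow> 'a) \<times> 'a) set"
type_synonym 'a fun_section = "'a set \<Rightarrow> ('a \<times> 'a) set"
type_synonym 'a cochain = "'a set set \<Rightarrow> 'a der_section list \<Rightarrow> 'a fun_section"

definition tuples :: "nat \<Rightarrow> 'b set \<Rightarrow> 'b list set" where
  "tuples p X = {gs. length gs = p \<and> set gs \<subseteq> X}"

text \<open>
  By the universal properties of exterior powers and of sheafification, a homomorphism
  from the \<open>p\<close>-th exterior power of the sheaf of \<open>L\<close> to the structure sheaf, over \<open>U\<close>, is a family of
  alternating \<open>\<O>(V)\<close>-multilinear maps of \<open>p\<close> sections over \<open>V\<close>, for \<open>V\<close> open in \<open>U\<close>, compatible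
  with restriction.
\<close>

definition cochains :: "nat \<Rightarrow> 'a ring \<Rightarrow> ('a, 'a \<Rightarrow> 'a) module \<Rightarrow> 'a set set \<Rightarrow> 'a cochain set" where
  "cochains p R L U =
     {\<phi> \<in> (\<Pi>\<^sub>E V\<in>opens_in R U. tuples p (sections R L V) \<rightarrow>\<^sub>E carrier (section_ring R V)).
        (\<forall>V\<in>opens_in R U. \<forall>V'\<in>opens_in R V. \<forall>gs\<in>tuples p (sections R L V).
           \<phi> V' (map (\<lambda>g. restrict g V') gs) = restrict (\<phi> V gs) V') \<and>
        (\<forall>V\<in>opens_in R U. \<forall>gs\<in>tuples p (sections R L V). \<forall>i<p.
           \<forall>a\<in>carrier (section_ring R V). \<forall>g\<in>sections R L V. \<forall>h\<in>sections R L V.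
           \<phi> V (gs[i := a \<odot>\<^bsub>section_module R L V\<^esub> g \<oplus>\<^bsub>section_module R L V\<^esub> h]) =
             a \<otimes>\<^bsub>section_ring R V\<^esub> \<phi> V (gs[i := g]) \<oplus>\<^bsub>section_ring R V\<^esub> \<phi> V (gs[i := h])) \<and>
        (\<forall>V\<in>opens_in R U. \<forall>gs\<in>tuples p (sections R L V). \<forall>i j. i < j \<and> j < p \<and> gs ! i = gs ! j \<longrightarrow>
           \<phi> V gs = \<zero>\<^bsub>section_ring R V\<^esub>)}"

definition cochain_group :: "nat \<Rightarrow> 'a ring \<Rightarrow> ('a, 'a \<Rightarrow> 'a) module \<Rightarrow> 'a set set \<Rightarrow> 'a cochain monoid" where
  "cochain_group p R L U =
     \<lparr>carrier = cochains p R L U,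
      mult = (\<lambda>\<phi> \<psi>. \<lambda>V\<in>opens_in R U. \<lambda>gs\<in>tuples p (sections R L V).
                \<phi> V gs \<oplus>\<^bsub>section_ring R V\<^esub> \<psi> V gs),
      one = (\<lambda>V\<in>opens_in R U. \<lambda>gs\<in>tuples p (sections R L V). \<zero>\<^bsub>section_ring R V\<^esub>)\<rparr>"

text \<open>
  Arguments are counted from \<open>0\<close>, so the sign \<open>(-1)\<^sup>i\<^sup>+\<^sup>1\<close> of the usual formula becomes
  \<open>(-1)\<^sup>i\<close>. The list \<open>nths gs (- I)\<close> is \<open>gs\<close> with the entries at positions in \<open>I\<close> omitted.
\<close>

definition differential :: "nat \<Rightarrow> 'a ring \<Rightarrow> ('a, 'a \<Rightarrow> 'a) module \<Rightarrow> 'a set set \<Rightarrow> 'a cochain \<Rightarrow> 'a cochain" where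
  "differential p R L U \<phi> =
     (\<lambda>V\<in>opens_in R U. \<lambda>gs\<in>tuples (Suc p) (sections R L V).
        let A = section_ring R V; sgn = (\<lambda>k. (\<ominus>\<^bsub>A\<^esub> \<one>\<^bsub>A\<^esub>) [^]\<^bsub>A\<^esub> (k::nat)) in
        (\<Oplus>\<^bsub>A\<^esub>i\<in>{..p}. sgn i \<otimes>\<^bsub>A\<^esub>
           (\<lambda>P\<in>V. stalk_action R P ((gs ! i) P) (\<phi> V (nths gs (- {i})) P))) \<oplus>\<^bsub>A\<^esub>
        (\<Oplus>\<^bsub>A\<^esub>j\<in>{..p}. \<Oplus>\<^bsub>A\<^esub>i\<in>{..<j}. sgn (i + j) \<otimes>\<^bsub>A\<^esub>
           \<phi> V ((\<lambda>P\<in>V. stalk_bracket R L P ((gs ! i) P) ((gs ! j) P)) # nths gs (- {i, j}))))"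

definition cocycle_group :: "nat \<Rightarrow> 'a ring \<Rightarrow> ('a, 'a \<Rightarrow> 'a) module \<Rightarrow> 'a set set \<Rightarrow> 'a cochain monoid" where
  "cocycle_group p R L U =
     (cochain_group p R L U)
       \<lparr>carrier := Coset.kernel (cochain_group p R L U) (cochain_group (Suc p) R L U) (differential p R L U)\<rparr>"

fun coboundaries :: "nat \<Rightarrow> 'a ring \<Rightarrow> ('a, 'a \<Rightarrow> 'a) module \<Rightarrow> 'a set set \<Rightarrow> 'a cochain set" where
  "coboundaries 0 R L U = {\<one>\<^bsub>cochain_group 0 R L U\<^esub>}"
| "coboundaries (Suc p) R L U = differential p R L U ` cochains p R L U"

definition cohomology :: "nat \<Rightarrow> 'a ring \<Rightarrow> ('a, 'a \<Rightarrow> 'a) module \<Rightarrow> 'a set set \<Rightarrow> 'a cochain set monoid" where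
  "cohomology p R L U = cocycle_group p R L U Mod coboundaries p R L U"

definition cohomology_class :: "nat \<Rightarrow> 'a ring \<Rightarrow> ('a, 'a \<Rightarrow> 'a) module \<Rightarrow> 'a set set \<Rightarrow> 'a cochain \<Rightarrow> 'a cochain set" where
  "cohomology_class p R L U \<phi> = coboundaries p R L U #>\<^bsub>cocycle_group p R L U\<^esub> \<phi>"

section \<open>The first Chern class\<close>

definition trace_curvature :: "'a set \<Rightarrow> 'a ring \<Rightarrow> ('a, 'm) module \<Rightarrow> (('a \<Rightarrow> 'a) \<Rightarrow> 'm \<Rightarrow> 'm) \<Rightarrow> 'a cochain" where
  "trace_curvature F R W nabla =
     (\<lambda>V\<in>opens_in R (locally_free_locus R W).
        \<lambda>gs\<in>tuples 2 (sections R (linear_lie_rinehart F R W) V).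
          \<lambda>P\<in>V. module_trace (stalk_ring R P) (stalk R W P)
            (stalk_curvature R W nabla P ((gs ! 0) P) ((gs ! 1) P)))"

abbreviation chern_H2 :: "'a set \<Rightarrow> 'a ring \<Rightarrow> ('a, 'm) module \<Rightarrow> 'a cochain set monoid" where
  "chern_H2 F R W \<equiv> cohomology 2 R (linear_lie_rinehart F R W) (locally_free_locus R W)"

text \<open>
  The class of the trace of the curvature of any connection; meaningful only if a connection exists.
\<close>

definition first_chern_class :: "'a set \<Rightarrow> 'a ring \<Rightarrow> ('a, 'm) module \<Rightarrow> 'a cochain set" where
  "first_chern_class F R W =
     (THE c. \<exists>nabla. is_connection F R W nabla \<and>
        c = cohomology_class 2 R (linear_lie_rinehart F R W) (locally_free_locus R W)
              (trace_curvature F R W nabla))"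

section \<open>Finite groups acting on the polynomial ring in two variables\<close>

definition GL :: "nat \<Rightarrow> complex mat monoid" where
  "GL n = units_of (ring_mat TYPE(complex) n ())"

text \<open>
  A non-identity element fixing a line (a hyperplane of the plane) pointwise; finite order is
  automatic for elements of a finite group.
\<close>

definition pseudo_reflection :: "complex mat \<Rightarrow> bool" where
  "pseudo_reflection g \<longleftrightarrow> g \<in> carrier (GL 2) \<and> g \<noteq> 1\<^sub>m 2 \<and> kernel_dim (g - 1\<^sub>m 2) = 1"

text \<open>
  \<open>\<complex>[x, y]\<close> is the type of polynomials in \<open>y\<close> with coefficients in \<open>\<complex>[x]\<close>.
\<close>

type_synonym poly_xy = "complex poly poly"

definition const_xy :: "complex \<Rightarrow> poly_xy" where
  "const_xy c = [:[:c:]:]"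

definition var_x :: poly_xy where
  "var_x = [:[:0, 1:]:]"

definition var_y :: poly_xy where
  "var_y = [:0, 1:]"

definition subst_xy :: "poly_xy \<Rightarrow> poly_xy \<Rightarrow> poly_xy \<Rightarrow> poly_xy" where
  "subst_xy f p q = poly (map_poly (\<lambda>c. poly (map_poly const_xy c) p) f) q"

text \<open>
  The left action by algebra automorphisms on the symmetric algebra of the plane with basis
  \<open>x, y\<close>: \<open>g\<close> sends the \<open>j\<close>-th variable to the linear form with coefficients the \<open>j\<close>-th column of \<open>g\<close>.
\<close>

definition act_poly :: "complex mat \<Rightarrow> poly_xy \<Rightarrow> poly_xy" where
  "act_poly g f =
     subst_xy f
       (const_xy (g $$ (0, 0)) * var_x + const_xy (g $$ (1, 0)) * var_y)
       (const_xy (g $$ (0, 1)) * var_x + const_xy (g $$ (1, 1)) * var_y)"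

definition invariant_ring :: "complex mat set \<Rightarrow> poly_xy ring" where
  "invariant_ring G = class_ring\<lparr>carrier := {f. \<forall>g\<in>G. act_poly g f = f}\<rparr>"

text \<open>
  For \<open>V = \<complex>\<^sup>n\<close> the module \<open>V \<otimes> \<complex>[x, y]\<close> consists of the vectors of length \<open>n\<close> over
  \<open>\<complex>[x, y]\<close>, where \<open>v \<otimes> a\<close> has entries \<open>v\<^sub>i a\<close>; then \<open>g (v \<otimes> a) = \<rho>(g) v \<otimes> g a\<close> is the following
  action.
\<close>

definition act_tensor :: "(complex mat \<Rightarrow> complex mat) \<Rightarrow> complex mat \<Rightarrow> poly_xy vec \<Rightarrow> poly_xy vec" where
  "act_tensor \<rho> g w = map_mat const_xy (\<rho> g) *\<^sub>v map_vec (act_poly g) w"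

definition invariant_module :: "complex mat set \<Rightarrow> nat \<Rightarrow> (complex mat \<Rightarrow> complex mat) \<Rightarrow> (poly_xy, poly_xy vec) module" where
  "invariant_module G n \<rho> =
     (module_vec TYPE(poly_xy) n)\<lparr>carrier := {w \<in> carrier_vec n. \<forall>g\<in>G. act_tensor \<rho> g w = w}\<rparr>"

end

theory Submission
  imports Defs "HOL-Computational_Algebra.Polynomial_Factorial" "HOL-Computational_Algebra.Field_as_Ring"
    "HOL-Computational_Algebra.Fraction_Field" "Jordan_Normal_Form.Char_Poly"
begin

text \<open>
  Let \<open>B\<close> be the ring of invariants of \<open>A = \<complex>[x, y]\<close>. The reason for the vanishing is that \<open>W\<close> carries a
  flat connection, and that the curvatures of any two connections differ by a commutator and by the
  covariant derivative of an endomorphism-valued form. On traces the commutator disappears, and the trace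
  of the form is a primitive.

  As \<open>G\<close> contains no pseudo-reflections, \<open>A\<close> is unramified over \<open>B\<close> in codimension one. Algebraically,
  there are elements \<open>u\<close>, \<open>e\<close> of \<open>A\<close> with \<open>\<Sum>k. u k * g (e k) = 0\<close> for \<open>g \<noteq> 1\<close> and
  \<open>\<Sum>k. u k * e k = d\<close> (\<open>dual_system\<close>), and every prime element of \<open>A\<close> is avoided by some such
  \<open>d\<close> (\<open>discriminant_generic\<close>): for the prime \<open>f\<close> one takes the product of the
  \<open>l - h l\<close> over the nontrivial group elements \<open>h\<close>, where \<open>l\<close> is a general linear form. Galois descent along a dual system
  has the denominator \<open>d\<close> or \<open>d\<^sup>2\<close>. Since \<open>A\<close> is factorial and the \<open>d\<close> have no common prime divisor, the
  denominators cancel. Therefore every derivation of \<open>B\<close> extends uniquely to a derivation of \<open>A\<close>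
  (\<open>extension_exists\<close>), and every \<open>B\<close>-linear endomorphism of \<open>W\<close> is given by a unique matrix over \<open>A\<close>
  (\<open>matrix_exists\<close>, \<open>matrix_eqI\<close>).

  The extension \<open>E \<delta>\<close> of a derivation \<open>\<delta>\<close>, applied to the entries of vectors, preserves \<open>W\<close>
  (\<open>flat_connection_closed\<close>). This gives a flat connection defined for all derivations, so the
  Kodaira-Spencer map is zero and its kernel consists of all derivations (\<open>linear_lie_rinehart_eq\<close>). Any other
  connection has the form \<open>E \<delta> + M \<delta>\<close> with a matrix \<open>M \<delta>\<close> over \<open>A\<close> depending linearly on \<open>\<delta>\<close>. Its curvature is the
  matrix \<open>E \<delta> (M \<eta>) - E \<eta> (M \<delta>) + [M \<delta>, M \<eta>] - M [\<delta>, \<eta>]\<close>. The trace \<open>\<psi> \<delta>\<close> of \<open>M \<delta>\<close> is invariant under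
  \<open>G\<close>, hence lies in \<open>B\<close>, and the trace of the curvature is \<open>\<delta> (\<psi> \<eta>) - \<eta> (\<psi> \<delta>) - \<psi> [\<delta>, \<eta>]\<close>, which is the
  Chevalley-Hochschild differential of \<open>\<psi>\<close> (\<open>trace_curvature_exact\<close>).

  This computation has to be carried to the sheaves on the locally free locus. All modules involved are
  torsion-free, so their stalks embed into vectors of fractions, and equality of sections can be tested
  on these values (\<open>torsion_free_module\<close>). A basis of a stalk of \<open>W\<close> over the local ring is also a basis
  of the vectors of length \<open>n\<close> over the field of fractions, so the trace over the local ring is the
  trace of the matrix (\<open>module_trace_value\<close>).
\<close>

section \<open>Dual systems for a finite group acting on a domain\<close>

definition derivation_on :: "'a::idom set \<Rightarrow> ('a \<Rightarrow> 'a) \<Rightarrow> bool" where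
  "derivation_on S D \<longleftrightarrow>
     (\<forall>a\<in>S. \<forall>b\<in>S. D (a + b) = D a + D b) \<and> (\<forall>a\<in>S. \<forall>b\<in>S. D (a * b) = a * D b + D a * b)"

lemma derivation_onD:
  assumes "derivation_on S D" "a \<in> S" "b \<in> S"
  shows "D (a + b) = D a + D b" "D (a * b) = a * D b + D a * b"
  using assms unfolding derivation_on_def by blast+

locale finite_ring_action = group \<G> for \<G> :: "('g, 'x) monoid_scheme" (structure) +
  fixes act :: "'g \<Rightarrow> 'a::idom \<Rightarrow> 'a"
  assumes finite_carrier: "finite (carrier \<G>)"
    and act_add: "g \<in> carrier \<G> \<Longrightarrow> act g (a + b) = act g a + act g b"
    and act_mult: "g \<in> carrier \<G> \<Longrightarrow> act g (a * b) = act g a * act g b"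
    and act_1: "g \<in> carrier \<G> \<Longrightarrow> act g 1 = 1"
    and act_one: "act \<one> a = a"
    and act_act: "g \<in> carrier \<G> \<Longrightarrow> h \<in> carrier \<G> \<Longrightarrow> act (g \<otimes> h) a = act g (act h a)"
begin

definition invariants :: "'a set" where
  "invariants = {a. \<forall>g\<in>carrier \<G>. act g a = a}"

definition transfer :: "'a \<Rightarrow> 'a" where
  "transfer a = (\<Sum>g\<in>carrier \<G>. act g a)"

lemma act_0: "g \<in> carrier \<G> \<Longrightarrow> act g 0 = 0"
  using act_add[of g 0 0] by (metis add.right_neutral add_left_cancel)

lemma act_minus: "g \<in> carrier \<G> \<Longrightarrow> act g (- a) = - act g a"
  using act_add[of g a "- a"] act_0[of g] by (simp add: eq_neg_iff_add_eq_0 add.commute)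

lemma act_diff: "g \<in> carrier \<G> \<Longrightarrow> act g (a - b) = act g a - act g b"
  using act_add[of g a "- b"] by (simp add: act_minus)

lemma act_sum: "g \<in> carrier \<G> \<Longrightarrow> act g (\<Sum>k\<in>I. f k) = (\<Sum>k\<in>I. act g (f k))"
  by (induction I rule: infinite_finite_induct) (auto simp: act_0 act_add)

lemma act_prod: "g \<in> carrier \<G> \<Longrightarrow> act g (\<Prod>k\<in>I. f k) = (\<Prod>k\<in>I. act g (f k))"
  by (induction I rule: infinite_finite_induct) (auto simp: act_1 act_mult)

lemma act_inv_cancel: "g \<in> carrier \<G> \<Longrightarrow> act (inv g) (act g a) = a"
  using act_act[of "inv g" g a] by (simp add: act_one)

lemma act_cancel_inv: "g \<in> carrier \<G> \<Longrightarrow> act g (act (inv g) a) = a"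
  using act_act[of g "inv g" a] by (simp add: act_one)

lemma invariants_act: "a \<in> invariants \<Longrightarrow> g \<in> carrier \<G> \<Longrightarrow> act g a = a"
  by (simp add: invariants_def)

lemma invariants_closed:
  "a \<in> invariants \<Longrightarrow> b \<in> invariants \<Longrightarrow> a + b \<in> invariants"
  "a \<in> invariants \<Longrightarrow> b \<in> invariants \<Longrightarrow> a * b \<in> invariants"
  "a \<in> invariants \<Longrightarrow> b \<in> invariants \<Longrightarrow> a - b \<in> invariants"
  "a \<in> invariants \<Longrightarrow> - a \<in> invariants"
  "0 \<in> invariants" "1 \<in> invariants"
  by (auto simp: invariants_def act_add act_mult act_diff act_minus act_0 act_1)

lemma sum_translate:
  assumes "h \<in> carrier \<G>"
  shows "(\<Sum>g\<in>carrier \<G>. f (h \<otimes> g)) = (\<Sum>g\<in>carrier \<G>. f g)"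
proof (rule sum.reindex_bij_witness[where i = "\<lambda>g. inv h \<otimes> g" and j = "\<lambda>g. h \<otimes> g"])
  fix g assume "g \<in> carrier \<G>"
  then show "inv h \<otimes> (h \<otimes> g) = g" "h \<otimes> (inv h \<otimes> g) = g"
    using assms by (auto simp flip: m_assoc)
qed (use assms in auto)

lemma transfer_invariant: "transfer a \<in> invariants"
proof -
  have "act h (transfer a) = transfer a" if h: "h \<in> carrier \<G>" for h
  proof -
    have "act h (transfer a) = (\<Sum>g\<in>carrier \<G>. act (h \<otimes> g) a)"
      using h by (simp add: transfer_def act_sum act_act)
    also have "\<dots> = transfer a"
      unfolding transfer_def by (rule sum_translate[OF h])
    finally show ?thesis .
  qed
  then show ?thesis by (simp add: invariants_def)
qed

lemma transfer_add: "transfer (a + b) = transfer a + transfer b"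
  by (simp add: transfer_def act_add sum.distrib)

lemma transfer_mult_invariant: "b \<in> invariants \<Longrightarrow> transfer (b * a) = b * transfer a"
  by (simp add: transfer_def act_mult invariants_act sum_distrib_left)

text \<open>
  The Galois coordinates of Chase, Harrison and Rosenberg with a common denominator \<open>d\<close>: the families
  \<open>u\<close> and \<open>e / d\<close> exhibit the ring as a Galois extension of its invariants wherever \<open>d\<close> is invertible.
\<close>

definition dual_system :: "'k set \<Rightarrow> ('k \<Rightarrow> 'a) \<Rightarrow> ('k \<Rightarrow> 'a) \<Rightarrow> 'a \<Rightarrow> bool" where
  "dual_system I u e d \<longleftrightarrow> finite I \<and>
     (\<forall>g\<in>carrier \<G>. (\<Sum>k\<in>I. u k * act g (e k)) = (if g = \<one> then d else 0))"

text \<open>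
  The index sets live in the type that \<open>dual_system_orbit\<close> produces, because a definition cannot
  quantify over types.
\<close>

definition discriminants :: "'a set" where
  "discriminants = {d. \<exists>(I :: 'g set set) u e. dual_system I u e d}"

lemma dual_systemD:
  assumes "dual_system I u e d" "g \<in> carrier \<G>"
  shows "(\<Sum>k\<in>I. u k * act g (e k)) = (if g = \<one> then d else 0)"
  using assms by (auto simp: dual_system_def)

lemma dual_system_sym:
  assumes "dual_system I u e d" "g \<in> carrier \<G>"
  shows "(\<Sum>k\<in>I. act g (u k) * e k) = (if g = \<one> then d else 0)"
proof -
  have "(\<Sum>k\<in>I. act g (u k) * e k) = act g (\<Sum>k\<in>I. u k * act (inv g) (e k))"
    using assms by (simp add: act_sum act_mult act_cancel_inv)
  also have "\<dots> = act g (if inv g = \<one> then d else 0)"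
    using assms by (subst dual_systemD[OF assms(1)]) auto
  also have "\<dots> = (if g = \<one> then d else 0)"
    using assms(2) by (auto simp: act_one act_0 inv_eq_1_iff)
  finally show ?thesis .
qed

text \<open>
  The elements \<open>u\<close> generate the ring over its invariants up to the factor \<open>d\<close>: in the sum over the
  group only the identity survives.
\<close>

lemma dual_expand:
  assumes "dual_system I u e d"
  shows "(\<Sum>k\<in>I. u k * transfer (e k * a)) = d * a"
proof -
  have "(\<Sum>k\<in>I. u k * transfer (e k * a)) =
      (\<Sum>g\<in>carrier \<G>. act g a * (\<Sum>k\<in>I. u k * act g (e k)))"
    by (simp add: transfer_def act_mult sum_distrib_left mult_ac) (rule sum.swap)
  also have "\<dots> = (\<Sum>g\<in>carrier \<G>. if g = \<one> then act g a * d else 0)"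
    by (intro sum.cong refl) (simp add: dual_systemD[OF assms])
  also have "\<dots> = d * a"
    by (simp add: finite_carrier act_one mult.commute)
  finally show ?thesis .
qed

lemma dual_expand_sym:
  assumes "dual_system I u e d"
  shows "(\<Sum>k\<in>I. transfer (a * u k) * e k) = d * a"
proof -
  have "(\<Sum>k\<in>I. transfer (a * u k) * e k) =
      (\<Sum>g\<in>carrier \<G>. act g a * (\<Sum>k\<in>I. act g (u k) * e k))"
    by (simp add: transfer_def act_mult sum_distrib_left sum_distrib_right mult_ac) (rule sum.swap)
  also have "\<dots> = (\<Sum>g\<in>carrier \<G>. if g = \<one> then act g a * d else 0)"
    by (intro sum.cong refl) (simp add: dual_system_sym[OF assms])
  also have "\<dots> = d * a"
    by (simp add: finite_carrier act_one mult.commute)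
  finally show ?thesis .
qed

text \<open>
  The expansion of \<open>\<Prod>h\<in>H. l - act g (act h l)\<close> over the subsets of \<open>H\<close> is a sum of products of a
  power of \<open>l\<close> and a conjugate under \<open>g\<close>. For \<open>g \<noteq> \<one>\<close> the factor with \<open>h = inv g\<close> vanishes.
\<close>

lemma dual_system_orbit:
  fixes l :: 'a
  defines "H \<equiv> carrier \<G> - {\<one>}"
  shows "dual_system (Pow H) (\<lambda>S. l ^ card S) (\<lambda>S. \<Prod>h\<in>H - S. - act h l) (\<Prod>h\<in>H. l - act h l)"
  unfolding dual_system_def
proof (intro conjI ballI)
  have fin: "finite H"
    by (simp add: H_def finite_carrier)
  then show "finite (Pow H)" by simp
  fix g assume g: "g \<in> carrier \<G>"
  have "(\<Sum>S\<in>Pow H. l ^ card S * act g (\<Prod>h\<in>H - S. - act h l)) =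
      (\<Sum>S\<in>Pow H. (\<Prod>h\<in>S. l) * (\<Prod>h\<in>H - S. - act g (act h l)))"
    using g by (simp add: act_prod act_minus)
  also have "\<dots> = (\<Prod>h\<in>H. l + - act g (act h l))"
    by (rule prod_add[OF fin, symmetric])
  also have "\<dots> = (if g = \<one> then \<Prod>h\<in>H. l - act h l else 0)"
  proof (cases "g = \<one>")
    case False
    have "inv g \<in> H" using g False by (auto simp: H_def inv_eq_1_iff)
    moreover have "l + - act g (act (inv g) l) = 0" using g by (simp add: act_cancel_inv)
    ultimately show ?thesis using False fin by (auto intro!: prod_zero)
  qed (simp add: act_one)
  finally show "(\<Sum>S\<in>Pow H. l ^ card S * act g (\<Prod>h\<in>H - S. - act h l)) =
      (if g = \<one> then \<Prod>h\<in>H. l - act h l else 0)" .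
qed

section \<open>Extending derivations from the invariants\<close>

lemma act_eq_0_iff: "g \<in> carrier \<G> \<Longrightarrow> act g a = 0 \<longleftrightarrow> a = 0"
  using act_inv_cancel[of g a] act_0[of "inv g"] act_0[of g] by auto

text \<open>
  The multiple is the norm of \<open>d\<close>.
\<close>

lemma invariant_multiple:
  assumes "d \<noteq> 0"
  obtains c where "c * d \<in> invariants" "c * d \<noteq> 0"
proof
  let ?c = "\<Prod>g\<in>carrier \<G> - {\<one>}. act g d"
  have c: "?c * d = (\<Prod>g\<in>carrier \<G>. act g d)"
    by (subst prod.remove[OF finite_carrier one_closed]) (simp add: act_one mult.commute)
  then show "?c * d \<noteq> 0"
    using assms finite_carrier by (simp add: prod_zero_iff act_eq_0_iff)
  have "act h (\<Prod>g\<in>carrier \<G>. act g d) = (\<Prod>g\<in>carrier \<G>. act g d)" if h: "h \<in> carrier \<G>" for h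
  proof -
    have "act h (\<Prod>g\<in>carrier \<G>. act g d) = (\<Prod>g\<in>carrier \<G>. act (h \<otimes> g) d)"
      using h by (simp add: act_prod act_act)
    also have "\<dots> = (\<Prod>g\<in>carrier \<G>. act g d)"
    proof (rule prod.reindex_bij_witness[where i = "\<lambda>g. inv h \<otimes> g" and j = "\<lambda>g. h \<otimes> g"])
      fix g assume "g \<in> carrier \<G>"
      then show "inv h \<otimes> (h \<otimes> g) = g" "h \<otimes> (inv h \<otimes> g) = g"
        using h by (auto simp flip: m_assoc)
    qed (use h in auto)
    finally show ?thesis .
  qed
  then show "?c * d \<in> invariants"
    by (simp add: c invariants_def)
qed

text \<open>
  The matrix \<open>\<beta>\<close> describes multiplication by \<open>a\<close> on the family \<open>e\<close> and, by duality, also on the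
  family \<open>u\<close>; the norm of \<open>d\<close> clears its denominators. Through this matrix, maps which are linear only
  over the invariants can be handled as if they were linear over the whole ring.
\<close>

lemma structure_constants:
  assumes dual: "dual_system I u e d" and d: "d \<noteq> 0"
  obtains N \<beta> where "N \<in> invariants" "N \<noteq> 0" "\<And>k j. \<beta> k j \<in> invariants"
    "\<And>k x. N * (e k * a * x) = (\<Sum>j\<in>I. \<beta> k j * (e j * x))"
    "\<And>j. (\<Sum>k\<in>I. u k * \<beta> k j) = N * a * u j"
proof -
  obtain c where N: "c * d \<in> invariants" "c * d \<noteq> 0"
    using invariant_multiple[OF d] .
  define \<beta> where "\<beta> k j = transfer (c * e k * a * u j)" for k j
  show ?thesis
  proof (rule that[OF N])
    show "\<beta> k j \<in> invariants" for k j
      by (simp add: \<beta>_def transfer_invariant)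
    show "(\<Sum>k\<in>I. u k * \<beta> k j) = c * d * a * u j" for j
      unfolding \<beta>_def using dual_expand[OF dual, of "c * a * u j"] by (simp add: mult_ac)
    fix k x
    have "c * d * (e k * a * x) = (\<Sum>j\<in>I. \<beta> k j * e j) * x"
      unfolding \<beta>_def by (subst dual_expand_sym[OF dual]) (simp only: mult_ac)
    then show "c * d * (e k * a * x) = (\<Sum>j\<in>I. \<beta> k j * (e j * x))"
      by (simp only: sum_distrib_right mult.assoc)
  qed
qed

text \<open>
  If \<open>\<delta>\<close> extends to a derivation \<open>E0\<close> of the whole ring, then the operator \<open>H\<close> below is
  \<open>d\<^sup>2 E0\<close> plus multiplication by a fixed element. Subtracting \<open>H 1\<close> therefore isolates \<open>d\<^sup>2 E0\<close>. As \<open>H\<close>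
  only involves \<open>\<delta>\<close>, this proves uniqueness of \<open>E0\<close> and also constructs it up to the factor \<open>d\<^sup>2\<close>. A
  single summation \<open>\<delta>0\<close> is not enough, since it differs from \<open>d E0\<close> by a map that is linear over the
  invariants only.
\<close>

context
  fixes I :: "'k set" and u e :: "'k \<Rightarrow> 'a" and d :: 'a and \<delta> :: "'a \<Rightarrow> 'a"
  assumes dual: "dual_system I u e d" and d: "d \<noteq> 0"
    and \<delta>: "derivation_on invariants \<delta>"
begin

private definition \<delta>0 where "\<delta>0 a = (\<Sum>k\<in>I. u k * \<delta> (transfer (e k * a)))"
private definition H where "H a = (\<Sum>k\<in>I. u k * \<delta>0 (e k * a))"

private lemma \<delta>0_add: "\<delta>0 (a + b) = \<delta>0 a + \<delta>0 b"
  by (simp add: \<delta>0_def algebra_simps transfer_add derivation_onD[OF \<delta>] transfer_invariant sum.distrib)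

private lemma \<delta>0_0: "\<delta>0 0 = 0"
  using \<delta>0_add[of 0 0] by (metis add.right_neutral add_left_cancel)

private lemma \<delta>0_sum: "\<delta>0 (\<Sum>k\<in>J. f k) = (\<Sum>k\<in>J. \<delta>0 (f k))"
  by (induction J rule: infinite_finite_induct) (auto simp: \<delta>0_add \<delta>0_0)

private lemma \<delta>0_mult:
  assumes b: "b \<in> invariants"
  shows "\<delta>0 (b * a) = b * \<delta>0 a + d * \<delta> b * a"
proof -
  have "\<delta>0 (b * a) = (\<Sum>k\<in>I. u k * \<delta> (b * transfer (e k * a)))"
    by (simp add: \<delta>0_def mult.left_commute[of _ b] transfer_mult_invariant[OF b])
  also have "\<dots> = (\<Sum>k\<in>I. b * (u k * \<delta> (transfer (e k * a))) + \<delta> b * (u k * transfer (e k * a)))"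
    by (intro sum.cong refl) (simp add: derivation_onD[OF \<delta> b transfer_invariant] algebra_simps)
  also have "\<dots> = b * \<delta>0 a + \<delta> b * (d * a)"
    by (simp add: \<delta>0_def sum.distrib dual_expand[OF dual] flip: sum_distrib_left)
  finally show ?thesis by (simp add: mult_ac)
qed

private lemma sum_ue: "(\<Sum>k\<in>I. u k * e k) = d"
  using dual_systemD[OF dual one_closed] by (simp add: act_one)

text \<open>
  \<open>H\<close> is a differential operator of order one: its commutator with multiplication by \<open>a\<close> is again a
  multiplication. This becomes the Leibniz rule for \<open>E\<close>.
\<close>

private lemma H_commutator: "H (a * x) - a * H x = x * (H a - a * H 1)"
proof -
  obtain N \<beta> where N: "N \<in> invariants" "N \<noteq> 0" and \<beta>: "\<And>k j. \<beta> k j \<in> invariants"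
    and e: "\<And>k x. N * (e k * a * x) = (\<Sum>j\<in>I. \<beta> k j * (e j * x))"
    and u: "\<And>j. (\<Sum>k\<in>I. u k * \<beta> k j) = N * a * u j"
    by (rule structure_constants[OF dual d, of a], rule that; assumption)
  define K where "K = (\<Sum>k\<in>I. \<Sum>j\<in>I. u k * (d * \<delta> (\<beta> k j) * e j)) - d * d * \<delta> (N) * a"
  have "N * H (a * x) = N * a * H x + x * K" for x
  proof -
    have "N * H (a * x) = (\<Sum>k\<in>I. u k * (N * \<delta>0 (e k * a * x)))"
      by (simp add: H_def sum_distrib_left mult_ac)
    also have "\<dots> = (\<Sum>k\<in>I. u k * \<delta>0 (N * (e k * a * x)) - u k * e k * (d * \<delta> (N) * a * x))"
      by (intro sum.cong refl) (simp only: \<delta>0_mult[OF N(1)], simp add: algebra_simps)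
    also have "\<dots> = (\<Sum>k\<in>I. u k * \<delta>0 (N * (e k * a * x))) - d * (d * \<delta> (N) * a * x)"
      by (simp only: sum_subtractf sum_ue flip: sum_distrib_right)
    also have "(\<Sum>k\<in>I. u k * \<delta>0 (N * (e k * a * x))) =
        (\<Sum>k\<in>I. \<Sum>j\<in>I. u k * \<beta> k j * \<delta>0 (e j * x) + u k * (d * \<delta> (\<beta> k j) * e j) * x)"
      by (simp only: e \<delta>0_sum \<delta>0_mult[OF \<beta>] sum_distrib_left) (simp add: algebra_simps)
    also have "\<dots> = (\<Sum>k\<in>I. \<Sum>j\<in>I. u k * \<beta> k j * \<delta>0 (e j * x)) + (\<Sum>k\<in>I. \<Sum>j\<in>I. u k * (d * \<delta> (\<beta> k j) * e j)) * x"
      by (simp only: sum.distrib sum_distrib_right)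
    also have "(\<Sum>k\<in>I. \<Sum>j\<in>I. u k * \<beta> k j * \<delta>0 (e j * x)) = (\<Sum>j\<in>I. (\<Sum>k\<in>I. u k * \<beta> k j) * \<delta>0 (e j * x))"
      by (subst sum.swap) (simp add: sum_distrib_right)
    also have "\<dots> = N * a * H x"
      by (simp add: u H_def sum_distrib_left mult_ac)
    finally show ?thesis
      by (simp add: K_def algebra_simps)
  qed
  from this[of x] this[of 1] have H: "N * H (a * x) = N * a * H x + x * K" "K = N * H a - N * a * H 1"
    by simp_all
  have "N * (H (a * x) - a * H x) = N * (x * (H a - a * H 1))"
    unfolding right_diff_distrib H by (simp add: algebra_simps)
  then show ?thesis using N(2) by simp
qed

private definition E where "E a = H a - a * H 1"

private lemma H_add: "H (a + b) = H a + H b"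
  by (simp add: H_def distrib_left \<delta>0_add sum.distrib)

lemma scaled_extension_exists:
  "\<exists>E. derivation_on UNIV E \<and> (\<forall>b\<in>invariants. E b = d\<^sup>2 * \<delta> b)"
proof (intro exI conjI ballI)
  show "derivation_on UNIV E"
    unfolding derivation_on_def
  proof (intro conjI ballI)
    fix a b
    show "E (a + b) = E a + E b"
      by (simp add: E_def H_add algebra_simps)
    show "E (a * b) = a * E b + E a * b"
      using H_commutator[of a b] by (simp add: E_def algebra_simps)
  qed
  fix b assume b: "b \<in> invariants"
  have "H b = b * H 1 + d * \<delta> b * (\<Sum>k\<in>I. u k * e k)"
    by (simp add: H_def mult.commute[of _ b] \<delta>0_mult[OF b] sum.distrib distrib_left sum_distrib_left mult_ac)
  then show "E b = d\<^sup>2 * \<delta> b"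
    by (simp add: E_def sum_ue power2_eq_square)
qed

private lemma extension_eq_E:
  assumes E0: "derivation_on UNIV E0" and eq: "\<And>b. b \<in> invariants \<Longrightarrow> E0 b = \<delta> b"
  shows "d\<^sup>2 * E0 a = E a"
proof -
  have E0_0: "E0 0 = 0"
    using derivation_onD(1)[OF E0, of 0 0] by (metis add.right_neutral add_left_cancel UNIV_I)
  have E0_sum: "E0 (\<Sum>k\<in>J. f k) = (\<Sum>k\<in>J. E0 (f k))" for J :: "'k set" and f
    by (induction J rule: infinite_finite_induct) (auto simp: E0_0 derivation_onD[OF E0])
  have \<delta>0: "\<delta>0 y = E0 (d * y) - (\<Sum>k\<in>I. E0 (u k) * transfer (e k * y))" for y
    by (simp add: \<delta>0_def E0_sum transfer_invariant derivation_onD[OF E0] sum.distrib flip: eq dual_expand[OF dual])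
  define Z where "Z = (\<Sum>j\<in>I. u j * E0 (d * e j)) - (\<Sum>k\<in>I. E0 (u k) * (d * e k))"
  have "H y = Z * y + d\<^sup>2 * E0 y" for y
  proof -
    have "H y = (\<Sum>j\<in>I. u j * E0 (d * e j) * y + u j * e j * (d * E0 y) -
        (\<Sum>k\<in>I. E0 (u k) * (u j * transfer (e j * (e k * y)))))"
      unfolding H_def
    proof (intro sum.cong refl)
      fix j
      have "E0 (d * (e j * y)) = E0 (d * e j) * y + d * e j * E0 y"
        using derivation_onD(2)[OF E0, of "d * e j" y] by (simp add: mult_ac)
      then show "u j * \<delta>0 (e j * y) = u j * E0 (d * e j) * y + u j * e j * (d * E0 y) -
          (\<Sum>k\<in>I. E0 (u k) * (u j * transfer (e j * (e k * y))))"
        by (simp only: \<delta>0 right_diff_distrib distrib_left sum_distrib_left mult_ac)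
    qed
    also have "\<dots> = (\<Sum>j\<in>I. u j * E0 (d * e j)) * y + d * (d * E0 y) -
        (\<Sum>j\<in>I. \<Sum>k\<in>I. E0 (u k) * (u j * transfer (e j * (e k * y))))"
      by (simp only: sum_subtractf sum.distrib sum_ue flip: sum_distrib_right)
    also have "(\<Sum>j\<in>I. \<Sum>k\<in>I. E0 (u k) * (u j * transfer (e j * (e k * y)))) =
        (\<Sum>k\<in>I. E0 (u k) * (\<Sum>j\<in>I. u j * transfer (e j * (e k * y))))"
      by (subst sum.swap) (simp only: sum_distrib_left)
    also have "\<dots> = (\<Sum>k\<in>I. E0 (u k) * (d * e k)) * y"
      by (simp only: dual_expand[OF dual] sum_distrib_right mult.assoc)
    finally show ?thesis
      by (simp only: Z_def power2_eq_square left_diff_distrib) (simp add: algebra_simps)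
  qed
  moreover have "E0 1 = 0"
    using derivation_onD(2)[OF E0, of 1 1] by (metis add.right_neutral add_left_cancel UNIV_I mult_1_left mult_1_right)
  ultimately show ?thesis
    by (simp add: E_def)
qed

lemma extension_unique:
  assumes "derivation_on UNIV E1" "\<And>b. b \<in> invariants \<Longrightarrow> E1 b = \<delta> b"
    and "derivation_on UNIV E2" "\<And>b. b \<in> invariants \<Longrightarrow> E2 b = \<delta> b"
  shows "E1 = E2"
proof
  fix a
  have "d\<^sup>2 * E1 a = d\<^sup>2 * E2 a"
    using extension_eq_E[OF assms(1,2)] extension_eq_E[OF assms(3,4)] by simp
  then show "E1 a = E2 a" using d by simp
qed

end

end

section \<open>Purity: denominators cancel in codimension one\<close>

text \<open>
  Purity holds in a factorial ring as soon as every prime element is avoided by some discriminant, that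
  is, if the ring is unramified over its invariants in codimension one. The square is the power of the
  denominator that occurs in \<open>scaled_extension_exists\<close>.
\<close>

locale pure_ring_action = finite_ring_action \<G> act
  for \<G> :: "('g, 'x) monoid_scheme" (structure) and act :: "'g \<Rightarrow> 'a::idom \<Rightarrow> 'a" +
  assumes purity: "c \<noteq> 0 \<Longrightarrow> \<forall>d\<in>discriminants. c dvd d\<^sup>2 * a \<Longrightarrow> c dvd a"
    and discriminant_exists: "\<exists>d\<in>discriminants. d \<noteq> 0"
begin

lemma dual_system_exists: "\<exists>(I :: 'g set set) u e d. dual_system I u e d \<and> d \<noteq> 0"
  using discriminant_exists unfolding discriminants_def by blast

text \<open>
  Different dual systems lead to the same derivation with different denominators. So the denominator of
  one of them divides after multiplication by the square of any discriminant, and purity cancels it.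
\<close>

lemma extension_exists:
  assumes \<delta>: "derivation_on invariants \<delta>"
  shows "\<exists>E. derivation_on UNIV E \<and> (\<forall>b\<in>invariants. E b = \<delta> b)"
proof -
  obtain I0 :: "'g set set" and u0 e0 d0 where dual0: "dual_system I0 u0 e0 d0" and d0: "d0 \<noteq> 0"
    using dual_system_exists by blast
  obtain E0 where E0: "derivation_on UNIV E0" "\<And>b. b \<in> invariants \<Longrightarrow> E0 b = d0\<^sup>2 * \<delta> b"
    using scaled_extension_exists[OF dual0 d0 \<delta>] by blast
  have "d0\<^sup>2 dvd E0 a" for a
  proof (rule purity)
    show "d0\<^sup>2 \<noteq> 0" using d0 by simp
  next
    have "d0\<^sup>2 dvd d\<^sup>2 * E0 a" if dual: "dual_system I u e d" for I :: "'g set set" and u e d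
    proof (cases "d = 0")
      case False
      obtain E where E: "derivation_on UNIV E" "\<And>b. b \<in> invariants \<Longrightarrow> E b = d\<^sup>2 * \<delta> b"
        using scaled_extension_exists[OF dual False \<delta>] by blast
      have "(\<lambda>a. d\<^sup>2 * E0 a) = (\<lambda>a. d0\<^sup>2 * E a)"
      proof (rule extension_unique[OF dual0 d0])
        show "derivation_on invariants (\<lambda>b. d\<^sup>2 * d0\<^sup>2 * \<delta> b)"
          using \<delta> by (simp add: derivation_on_def algebra_simps)
        show "derivation_on UNIV (\<lambda>a. d\<^sup>2 * E0 a)" "derivation_on UNIV (\<lambda>a. d0\<^sup>2 * E a)"
          using E0(1) E(1) by (simp_all add: derivation_on_def algebra_simps)
      qed (simp_all add: E0(2) E(2))
      then have "d\<^sup>2 * E0 a = d0\<^sup>2 * E a" by (rule fun_cong)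
      then show ?thesis by simp
    qed simp
    then show "\<forall>d\<in>discriminants. d0\<^sup>2 dvd d\<^sup>2 * E0 a"
      unfolding discriminants_def by blast
  qed
  then obtain E where E: "\<And>a. E0 a = d0\<^sup>2 * E a"
    unfolding dvd_def by metis
  have "derivation_on UNIV E"
    unfolding derivation_on_def
  proof (intro conjI ballI)
    fix a b
    have "d0\<^sup>2 * E (a + b) = d0\<^sup>2 * (E a + E b)"
      using derivation_onD(1)[OF E0(1), of a b] by (simp add: E distrib_left)
    then show "E (a + b) = E a + E b" using d0 by simp
    have "d0\<^sup>2 * E (a * b) = d0\<^sup>2 * (a * E b + E a * b)"
      using derivation_onD(2)[OF E0(1), of a b] by (simp add: E algebra_simps)
    then show "E (a * b) = a * E b + E a * b" using d0 by simp
  qed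
  moreover have "E b = \<delta> b" if "b \<in> invariants" for b
    using E0(2)[OF that] E[of b] d0 by simp
  ultimately show ?thesis by blast
qed

definition extension :: "('a \<Rightarrow> 'a) \<Rightarrow> 'a \<Rightarrow> 'a" where
  "extension \<delta> = (SOME E. derivation_on UNIV E \<and> (\<forall>b\<in>invariants. E b = \<delta> b))"

lemma extension:
  assumes "derivation_on invariants \<delta>"
  shows "derivation_on UNIV (extension \<delta>)" "b \<in> invariants \<Longrightarrow> extension \<delta> b = \<delta> b"
  using someI_ex[OF extension_exists[OF assms]] by (auto simp: extension_def)

lemma derivation_eqI:
  assumes E: "derivation_on UNIV E1" "derivation_on UNIV E2"
    and eq: "\<And>b. b \<in> invariants \<Longrightarrow> E1 b = E2 b"
  shows "E1 = E2"
proof -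
  obtain I0 :: "'g set set" and u0 e0 d0 where dual0: "dual_system I0 u0 e0 d0" and d0: "d0 \<noteq> 0"
    using dual_system_exists by blast
  have "derivation_on invariants E2"
    using E(2) by (simp add: derivation_on_def)
  from extension_unique[OF dual0 d0 this E(1) eq E(2)] show ?thesis by simp
qed

text \<open>
  Conjugation by a group element does not change the restriction to the invariants, so uniqueness of
  the extension applies.
\<close>

lemma extension_act:
  assumes \<delta>: "derivation_on invariants \<delta>" "\<And>b. b \<in> invariants \<Longrightarrow> \<delta> b \<in> invariants"
    and g: "g \<in> carrier \<G>"
  shows "act g (extension \<delta> a) = extension \<delta> (act g a)"
proof -
  have "(\<lambda>a. act (inv g) (extension \<delta> (act g a))) = extension \<delta>"
  proof (rule derivation_eqI)
    show "derivation_on UNIV (\<lambda>a. act (inv g) (extension \<delta> (act g a)))"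
      using derivation_onD[OF extension(1)[OF \<delta>(1)]] g
      by (simp add: derivation_on_def act_add act_mult act_inv_cancel)
    show "derivation_on UNIV (extension \<delta>)"
      by (rule extension(1)[OF \<delta>(1)])
    fix b assume "b \<in> invariants"
    then show "act (inv g) (extension \<delta> (act g b)) = extension \<delta> b"
      using g by (simp add: invariants_act extension(2)[OF \<delta>(1)] \<delta>(2))
  qed
  then have "act (inv g) (extension \<delta> (act g a)) = extension \<delta> a" by (rule fun_cong)
  then show ?thesis using g by (metis act_cancel_inv)
qed

end

section \<open>Twisted invariant vectors\<close>

text \<open>
  The matrices form a one-cocycle, which makes \<open>twist\<close> below a semilinear action on vectors.
\<close>

locale twisted_action = pure_ring_action \<G> act
  for \<G> :: "('g, 'x) monoid_scheme" (structure) and act :: "'g \<Rightarrow> 'a::idom \<Rightarrow> 'a" +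
  fixes n :: nat and r :: "'g \<Rightarrow> 'a mat"
  assumes r_carrier: "g \<in> carrier \<G> \<Longrightarrow> r g \<in> carrier_mat n n"
    and r_one: "r \<one> = 1\<^sub>m n"
    and r_mult: "g \<in> carrier \<G> \<Longrightarrow> h \<in> carrier \<G> \<Longrightarrow> r (g \<otimes> h) = r g * map_mat (act g) (r h)"
begin

definition twist :: "'g \<Rightarrow> 'a vec \<Rightarrow> 'a vec" where
  "twist g w = r g *\<^sub>v map_vec (act g) w"

definition twisted_invariants :: "'a vec set" where
  "twisted_invariants = {w \<in> carrier_vec n. \<forall>g\<in>carrier \<G>. twist g w = w}"

text \<open>
  Vectors of a fixed length do not form a type, so their sums are taken entrywise.
\<close>

definition vsum :: "'k set \<Rightarrow> ('k \<Rightarrow> 'a vec) \<Rightarrow> 'a vec" where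
  "vsum I f = vec n (\<lambda>i. \<Sum>k\<in>I. f k $ i)"

lemma vsum_carrier [simp]: "vsum I f \<in> carrier_vec n"
  and vsum_nth: "i < n \<Longrightarrow> vsum I f $ i = (\<Sum>k\<in>I. f k $ i)"
  and dim_vsum [simp]: "dim_vec (vsum I f) = n"
  by (simp_all add: vsum_def)

lemma mult_mat_vec_nth:
  assumes "M \<in> carrier_mat n n" "v \<in> carrier_vec n" "i < n"
  shows "(M *\<^sub>v v) $ i = (\<Sum>j<n. M $$ (i, j) * v $ j)"
  using assms by (simp add: scalar_prod_def lessThan_atLeast0 row_def)

lemma twist_carrier: "g \<in> carrier \<G> \<Longrightarrow> twist g w \<in> carrier_vec n"
  unfolding twist_def by (intro carrier_vecI) (use r_carrier[of g] in simp)

lemma twist_nth: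
  assumes "g \<in> carrier \<G>" "w \<in> carrier_vec n" "i < n"
  shows "twist g w $ i = (\<Sum>j<n. r g $$ (i, j) * act g (w $ j))"
  using assms by (simp add: twist_def mult_mat_vec_nth[OF r_carrier] del: index_mult_mat_vec)

lemma twist_smult:
  assumes "g \<in> carrier \<G>" "w \<in> carrier_vec n"
  shows "twist g (a \<cdot>\<^sub>v w) = act g a \<cdot>\<^sub>v twist g w"
proof (rule eq_vecI)
  have dim: "dim_vec (twist g v) = n" for v
    using twist_carrier[OF assms(1), of v] by simp
  then show "dim_vec (twist g (a \<cdot>\<^sub>v w)) = dim_vec (act g a \<cdot>\<^sub>v twist g w)"
    by simp
  fix i assume "i < dim_vec (act g a \<cdot>\<^sub>v twist g w)"
  then show "twist g (a \<cdot>\<^sub>v w) $ i = (act g a \<cdot>\<^sub>v twist g w) $ i"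
    using assms by (simp add: dim twist_nth act_mult sum_distrib_left mult_ac)
qed

lemma twist_vsum:
  assumes "g \<in> carrier \<G>" "\<And>k. k \<in> I \<Longrightarrow> f k \<in> carrier_vec n"
  shows "twist g (vsum I f) = vsum I (\<lambda>k. twist g (f k))"
proof (rule eq_vecI)
  show "dim_vec (twist g (vsum I f)) = dim_vec (vsum I (\<lambda>k. twist g (f k)))"
    using twist_carrier[OF assms(1), of "vsum I f"] by simp
  fix i assume "i < dim_vec (vsum I (\<lambda>k. twist g (f k)))"
  then have i: "i < n" by simp
  have "twist g (vsum I f) $ i = (\<Sum>j<n. \<Sum>k\<in>I. r g $$ (i, j) * act g (f k $ j))"
    using assms(1) i by (simp add: twist_nth vsum_nth act_sum sum_distrib_left)
  also have "\<dots> = (\<Sum>k\<in>I. \<Sum>j<n. r g $$ (i, j) * act g (f k $ j))"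
    by (rule sum.swap)
  also have "\<dots> = vsum I (\<lambda>k. twist g (f k)) $ i"
    using assms i by (simp add: twist_nth vsum_nth)
  finally show "twist g (vsum I f) $ i = vsum I (\<lambda>k. twist g (f k)) $ i" .
qed

lemma twist_one: "w \<in> carrier_vec n \<Longrightarrow> twist \<one> w = w"
  by (simp add: twist_def r_one map_vec_def act_one) (metis carrier_vecD vec_eq_iff dim_vec index_vec)

lemma twist_twist:
  assumes g: "g \<in> carrier \<G>" and h: "h \<in> carrier \<G>" and w: "w \<in> carrier_vec n"
  shows "twist (g \<otimes> h) w = twist g (twist h w)"
proof (rule eq_vecI)
  show "dim_vec (twist (g \<otimes> h) w) = dim_vec (twist g (twist h w))"
    using twist_carrier[OF g, of "twist h w"] twist_carrier[of "g \<otimes> h" w] g h by simp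
  fix i assume "i < dim_vec (twist g (twist h w))"
  then have i: "i < n" using twist_carrier[OF g, of "twist h w"] by simp
  have "twist g (twist h w) $ i =
      (\<Sum>j<n. r g $$ (i, j) * act g (\<Sum>k<n. r h $$ (j, k) * act h (w $ k)))"
    using g h w i by (simp add: twist_nth twist_carrier)
  also have "\<dots> = (\<Sum>j<n. \<Sum>k<n. r g $$ (i, j) * act g (r h $$ (j, k)) * act g (act h (w $ k)))"
    using g by (simp add: act_sum act_mult sum_distrib_left mult_ac)
  also have "\<dots> = (\<Sum>k<n. \<Sum>j<n. r g $$ (i, j) * act g (r h $$ (j, k)) * act g (act h (w $ k)))"
    by (rule sum.swap)
  also have "\<dots> = (\<Sum>k<n. r (g \<otimes> h) $$ (i, k) * act (g \<otimes> h) (w $ k))"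
  proof (intro sum.cong refl)
    fix k assume "k \<in> {..<n}"
    then have "r (g \<otimes> h) $$ (i, k) = (\<Sum>j<n. r g $$ (i, j) * act g (r h $$ (j, k)))"
      using r_carrier[OF g] r_carrier[OF h] i
      by (simp add: r_mult[OF g h] scalar_prod_def lessThan_atLeast0 row_def col_def)
    then show "(\<Sum>j<n. r g $$ (i, j) * act g (r h $$ (j, k)) * act g (act h (w $ k))) =
        r (g \<otimes> h) $$ (i, k) * act (g \<otimes> h) (w $ k)"
      using g h by (simp add: sum_distrib_right act_act)
  qed
  also have "\<dots> = twist (g \<otimes> h) w $ i"
    using g h w i by (simp add: twist_nth)
  finally show "twist (g \<otimes> h) w $ i = twist g (twist h w) $ i" by simp
qed

definition vtransfer :: "'a vec \<Rightarrow> 'a vec" where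
  "vtransfer v = vsum (carrier \<G>) (\<lambda>g. twist g v)"

lemma dim_vtransfer [simp]: "dim_vec (vtransfer v) = n"
  by (simp add: vtransfer_def)

lemma twisted_invariants_carrier: "w \<in> twisted_invariants \<Longrightarrow> w \<in> carrier_vec n"
  and twisted_invariants_twist: "w \<in> twisted_invariants \<Longrightarrow> g \<in> carrier \<G> \<Longrightarrow> twist g w = w"
  by (simp_all add: twisted_invariants_def)

lemma vtransfer_invariant:
  assumes v: "v \<in> carrier_vec n"
  shows "vtransfer v \<in> twisted_invariants"
proof -
  have "twist h (vtransfer v) = vtransfer v" if h: "h \<in> carrier \<G>" for h
  proof -
    have "twist h (vtransfer v) = vsum (carrier \<G>) (\<lambda>g. twist h (twist g v))"
      unfolding vtransfer_def by (rule twist_vsum[OF h]) (simp add: twist_carrier)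
    also have "\<dots> = vec n (\<lambda>i. \<Sum>g\<in>carrier \<G>. twist (h \<otimes> g) v $ i)"
      unfolding vsum_def by (intro arg_cong[where f = "vec n"] ext sum.cong refl) (simp add: twist_twist[OF h _ v])
    also have "\<dots> = vtransfer v"
      unfolding vtransfer_def vsum_def using sum_translate[OF h, of "\<lambda>g. twist g v $ i" for i] by simp
    finally show ?thesis .
  qed
  then show ?thesis by (simp add: twisted_invariants_def vtransfer_def)
qed

lemma vtransfer_smult_nth:
  assumes "v \<in> carrier_vec n" "i < n"
  shows "vtransfer (a \<cdot>\<^sub>v v) $ i = (\<Sum>g\<in>carrier \<G>. act g a * twist g v $ i)"
proof -
  have "twist g v \<in> carrier_vec n" if "g \<in> carrier \<G>" for g
    by (rule twist_carrier[OF that])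
  then have "(act g a \<cdot>\<^sub>v twist g v) $ i = act g a * twist g v $ i" if "g \<in> carrier \<G>" for g
    using assms(2) that by (metis carrier_vecD index_smult_vec(1))
  then show ?thesis
    using assms by (simp add: vtransfer_def vsum_nth twist_smult)
qed

lemma vtransfer_smult_invariant:
  assumes w: "w \<in> twisted_invariants"
  shows "vtransfer (a \<cdot>\<^sub>v w) = transfer a \<cdot>\<^sub>v w"
proof (rule eq_vecI)
  note wc = twisted_invariants_carrier[OF w]
  show "dim_vec (vtransfer (a \<cdot>\<^sub>v w)) = dim_vec (transfer a \<cdot>\<^sub>v w)"
    using wc by (simp add: vtransfer_def)
  fix i assume "i < dim_vec (transfer a \<cdot>\<^sub>v w)"
  then show "vtransfer (a \<cdot>\<^sub>v w) $ i = (transfer a \<cdot>\<^sub>v w) $ i"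
    using wc by (simp add: vtransfer_smult_nth twisted_invariants_twist[OF w] transfer_def sum_distrib_right)
qed

text \<open>Applied to the coordinates, duality writes \<open>d v\<close> as a combination of invariant vectors.\<close>

lemma dual_expand_vec:
  assumes dual: "dual_system I u e d" and v: "v \<in> carrier_vec n" and i: "i < n"
  shows "(\<Sum>k\<in>I. u k * vtransfer (e k \<cdot>\<^sub>v v) $ i) = d * v $ i"
proof -
  have "(\<Sum>k\<in>I. u k * vtransfer (e k \<cdot>\<^sub>v v) $ i) =
      (\<Sum>g\<in>carrier \<G>. (\<Sum>k\<in>I. u k * act g (e k)) * twist g v $ i)"
    by (simp add: vtransfer_smult_nth[OF v i] sum_distrib_left sum_distrib_right mult_ac) (rule sum.swap)
  also have "\<dots> = (\<Sum>g\<in>carrier \<G>. if g = \<one> then d * twist g v $ i else 0)"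
    by (intro sum.cong refl) (simp add: dual_systemD[OF dual])
  also have "\<dots> = d * v $ i"
    by (simp add: finite_carrier twist_one[OF v])
  finally show ?thesis .
qed

lemma twisted_invariants_closed:
  "v \<in> twisted_invariants \<Longrightarrow> w \<in> twisted_invariants \<Longrightarrow> v + w \<in> twisted_invariants"
  "b \<in> invariants \<Longrightarrow> w \<in> twisted_invariants \<Longrightarrow> b \<cdot>\<^sub>v w \<in> twisted_invariants"
  "0\<^sub>v n \<in> twisted_invariants"
proof -
  show "v + w \<in> twisted_invariants" if v: "v \<in> twisted_invariants" and w: "w \<in> twisted_invariants"
  proof -
    have "v + w = vsum UNIV (\<lambda>k. if k then v else w)"
      using v w by (intro eq_vecI) (auto simp: UNIV_bool vsum_nth twisted_invariants_def)
    moreover have "twist g (vsum UNIV (\<lambda>k. if k then v else w)) = vsum UNIV (\<lambda>k. if k then v else w)"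
      if "g \<in> carrier \<G>" for g
      using v w that by (subst twist_vsum) (auto simp: twisted_invariants_def intro!: arg_cong[where f = "vsum UNIV"])
    ultimately show ?thesis by (simp add: twisted_invariants_def)
  qed
  show "b \<cdot>\<^sub>v w \<in> twisted_invariants" if "b \<in> invariants" "w \<in> twisted_invariants"
    using that by (auto simp: twisted_invariants_def twist_smult invariants_act)
  show "0\<^sub>v n \<in> twisted_invariants"
    using twist_vsum[of _ "{}" undefined] by (simp add: twisted_invariants_def vsum_def zero_vec_def)
qed

section \<open>Linear maps between twisted invariants extend to matrices\<close>

definition module_map :: "('a vec \<Rightarrow> 'a vec) \<Rightarrow> bool" where
  "module_map \<alpha> \<longleftrightarrow>
     (\<forall>w\<in>twisted_invariants. \<alpha> w \<in> carrier_vec n) \<and>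
     (\<forall>v\<in>twisted_invariants. \<forall>w\<in>twisted_invariants. \<alpha> (v + w) = \<alpha> v + \<alpha> w) \<and>
     (\<forall>b\<in>invariants. \<forall>w\<in>twisted_invariants. \<alpha> (b \<cdot>\<^sub>v w) = b \<cdot>\<^sub>v \<alpha> w)"

lemma module_mapD:
  assumes "module_map \<alpha>" "w \<in> twisted_invariants"
  shows "\<alpha> w \<in> carrier_vec n" "v \<in> twisted_invariants \<Longrightarrow> \<alpha> (v + w) = \<alpha> v + \<alpha> w"
    "b \<in> invariants \<Longrightarrow> \<alpha> (b \<cdot>\<^sub>v w) = b \<cdot>\<^sub>v \<alpha> w"
  using assms by (auto simp: module_map_def)

lemma module_map_vsum:
  assumes \<alpha>: "module_map \<alpha>" and fin: "finite J" and f: "\<And>j. j \<in> J \<Longrightarrow> f j \<in> twisted_invariants"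
  shows "\<alpha> (vsum J f) = vsum J (\<lambda>j. \<alpha> (f j)) \<and> vsum J f \<in> twisted_invariants"
  using fin f
proof (induction J rule: finite_induct)
  case empty
  have "\<alpha> (0 \<cdot>\<^sub>v 0\<^sub>v n) = 0 \<cdot>\<^sub>v \<alpha> (0\<^sub>v n)"
    by (intro module_mapD[OF \<alpha>] twisted_invariants_closed invariants_closed)
  moreover have "0 \<cdot>\<^sub>v x = 0\<^sub>v n" if "x \<in> carrier_vec n" for x :: "'a vec"
    using that by auto
  moreover have "\<alpha> (0\<^sub>v n) \<in> carrier_vec n"
    by (intro module_mapD[OF \<alpha>] twisted_invariants_closed)
  ultimately have "\<alpha> (0\<^sub>v n) = 0\<^sub>v n" by simp
  then show ?case
    by (simp add: vsum_def flip: zero_vec_def) (simp add: twisted_invariants_closed)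
next
  case (insert j J)
  have split: "vsum (insert j J) h = h j + vsum J h" if "h j \<in> carrier_vec n" for h
    using insert.hyps that by (intro eq_vecI) (auto simp: vsum_nth)
  have f: "f j \<in> twisted_invariants" "vsum J f \<in> twisted_invariants"
    and IH: "\<alpha> (vsum J f) = vsum J (\<lambda>j. \<alpha> (f j))"
    using insert by auto
  show ?case
    using f by (simp add: split twisted_invariants_carrier module_mapD[OF \<alpha>] twisted_invariants_closed IH)
qed

text \<open>
  The map \<open>\<alpha>\<close> is applied to the averages of \<open>v\<close> against the family \<open>e\<close>, and the results are reassembled
  with the family \<open>u\<close>. On twisted invariants this gives \<open>d \<alpha>\<close>. It makes sense for every vector and is
  linear over the whole ring, so it is given by a matrix.
\<close>

context
  fixes I :: "'k set" and u e :: "'k \<Rightarrow> 'a" and d :: 'a and \<alpha> :: "'a vec \<Rightarrow> 'a vec"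
  assumes dual: "dual_system I u e d" and d: "d \<noteq> 0" and \<alpha>: "module_map \<alpha>"
begin

private definition N where
  "N v = vsum I (\<lambda>k. u k \<cdot>\<^sub>v \<alpha> (vtransfer (e k \<cdot>\<^sub>v v)))"

private lemma fin: "finite I"
  using dual by (simp add: dual_system_def)

private lemma \<alpha>_carrier: "v \<in> carrier_vec n \<Longrightarrow> \<alpha> (vtransfer (a \<cdot>\<^sub>v v)) \<in> carrier_vec n"
  by (intro module_mapD(1)[OF \<alpha>] vtransfer_invariant) simp

private lemma N_nth: "v \<in> carrier_vec n \<Longrightarrow> i < n \<Longrightarrow>
    N v $ i = (\<Sum>k\<in>I. u k * \<alpha> (vtransfer (e k \<cdot>\<^sub>v v)) $ i)"
  unfolding N_def vsum_nth
proof (intro sum.cong refl)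
  fix k assume "v \<in> carrier_vec n" "i < n"
  then show "(u k \<cdot>\<^sub>v \<alpha> (vtransfer (e k \<cdot>\<^sub>v v))) $ i = u k * \<alpha> (vtransfer (e k \<cdot>\<^sub>v v)) $ i"
    using \<alpha>_carrier[of v "e k"] by (metis carrier_vecD index_smult_vec(1))
qed

private lemma N_vsum:
  assumes J: "finite J" and f: "\<And>j. j \<in> J \<Longrightarrow> f j \<in> carrier_vec n" and i: "i < n"
  shows "N (vsum J f) $ i = (\<Sum>j\<in>J. N (f j) $ i)"
proof -
  have "vtransfer (a \<cdot>\<^sub>v vsum J f) = vsum J (\<lambda>j. vtransfer (a \<cdot>\<^sub>v f j))" for a
  proof (rule eq_vecI)
    fix i assume "i < dim_vec (vsum J (\<lambda>j. vtransfer (a \<cdot>\<^sub>v f j)))"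
    then have i: "i < n" by simp
    have "vtransfer (a \<cdot>\<^sub>v vsum J f) $ i = (\<Sum>g\<in>carrier \<G>. \<Sum>j\<in>J. act g a * twist g (f j) $ i)"
      using i f by (simp add: vtransfer_smult_nth twist_vsum vsum_nth sum_distrib_left)
    also have "\<dots> = vsum J (\<lambda>j. vtransfer (a \<cdot>\<^sub>v f j)) $ i"
      using i f by (subst sum.swap) (simp add: vtransfer_smult_nth vsum_nth)
    finally show "vtransfer (a \<cdot>\<^sub>v vsum J f) $ i = vsum J (\<lambda>j. vtransfer (a \<cdot>\<^sub>v f j)) $ i" .
  qed (simp add: vtransfer_def)
  moreover have "\<alpha> (vsum J (\<lambda>j. vtransfer (a \<cdot>\<^sub>v f j))) = vsum J (\<lambda>j. \<alpha> (vtransfer (a \<cdot>\<^sub>v f j)))" for a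
    using module_map_vsum[OF \<alpha> J, of "\<lambda>j. vtransfer (a \<cdot>\<^sub>v f j)"] f by (simp add: vtransfer_invariant)
  ultimately have "N (vsum J f) $ i = (\<Sum>k\<in>I. \<Sum>j\<in>J. u k * \<alpha> (vtransfer (e k \<cdot>\<^sub>v f j)) $ i)"
    using i by (simp add: N_nth vsum_nth sum_distrib_left)
  also have "\<dots> = (\<Sum>j\<in>J. N (f j) $ i)"
    using i f by (subst sum.swap) (simp add: N_nth)
  finally show ?thesis .
qed

text \<open>
  The structure constants are invariant, so they pass through \<open>\<alpha>\<close>; on the family \<open>u\<close> they
  turn back into multiplication by \<open>a\<close>.
\<close>

private lemma N_smult:
  assumes v: "v \<in> carrier_vec n" and i: "i < n"
  shows "N (a \<cdot>\<^sub>v v) $ i = a * N v $ i"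
proof -
  obtain M \<beta> where M: "M \<in> invariants" "M \<noteq> 0" and \<beta>: "\<And>k j. \<beta> k j \<in> invariants"
    and e: "\<And>k x. M * (e k * a * x) = (\<Sum>j\<in>I. \<beta> k j * (e j * x))"
    and u: "\<And>j. (\<Sum>k\<in>I. u k * \<beta> k j) = M * a * u j"
    by (rule structure_constants[OF dual d, of a], rule that; assumption)
  have exp: "M \<cdot>\<^sub>v vtransfer (e k \<cdot>\<^sub>v (a \<cdot>\<^sub>v v)) = vsum I (\<lambda>j. \<beta> k j \<cdot>\<^sub>v vtransfer (e j \<cdot>\<^sub>v v))" for k
  proof (rule eq_vecI)
    fix i assume "i < dim_vec (vsum I (\<lambda>j. \<beta> k j \<cdot>\<^sub>v vtransfer (e j \<cdot>\<^sub>v v)))"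
    then have i: "i < n" by simp
    have "M * act g (e k * a) = (\<Sum>j\<in>I. \<beta> k j * act g (e j))" if "g \<in> carrier \<G>" for g
      using arg_cong[OF e[of k 1], of "act g"] that
      by (simp add: act_mult act_sum invariants_act[OF M(1)] invariants_act[OF \<beta>])
    then have "(\<Sum>g\<in>carrier \<G>. M * act g (e k * a) * twist g v $ i) =
        (\<Sum>g\<in>carrier \<G>. (\<Sum>j\<in>I. \<beta> k j * act g (e j)) * twist g v $ i)"
      by (intro sum.cong refl) simp
    then have "M * vtransfer (e k * a \<cdot>\<^sub>v v) $ i = (\<Sum>g\<in>carrier \<G>. \<Sum>j\<in>I. \<beta> k j * (act g (e j) * twist g v $ i))"
      by (simp only: vtransfer_smult_nth[OF v i] sum_distrib_left sum_distrib_right mult.assoc)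
    also have "\<dots> = vsum I (\<lambda>j. \<beta> k j \<cdot>\<^sub>v vtransfer (e j \<cdot>\<^sub>v v)) $ i"
      using i by (subst sum.swap) (simp add: vsum_nth vtransfer_smult_nth[OF v i] sum_distrib_left dim_vtransfer)
    finally show "(M \<cdot>\<^sub>v vtransfer (e k \<cdot>\<^sub>v (a \<cdot>\<^sub>v v))) $ i = vsum I (\<lambda>j. \<beta> k j \<cdot>\<^sub>v vtransfer (e j \<cdot>\<^sub>v v)) $ i"
      using i by (simp add: smult_smult_assoc vtransfer_def)
  qed (simp add: vtransfer_def)
  have inv: "vtransfer (x \<cdot>\<^sub>v v) \<in> twisted_invariants" "vtransfer (x \<cdot>\<^sub>v (y \<cdot>\<^sub>v v)) \<in> twisted_invariants" for x y
    using v by (auto intro: vtransfer_invariant)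
  have step: "M * \<alpha> (vtransfer (e k \<cdot>\<^sub>v (a \<cdot>\<^sub>v v))) $ i = (\<Sum>j\<in>I. \<beta> k j * \<alpha> (vtransfer (e j \<cdot>\<^sub>v v)) $ i)" for k
  proof -
    have "\<alpha> (M \<cdot>\<^sub>v vtransfer (e k \<cdot>\<^sub>v (a \<cdot>\<^sub>v v))) = vsum I (\<lambda>j. \<beta> k j \<cdot>\<^sub>v \<alpha> (vtransfer (e j \<cdot>\<^sub>v v)))"
      using module_map_vsum[OF \<alpha> fin, of "\<lambda>j. \<beta> k j \<cdot>\<^sub>v vtransfer (e j \<cdot>\<^sub>v v)"] inv
      by (simp add: exp twisted_invariants_closed \<beta> module_mapD(3)[OF \<alpha>])
    then have "(M \<cdot>\<^sub>v \<alpha> (vtransfer (e k \<cdot>\<^sub>v (a \<cdot>\<^sub>v v)))) $ i = (\<Sum>j\<in>I. (\<beta> k j \<cdot>\<^sub>v \<alpha> (vtransfer (e j \<cdot>\<^sub>v v))) $ i)"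
      using i by (simp add: module_mapD(3)[OF \<alpha> inv(2) M(1)] vsum_nth)
    moreover have "dim_vec (\<alpha> (vtransfer (x \<cdot>\<^sub>v v))) = n" "dim_vec (\<alpha> (vtransfer (x \<cdot>\<^sub>v (y \<cdot>\<^sub>v v)))) = n" for x y
      using module_mapD(1)[OF \<alpha> inv(1)] module_mapD(1)[OF \<alpha> inv(2)] by simp_all
    ultimately show ?thesis using i by simp
  qed
  have "M * N (a \<cdot>\<^sub>v v) $ i = (\<Sum>k\<in>I. \<Sum>j\<in>I. u k * \<beta> k j * \<alpha> (vtransfer (e j \<cdot>\<^sub>v v)) $ i)"
    using v i by (simp add: N_nth sum_distrib_left mult.left_commute[of M] step mult.assoc)
  also have "\<dots> = (\<Sum>j\<in>I. (\<Sum>k\<in>I. u k * \<beta> k j) * \<alpha> (vtransfer (e j \<cdot>\<^sub>v v)) $ i)"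
    by (subst sum.swap) (simp add: sum_distrib_right)
  also have "\<dots> = M * (a * N v $ i)"
    using v i by (simp add: u N_nth sum_distrib_left mult.assoc)
  finally show ?thesis using M(2) by simp
qed

lemma scaled_matrix_exists:
  "\<exists>M \<in> carrier_mat n n. \<forall>w\<in>twisted_invariants. M *\<^sub>v w = d \<cdot>\<^sub>v \<alpha> w"
proof (intro bexI ballI)
  let ?M = "mat n n (\<lambda>(i, j). N (unit_vec n j) $ i)"
  show "?M \<in> carrier_mat n n" by simp
  fix w assume w: "w \<in> twisted_invariants"
  note wc = twisted_invariants_carrier[OF w]
  show "?M *\<^sub>v w = d \<cdot>\<^sub>v \<alpha> w"
  proof (rule eq_vecI)
    have dim: "dim_vec (\<alpha> w) = n" using module_mapD(1)[OF \<alpha> w] by simp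
    then show "dim_vec (?M *\<^sub>v w) = dim_vec (d \<cdot>\<^sub>v \<alpha> w)" by simp
    fix i assume "i < dim_vec (d \<cdot>\<^sub>v \<alpha> w)"
    then have i: "i < n" using dim by simp
    have "w = vsum {..<n} (\<lambda>j. w $ j \<cdot>\<^sub>v unit_vec n j)"
      using wc by (intro eq_vecI) (auto simp: vsum_nth unit_vec_def if_distrib cong: if_cong)
    then have "N w $ i = N (vsum {..<n} (\<lambda>j. w $ j \<cdot>\<^sub>v unit_vec n j)) $ i" by simp
    also have "\<dots> = (\<Sum>j<n. w $ j * N (unit_vec n j) $ i)"
      using i by (simp add: N_vsum N_smult)
    also have "\<dots> = (?M *\<^sub>v w) $ i"
      using i wc by (subst mult_mat_vec_nth) (auto intro!: sum.cong)
    finally have "(?M *\<^sub>v w) $ i = N w $ i" by simp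
    also have "\<dots> = (\<Sum>k\<in>I. u k * transfer (e k * 1)) * \<alpha> w $ i"
      using dim i wc w
      by (simp add: N_nth vtransfer_smult_invariant module_mapD(3)[OF \<alpha> w transfer_invariant] sum_distrib_left sum_distrib_right mult_ac)
    also have "\<dots> = (d \<cdot>\<^sub>v \<alpha> w) $ i"
      using i dim by (subst dual_expand[OF dual]) simp
    finally show "(?M *\<^sub>v w) $ i = (d \<cdot>\<^sub>v \<alpha> w) $ i" .
  qed
qed

end

text \<open>
  The twisted invariants generate all vectors up to a denominator.
\<close>

lemma matrix_eqI:
  assumes M: "M \<in> carrier_mat n n" and M': "M' \<in> carrier_mat n n"
    and eq: "\<And>w. w \<in> twisted_invariants \<Longrightarrow> M *\<^sub>v w = M' *\<^sub>v w"
  shows "M = M'"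
proof (rule eq_matI)
  obtain I0 :: "'g set set" and u0 e0 d0 where dual: "dual_system I0 u0 e0 d0" and d: "d0 \<noteq> 0"
    using dual_system_exists by blast
  fix i j assume "i < dim_row M'" "j < dim_col M'"
  then have i: "i < n" and j: "j < n" using M' by auto
  let ?q = "\<lambda>k. vtransfer (e0 k \<cdot>\<^sub>v unit_vec n j)"
  have "d0 * X $$ (i, j) = (\<Sum>k\<in>I0. u0 k * (X *\<^sub>v ?q k) $ i)" if X: "X \<in> carrier_mat n n" for X
  proof -
    have q: "?q k \<in> carrier_vec n" for k by (simp add: vtransfer_def)
    have "(\<Sum>k\<in>I0. u0 k * (X *\<^sub>v ?q k) $ i) = (\<Sum>l<n. X $$ (i, l) * (\<Sum>k\<in>I0. u0 k * ?q k $ l))"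
      unfolding mult_mat_vec_nth[OF X q i] by (simp add: sum_distrib_left mult_ac) (rule sum.swap)
    also have "\<dots> = (\<Sum>l<n. X $$ (i, l) * (d0 * unit_vec n j $ l))"
      by (intro sum.cong refl) (simp add: dual_expand_vec[OF dual])
    also have "\<dots> = d0 * X $$ (i, j)"
      using j by (simp add: unit_vec_def if_distrib mult.commute cong: if_cong)
    finally show ?thesis by simp
  qed
  from this[OF M] this[OF M'] have "d0 * M $$ (i, j) = d0 * M' $$ (i, j)"
    by (simp add: eq vtransfer_invariant)
  then show "M $$ (i, j) = M' $$ (i, j)" using d by simp
qed (use M M' in auto)

text \<open>
  As for derivations, the matrices obtained from different dual systems agree up to their denominators,
  and purity cancels these.
\<close>

lemma matrix_exists:
  assumes \<alpha>: "module_map \<alpha>"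
  shows "\<exists>M \<in> carrier_mat n n. \<forall>w\<in>twisted_invariants. M *\<^sub>v w = \<alpha> w"
proof -
  obtain I0 :: "'g set set" and u0 e0 d0 where dual0: "dual_system I0 u0 e0 d0" and d0: "d0 \<noteq> 0"
    using dual_system_exists by blast
  obtain N0 where N0: "N0 \<in> carrier_mat n n" "\<And>w. w \<in> twisted_invariants \<Longrightarrow> N0 *\<^sub>v w = d0 \<cdot>\<^sub>v \<alpha> w"
    using scaled_matrix_exists[OF dual0 d0 \<alpha>] by blast
  have "d0 dvd N0 $$ (i, j)" if i: "i < n" and j: "j < n" for i j
  proof (rule purity[OF d0])
    have "d0 dvd d\<^sup>2 * N0 $$ (i, j)" if dual: "dual_system I u e d" for I :: "'g set set" and u e d
    proof (cases "d = 0")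
      case False
      obtain N where N: "N \<in> carrier_mat n n" "\<And>w. w \<in> twisted_invariants \<Longrightarrow> N *\<^sub>v w = d \<cdot>\<^sub>v \<alpha> w"
        using scaled_matrix_exists[OF dual False \<alpha>] by blast
      have "d \<cdot>\<^sub>m N0 = d0 \<cdot>\<^sub>m N"
      proof (rule matrix_eqI)
        fix w assume w: "w \<in> twisted_invariants"
        have "(c \<cdot>\<^sub>m X) *\<^sub>v w = c \<cdot>\<^sub>v (X *\<^sub>v w)" if "X \<in> carrier_mat n n" for c X
          using that twisted_invariants_carrier[OF w] by (intro eq_vecI) auto
        then show "(d \<cdot>\<^sub>m N0) *\<^sub>v w = (d0 \<cdot>\<^sub>m N) *\<^sub>v w"
          using N0 N w by (simp add: smult_smult_assoc mult.commute)
      qed (use N N0 in auto)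
      then have "(d \<cdot>\<^sub>m N0) $$ (i, j) = (d0 \<cdot>\<^sub>m N) $$ (i, j)" by simp
      then have "d * N0 $$ (i, j) = d0 * N $$ (i, j)"
        using N(1) N0(1) i j by simp
      then have "d\<^sup>2 * N0 $$ (i, j) = d0 * (d * N $$ (i, j))"
        by (simp add: power2_eq_square mult_ac)
      then show ?thesis by simp
    qed simp
    then show "\<forall>d\<in>discriminants. d0 dvd d\<^sup>2 * N0 $$ (i, j)"
      unfolding discriminants_def by blast
  qed
  then obtain m where m: "\<And>i j. i < n \<Longrightarrow> j < n \<Longrightarrow> N0 $$ (i, j) = d0 * m i j"
    unfolding dvd_def by metis
  have "mat n n (\<lambda>(i, j). m i j) *\<^sub>v w = \<alpha> w" if w: "w \<in> twisted_invariants" for w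
  proof (rule eq_vecI)
    note wc = twisted_invariants_carrier[OF w]
    have dim: "dim_vec (\<alpha> w) = n" using module_mapD(1)[OF \<alpha> w] by simp
    then show "dim_vec (mat n n (\<lambda>(i, j). m i j) *\<^sub>v w) = dim_vec (\<alpha> w)" by simp
    fix i assume "i < dim_vec (\<alpha> w)"
    then have i: "i < n" using dim by simp
    have "d0 * (mat n n (\<lambda>(i, j). m i j) *\<^sub>v w) $ i = (\<Sum>j<n. d0 * m i j * w $ j)"
      using i wc by (subst mult_mat_vec_nth) (auto simp: sum_distrib_left mult.assoc)
    also have "\<dots> = (N0 *\<^sub>v w) $ i"
      using i wc N0(1) by (subst mult_mat_vec_nth) (auto simp: m)
    also have "\<dots> = d0 * \<alpha> w $ i"
      using i dim by (simp add: N0(2)[OF w])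
    finally show "(mat n n (\<lambda>(i, j). m i j) *\<^sub>v w) $ i = \<alpha> w $ i" using d0 by simp
  qed
  then show ?thesis by (intro bexI[of _ "mat n n (\<lambda>(i, j). m i j)"]) auto
qed

end

section \<open>Linear substitutions in two variables\<close>

lemma const_xy_hom [simp]:
  "const_xy 0 = 0" "const_xy 1 = 1"
  "const_xy (a + b) = const_xy a + const_xy b"
  "const_xy (a * b) = const_xy a * const_xy b"
  "const_xy (- a) = - const_xy a"
  "const_xy (a - b) = const_xy a - const_xy b"
  by (simp_all add: const_xy_def one_pCons)

lemma const_xy_eq_0_iff [simp]: "const_xy a = 0 \<longleftrightarrow> a = 0"
  by (simp add: const_xy_def)

interpretation const_xy: comm_ring_hom const_xy
  by unfold_locales simp_all

lemma subst_xy_hom: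
  "subst_xy (a + b) p q = subst_xy a p q + subst_xy b p q"
  "subst_xy (a * b) p q = subst_xy a p q * subst_xy b p q"
  "subst_xy (const_xy c) p q = const_xy c"
  "subst_xy var_x p q = p"
  "subst_xy var_y p q = q"
proof -
  interpret c: map_poly_comm_ring_hom const_xy ..
  interpret ev: comm_ring_hom "\<lambda>c. poly (map_poly const_xy c) p"
    by unfold_locales (simp_all add: c.hom_add c.hom_mult)
  interpret ev2: map_poly_comm_ring_hom "\<lambda>c. poly (map_poly const_xy c) p" ..
  show "subst_xy (a + b) p q = subst_xy a p q + subst_xy b p q"
    "subst_xy (a * b) p q = subst_xy a p q * subst_xy b p q"
    by (simp_all add: subst_xy_def ev2.hom_add ev2.hom_mult)
  show "subst_xy (const_xy c) p q = const_xy c"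
    by (cases "c = 0") (simp_all add: subst_xy_def const_xy_def map_poly_pCons)
  show "subst_xy var_x p q = p" "subst_xy var_y p q = q"
    by (simp_all add: subst_xy_def var_x_def var_y_def map_poly_pCons)
qed

lemma poly_xy_induct [case_names const x y add mult]:
  assumes const: "\<And>c. P (const_xy c)" and x: "P var_x" and y: "P var_y"
    and add: "\<And>a b. P a \<Longrightarrow> P b \<Longrightarrow> P (a + b)" and mult: "\<And>a b. P a \<Longrightarrow> P b \<Longrightarrow> P (a * b)"
  shows "P f"
proof -
  have 0: "P [:0:]"
    using const[of 0] by simp
  have c: "P [:c:]" for c :: "complex poly"
  proof (induction c)
    case (pCons a c)
    have "[:pCons a c:] = const_xy a + var_x * [:c:]"
      by (simp add: const_xy_def var_x_def)
    then show ?case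
      using pCons const x add mult by metis
  qed (use 0 in simp)
  show ?thesis
  proof (induction f)
    case (pCons a f)
    have "pCons a f = [:a:] + var_y * f"
      by (simp add: var_y_def)
    then show ?case
      using pCons c y add mult by metis
  qed (use 0 in simp)
qed

lemma act_poly_hom [simp]:
  "act_poly g (a + b) = act_poly g a + act_poly g b"
  "act_poly g (a * b) = act_poly g a * act_poly g b"
  "act_poly g (const_xy c) = const_xy c"
  "act_poly g var_x = const_xy (g $$ (0, 0)) * var_x + const_xy (g $$ (1, 0)) * var_y"
  "act_poly g var_y = const_xy (g $$ (0, 1)) * var_x + const_xy (g $$ (1, 1)) * var_y"
  by (simp_all add: act_poly_def subst_xy_hom)

lemma act_poly_one: "act_poly (1\<^sub>m 2) f = f"
  by (induction f rule: poly_xy_induct) simp_all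

lemma act_poly_mult:
  assumes "g \<in> carrier_mat 2 2" "h \<in> carrier_mat 2 2"
  shows "act_poly (g * h) f = act_poly g (act_poly h f)"
  using assms
  by (induction f rule: poly_xy_induct)
    (simp_all add: scalar_prod_def algebra_simps numeral_2_eq_2)

lemma carrier_GL: "g \<in> carrier (GL n) \<Longrightarrow> g \<in> carrier_mat n n"
  by (auto simp: GL_def units_of_def Units_def ring_mat_def)

lemma GL_simps: "monoid.mult (GL n) = (*)" "one (GL n) = 1\<^sub>m n"
  by (simp_all add: GL_def units_of_def ring_mat_def)

section \<open>A singular matrix of size two\<close>

lemma kernel_dim_singular_2:
  fixes M :: "complex mat"
  assumes M: "M \<in> carrier_mat 2 2" and nz: "M \<noteq> 0\<^sub>m 2 2"
    and det: "M $$ (0, 0) * M $$ (1, 1) = M $$ (0, 1) * M $$ (1, 0)"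
  shows "kernel_dim M = 1"
proof -
  have card_1: "card {w} = 1" for w :: "complex vec" by simp
  interpret kernel 2 2 M by unfold_locales (rule M)
  have less_2: "i < 2 \<longleftrightarrow> i = 0 \<or> i = 1" for i :: nat by auto
  have mv: "(M *\<^sub>v w) $ i = M $$ (i, 0) * w $ 0 + M $$ (i, 1) * w $ 1" if "w \<in> carrier_vec 2" "i < 2" for w i
    using M that by (simp add: scalar_prod_def numeral_2_eq_2)
  have kernel_iff: "w \<in> mat_kernel M \<longleftrightarrow> w \<in> carrier_vec 2 \<and>
      (\<forall>i<2. M $$ (i, 0) * w $ 0 + M $$ (i, 1) * w $ 1 = 0)" for w
    unfolding mat_kernel[OF M] using M mv[of w] by (auto simp: vec_eq_iff)
  obtain i where i: "i < 2" "M $$ (i, 0) \<noteq> 0 \<or> M $$ (i, 1) \<noteq> 0"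
    using nz M by (force simp: mat_eq_iff less_2)
  \<comment> \<open>The kernel is orthogonal to a nonzero row, here turned by a right angle.\<close>
  define v where "v = vec 2 (\<lambda>j. if j = 0 then - M $$ (i, 1) else M $$ (i, 0))"
  have v: "v \<in> carrier_vec 2" "v $ 0 = - M $$ (i, 1)" "v $ Suc 0 = M $$ (i, 0)"
    by (simp_all add: v_def)
  have vk: "v \<in> mat_kernel M"
    using i det by (auto simp: kernel_iff v less_2 algebra_simps)
  have fin: "finite {v}" and sub: "{v} \<subseteq> mat_kernel M"
    using vk by auto
  have indpt: "\<not> lin_dep {v}"
  proof (rule Ker.finite_lin_indpt2[OF fin sub])
    fix a assume "lincomb a {v} = 0\<^sub>v 2"
    then have "a v * v $ j = 0" if "j < 2" for j
      using lincomb_index[OF that sub, of a] that by simp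
    from this[of 0] this[of 1] show "\<forall>w\<in>{v}. a w = 0"
      using i v by auto
  qed
  have gen: "span {v} = mat_kernel M"
  proof -
    have "w \<in> span {v}" if w: "w \<in> mat_kernel M" for w
    proof -
      have wc: "w \<in> carrier_vec 2" and eq: "M $$ (i, 0) * w $ 0 + M $$ (i, 1) * w $ 1 = 0"
        using w i by (auto simp: kernel_iff)
      define c where "c = (if M $$ (i, 0) \<noteq> 0 then w $ 1 / M $$ (i, 0) else - w $ 0 / M $$ (i, 1))"
      have w_eq: "w $ j = c * v $ j" if "j < 2" for j
        using that eq i(2) by (auto simp: less_2 v c_def field_simps add_eq_0_iff split: if_splits)
      have "lincomb (\<lambda>_. c) {v} \<in> carrier_vec 2"
        using Ker.lincomb_closed[OF sub, of "\<lambda>_. c"] mat_kernelD(1)[OF M] by blast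
      then have "w = lincomb (\<lambda>_. c) {v}"
        using wc w_eq lincomb_index[OF _ sub, of _ "\<lambda>_. c"] by (simp add: vec_eq_iff)
      then show ?thesis unfolding Ker.span_def by auto
    qed
    moreover have "span {v} \<subseteq> mat_kernel M"
      using Ker.span_is_subset2[OF sub] .
    ultimately show ?thesis by blast
  qed
  have basis: "basis {v}"
    unfolding Ker.basis_def by (intro conjI indpt gen sub)
  have "kernel_dim M = card {v}"
    unfolding kernel_dim using Ker.dim_basis[OF fin basis] .
  then show ?thesis
    unfolding card_1 .
qed

section \<open>Purity for small groups\<close>

text \<open>
  At each prime \<open>p\<close>, the multiplicities are compared using an element of \<open>D\<close> that is prime to \<open>p\<close>.
\<close>

lemma dvd_of_dvd_square_mult:
  fixes c a :: "'a::factorial_semiring"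
  assumes D: "\<And>p. prime p \<Longrightarrow> \<exists>d\<in>D. \<not> p dvd d"
    and c: "c \<noteq> 0" and dvd: "\<forall>d\<in>D. c dvd d\<^sup>2 * a"
  shows "c dvd a"
proof (cases "a = 0")
  case False
  show ?thesis
  proof (rule multiplicity_le_imp_dvd[OF c])
    fix p :: 'a
    assume p: "prime p"
    obtain d where d: "d \<in> D" "\<not> p dvd d"
      using D[OF p] by blast
    then have "d \<noteq> 0" by auto
    have "multiplicity p c \<le> multiplicity p (d\<^sup>2 * a)"
      using dvd d(1) \<open>d \<noteq> 0\<close> False by (intro dvd_imp_multiplicity_le) auto
    also have "\<dots> = 2 * multiplicity p d + multiplicity p a"
      using p \<open>d \<noteq> 0\<close> False
      by (simp add: prime_elem_multiplicity_mult_distrib prime_elem_multiplicity_power_distrib)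
    also have "multiplicity p d = 0"
      using d(2) by (rule not_dvd_imp_multiplicity_0)
    finally show "multiplicity p c \<le> multiplicity p a" by simp
  qed
qed simp

lemma not_is_unit_var_y: "\<not> is_unit var_y"
  by (simp add: var_y_def is_unit_poly_iff)

lemma prime_exists_xy: "\<exists>f :: poly_xy. prime f"
proof -
  have "var_y \<noteq> 0" by (simp add: var_y_def)
  from prime_divisor_exists[OF this not_is_unit_var_y] show ?thesis by blast
qed

text \<open>
  Independent linear forms generate both variables, and these have no common prime divisor.
\<close>

lemma prime_dvd_linear_forms:
  fixes f :: poly_xy
  assumes f: "prime f"
    and 1: "f dvd const_xy a * var_x + const_xy b * var_y"
    and 2: "f dvd const_xy c * var_x + const_xy d * var_y"
  shows "a * d = b * c"
proof (rule ccontr)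
  assume ne: "a * d \<noteq> b * c"
  have cancel: "f dvd z" if "f dvd const_xy k * z" "k \<noteq> 0" for k z
  proof -
    have "f dvd const_xy (inverse k) * (const_xy k * z)"
      using that(1) by (rule dvd_mult)
    also have "\<dots> = const_xy (inverse k * k) * z" by (simp only: const_xy_hom mult.assoc)
    finally show ?thesis using that(2) by simp
  qed
  have "f dvd const_xy d * (const_xy a * var_x + const_xy b * var_y) - const_xy b * (const_xy c * var_x + const_xy d * var_y)"
    using 1 2 by (intro dvd_diff dvd_mult)
  also have "\<dots> = const_xy (a * d - b * c) * var_x"
    by (simp add: algebra_simps)
  finally have x: "f dvd var_x" by (rule cancel) (use ne in simp)
  have "f dvd const_xy a * (const_xy c * var_x + const_xy d * var_y) - const_xy c * (const_xy a * var_x + const_xy b * var_y)"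
    using 1 2 by (intro dvd_diff dvd_mult)
  also have "\<dots> = const_xy (a * d - b * c) * var_y"
    by (simp add: algebra_simps)
  finally have y: "f dvd var_y" by (rule cancel) (use ne in simp)
  have "degree f \<le> degree var_x"
    using x by (rule dvd_imp_degree_le) (simp add: var_x_def)
  then obtain p where p: "f = [:p:]"
    by (auto simp: var_x_def elim: degree_eq_zeroE)
  have "p dvd coeff var_y 1"
    using y unfolding p const_poly_dvd_iff by blast
  then have "is_unit f"
    by (simp add: p var_y_def is_unit_const_poly_iff)
  then show False using f not_prime_unit by blast
qed

text \<open>
  The two sides differ by the determinant of \<open>1 - h\<close>. If it vanished, then \<open>h\<close> would fix a line pointwise.
\<close>

lemma not_pseudo_reflectionD:
  assumes h: "h \<in> carrier (GL 2)" "h \<noteq> 1\<^sub>m 2" "\<not> pseudo_reflection h"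
  shows "(1 - h $$ (0, 0)) * (1 - h $$ (1, 1)) \<noteq> h $$ (1, 0) * h $$ (0, 1)"
proof
  assume eq: "(1 - h $$ (0, 0)) * (1 - h $$ (1, 1)) = h $$ (1, 0) * h $$ (0, 1)"
  note hc = carrier_GL[OF h(1)]
  have "kernel_dim (h - 1\<^sub>m 2) = 1"
  proof (rule kernel_dim_singular_2)
    show "h - 1\<^sub>m 2 \<in> carrier_mat 2 2" using hc by auto
    show "h - 1\<^sub>m 2 \<noteq> 0\<^sub>m 2 2"
    proof
      assume z: "h - 1\<^sub>m 2 = 0\<^sub>m 2 2"
      have "h = 1\<^sub>m 2"
      proof (rule eq_matI)
        fix i j assume "i < dim_row (1\<^sub>m 2 :: complex mat)" "j < dim_col (1\<^sub>m 2 :: complex mat)"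
        then show "h $$ (i, j) = 1\<^sub>m 2 $$ (i, j)"
          using arg_cong[OF z, of "\<lambda>m. m $$ (i, j)"] hc by simp
      qed (use hc in auto)
      then show False using h(2) by simp
    qed
    have "(h $$ (0, 0) - 1) * (h $$ (1, 1) - 1) = h $$ (0, 1) * h $$ (1, 0)"
      using eq by (simp only: algebra_simps)
    then show "(h - 1\<^sub>m 2) $$ (0, 0) * (h - 1\<^sub>m 2) $$ (1, 1) = (h - 1\<^sub>m 2) $$ (0, 1) * (h - 1\<^sub>m 2) $$ (1, 0)"
      using hc by simp
  qed
  then show False using h by (simp add: pseudo_reflection_def)
qed

locale small_group =
  fixes G :: "complex mat set"
  assumes subgroup: "subgroup G (GL 2)" and finite_G: "finite G"
    and small: "\<forall>g\<in>G. \<not> pseudo_reflection g"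
begin

abbreviation \<G> where "\<G> \<equiv> (GL 2)\<lparr>carrier := G\<rparr>"

lemma group_GL: "group (GL n)"
  unfolding GL_def by (rule monoid.units_group[OF ring.is_monoid[OF ring_mat]])

lemma G_GL: "g \<in> G \<Longrightarrow> g \<in> carrier (GL 2)"
  by (rule subgroup.mem_carrier[OF subgroup])

sublocale finite_ring_action \<G> act_poly
proof -
  interpret group \<G>
    by (rule subgroup.subgroup_is_group[OF subgroup group_GL])
  have c: "g \<in> carrier_mat 2 2" if "g \<in> G" for g
    using carrier_GL G_GL that by blast
  show "finite_ring_action \<G> act_poly"
  proof unfold_locales
    fix g assume "g \<in> carrier \<G>"
    show "act_poly g 1 = 1"
      using act_poly_hom(3)[of g 1] by simp
  next
    fix g h a assume "g \<in> carrier \<G>" "h \<in> carrier \<G>"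
    then have "g \<in> carrier_mat 2 2" "h \<in> carrier_mat 2 2"
      by (simp_all add: c)
    then show "act_poly (g \<otimes>\<^bsub>\<G>\<^esub> h) a = act_poly g (act_poly h a)"
      by (simp add: GL_simps act_poly_mult)
  qed (simp_all add: finite_G GL_simps act_poly_one)
qed

text \<open>
  Let \<open>l\<close> be the linear form \<open>x + t y\<close>. For a nontrivial \<open>h\<close>, the forms \<open>l - h l\<close> belonging to two values of
  \<open>t\<close> span the image of \<open>1 - h\<close>, which contains both variables because \<open>1 - h\<close> is invertible. So \<open>f\<close>
  divides at most one of these forms, and finitely many \<open>t\<close> are excluded in all.
\<close>

lemma generic_linear_form:
  fixes f :: poly_xy
  assumes f: "prime f"
  shows "\<exists>l. \<not> f dvd (\<Prod>h\<in>G - {1\<^sub>m 2}. l - act_poly h l)"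
proof -
  define L where "L t = var_x + const_xy t * var_y" for t
  define bad where "bad h = {t. f dvd L t - act_poly h (L t)}" for h
  have "finite (bad h)" if h: "h \<in> G - {1\<^sub>m 2}" for h
  proof -
    have "t = t'" if t: "t \<in> bad h" "t' \<in> bad h" for t t'
    proof (rule ccontr)
      assume ne: "t \<noteq> t'"
      let ?X = "const_xy (1 - h $$ (0, 0)) * var_x + const_xy (- h $$ (1, 0)) * var_y"
      let ?Y = "const_xy (- h $$ (0, 1)) * var_x + const_xy (1 - h $$ (1, 1)) * var_y"
      have L: "L t - act_poly h (L t) = ?X + const_xy t * ?Y" for t
        by (simp add: L_def algebra_simps)
      have "f dvd (?X + const_xy t * ?Y) - (?X + const_xy t' * ?Y)"
        using t unfolding bad_def mem_Collect_eq L by (rule dvd_diff)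
      then have "f dvd const_xy (inverse (t - t')) * ((?X + const_xy t * ?Y) - (?X + const_xy t' * ?Y))"
        by (rule dvd_mult)
      also have "\<dots> = const_xy (inverse (t - t') * (t - t')) * ?Y"
        unfolding const_xy_hom by (simp only: algebra_simps)
      finally have Y: "f dvd ?Y" using ne by simp
      have "f dvd (?X + const_xy t * ?Y) - const_xy t * ?Y"
        using t(1) Y unfolding bad_def mem_Collect_eq L by (rule dvd_diff[OF _ dvd_mult])
      then have X: "f dvd ?X" by simp
      have "h \<in> carrier (GL 2)" "h \<noteq> 1\<^sub>m 2" "\<not> pseudo_reflection h"
        using h G_GL small by auto
      from not_pseudo_reflectionD[OF this] prime_dvd_linear_forms[OF f X Y] show False
        by simp
    qed
    then have "bad h \<subseteq> {t}" if "t \<in> bad h" for t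
      using that by blast
    then show ?thesis
      by (metis all_not_in_conv finite.emptyI finite.insertI finite_subset)
  qed
  then have "finite (\<Union>h\<in>G - {1\<^sub>m 2}. bad h)"
    using finite_G by blast
  from ex_new_if_finite[OF infinite_UNIV_char_0 this]
  obtain t where "t \<notin> (\<Union>h\<in>G - {1\<^sub>m 2}. bad h)" by blast
  then have "\<not> f dvd L t - act_poly h (L t)" if "h \<in> G - {1\<^sub>m 2}" for h
    using that by (auto simp: bad_def)
  then have "\<not> f dvd (\<Prod>h\<in>G - {1\<^sub>m 2}. L t - act_poly h (L t))"
    using f finite_G by (subst prime_dvd_prod_iff) auto
  then show ?thesis by blast
qed

text \<open>
  This is the absence of ramification in codimension one.
\<close>

lemma discriminant_generic:
  fixes f :: poly_xy
  assumes f: "prime f"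
  shows "\<exists>d\<in>discriminants. \<not> f dvd d"
proof -
  obtain l where "\<not> f dvd (\<Prod>h\<in>G - {1\<^sub>m 2}. l - act_poly h l)"
    using generic_linear_form[OF f] by blast
  moreover have "(\<Prod>h\<in>G - {1\<^sub>m 2}. l - act_poly h l) \<in> discriminants"
    using dual_system_orbit[of l] unfolding discriminants_def by (auto simp: GL_simps)
  ultimately show ?thesis by blast
qed

lemma dvd_of_dvd_discriminant_mult:
  "(c :: poly_xy) \<noteq> 0 \<Longrightarrow> \<forall>d\<in>discriminants. c dvd d\<^sup>2 * a \<Longrightarrow> c dvd a"
  by (rule dvd_of_dvd_square_mult[OF discriminant_generic])

lemma nonzero_discriminant: "\<exists>d\<in>discriminants. d \<noteq> 0"
proof -
  obtain f :: poly_xy where "prime f"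
    using prime_exists_xy by blast
  then obtain d where "d \<in> discriminants" "\<not> f dvd d"
    using discriminant_generic by blast
  then show ?thesis
    by (intro bexI[of _ d]) auto
qed

sublocale pure_ring_action \<G> act_poly
  by (rule pure_ring_action.intro[OF finite_ring_action_axioms pure_ring_action_axioms.intro[OF
    dvd_of_dvd_discriminant_mult nonzero_discriminant]])

end

section \<open>Structures with faithful values\<close>

text \<open>
  Stalks and modules of sections embed into families of fractions. An embedding compatible with the
  operations transports the axioms, so none of them has to be checked on equivalence classes.
\<close>

lemma abelian_group_of_values:
  fixes A :: "('r, 'x) module" and v :: "'x \<Rightarrow> 'j \<Rightarrow> 'k::ab_group_add"
  assumes zero: "\<zero>\<^bsub>A\<^esub> \<in> carrier A" "\<And>j. v \<zero>\<^bsub>A\<^esub> j = 0"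
    and add: "\<And>x y. x \<in> carrier A \<Longrightarrow> y \<in> carrier A \<Longrightarrow> x \<oplus>\<^bsub>A\<^esub> y \<in> carrier A"
      "\<And>x y j. x \<in> carrier A \<Longrightarrow> y \<in> carrier A \<Longrightarrow> v (x \<oplus>\<^bsub>A\<^esub> y) j = v x j + v y j"
    and neg: "\<And>x. x \<in> carrier A \<Longrightarrow> \<exists>y\<in>carrier A. \<forall>j. v y j = - v x j"
    and inj: "\<And>x y. x \<in> carrier A \<Longrightarrow> y \<in> carrier A \<Longrightarrow> (\<And>j. v x j = v y j) \<Longrightarrow> x = y"
  shows "abelian_group A"
proof (rule abelian_groupI)
  show "\<exists>y\<in>carrier A. y \<oplus>\<^bsub>A\<^esub> x = \<zero>\<^bsub>A\<^esub>" if x: "x \<in> carrier A" for x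
  proof -
    obtain y where y: "y \<in> carrier A" "\<forall>j. v y j = - v x j"
      using neg[OF x] by blast
    then have "y \<oplus>\<^bsub>A\<^esub> x = \<zero>\<^bsub>A\<^esub>"
      using x by (intro inj) (simp_all add: zero add)
    with y show ?thesis by blast
  qed
qed (auto intro!: inj simp: zero add ac_simps)

lemma cring_of_values:
  fixes A :: "'x ring" and v :: "'x \<Rightarrow> 'j \<Rightarrow> 'k::comm_ring_1"
  assumes zero: "\<zero>\<^bsub>A\<^esub> \<in> carrier A" "\<And>j. v \<zero>\<^bsub>A\<^esub> j = 0"
    and one: "\<one>\<^bsub>A\<^esub> \<in> carrier A" "\<And>x j. x \<in> carrier A \<Longrightarrow> v \<one>\<^bsub>A\<^esub> j * v x j = v x j"
    and add: "\<And>x y. x \<in> carrier A \<Longrightarrow> y \<in> carrier A \<Longrightarrow> x \<oplus>\<^bsub>A\<^esub> y \<in> carrier A"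
      "\<And>x y j. x \<in> carrier A \<Longrightarrow> y \<in> carrier A \<Longrightarrow> v (x \<oplus>\<^bsub>A\<^esub> y) j = v x j + v y j"
    and mult: "\<And>x y. x \<in> carrier A \<Longrightarrow> y \<in> carrier A \<Longrightarrow> x \<otimes>\<^bsub>A\<^esub> y \<in> carrier A"
      "\<And>x y j. x \<in> carrier A \<Longrightarrow> y \<in> carrier A \<Longrightarrow> v (x \<otimes>\<^bsub>A\<^esub> y) j = v x j * v y j"
    and neg: "\<And>x. x \<in> carrier A \<Longrightarrow> \<exists>y\<in>carrier A. \<forall>j. v y j = - v x j"
    and inj: "\<And>x y. x \<in> carrier A \<Longrightarrow> y \<in> carrier A \<Longrightarrow> (\<And>j. v x j = v y j) \<Longrightarrow> x = y"
  shows "cring A"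
proof (rule cringI)
  show "abelian_group A"
  proof (rule abelian_groupI)
    show "\<exists>y\<in>carrier A. y \<oplus>\<^bsub>A\<^esub> x = \<zero>\<^bsub>A\<^esub>" if x: "x \<in> carrier A" for x
    proof -
      obtain y where y: "y \<in> carrier A" "\<forall>j. v y j = - v x j"
        using neg[OF x] by blast
      then have "y \<oplus>\<^bsub>A\<^esub> x = \<zero>\<^bsub>A\<^esub>"
        using x by (intro inj) (simp_all add: zero add)
      with y show ?thesis by blast
    qed
  qed (auto intro!: inj simp: zero add ac_simps)
  show "comm_monoid A"
  proof (rule comm_monoidI)
    show "\<one>\<^bsub>A\<^esub> \<otimes>\<^bsub>A\<^esub> x = x" if "x \<in> carrier A" for x
      using that by (intro inj) (simp_all only: one mult)
  qed (auto intro!: inj simp: one(1) mult ac_simps)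
  show "(x \<oplus>\<^bsub>A\<^esub> y) \<otimes>\<^bsub>A\<^esub> z = x \<otimes>\<^bsub>A\<^esub> z \<oplus>\<^bsub>A\<^esub> y \<otimes>\<^bsub>A\<^esub> z"
    if "x \<in> carrier A" "y \<in> carrier A" "z \<in> carrier A" for x y z
    using that by (intro inj) (auto simp: add mult algebra_simps)
qed

lemma value_finsum:
  fixes A :: "('x, 'b) ring_scheme" and v :: "'x \<Rightarrow> 'k::ab_group_add"
  assumes A: "abelian_monoid A"
    and zero: "v \<zero>\<^bsub>A\<^esub> = 0"
    and add: "\<And>x y. x \<in> carrier A \<Longrightarrow> y \<in> carrier A \<Longrightarrow> v (x \<oplus>\<^bsub>A\<^esub> y) = v x + v y"
    and I: "finite I" and f: "\<And>i. i \<in> I \<Longrightarrow> f i \<in> carrier A"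
  shows "v (\<Oplus>\<^bsub>A\<^esub>i\<in>I. f i) = (\<Sum>i\<in>I. v (f i))"
  using I f
proof (induction I rule: finite_induct)
  case empty
  then show ?case by (simp add: abelian_monoid.finsum_empty[OF A] zero)
next
  case (insert i I)
  have "(\<Oplus>\<^bsub>A\<^esub>i\<in>insert i I. f i) = f i \<oplus>\<^bsub>A\<^esub> (\<Oplus>\<^bsub>A\<^esub>i\<in>I. f i)"
    using insert by (intro abelian_monoid.finsum_insert[OF A]) auto
  moreover have "(\<Oplus>\<^bsub>A\<^esub>i\<in>I. f i) \<in> carrier A"
    using insert by (intro abelian_monoid.finsum_closed[OF A]) auto
  ultimately show ?case
    using insert by (simp add: add)
qed

lemma value_uminus:
  fixes A :: "('x, 'b) ring_scheme" and v :: "'x \<Rightarrow> 'k::ab_group_add"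
  assumes A: "abelian_group A"
    and zero: "v \<zero>\<^bsub>A\<^esub> = 0"
    and add: "\<And>x y. x \<in> carrier A \<Longrightarrow> y \<in> carrier A \<Longrightarrow> v (x \<oplus>\<^bsub>A\<^esub> y) = v x + v y"
    and x: "x \<in> carrier A"
  shows "v (\<ominus>\<^bsub>A\<^esub> x) = - v x"
proof -
  interpret abelian_group A by (rule A)
  show ?thesis
    using add[of "\<ominus>\<^bsub>A\<^esub> x" x] x zero by (simp add: l_neg eq_neg_iff_add_eq_0)
qed

lemma value_minus:
  fixes A :: "('x, 'b) ring_scheme" and v :: "'x \<Rightarrow> 'k::ab_group_add"
  assumes A: "abelian_group A"
    and zero: "v \<zero>\<^bsub>A\<^esub> = 0"
    and add: "\<And>x y. x \<in> carrier A \<Longrightarrow> y \<in> carrier A \<Longrightarrow> v (x \<oplus>\<^bsub>A\<^esub> y) = v x + v y"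
    and x: "x \<in> carrier A" and y: "y \<in> carrier A"
  shows "v (x \<ominus>\<^bsub>A\<^esub> y) = v x - v y"
proof -
  interpret abelian_group A by (rule A)
  show ?thesis
    using x y by (simp add: a_minus_def add value_uminus[OF A zero add])
qed

section \<open>Stalks of torsion-free modules over a domain\<close>

text \<open>
  The coordinates, as fractions, of the class \<open>x\<close>, read off from some representative.
\<close>

definition frac_val :: "('m \<Rightarrow> 'i \<Rightarrow> 'a::idom) \<Rightarrow> ('m \<times> 'a) set \<Rightarrow> 'i \<Rightarrow> 'a fract" where
  "frac_val emb x i = (case SOME p. p \<in> x of (m, s) \<Rightarrow> Fract (emb m i) s)"

locale domain_subring =
  fixes B :: "'a::idom set"
  assumes B_closed: "0 \<in> B" "1 \<in> B" "\<And>a b. a \<in> B \<Longrightarrow> b \<in> B \<Longrightarrow> a + b \<in> B"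
    "\<And>a b. a \<in> B \<Longrightarrow> b \<in> B \<Longrightarrow> a * b \<in> B" "\<And>a. a \<in> B \<Longrightarrow> - a \<in> B"
begin

definition R :: "'a ring" where
  "R = class_ring\<lparr>carrier := B\<rparr>"

lemma R_simps [simp]:
  "carrier R = B" "monoid.mult R = (*)" "one R = 1" "zero R = 0" "add R = (+)"
  by (simp_all add: R_def)

lemma cring_R: "cring R"
  by (rule cring_of_values[where v = "\<lambda>a (_ :: unit). a"])
    (auto simp: B_closed intro: bexI[of _ "- x" for x])

lemma R_minus: "a \<in> B \<Longrightarrow> b \<in> B \<Longrightarrow> a \<ominus>\<^bsub>R\<^esub> b = a - b"
  using cring_R by (intro value_minus[where v = "\<lambda>a. a"]) (auto simp: cring_def ring_def)

lemma Spec_D: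
  assumes "P \<in> Spec R"
  shows "P \<subseteq> B" "0 \<in> P" "1 \<notin> P" "\<And>s t. s \<in> B - P \<Longrightarrow> t \<in> B - P \<Longrightarrow> s * t \<in> B - P"
    "\<And>s. s \<in> B - P \<Longrightarrow> s \<noteq> 0"
proof -
  have P: "primeideal P R" using assms by (simp add: Spec_def)
  then have ideal: "ideal P R" by (rule primeideal.axioms)
  then have sub: "additive_subgroup P R" by (rule ideal.axioms)
  show "P \<subseteq> B" using additive_subgroup.a_subset[OF sub] by simp
  show 0: "0 \<in> P" using additive_subgroup.zero_closed[OF sub] by simp
  show "1 \<notin> P" using ideal.one_imp_carrier[OF ideal] primeideal.I_notcarr[OF P] by auto
  show "s * t \<in> B - P" if "s \<in> B - P" "t \<in> B - P" for s t
    using primeideal.I_prime[OF P, of s t] that by (auto simp: B_closed)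
  show "s \<noteq> 0" if "s \<in> B - P" for s
    using 0 that by auto
qed

lemma zariski_open_subset: "zariski_open R V \<Longrightarrow> V \<subseteq> Spec R"
  by (auto simp: zariski_open_def)

lemma zariski_open_basic:
  assumes "t \<in> B"
  shows "zariski_open R {P \<in> Spec R. t \<notin> P}"
  unfolding zariski_open_def using assms by (intro exI[of _ "{t}"]) auto

lemma zariski_open_Int:
  assumes "zariski_open R V" "zariski_open R V'"
  shows "zariski_open R (V \<inter> V')"
proof -
  obtain E E' where E: "E \<subseteq> B" "V = {P \<in> Spec R. \<not> E \<subseteq> P}" "E' \<subseteq> B" "V' = {P \<in> Spec R. \<not> E' \<subseteq> P}"
    using assms by (auto simp: zariski_open_def)
  let ?EE = "(\<lambda>(a, b). a * b) ` (E \<times> E')"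
  have "\<not> ?EE \<subseteq> P \<longleftrightarrow> \<not> E \<subseteq> P \<and> \<not> E' \<subseteq> P" if P: "P \<in> Spec R" for P
  proof
    assume "\<not> ?EE \<subseteq> P"
    then obtain a b where ab: "a \<in> E" "b \<in> E'" "a * b \<notin> P" by auto
    have "ideal P R" using P by (simp add: Spec_def primeideal_def)
    from ideal.I_l_closed[OF this] ideal.I_r_closed[OF this]
    have "b \<in> P \<Longrightarrow> a * b \<in> P" "a \<in> P \<Longrightarrow> a * b \<in> P"
      using ab E by auto
    with ab show "\<not> E \<subseteq> P \<and> \<not> E' \<subseteq> P" by blast
  next
    assume "\<not> E \<subseteq> P \<and> \<not> E' \<subseteq> P"
    then obtain a b where ab: "a \<in> E" "b \<in> E'" "a \<notin> P" "b \<notin> P" by blast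
    with E Spec_D(4)[OF P, of a b] have "a * b \<notin> P" by auto
    with ab show "\<not> ?EE \<subseteq> P" by force
  qed
  then have "V \<inter> V' = {P \<in> Spec R. \<not> ?EE \<subseteq> P}"
    using E by blast
  moreover have "?EE \<subseteq> B" using E by (auto simp: B_closed subset_iff)
  ultimately show ?thesis
    unfolding zariski_open_def R_simps by blast
qed

abbreviation quot :: "('a, 'm) module \<Rightarrow> 'a set \<Rightarrow> 'm \<Rightarrow> 'a \<Rightarrow> ('m \<times> 'a) set" where
  "quot M P \<equiv> fraction R (B - P) M"

lemma quot_carrier:
  "m \<in> carrier M \<Longrightarrow> s \<in> B - P \<Longrightarrow> quot M P m s \<in> carrier (stalk R M P)"
  by (simp add: stalk_def localization_def fraction_def quotientI)

lemma stalk_cases: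
  assumes "x \<in> carrier (stalk R M P)"
  obtains m s where "m \<in> carrier M" "s \<in> B - P" "x = quot M P m s"
  using assms by (auto simp: stalk_def localization_def fraction_def elim: quotientE)

lemma sections_local:
  assumes "f \<in> sections R M V" "P \<in> V"
  obtains N m t where "zariski_open R N" "P \<in> N" "N \<subseteq> V" "m \<in> carrier M" "t \<in> B"
    "\<And>Q. Q \<in> N \<Longrightarrow> t \<notin> Q \<and> f Q = quot M Q m t"
proof -
  have "\<exists>N m t. zariski_open R N \<and> P \<in> N \<and> N \<subseteq> V \<and> m \<in> carrier M \<and> t \<in> carrier R \<and>
      (\<forall>Q\<in>N. t \<notin> Q \<and> f Q = quot M Q m t)"
    using assms unfolding sections_def by simp
  then show ?thesis
    using that by auto
qed

text \<open>
  The operations on sections are given on stalks by one formula in numerators and denominators. Such a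
  formula sends sections that are locally single fractions to sections of the same kind.
\<close>

lemma sections_binary:
  fixes M :: "('a, 'm) module" and M' :: "('a, 'm2) module" and M'' :: "('a, 'm3) module"
  assumes f: "f \<in> sections R M V" and g: "g \<in> sections R M' V"
    and F: "\<And>Q m s n t. Q \<in> Spec R \<Longrightarrow> m \<in> carrier M \<Longrightarrow> n \<in> carrier M' \<Longrightarrow> s \<in> B - Q \<Longrightarrow> t \<in> B - Q \<Longrightarrow>
        F Q (quot M Q m s) (quot M' Q n t) = quot M'' Q (h m s n t) (k s t) \<and>
        h m s n t \<in> carrier M'' \<and> k s t \<in> B - Q"
  shows "(\<lambda>P\<in>V. F P (f P) (g P)) \<in> sections R M'' V"
proof -
  have local: "\<exists>N m t. zariski_open R N \<and> P \<in> N \<and> N \<subseteq> V \<and> m \<in> carrier M'' \<and> t \<in> carrier R \<and>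
      (\<forall>Q\<in>N. t \<notin> Q \<and> F Q (f Q) (g Q) = quot M'' Q m t)" if P: "P \<in> V" for P
  proof -
    obtain N m s where N: "zariski_open R N" "P \<in> N" "N \<subseteq> V" "m \<in> carrier M" "s \<in> B"
      and fQ: "\<And>Q. Q \<in> N \<Longrightarrow> s \<notin> Q \<and> f Q = quot M Q m s"
      by (rule sections_local[OF f P], rule that; assumption)
    obtain N' n t where N': "zariski_open R N'" "P \<in> N'" "N' \<subseteq> V" "n \<in> carrier M'" "t \<in> B"
      and gQ: "\<And>Q. Q \<in> N' \<Longrightarrow> t \<notin> Q \<and> g Q = quot M' Q n t"
      by (rule sections_local[OF g P], rule that; assumption)
    have Q: "k s t \<notin> Q \<and> F Q (f Q) (g Q) = quot M'' Q (h m s n t) (k s t)"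
      "h m s n t \<in> carrier M''" "k s t \<in> B"
      if "Q \<in> N \<inter> N'" for Q
    proof -
      have "Q \<in> Spec R" using zariski_open_subset[OF N(1)] that by blast
      from F[OF this N(4) N'(4), of s t] fQ[of Q] gQ[of Q] that N(5) N'(5)
      show "k s t \<notin> Q \<and> F Q (f Q) (g Q) = quot M'' Q (h m s n t) (k s t)"
        "h m s n t \<in> carrier M''" "k s t \<in> B" by auto
    qed
    have "zariski_open R (N \<inter> N')" "P \<in> N \<inter> N'" "N \<inter> N' \<subseteq> V"
      using zariski_open_Int N N' by auto
    with Q show ?thesis
      by (intro exI[of _ "N \<inter> N'"] exI[of _ "h m s n t"] exI[of _ "k s t"]) auto
  qed
  have "F P (f P) (g P) \<in> carrier (stalk R M'' P)" if P: "P \<in> V" for P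
  proof -
    obtain N m t where *: "zariski_open R N" "P \<in> N" "m \<in> carrier M''" "t \<in> B" "t \<notin> P"
        "F P (f P) (g P) = quot M'' P m t"
      using local[OF P] by auto
    then show ?thesis
      by (simp add: quot_carrier)
  qed
  moreover have "\<exists>N m t. zariski_open R N \<and> P \<in> N \<and> N \<subseteq> V \<and> m \<in> carrier M'' \<and> t \<in> carrier R \<and>
      (\<forall>Q\<in>N. t \<notin> Q \<and> (\<lambda>P\<in>V. F P (f P) (g P)) Q = quot M'' Q m t)" if P: "P \<in> V" for P
  proof -
    obtain N m t where *: "zariski_open R N" "P \<in> N" "N \<subseteq> V" "m \<in> carrier M''" "t \<in> carrier R"
        "\<forall>Q\<in>N. t \<notin> Q \<and> F Q (f Q) (g Q) = quot M'' Q m t"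
      using local[OF P] by auto
    moreover have "\<forall>Q\<in>N. (\<lambda>P\<in>V. F P (f P) (g P)) Q = F Q (f Q) (g Q)"
      using *(3) by auto
    ultimately show ?thesis by (intro exI[of _ N] exI[of _ m] exI[of _ t]) auto
  qed
  ultimately show ?thesis
    unfolding sections_def by auto
qed

lemma sections_restrict:
  assumes f: "f \<in> sections R M V" and V': "zariski_open R V'" "V' \<subseteq> V"
  shows "restrict f V' \<in> sections R M V'"
proof -
  have "\<exists>N m t. zariski_open R N \<and> P \<in> N \<and> N \<subseteq> V' \<and> m \<in> carrier M \<and> t \<in> carrier R \<and>
      (\<forall>Q\<in>N. t \<notin> Q \<and> restrict f V' Q = quot M Q m t)" if P: "P \<in> V'" for P
  proof -
    obtain N m s where N: "zariski_open R N" "P \<in> N" "N \<subseteq> V" "m \<in> carrier M" "s \<in> B"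
      "\<And>Q. Q \<in> N \<Longrightarrow> s \<notin> Q \<and> f Q = quot M Q m s"
      by (rule sections_local[OF f subsetD[OF V'(2) P]], rule that; assumption)
    then show ?thesis
      using zariski_open_Int[OF N(1) V'(1)] P
      by (intro exI[of _ "N \<inter> V'"] exI[of _ m] exI[of _ s]) auto
  qed
  moreover have "restrict f V' \<in> (\<Pi>\<^sub>E P\<in>V'. carrier (stalk R M P))"
    using f V' by (auto simp: sections_def PiE_iff)
  ultimately show ?thesis by (simp add: sections_def)
qed

lemma sections_fraction:
  assumes V: "zariski_open R V" and m: "m \<in> carrier M" and t: "t \<in> B" "\<And>Q. Q \<in> V \<Longrightarrow> t \<notin> Q"
  shows "(\<lambda>P\<in>V. quot M P m t) \<in> sections R M V"
proof -
  have "\<exists>N m' t'. zariski_open R N \<and> P \<in> N \<and> N \<subseteq> V \<and> m' \<in> carrier M \<and> t' \<in> carrier R \<and>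
      (\<forall>Q\<in>N. t' \<notin> Q \<and> (\<lambda>P\<in>V. quot M P m t) Q = quot M Q m' t')" if P: "P \<in> V" for P
    using assms P by (intro exI[of _ V] exI[of _ m] exI[of _ t]) auto
  then show ?thesis
    using m t by (auto simp: sections_def quot_carrier)
qed

lemma sections_carrier: "f \<in> sections R M V \<Longrightarrow> P \<in> V \<Longrightarrow> f P \<in> carrier (stalk R M P)"
  by (auto simp: sections_def PiE_iff)

lemma sections_extensional: "f \<in> sections R M V \<Longrightarrow> f \<in> extensional V"
  by (auto simp: sections_def PiE_iff)

end

text \<open>
  The map \<open>emb\<close> realizes the module inside a power of the domain. The ring itself, its derivations
  (through their values) and the twisted invariants (through their entries) are of this form. The stalks
  then embed into powers of the field of fractions, and every identity in a stalk becomes an identity of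
  fractions.
\<close>

locale torsion_free_module = domain_subring B for B :: "'a::idom set" +
  fixes M :: "('a, 'm) module" and emb :: "'m \<Rightarrow> 'i \<Rightarrow> 'a"
  assumes M_closed: "\<zero>\<^bsub>M\<^esub> \<in> carrier M"
      "\<And>x y. x \<in> carrier M \<Longrightarrow> y \<in> carrier M \<Longrightarrow> x \<oplus>\<^bsub>M\<^esub> y \<in> carrier M"
      "\<And>a x. a \<in> B \<Longrightarrow> x \<in> carrier M \<Longrightarrow> a \<odot>\<^bsub>M\<^esub> x \<in> carrier M"
    and emb: "\<And>i. emb \<zero>\<^bsub>M\<^esub> i = 0"
      "\<And>x y i. x \<in> carrier M \<Longrightarrow> y \<in> carrier M \<Longrightarrow> emb (x \<oplus>\<^bsub>M\<^esub> y) i = emb x i + emb y i"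
      "\<And>a x i. a \<in> B \<Longrightarrow> x \<in> carrier M \<Longrightarrow> emb (a \<odot>\<^bsub>M\<^esub> x) i = a * emb x i"
    and emb_inj: "\<And>x y. x \<in> carrier M \<Longrightarrow> y \<in> carrier M \<Longrightarrow> (\<And>i. emb x i = emb y i) \<Longrightarrow> x = y"
begin

lemma abelian_group_M: "abelian_group M"
proof (rule abelian_group_of_values[where v = emb])
  fix x assume "x \<in> carrier M"
  then show "\<exists>y\<in>carrier M. \<forall>j. emb y j = - emb x j"
    by (intro bexI[of _ "(- 1) \<odot>\<^bsub>M\<^esub> x"]) (simp_all add: emb M_closed B_closed)
qed (auto simp: M_closed emb emb_inj)

lemma M_minus_closed: "x \<in> carrier M \<Longrightarrow> y \<in> carrier M \<Longrightarrow> x \<ominus>\<^bsub>M\<^esub> y \<in> carrier M"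
  by (rule abelian_group.minus_closed[OF abelian_group_M])

lemma emb_minus: "x \<in> carrier M \<Longrightarrow> y \<in> carrier M \<Longrightarrow> emb (x \<ominus>\<^bsub>M\<^esub> y) i = emb x i - emb y i"
  by (rule value_minus[OF abelian_group_M, where v = "\<lambda>x. emb x i"]) (simp_all add: emb)

abbreviation val where "val \<equiv> frac_val emb"

context
  fixes P assumes P: "P \<in> Spec R"
begin

lemma frac_rel_iff:
  assumes "m \<in> carrier M" "n \<in> carrier M" "s \<in> B - P" "t \<in> B - P"
  shows "((m, s), (n, t)) \<in> frac_rel R (B - P) M \<longleftrightarrow> (\<forall>i. Fract (emb m i) s = Fract (emb n i) t)"
proof -
  have cong: "u \<odot>\<^bsub>M\<^esub> (t \<odot>\<^bsub>M\<^esub> m) = u \<odot>\<^bsub>M\<^esub> (s \<odot>\<^bsub>M\<^esub> n) \<longleftrightarrow> (\<forall>i. Fract (emb m i) s = Fract (emb n i) t)"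
    if u: "u \<in> B - P" for u
  proof -
    have "u \<odot>\<^bsub>M\<^esub> (t \<odot>\<^bsub>M\<^esub> m) = u \<odot>\<^bsub>M\<^esub> (s \<odot>\<^bsub>M\<^esub> n) \<longleftrightarrow> (\<forall>i. u * (t * emb m i) = u * (s * emb n i))"
      using emb_inj[of "u \<odot>\<^bsub>M\<^esub> (t \<odot>\<^bsub>M\<^esub> m)" "u \<odot>\<^bsub>M\<^esub> (s \<odot>\<^bsub>M\<^esub> n)"] emb(3)[of u "t \<odot>\<^bsub>M\<^esub> m"]
        emb(3)[of u "s \<odot>\<^bsub>M\<^esub> n"] assms u
      by (metis DiffD1 M_closed(3) emb(3))
    also have "\<dots> \<longleftrightarrow> (\<forall>i. Fract (emb m i) s = Fract (emb n i) t)"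
      using Spec_D(5)[OF P] assms u by (auto simp: eq_fract mult_ac)
    finally show ?thesis .
  qed
  have "1 \<in> B - P" using Spec_D(3)[OF P] B_closed by simp
  with cong assms show ?thesis
    unfolding frac_rel_def by auto
qed

lemma quot_eq: 
  assumes "m \<in> carrier M" "s \<in> B - P"
  shows "quot M P m s = {(n, t). n \<in> carrier M \<and> t \<in> B - P \<and> (\<forall>i. Fract (emb n i) t = Fract (emb m i) s)}"
proof -
  have "frac_rel R (B - P) M \<subseteq> (carrier M \<times> (B - P)) \<times> (carrier M \<times> (B - P))"
    by (auto simp: frac_rel_def)
  then show ?thesis
    using frac_rel_iff[OF assms(1) _ assms(2)]
    by (auto simp: fraction_def) 
qed

lemma frac_val_frac:
  assumes "m \<in> carrier M" "s \<in> B - P"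
  shows "val (quot M P m s) i = Fract (emb m i) s"
proof -
  have "(m, s) \<in> quot M P m s"
    using assms by (simp add: quot_eq)
  then have "(SOME p. p \<in> quot M P m s) \<in> quot M P m s"
    by (rule someI)
  then show ?thesis
    using assms unfolding frac_val_def by (cases "SOME p. p \<in> quot M P m s") (auto simp: quot_eq)
qed

lemma frac_eq_iff:
  assumes "m \<in> carrier M" "s \<in> B - P" "n \<in> carrier M" "t \<in> B - P"
  shows "quot M P m s = quot M P n t \<longleftrightarrow> (\<forall>i. Fract (emb m i) s = Fract (emb n i) t)"
proof
  assume eq: "quot M P m s = quot M P n t"
  show "\<forall>i. Fract (emb m i) s = Fract (emb n i) t"
    using frac_val_frac[OF assms(1,2)] frac_val_frac[OF assms(3,4)] unfolding eq by simp
next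
  assume "\<forall>i. Fract (emb m i) s = Fract (emb n i) t"
  then show "quot M P m s = quot M P n t"
    unfolding quot_eq[OF assms(1,2)] quot_eq[OF assms(3,4)] by simp
qed

lemma val_inj:
  assumes "x \<in> carrier (stalk R M P)" "y \<in> carrier (stalk R M P)" "\<And>i. val x i = val y i"
  shows "x = y"
  using assms by (elim stalk_cases) (simp add: frac_eq_iff frac_val_frac)

text \<open>
  Operations on classes are defined as unions over all representatives; the union collapses when its
  members agree.
\<close>

lemma UN_frac:
  assumes "m \<in> carrier M" "s \<in> B - P"
    and "\<And>n t. n \<in> carrier M \<Longrightarrow> t \<in> B - P \<Longrightarrow> (\<forall>i. Fract (emb n i) t = Fract (emb m i) s) \<Longrightarrow> F n t = F m s"
  shows "(\<Union>(n, t)\<in>quot M P m s. F n t) = F m s"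
proof (rule SUP_eq_const)
  show "quot M P m s \<noteq> {}"
    using assms(1,2) by (auto simp: quot_eq)
  fix p assume "p \<in> quot M P m s"
  then have "F (fst p) (snd p) = F m s"
    unfolding quot_eq[OF assms(1,2)] by (intro assms(3)) auto
  then show "(case p of (n, t) \<Rightarrow> F n t) = F m s"
    by (simp only: case_prod_unfold)
qed

end

end

context domain_subring
begin

lemma UN_frac_frac:
  assumes M: "torsion_free_module B M emb" and M': "torsion_free_module B M' emb'"
    and M'': "torsion_free_module B M'' emb''" and P: "P \<in> Spec R"
    and closed: "\<And>m s n t. m \<in> carrier M \<Longrightarrow> s \<in> B - P \<Longrightarrow> n \<in> carrier M' \<Longrightarrow> t \<in> B - P \<Longrightarrow>
        h m s n t \<in> carrier M'' \<and> k s t \<in> B - P"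
    and cong: "\<And>m s n t m' s' n' t' i. m \<in> carrier M \<Longrightarrow> s \<in> B - P \<Longrightarrow> n \<in> carrier M' \<Longrightarrow> t \<in> B - P \<Longrightarrow>
        m' \<in> carrier M \<Longrightarrow> s' \<in> B - P \<Longrightarrow> n' \<in> carrier M' \<Longrightarrow> t' \<in> B - P \<Longrightarrow>
        (\<And>i. Fract (emb m i) s = Fract (emb m' i) s') \<Longrightarrow> (\<And>i. Fract (emb' n i) t = Fract (emb' n' i) t') \<Longrightarrow>
        Fract (emb'' (h m s n t) i) (k s t) = Fract (emb'' (h m' s' n' t') i) (k s' t')"
    and m: "m \<in> carrier M" and s: "s \<in> B - P" and n: "n \<in> carrier M'" and t: "t \<in> B - P"
  shows "(\<Union>(m, s)\<in>quot M P m s. \<Union>(n, t)\<in>quot M' P n t. quot M'' P (h m s n t) (k s t)) =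
      quot M'' P (h m s n t) (k s t)"
proof -
  interpret M: torsion_free_module B M emb by (rule M)
  interpret M': torsion_free_module B M' emb' by (rule M')
  interpret M'': torsion_free_module B M'' emb'' by (rule M'')
  have eq: "quot M'' P (h m1 s1 n1 t1) (k s1 t1) = quot M'' P (h m2 s2 n2 t2) (k s2 t2)"
    if *: "m1 \<in> carrier M" "s1 \<in> B - P" "n1 \<in> carrier M'" "t1 \<in> B - P"
      "m2 \<in> carrier M" "s2 \<in> B - P" "n2 \<in> carrier M'" "t2 \<in> B - P"
      "\<forall>i. Fract (emb m1 i) s1 = Fract (emb m2 i) s2" "\<forall>i. Fract (emb' n1 i) t1 = Fract (emb' n2 i) t2"
    for m1 s1 n1 t1 m2 s2 n2 t2
  proof -
    have "h m1 s1 n1 t1 \<in> carrier M''" "k s1 t1 \<in> B - P" "h m2 s2 n2 t2 \<in> carrier M''" "k s2 t2 \<in> B - P"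
      using closed[OF *(1-4)] closed[OF *(5-8)] by blast+
    moreover have "\<forall>i. Fract (emb'' (h m1 s1 n1 t1) i) (k s1 t1) = Fract (emb'' (h m2 s2 n2 t2) i) (k s2 t2)"
      using cong[OF *(1-8)] *(9,10) by blast
    ultimately show ?thesis
      using M''.frac_eq_iff[OF P] by blast
  qed
  have inner: "(\<Union>(n, t)\<in>quot M' P n t. quot M'' P (h m1 s1 n t) (k s1 t)) = quot M'' P (h m1 s1 n t) (k s1 t)"
    if "m1 \<in> carrier M" "s1 \<in> B - P" for m1 s1
    by (rule M'.UN_frac[OF P n t], rule eq) (use that n t in auto)
  show ?thesis
  proof (rule trans[OF M.UN_frac[OF P m s]])
    fix m1 s1
    assume *: "m1 \<in> carrier M" "s1 \<in> B - P" "\<forall>i. Fract (emb m1 i) s1 = Fract (emb m i) s"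
    show "(\<Union>(n, t)\<in>quot M' P n t. quot M'' P (h m1 s1 n t) (k s1 t)) =
        (\<Union>(n, t)\<in>quot M' P n t. quot M'' P (h m s n t) (k s t))"
      unfolding inner[OF *(1,2)] inner[OF m s] by (rule eq) (use * m s n t in auto)
  qed (rule inner[OF m s])
qed

lemma regular_torsion_free: "torsion_free_module B (regular_module R) (\<lambda>b (_ :: unit). b)"
  by unfold_locales (auto simp: regular_module_def B_closed)

lemma carrier_regular [simp]: "carrier (regular_module R) = B"
  by (simp add: regular_module_def)

lemma regular_stalk_cases:
  assumes "a \<in> carrier (stalk R (regular_module R) P)"
  obtains b s where "b \<in> B" "s \<in> B - P" "a = quot (regular_module R) P b s"
proof -
  obtain b s where "b \<in> carrier (regular_module R)" "s \<in> B - P" "a = quot (regular_module R) P b s"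
    using assms by (rule stalk_cases)
  then show ?thesis
    by (intro that[of b s]) (simp_all only: carrier_regular)
qed

text \<open>
  The ring is embedded with a single coordinate, indexed by the unit type.
\<close>

definition rval :: "('a \<times> 'a) set \<Rightarrow> 'a fract" where
  "rval a = frac_val (\<lambda>b (_ :: unit). b) a ()"

context
  fixes P assumes P: "P \<in> Spec R"
begin

lemma rval_frac: "b \<in> B \<Longrightarrow> s \<in> B - P \<Longrightarrow> rval (quot (regular_module R) P b s) = Fract b s"
  unfolding rval_def
  using torsion_free_module.frac_val_frac[OF regular_torsion_free P, of b s "()"] by simp

lemma rval_inj:
  assumes "x \<in> carrier (stalk R (regular_module R) P)" "y \<in> carrier (stalk R (regular_module R) P)" "rval x = rval y"
  shows "x = y"
  using torsion_free_module.val_inj[OF regular_torsion_free P assms(1,2)] assms(3)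
  by (simp add: rval_def)

end

end

context torsion_free_module
begin

context
  fixes P assumes P: "P \<in> Spec R"
begin

lemma stalk_add_frac:
  assumes "m \<in> carrier M" "s \<in> B - P" "n \<in> carrier M" "t \<in> B - P"
  shows "quot M P m s \<oplus>\<^bsub>stalk R M P\<^esub> quot M P n t = quot M P (t \<odot>\<^bsub>M\<^esub> m \<oplus>\<^bsub>M\<^esub> s \<odot>\<^bsub>M\<^esub> n) (s * t)"
    "t \<odot>\<^bsub>M\<^esub> m \<oplus>\<^bsub>M\<^esub> s \<odot>\<^bsub>M\<^esub> n \<in> carrier M" "s * t \<in> B - P"
    "Fract (emb (t \<odot>\<^bsub>M\<^esub> m \<oplus>\<^bsub>M\<^esub> s \<odot>\<^bsub>M\<^esub> n) i) (s * t) = Fract (emb m i) s + Fract (emb n i) t"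
proof -
  have val: "Fract (emb (t \<odot>\<^bsub>M\<^esub> m \<oplus>\<^bsub>M\<^esub> s \<odot>\<^bsub>M\<^esub> n) i) (s * t) = Fract (emb m i) s + Fract (emb n i) t"
    if "m \<in> carrier M" "s \<in> B - P" "n \<in> carrier M" "t \<in> B - P" for m n s t i
    using that Spec_D(5)[OF P, of s] Spec_D(5)[OF P, of t] by (simp add: emb M_closed mult_ac)
  have closed: "t \<odot>\<^bsub>M\<^esub> m \<oplus>\<^bsub>M\<^esub> s \<odot>\<^bsub>M\<^esub> n \<in> carrier M \<and> s * t \<in> B - P"
    if "m \<in> carrier M" "s \<in> B - P" "n \<in> carrier M" "t \<in> B - P" for m n s t
    using that Spec_D(4)[OF P, of s t] by (simp add: M_closed)
  have "(\<Union>(m, s)\<in>quot M P m s. \<Union>(n, t)\<in>quot M P n t. quot M P (t \<odot>\<^bsub>M\<^esub> m \<oplus>\<^bsub>M\<^esub> s \<odot>\<^bsub>M\<^esub> n) (s * t)) =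
      quot M P (t \<odot>\<^bsub>M\<^esub> m \<oplus>\<^bsub>M\<^esub> s \<odot>\<^bsub>M\<^esub> n) (s * t)"
    by (rule UN_frac_frac[OF torsion_free_module_axioms torsion_free_module_axioms torsion_free_module_axioms P closed _ assms])
      (simp_all only: val)
  then show "quot M P m s \<oplus>\<^bsub>stalk R M P\<^esub> quot M P n t = quot M P (t \<odot>\<^bsub>M\<^esub> m \<oplus>\<^bsub>M\<^esub> s \<odot>\<^bsub>M\<^esub> n) (s * t)"
    by (simp add: stalk_def localization_def)
  show "t \<odot>\<^bsub>M\<^esub> m \<oplus>\<^bsub>M\<^esub> s \<odot>\<^bsub>M\<^esub> n \<in> carrier M" "s * t \<in> B - P"
    "Fract (emb (t \<odot>\<^bsub>M\<^esub> m \<oplus>\<^bsub>M\<^esub> s \<odot>\<^bsub>M\<^esub> n) i) (s * t) = Fract (emb m i) s + Fract (emb n i) t"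
    using closed[OF assms] val[OF assms] by simp_all
qed

lemma stalk_smult_frac:
  assumes "b \<in> B" "s \<in> B - P" "m \<in> carrier M" "t \<in> B - P"
  shows "quot (regular_module R) P b s \<odot>\<^bsub>stalk R M P\<^esub> quot M P m t = quot M P (b \<odot>\<^bsub>M\<^esub> m) (s * t)"
    "b \<odot>\<^bsub>M\<^esub> m \<in> carrier M" "s * t \<in> B - P"
    "Fract (emb (b \<odot>\<^bsub>M\<^esub> m) i) (s * t) = Fract b s * Fract (emb m i) t"
proof -
  have val: "Fract (emb (b \<odot>\<^bsub>M\<^esub> m) i) (s * t) = Fract b s * Fract (emb m i) t"
    if "b \<in> B" "s \<in> B - P" "m \<in> carrier M" "t \<in> B - P" for b m s t i
    using that by (simp add: emb)
  have closed: "b \<odot>\<^bsub>M\<^esub> m \<in> carrier M \<and> s * t \<in> B - P"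
    if "b \<in> carrier (regular_module R)" "s \<in> B - P" "m \<in> carrier M" "t \<in> B - P" for b m s t
    using that Spec_D(4)[OF P, of s t] by (simp add: M_closed)
  have b: "b \<in> carrier (regular_module R)" using assms(1) by simp
  have "(\<Union>(b, s)\<in>quot (regular_module R) P b s. \<Union>(m, t)\<in>quot M P m t. quot M P (b \<odot>\<^bsub>M\<^esub> m) (s * t)) =
      quot M P (b \<odot>\<^bsub>M\<^esub> m) (s * t)"
    by (rule UN_frac_frac[OF regular_torsion_free torsion_free_module_axioms torsion_free_module_axioms P closed _ b assms(2-4)])
      (simp_all only: val carrier_regular)
  then show "quot (regular_module R) P b s \<odot>\<^bsub>stalk R M P\<^esub> quot M P m t = quot M P (b \<odot>\<^bsub>M\<^esub> m) (s * t)"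
    by (simp add: stalk_def localization_def)
  show "b \<odot>\<^bsub>M\<^esub> m \<in> carrier M" "s * t \<in> B - P"
    "Fract (emb (b \<odot>\<^bsub>M\<^esub> m) i) (s * t) = Fract b s * Fract (emb m i) t"
    using closed[OF b assms(2-4)] val[OF assms] by simp_all
qed

lemma stalk_zero: "\<zero>\<^bsub>stalk R M P\<^esub> = quot M P \<zero>\<^bsub>M\<^esub> 1" and one_notin: "1 \<in> B - P"
  using Spec_D(3)[OF P] by (simp_all add: stalk_def localization_def B_closed)

lemma stalk_zero_ops:
  "\<zero>\<^bsub>stalk R M P\<^esub> \<in> carrier (stalk R M P)" "val \<zero>\<^bsub>stalk R M P\<^esub> i = 0"
proof -
  show "\<zero>\<^bsub>stalk R M P\<^esub> \<in> carrier (stalk R M P)"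
    unfolding stalk_zero by (intro quot_carrier M_closed one_notin)
  show "val \<zero>\<^bsub>stalk R M P\<^esub> i = 0"
    unfolding stalk_zero frac_val_frac[OF P M_closed(1) one_notin] by (simp add: emb fract_collapse)
qed

lemma stalk_add_ops:
  assumes x: "x \<in> carrier (stalk R M P)" and y: "y \<in> carrier (stalk R M P)"
  shows "x \<oplus>\<^bsub>stalk R M P\<^esub> y \<in> carrier (stalk R M P)" "val (x \<oplus>\<^bsub>stalk R M P\<^esub> y) i = val x i + val y i"
proof -
  obtain m t where m: "m \<in> carrier M" "t \<in> B - P" "x = quot M P m t"
    using x by (rule stalk_cases)
  obtain n s where n: "n \<in> carrier M" "s \<in> B - P" "y = quot M P n s"
    using y by (rule stalk_cases)
  note add = stalk_add_frac[OF m(1,2) n(1,2)]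
  show "x \<oplus>\<^bsub>stalk R M P\<^esub> y \<in> carrier (stalk R M P)"
    unfolding m(3) n(3) add(1) by (rule quot_carrier[OF add(2,3)])
  show "val (x \<oplus>\<^bsub>stalk R M P\<^esub> y) i = val x i + val y i"
    unfolding m(3) n(3) add(1) frac_val_frac[OF P add(2,3)] frac_val_frac[OF P m(1,2)] frac_val_frac[OF P n(1,2)]
    by (rule add(4))
qed

lemma stalk_smult_ops:
  assumes a: "a \<in> carrier (stalk R (regular_module R) P)" and x: "x \<in> carrier (stalk R M P)"
  shows "a \<odot>\<^bsub>stalk R M P\<^esub> x \<in> carrier (stalk R M P)" "val (a \<odot>\<^bsub>stalk R M P\<^esub> x) i = rval a * val x i"
proof -
  obtain m t where m: "m \<in> carrier M" "t \<in> B - P" "x = quot M P m t"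
    using x by (rule stalk_cases)
  obtain b s where b: "b \<in> B" "s \<in> B - P" "a = quot (regular_module R) P b s"
    using a by (rule regular_stalk_cases)
  note smult = stalk_smult_frac[OF b(1,2) m(1,2)]
  show "a \<odot>\<^bsub>stalk R M P\<^esub> x \<in> carrier (stalk R M P)"
    unfolding b(3) m(3) smult(1) by (rule quot_carrier[OF smult(2,3)])
  show "val (a \<odot>\<^bsub>stalk R M P\<^esub> x) i = rval a * val x i"
    unfolding b(3) m(3) smult(1) frac_val_frac[OF P smult(2,3)] frac_val_frac[OF P m(1,2)] rval_frac[OF P b(1,2)]
    by (rule smult(4))
qed

lemmas stalk_ops = stalk_zero_ops stalk_add_ops stalk_smult_ops

lemma abelian_group_stalk: "abelian_group (stalk R M P)"
proof (rule abelian_group_of_values[where v = val])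
  fix x assume "x \<in> carrier (stalk R M P)"
  then obtain m s where x: "m \<in> carrier M" "s \<in> B - P" "x = quot M P m s"
    by (rule stalk_cases)
  have "(- 1) \<odot>\<^bsub>M\<^esub> m \<in> carrier M" using x by (intro M_closed) (simp add: B_closed)
  then show "\<exists>y\<in>carrier (stalk R M P). \<forall>j. val y j = - val x j"
    using x by (intro bexI[of _ "quot M P ((- 1) \<odot>\<^bsub>M\<^esub> m) s"] quot_carrier)
      (simp_all add: frac_val_frac[OF P] emb B_closed)
qed (simp_all only: stalk_ops val_inj[OF P])

lemma val_finsum:
  assumes "finite I" "\<And>k. k \<in> I \<Longrightarrow> f k \<in> carrier (stalk R M P)"
  shows "val (\<Oplus>\<^bsub>stalk R M P\<^esub>k\<in>I. f k) i = (\<Sum>k\<in>I. val (f k) i)"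
  by (rule value_finsum[where v = "\<lambda>x. val x i"])
    (use assms abelian_group_stalk in \<open>simp_all add: stalk_ops abelian_group_def\<close>)

end

end

section \<open>Rings and modules of sections\<close>

context domain_subring
begin

lemma stalk_ring_simps:
  "carrier (stalk_ring R P) = carrier (stalk R (regular_module R) P)"
  "monoid.mult (stalk_ring R P) = (\<odot>\<^bsub>stalk R (regular_module R) P\<^esub>)"
  "\<one>\<^bsub>stalk_ring R P\<^esub> = quot (regular_module R) P 1 1"
  "\<zero>\<^bsub>stalk_ring R P\<^esub> = \<zero>\<^bsub>stalk R (regular_module R) P\<^esub>"
  "add (stalk_ring R P) = add (stalk R (regular_module R) P)"
  by (simp_all add: stalk_ring_def localization_ring_def stalk_def Let_def)

context
  fixes P assumes P: "P \<in> Spec R"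
begin

lemma stalk_ring_zero_one:
  "\<zero>\<^bsub>stalk_ring R P\<^esub> \<in> carrier (stalk_ring R P)" "rval \<zero>\<^bsub>stalk_ring R P\<^esub> = 0"
  "\<one>\<^bsub>stalk_ring R P\<^esub> \<in> carrier (stalk_ring R P)" "rval \<one>\<^bsub>stalk_ring R P\<^esub> = 1"
proof -
  note reg = torsion_free_module.stalk_zero_ops[OF regular_torsion_free P]
  show "\<zero>\<^bsub>stalk_ring R P\<^esub> \<in> carrier (stalk_ring R P)" "rval \<zero>\<^bsub>stalk_ring R P\<^esub> = 0"
    using reg by (simp_all add: stalk_ring_simps rval_def)
  have one: "1 \<in> carrier (regular_module R)" "1 \<in> B - P"
    using torsion_free_module.one_notin[OF regular_torsion_free P] by (simp_all add: B_closed)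
  show "\<one>\<^bsub>stalk_ring R P\<^esub> \<in> carrier (stalk_ring R P)"
    unfolding stalk_ring_simps by (rule quot_carrier[OF one])
  show "rval \<one>\<^bsub>stalk_ring R P\<^esub> = 1"
    unfolding stalk_ring_simps using rval_frac[OF P, of 1 1] one by (simp add: fract_collapse)
qed

lemma stalk_ring_add_mult:
  assumes x: "x \<in> carrier (stalk_ring R P)" and y: "y \<in> carrier (stalk_ring R P)"
  shows "x \<oplus>\<^bsub>stalk_ring R P\<^esub> y \<in> carrier (stalk_ring R P)" "rval (x \<oplus>\<^bsub>stalk_ring R P\<^esub> y) = rval x + rval y"
    "x \<otimes>\<^bsub>stalk_ring R P\<^esub> y \<in> carrier (stalk_ring R P)" "rval (x \<otimes>\<^bsub>stalk_ring R P\<^esub> y) = rval x * rval y"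
proof -
  have xy: "x \<in> carrier (stalk R (regular_module R) P)" "y \<in> carrier (stalk R (regular_module R) P)"
    using x y by (simp_all only: stalk_ring_simps)
  note reg = torsion_free_module.stalk_add_ops[OF regular_torsion_free P xy]
    torsion_free_module.stalk_smult_ops[OF regular_torsion_free P xy]
  show "x \<oplus>\<^bsub>stalk_ring R P\<^esub> y \<in> carrier (stalk_ring R P)" "rval (x \<oplus>\<^bsub>stalk_ring R P\<^esub> y) = rval x + rval y"
    "x \<otimes>\<^bsub>stalk_ring R P\<^esub> y \<in> carrier (stalk_ring R P)" "rval (x \<otimes>\<^bsub>stalk_ring R P\<^esub> y) = rval x * rval y"
    unfolding stalk_ring_simps using reg reg(2,4)[of "()"] by (simp_all only: rval_def)
qed

lemma stalk_ring_inj: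
  "x \<in> carrier (stalk_ring R P) \<Longrightarrow> y \<in> carrier (stalk_ring R P) \<Longrightarrow> rval x = rval y \<Longrightarrow> x = y"
  unfolding stalk_ring_simps by (rule rval_inj[OF P])

lemma stalk_ring_neg:
  assumes x: "x \<in> carrier (stalk_ring R P)"
  shows "\<exists>y\<in>carrier (stalk_ring R P). rval y = - rval x"
proof -
  obtain b s where b: "b \<in> B" "s \<in> B - P" "x = quot (regular_module R) P b s"
    using x unfolding stalk_ring_simps by (rule regular_stalk_cases)
  have mb: "- b \<in> B" using b(1) by (rule B_closed)
  have "quot (regular_module R) P (- b) s \<in> carrier (stalk R (regular_module R) P)"
    using mb b(2) by (intro quot_carrier) simp_all
  moreover have "rval (quot (regular_module R) P (- b) s) = - rval x"
    unfolding b(3) rval_frac[OF P mb b(2)] rval_frac[OF P b(1,2)] by simp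
  ultimately show ?thesis
    unfolding stalk_ring_simps by blast
qed

lemma cring_stalk_ring: "cring (stalk_ring R P)"
proof (rule cring_of_values[where v = "\<lambda>x (_ :: unit). rval x"])
  fix x assume "x \<in> carrier (stalk_ring R P)"
  from stalk_ring_neg[OF this] show "\<exists>y\<in>carrier (stalk_ring R P). \<forall>j :: unit. rval y = - rval x"
    by blast
qed (simp_all add: stalk_ring_zero_one stalk_ring_add_mult stalk_ring_inj)

lemma rval_finsum:
  assumes "finite I" "\<And>k. k \<in> I \<Longrightarrow> f k \<in> carrier (stalk_ring R P)"
  shows "rval (\<Oplus>\<^bsub>stalk_ring R P\<^esub>k\<in>I. f k) = (\<Sum>k\<in>I. rval (f k))"
  using cring_stalk_ring
  by (intro value_finsum[where v = rval] assms stalk_ring_zero_one stalk_ring_add_mult)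
    (simp_all add: cring_def ring_def abelian_group_def)

end

lemma zariski_open_finite_Int:
  assumes V: "zariski_open R V" "P \<in> V" and fin: "finite I"
    and N: "\<forall>k\<in>I. zariski_open R (N k) \<and> P \<in> N k"
  shows "\<exists>N'. zariski_open R N' \<and> P \<in> N' \<and> N' \<subseteq> V \<and> (\<forall>k\<in>I. N' \<subseteq> N k)"
  using fin N
proof (induction I rule: finite_induct)
  case (insert k I)
  then obtain N' where "zariski_open R N'" "P \<in> N'" "N' \<subseteq> V" "\<forall>k\<in>I. N' \<subseteq> N k"
    by blast
  then show ?case
    using insert.prems zariski_open_Int[of N' "N k"]
    by (intro exI[of _ "N' \<inter> N k"]) blast
qed (use V in blast)

lemma section_ring_simps:
  "carrier (section_ring R V) = sections R (regular_module R) V"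
  "f \<otimes>\<^bsub>section_ring R V\<^esub> g = (\<lambda>P\<in>V. f P \<otimes>\<^bsub>stalk_ring R P\<^esub> g P)"
  "\<one>\<^bsub>section_ring R V\<^esub> = (\<lambda>P\<in>V. \<one>\<^bsub>stalk_ring R P\<^esub>)"
  "\<zero>\<^bsub>section_ring R V\<^esub> = (\<lambda>P\<in>V. \<zero>\<^bsub>stalk_ring R P\<^esub>)"
  "f \<oplus>\<^bsub>section_ring R V\<^esub> g = (\<lambda>P\<in>V. f P \<oplus>\<^bsub>stalk_ring R P\<^esub> g P)"
  by (simp_all add: section_ring_def)

lemma section_module_simps:
  "carrier (section_module R M V) = sections R M V"
  "\<zero>\<^bsub>section_module R M V\<^esub> = (\<lambda>P\<in>V. \<zero>\<^bsub>stalk R M P\<^esub>)"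
  "f \<oplus>\<^bsub>section_module R M V\<^esub> g = (\<lambda>P\<in>V. f P \<oplus>\<^bsub>stalk R M P\<^esub> g P)"
  "a \<odot>\<^bsub>section_module R M V\<^esub> f = (\<lambda>P\<in>V. a P \<odot>\<^bsub>stalk R M P\<^esub> f P)"
  by (simp_all add: section_module_def)

end

context torsion_free_module
begin

context
  fixes V assumes V: "zariski_open R V"
begin

private lemma V_Spec: "P \<in> V \<Longrightarrow> P \<in> Spec R"
  using zariski_open_subset[OF V] by blast

lemma sections_eqI:
  assumes f: "f \<in> sections R M V" and g: "g \<in> sections R M V"
    and eq: "\<And>P i. P \<in> V \<Longrightarrow> val (f P) i = val (g P) i"
  shows "f = g"
proof (rule extensionalityI[OF sections_extensional[OF f] sections_extensional[OF g]])
  fix P assume P: "P \<in> V"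
  show "f P = g P"
    by (rule val_inj[OF V_Spec[OF P] sections_carrier[OF f P] sections_carrier[OF g P] eq[OF P]])
qed

lemma sections_zero: "\<zero>\<^bsub>section_module R M V\<^esub> \<in> sections R M V"
proof -
  have "(\<lambda>P\<in>V. quot M P \<zero>\<^bsub>M\<^esub> 1) \<in> sections R M V"
    using Spec_D(3)[OF V_Spec] by (intro sections_fraction V M_closed B_closed) auto
  moreover have "(\<lambda>P\<in>V. quot M P \<zero>\<^bsub>M\<^esub> 1) = \<zero>\<^bsub>section_module R M V\<^esub>"
    unfolding section_module_simps using stalk_zero[OF V_Spec] by (intro restrict_ext) simp
  ultimately show ?thesis by simp
qed

lemma sections_add:
  assumes "f \<in> sections R M V" "g \<in> sections R M V"
  shows "f \<oplus>\<^bsub>section_module R M V\<^esub> g \<in> sections R M V"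
  unfolding section_module_simps
  by (rule sections_binary[OF assms, where h = "\<lambda>m s n t. t \<odot>\<^bsub>M\<^esub> m \<oplus>\<^bsub>M\<^esub> s \<odot>\<^bsub>M\<^esub> n" and k = "\<lambda>s t. s * t"])
    (intro conjI stalk_add_frac; assumption)

lemma sections_smult:
  assumes "a \<in> sections R (regular_module R) V" "f \<in> sections R M V"
  shows "a \<odot>\<^bsub>section_module R M V\<^esub> f \<in> sections R M V"
  unfolding section_module_simps
  by (rule sections_binary[OF assms, where h = "\<lambda>b s m t. b \<odot>\<^bsub>M\<^esub> m" and k = "\<lambda>s t. s * t"], unfold carrier_regular)
    (intro conjI stalk_smult_frac; assumption)

lemma section_value:
  assumes P: "P \<in> V"
  shows "val (\<zero>\<^bsub>section_module R M V\<^esub> P) i = 0"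
    "f \<in> sections R M V \<Longrightarrow> g \<in> sections R M V \<Longrightarrow>
      val ((f \<oplus>\<^bsub>section_module R M V\<^esub> g) P) i = val (f P) i + val (g P) i"
    "a \<in> sections R (regular_module R) V \<Longrightarrow> f \<in> sections R M V \<Longrightarrow>
      val ((a \<odot>\<^bsub>section_module R M V\<^esub> f) P) i = rval (a P) * val (f P) i"
  using stalk_zero_ops[OF V_Spec[OF P]] stalk_add_ops[OF V_Spec[OF P]] stalk_smult_ops[OF V_Spec[OF P]]
  by (simp_all add: section_module_simps P sections_carrier[OF _ P])

lemma sections_neg:
  assumes f: "f \<in> sections R M V"
  shows "\<exists>g\<in>sections R M V. \<forall>P\<in>V. \<forall>i. val (g P) i = - val (f P) i"
proof -
  define a where "a = (\<lambda>P\<in>V. quot (regular_module R) P (- 1) 1)"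
  have a: "a \<in> sections R (regular_module R) V"
    unfolding a_def using Spec_D(3)[OF V_Spec] by (intro sections_fraction V) (auto simp: B_closed)
  have "rval (a P) = - 1" if "P \<in> V" for P
    using rval_frac[OF V_Spec[OF that], of "- 1" 1] Spec_D(3)[OF V_Spec[OF that]] that
    by (simp add: a_def B_closed fract_collapse minus_fract[symmetric] del: minus_fract)
  then show ?thesis
    using sections_smult[OF a f] by (intro bexI[of _ "a \<odot>\<^bsub>section_module R M V\<^esub> f"]) (simp_all add: section_value a f)
qed

lemma abelian_group_sections: "abelian_group (section_module R M V)"
proof (rule abelian_group_of_values[where v = "\<lambda>f (P, i). if P \<in> V then val (f P) i else 0"], unfold section_module_simps(1))
  fix f assume "f \<in> sections R M V"
  from sections_neg[OF this] show "\<exists>g\<in>sections R M V. \<forall>j. (case j of (P, i) \<Rightarrow> if P \<in> V then val (g P) i else 0) =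
      - (case j of (P, i) \<Rightarrow> if P \<in> V then val (f P) i else 0)"
    by auto
next
  fix f g assume fg: "f \<in> sections R M V" "g \<in> sections R M V"
    and eq: "\<And>j. (case j of (P, i) \<Rightarrow> if P \<in> V then val (f P) i else 0) =
      (case j of (P, i) \<Rightarrow> if P \<in> V then val (g P) i else 0)"
  show "f = g"
  proof (rule sections_eqI[OF fg])
    show "val (f P) i = val (g P) i" if "P \<in> V" for P i
      using eq[of "(P, i)"] that by simp
  qed
qed (auto simp: sections_zero sections_add section_value)

lemma section_finsum_value:
  assumes P: "P \<in> V" and I: "finite I" and f: "\<And>k. k \<in> I \<Longrightarrow> f k \<in> sections R M V"
  shows "val ((\<Oplus>\<^bsub>section_module R M V\<^esub>k\<in>I. f k) P) i = (\<Sum>k\<in>I. val (f k P) i)"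
  by (rule value_finsum[where v = "\<lambda>f. val (f P) i"])
    (use abelian_group_sections in \<open>simp_all add: section_module_simps(1) section_value[OF P] I f abelian_group_def\<close>)

lemma sections_finsum:
  assumes "\<And>k. k \<in> I \<Longrightarrow> f k \<in> sections R M V"
  shows "(\<Oplus>\<^bsub>section_module R M V\<^esub>k\<in>I. f k) \<in> sections R M V"
  using abelian_monoid.finsum_closed[OF abelian_group.axioms(1)[OF abelian_group_sections], of f I]
  unfolding section_module_simps(1) using assms by blast

lemma section_expansion_iff:
  fixes n :: nat
  assumes x: "x \<in> sections R M V"
    and c: "\<forall>k<n. c k \<in> sections R (regular_module R) V" and e: "\<forall>k<n. e k \<in> sections R M V"
  shows "x = (\<Oplus>\<^bsub>section_module R M V\<^esub>k\<in>{..<n}. c k \<odot>\<^bsub>section_module R M V\<^esub> e k) \<longleftrightarrow>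
    (\<forall>P\<in>V. \<forall>i. val (x P) i = (\<Sum>k<n. rval (c k P) * val (e k P) i))"
proof -
  let ?y = "\<Oplus>\<^bsub>section_module R M V\<^esub>k\<in>{..<n}. c k \<odot>\<^bsub>section_module R M V\<^esub> e k"
  have ce: "c k \<odot>\<^bsub>section_module R M V\<^esub> e k \<in> sections R M V" if "k < n" for k
    using that c e by (intro sections_smult) auto
  have y: "?y \<in> sections R M V"
    by (rule sections_finsum) (simp add: ce)
  have val: "val (?y P) i = (\<Sum>k<n. rval (c k P) * val (e k P) i)" if "P \<in> V" for P i
    using ce c e by (subst section_finsum_value[OF that]) (simp_all add: section_value[OF that])
  show ?thesis
  proof
    assume "x = ?y"
    then show "\<forall>P\<in>V. \<forall>i. val (x P) i = (\<Sum>k<n. rval (c k P) * val (e k P) i)"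
      using val by simp
  next
    assume "\<forall>P\<in>V. \<forall>i. val (x P) i = (\<Sum>k<n. rval (c k P) * val (e k P) i)"
    then show "x = ?y"
      by (intro sections_eqI x y) (simp add: val)
  qed
qed

end

lemma stalk_finsum:
  assumes P: "P \<in> Spec R" and "\<And>k. k \<in> I \<Longrightarrow> f k \<in> carrier (stalk R M P)"
  shows "(\<Oplus>\<^bsub>stalk R M P\<^esub>k\<in>I. f k) \<in> carrier (stalk R M P)"
  using abelian_monoid.finsum_closed[OF abelian_group.axioms(1)[OF abelian_group_stalk[OF P]], of f I] assms(2)
  by blast

lemma stalk_expansion_iff:
  fixes n :: nat
  assumes P: "P \<in> Spec R" and x: "x \<in> carrier (stalk R M P)"
    and c: "\<forall>k<n. c k \<in> carrier (stalk_ring R P)" and e: "\<forall>k<n. e k \<in> carrier (stalk R M P)"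
  shows "x = (\<Oplus>\<^bsub>stalk R M P\<^esub>k\<in>{..<n}. c k \<odot>\<^bsub>stalk R M P\<^esub> e k) \<longleftrightarrow>
    (\<forall>i. val x i = (\<Sum>k<n. rval (c k) * val (e k) i))"
proof -
  let ?y = "\<Oplus>\<^bsub>stalk R M P\<^esub>k\<in>{..<n}. c k \<odot>\<^bsub>stalk R M P\<^esub> e k"
  have smult: "c k \<odot>\<^bsub>stalk R M P\<^esub> e k \<in> carrier (stalk R M P)"
      "val (c k \<odot>\<^bsub>stalk R M P\<^esub> e k) i = rval (c k) * val (e k) i" if "k < n" for k i
    using that c e by (intro stalk_smult_ops[OF P]; simp add: stalk_ring_simps)+
  have y: "?y \<in> carrier (stalk R M P)"
    by (rule stalk_finsum[OF P]) (simp add: smult(1))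
  have val: "val ?y i = (\<Sum>k<n. rval (c k) * val (e k) i)" for i
    using smult by (subst val_finsum[OF P]) simp_all
  show ?thesis
  proof
    assume "x = ?y"
    then show "\<forall>i. val x i = (\<Sum>k<n. rval (c k) * val (e k) i)"
      using val by simp
  next
    assume "\<forall>i. val x i = (\<Sum>k<n. rval (c k) * val (e k) i)"
    then show "x = ?y"
      by (intro val_inj[OF P x y]) (simp add: val)
  qed
qed

text \<open>
  An element of the stalk is a fraction which also represents a section near \<open>P\<close>, and there it has
  coordinates. For uniqueness, two coordinate vectors at \<open>P\<close> extend to a neighbourhood by the same fractions.
  The value of a fraction does not depend on the point, so a relation at \<open>P\<close> persists on the
  neighbourhood, where coordinates are unique.
\<close>

lemma stalk_basis:
  assumes V: "zariski_open R V" and P: "P \<in> V" and e: "\<And>i. i < n \<Longrightarrow> e i \<in> sections R M V"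
    and basis: "\<And>V'. V' \<in> opens_in R V \<Longrightarrow>
      is_basis (section_ring R V') (section_module R M V') n (\<lambda>i. restrict (e i) V')"
  shows "is_basis (stalk_ring R P) (stalk R M P) n (\<lambda>i. e i P)"
  unfolding is_basis_def
proof (intro conjI allI impI ballI)
  have PS: "P \<in> Spec R" using zariski_open_subset[OF V] P by blast
  show eP: "e i P \<in> carrier (stalk R M P)" if "i < n" for i
    by (rule sections_carrier[OF e[OF that] P])
  then have eP': "\<forall>k<n. e k P \<in> carrier (stalk R M P)" by blast
  fix x assume x: "x \<in> carrier (stalk R M P)"
  have ex: "\<exists>c. c \<in> {..<n} \<rightarrow>\<^sub>E carrier (stalk_ring R P) \<and> x = (\<Oplus>\<^bsub>stalk R M P\<^esub>i\<in>{..<n}. c i \<odot>\<^bsub>stalk R M P\<^esub> e i P)"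
  proof -
    obtain m t where m: "m \<in> carrier M" "t \<in> B - P" "x = quot M P m t"
      using x by (rule stalk_cases)
    define N where "N = V \<inter> {Q \<in> Spec R. t \<notin> Q}"
    have N: "zariski_open R N" "P \<in> N" "N \<subseteq> V"
      using zariski_open_Int[OF V zariski_open_basic[of t]] m P PS by (auto simp: N_def)
    then have NV: "N \<in> opens_in R V" by (simp add: opens_in_def)
    define X where "X = (\<lambda>Q\<in>N. quot M Q m t)"
    have X: "X \<in> sections R M N"
      unfolding X_def using m by (intro sections_fraction N) (auto simp: N_def)
    have eN: "\<forall>k<n. restrict (e k) N \<in> sections R M N"
      by (intro allI impI sections_restrict[OF e N(1,3)])
    obtain C where C: "C \<in> {..<n} \<rightarrow>\<^sub>E carrier (section_ring R N)"
      "X = (\<Oplus>\<^bsub>section_module R M N\<^esub>k\<in>{..<n}. C k \<odot>\<^bsub>section_module R M N\<^esub> restrict (e k) N)"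
      using basis[OF NV] X unfolding is_basis_def section_module_simps(1) by blast
    have Ck: "\<forall>k<n. C k \<in> sections R (regular_module R) N"
      using C(1) by (auto simp: section_ring_simps PiE_iff)
    have val: "val (X P) i = (\<Sum>k<n. rval (C k P) * val (restrict (e k) N P) i)" for i
      using C(2) section_expansion_iff[OF N(1) X Ck eN] N(2) by blast
    define c where "c = (\<lambda>k\<in>{..<n}. C k P)"
    have ck: "\<forall>k<n. c k \<in> carrier (stalk_ring R P)"
      using Ck by (auto simp: c_def stalk_ring_simps intro!: sections_carrier[OF _ N(2)])
    have "X P = x" using N(2) m by (simp add: X_def)
    then have "val x i = (\<Sum>k<n. rval (c k) * val (e k P) i)" for i
      using val[of i] N(2) by (simp add: c_def)
    then have "x = (\<Oplus>\<^bsub>stalk R M P\<^esub>k\<in>{..<n}. c k \<odot>\<^bsub>stalk R M P\<^esub> e k P)"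
      using stalk_expansion_iff[OF PS x ck eP'] by blast
    moreover have "c \<in> {..<n} \<rightarrow>\<^sub>E carrier (stalk_ring R P)"
      using ck by (auto simp: c_def)
    ultimately show ?thesis by blast
  qed
  moreover have "c = c'"
    if c: "c \<in> {..<n} \<rightarrow>\<^sub>E carrier (stalk_ring R P)" "x = (\<Oplus>\<^bsub>stalk R M P\<^esub>i\<in>{..<n}. c i \<odot>\<^bsub>stalk R M P\<^esub> e i P)"
      and c': "c' \<in> {..<n} \<rightarrow>\<^sub>E carrier (stalk_ring R P)" "x = (\<Oplus>\<^bsub>stalk R M P\<^esub>i\<in>{..<n}. c' i \<odot>\<^bsub>stalk R M P\<^esub> e i P)"
    for c c'
  proof -
    have ck: "\<forall>k<n. c k \<in> carrier (stalk_ring R P)" "\<forall>k<n. c' k \<in> carrier (stalk_ring R P)"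
      using c(1) c'(1) by auto
    have "val x i = (\<Sum>k<n. rval (c k) * val (e k P) i)" "val x i = (\<Sum>k<n. rval (c' k) * val (e k P) i)" for i
      using c(2) c'(2) stalk_expansion_iff[OF PS x ck(1) eP'] stalk_expansion_iff[OF PS x ck(2) eP'] by blast+
    then have eqP: "(\<Sum>k<n. rval (c k) * val (e k P) i) = (\<Sum>k<n. rval (c' k) * val (e k P) i)" for i
      by metis
    have "\<exists>b s b' s' N m t. b \<in> B \<and> s \<in> B - P \<and> c k = quot (regular_module R) P b s \<and>
        b' \<in> B \<and> s' \<in> B - P \<and> c' k = quot (regular_module R) P b' s' \<and>
        zariski_open R N \<and> P \<in> N \<and> m \<in> carrier M \<and> t \<in> B \<and> (\<forall>Q\<in>N. t \<notin> Q \<and> e k Q = quot M Q m t)"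
      if k: "k < n" for k
    proof -
      obtain b s where "b \<in> B" "s \<in> B - P" "c k = quot (regular_module R) P b s"
        using ck(1)[rule_format, OF k] unfolding stalk_ring_simps by (rule regular_stalk_cases)
      moreover obtain b' s' where "b' \<in> B" "s' \<in> B - P" "c' k = quot (regular_module R) P b' s'"
        using ck(2)[rule_format, OF k] unfolding stalk_ring_simps by (rule regular_stalk_cases)
      moreover obtain N m t where "zariski_open R N" "P \<in> N" "N \<subseteq> V" "m \<in> carrier M" "t \<in> B"
          "\<And>Q. Q \<in> N \<Longrightarrow> t \<notin> Q \<and> e k Q = quot M Q m t"
        by (rule sections_local[OF e[OF k] P], rule that; assumption)
      ultimately show ?thesis by blast
    qed
    then obtain b s b' s' N m t where bs: "\<And>k. k < n \<Longrightarrow> b k \<in> B \<and> s k \<in> B - P \<and> c k = quot (regular_module R) P (b k) (s k)"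
      and bs': "\<And>k. k < n \<Longrightarrow> b' k \<in> B \<and> s' k \<in> B - P \<and> c' k = quot (regular_module R) P (b' k) (s' k)"
      and N: "\<And>k. k < n \<Longrightarrow> zariski_open R (N k) \<and> P \<in> N k"
      and mt: "\<And>k. k < n \<Longrightarrow> m k \<in> carrier M \<and> t k \<in> B \<and> (\<forall>Q\<in>N k. t k \<notin> Q \<and> e k Q = quot M Q (m k) (t k))"
      by metis
    define N1 where "N1 k = N k \<inter> ({Q \<in> Spec R. s k \<notin> Q} \<inter> {Q \<in> Spec R. s' k \<notin> Q})" for k
    have "\<forall>k\<in>{..<n}. zariski_open R (N1 k) \<and> P \<in> N1 k"
    proof
      fix k assume "k \<in> {..<n}"
      then have "k < n" by simp
      from bs[OF this] bs'[OF this] N[OF this] show "zariski_open R (N1 k) \<and> P \<in> N1 k"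
        unfolding N1_def using PS by (auto intro!: zariski_open_Int zariski_open_basic)
    qed
    from zariski_open_finite_Int[OF V P finite_lessThan this] obtain U where
      U: "zariski_open R U" "P \<in> U" "U \<subseteq> V" "\<forall>k\<in>{..<n}. U \<subseteq> N1 k"
      by blast
    have US: "Q \<in> Spec R" if "Q \<in> U" for Q
      using zariski_open_subset[OF U(1)] that by blast
    have UV: "U \<in> opens_in R V" using U by (simp add: opens_in_def)
    have eU: "\<forall>k<n. restrict (e k) U \<in> sections R M U"
      by (intro allI impI sections_restrict[OF e U(1,3)])
    define C where "C = (\<lambda>k\<in>{..<n}. \<lambda>Q\<in>U. quot (regular_module R) Q (b k) (s k))"
    define C' where "C' = (\<lambda>k\<in>{..<n}. \<lambda>Q\<in>U. quot (regular_module R) Q (b' k) (s' k))"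
    have notin: "s k \<notin> Q" "s' k \<notin> Q" "Q \<in> N k" if "k < n" "Q \<in> U" for k Q
      using U(4) that by (auto simp: N1_def)
    have C: "C k \<in> sections R (regular_module R) U" "C' k \<in> sections R (regular_module R) U" if k: "k < n" for k
      using bs[OF k] bs'[OF k] notin[OF k] k unfolding C_def C'_def
      by (auto intro!: sections_fraction U(1))
    then have C': "\<forall>k<n. C k \<in> sections R (regular_module R) U" "\<forall>k<n. C' k \<in> sections R (regular_module R) U"
      by blast+
    have Cval: "rval (C k Q) = Fract (b k) (s k)" "rval (C' k Q) = Fract (b' k) (s' k)"
      "val (restrict (e k) U Q) i = Fract (emb (m k) i) (t k)" if k: "k < n" and Q: "Q \<in> U" for k Q i
    proof -
      have "b k \<in> B" "s k \<in> B - Q" "b' k \<in> B" "s' k \<in> B - Q" "m k \<in> carrier M" "t k \<in> B - Q"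
        using bs[OF k] bs'[OF k] notin[OF k Q] mt[OF k] by auto
      then show "rval (C k Q) = Fract (b k) (s k)" "rval (C' k Q) = Fract (b' k) (s' k)"
        "val (restrict (e k) U Q) i = Fract (emb (m k) i) (t k)"
        using k Q mt[OF k] notin(3)[OF k Q]
        by (simp_all add: C_def C'_def rval_frac[OF US[OF Q]] frac_val_frac[OF US[OF Q]])
    qed
    have CP: "C k P = c k" "C' k P = c' k" "restrict (e k) U P = e k P" if k: "k < n" for k
      using bs[OF k] bs'[OF k] k U(2) by (simp_all add: C_def C'_def)
    define Y where "Y = (\<Oplus>\<^bsub>section_module R M U\<^esub>k\<in>{..<n}. C k \<odot>\<^bsub>section_module R M U\<^esub> restrict (e k) U)"
    have Y: "Y \<in> sections R M U"
      unfolding Y_def using C(1) eU by (intro sections_finsum[OF U(1)] sections_smult[OF U(1)]) auto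
    have "val (Y Q) i = (\<Sum>k<n. rval (C k Q) * val (restrict (e k) U Q) i)" if "Q \<in> U" for Q i
      using section_expansion_iff[OF U(1) Y C'(1) eU] that unfolding Y_def by blast
    moreover have "(\<Sum>k<n. rval (C k Q) * val (restrict (e k) U Q) i) = (\<Sum>k<n. rval (C' k Q) * val (restrict (e k) U Q) i)"
      if Q: "Q \<in> U" for Q i
    proof -
      have "(\<Sum>k<n. rval (C k Q) * val (restrict (e k) U Q) i) = (\<Sum>k<n. rval (c k) * val (e k P) i)"
      proof (intro sum.cong refl)
        fix k assume "k \<in> {..<n}"
        then have k: "k < n" by simp
        have "rval (C k Q) = rval (c k)" "val (restrict (e k) U Q) i = val (e k P) i"
          using Cval(1)[OF k Q] Cval(1)[OF k U(2)] Cval(3)[OF k Q, of i] Cval(3)[OF k U(2), of i]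
          unfolding CP(1)[OF k] CP(3)[OF k] by (simp_all only:)
        then show "rval (C k Q) * val (restrict (e k) U Q) i = rval (c k) * val (e k P) i"
          by (simp only:)
      qed
      also have "\<dots> = (\<Sum>k<n. rval (c' k) * val (e k P) i)"
        by (rule eqP)
      also have "\<dots> = (\<Sum>k<n. rval (C' k Q) * val (restrict (e k) U Q) i)"
      proof (intro sum.cong refl)
        fix k assume "k \<in> {..<n}"
        then have k: "k < n" by simp
        have "rval (C' k Q) = rval (c' k)" "val (restrict (e k) U Q) i = val (e k P) i"
          using Cval(2)[OF k Q] Cval(2)[OF k U(2)] Cval(3)[OF k Q, of i] Cval(3)[OF k U(2), of i]
          unfolding CP(2)[OF k] CP(3)[OF k] by (simp_all only:)
        then show "rval (c' k) * val (e k P) i = rval (C' k Q) * val (restrict (e k) U Q) i"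
          by (simp only:)
      qed
      finally show ?thesis .
    qed
    ultimately have "Y = (\<Oplus>\<^bsub>section_module R M U\<^esub>k\<in>{..<n}. C' k \<odot>\<^bsub>section_module R M U\<^esub> restrict (e k) U)"
      using section_expansion_iff[OF U(1) Y C'(2) eU] by simp
    moreover have "C \<in> {..<n} \<rightarrow>\<^sub>E carrier (section_ring R U)" "C' \<in> {..<n} \<rightarrow>\<^sub>E carrier (section_ring R U)"
      using C by (auto simp: section_ring_simps C_def C'_def)
    moreover have "\<exists>!c. c \<in> {..<n} \<rightarrow>\<^sub>E carrier (section_ring R U) \<and>
        Y = (\<Oplus>\<^bsub>section_module R M U\<^esub>k\<in>{..<n}. c k \<odot>\<^bsub>section_module R M U\<^esub> restrict (e k) U)"
      using basis[OF UV] Y unfolding is_basis_def section_module_simps(1) by blast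
    ultimately have "C = C'"
      using Y_def by blast
    then have "c k = c' k" if "k \<in> {..<n}" for k
      using CP[of k] that by simp
    then show "c = c'"
      using c(1) c'(1) by (intro PiE_ext) auto
  qed
  ultimately show "\<exists>!c. c \<in> {..<n} \<rightarrow>\<^sub>E carrier (stalk_ring R P) \<and>
      x = (\<Oplus>\<^bsub>stalk R M P\<^esub>i\<in>{..<n}. c i \<odot>\<^bsub>stalk R M P\<^esub> e i P)"
    by blast
qed

end

context domain_subring
begin

lemma locally_free_stalk_basis:
  assumes M: "torsion_free_module B M emb" and P: "P \<in> locally_free_locus R M"
  shows "\<exists>n e. is_basis (stalk_ring R P) (stalk R M P) n e"
proof -
  obtain V n e where "zariski_open R V" "P \<in> V" "\<forall>i<n. e i \<in> sections R M V"
    "\<forall>V'\<in>opens_in R V. is_basis (section_ring R V') (section_module R M V') n (\<lambda>i. restrict (e i) V')"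
    using P unfolding locally_free_locus_def by blast
  then show ?thesis
    using torsion_free_module.stalk_basis[OF M, of V P n e] by blast
qed

section \<open>The ring of sections\<close>

context
  fixes V assumes V: "zariski_open R V"
begin

private lemma V_Spec: "P \<in> V \<Longrightarrow> P \<in> Spec R"
  using zariski_open_subset[OF V] by blast

private lemma section_stalk: "f \<in> sections R (regular_module R) V \<Longrightarrow> P \<in> V \<Longrightarrow> f P \<in> carrier (stalk_ring R P)"
  unfolding stalk_ring_simps by (rule sections_carrier)

lemma section_ring_closed:
  "\<zero>\<^bsub>section_ring R V\<^esub> \<in> sections R (regular_module R) V"
  "\<one>\<^bsub>section_ring R V\<^esub> \<in> sections R (regular_module R) V"
  "f \<in> sections R (regular_module R) V \<Longrightarrow> g \<in> sections R (regular_module R) V \<Longrightarrow>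
    f \<oplus>\<^bsub>section_ring R V\<^esub> g \<in> sections R (regular_module R) V"
  "f \<in> sections R (regular_module R) V \<Longrightarrow> g \<in> sections R (regular_module R) V \<Longrightarrow>
    f \<otimes>\<^bsub>section_ring R V\<^esub> g \<in> sections R (regular_module R) V"
proof -
  note reg = regular_torsion_free
  show "\<zero>\<^bsub>section_ring R V\<^esub> \<in> sections R (regular_module R) V"
    using torsion_free_module.sections_zero[OF reg V]
    by (simp add: section_ring_simps section_module_simps stalk_ring_simps)
  show "\<one>\<^bsub>section_ring R V\<^esub> \<in> sections R (regular_module R) V"
    unfolding section_ring_simps stalk_ring_simps
    using Spec_D(3)[OF V_Spec] by (intro sections_fraction V) (auto simp: B_closed)
  assume f: "f \<in> sections R (regular_module R) V" and g: "g \<in> sections R (regular_module R) V"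
  show "f \<oplus>\<^bsub>section_ring R V\<^esub> g \<in> sections R (regular_module R) V"
    using torsion_free_module.sections_add[OF reg V f g]
    by (simp add: section_ring_simps section_module_simps stalk_ring_simps)
  show "f \<otimes>\<^bsub>section_ring R V\<^esub> g \<in> sections R (regular_module R) V"
    using torsion_free_module.sections_smult[OF reg V f g]
    by (simp add: section_ring_simps section_module_simps stalk_ring_simps)
qed

lemma section_ring_value:
  assumes P: "P \<in> V"
  shows "rval (\<zero>\<^bsub>section_ring R V\<^esub> P) = 0" "rval (\<one>\<^bsub>section_ring R V\<^esub> P) = 1"
    "f \<in> sections R (regular_module R) V \<Longrightarrow> g \<in> sections R (regular_module R) V \<Longrightarrow>
      rval ((f \<oplus>\<^bsub>section_ring R V\<^esub> g) P) = rval (f P) + rval (g P)"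
    "f \<in> sections R (regular_module R) V \<Longrightarrow> g \<in> sections R (regular_module R) V \<Longrightarrow>
      rval ((f \<otimes>\<^bsub>section_ring R V\<^esub> g) P) = rval (f P) * rval (g P)"
  using stalk_ring_zero_one[OF V_Spec[OF P]] stalk_ring_add_mult[OF V_Spec[OF P]]
  by (simp_all add: section_ring_simps P section_stalk)

lemma section_ring_eqI:
  assumes f: "f \<in> sections R (regular_module R) V" and g: "g \<in> sections R (regular_module R) V"
    and eq: "\<And>P. P \<in> V \<Longrightarrow> rval (f P) = rval (g P)"
  shows "f = g"
proof (rule extensionalityI[OF sections_extensional[OF f] sections_extensional[OF g]])
  fix P assume P: "P \<in> V"
  show "f P = g P"
    by (rule stalk_ring_inj[OF V_Spec[OF P] section_stalk[OF f P] section_stalk[OF g P] eq[OF P]])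
qed

lemma cring_section_ring: "cring (section_ring R V)"
proof (rule cring_of_values[where v = "\<lambda>f P. if P \<in> V then rval (f P) else 0"], unfold section_ring_simps(1))
  fix f assume "f \<in> sections R (regular_module R) V"
  from torsion_free_module.sections_neg[OF regular_torsion_free V this]
  show "\<exists>g\<in>sections R (regular_module R) V. \<forall>P. (if P \<in> V then rval (g P) else 0) = - (if P \<in> V then rval (f P) else 0)"
    by (auto simp: rval_def)
next
  fix f g assume fg: "f \<in> sections R (regular_module R) V" "g \<in> sections R (regular_module R) V"
    and eq: "\<And>P. (if P \<in> V then rval (f P) else 0) = (if P \<in> V then rval (g P) else 0)"
  show "f = g"
  proof (rule section_ring_eqI[OF fg])
    show "rval (f P) = rval (g P)" if "P \<in> V" for P
      using eq[of P] that by simp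
  qed
qed (simp_all add: section_ring_closed section_ring_value)

lemma section_ring_finsum_value:
  assumes P: "P \<in> V" and I: "finite I" and f: "\<And>k. k \<in> I \<Longrightarrow> f k \<in> sections R (regular_module R) V"
  shows "rval ((\<Oplus>\<^bsub>section_ring R V\<^esub>k\<in>I. f k) P) = (\<Sum>k\<in>I. rval (f k P))"
proof -
  have "abelian_monoid (section_ring R V)"
    using cring_section_ring by (simp add: cring_def ring_def abelian_group_def)
  then show ?thesis
    by (rule value_finsum[where v = "\<lambda>f. rval (f P)"])
      (simp_all add: section_ring_simps(1) section_ring_value[OF P] I f)
qed

lemma section_ring_finsum_closed:
  assumes "\<And>k. k \<in> I \<Longrightarrow> f k \<in> sections R (regular_module R) V"
  shows "(\<Oplus>\<^bsub>section_ring R V\<^esub>k\<in>I. f k) \<in> sections R (regular_module R) V"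
proof -
  have "abelian_monoid (section_ring R V)"
    using cring_section_ring by (simp add: cring_def ring_def abelian_group_def)
  from abelian_monoid.finsum_closed[OF this, of f I] show ?thesis
    unfolding section_ring_simps(1) using assms by blast
qed

lemma section_ring_sign:
  "(\<ominus>\<^bsub>section_ring R V\<^esub> \<one>\<^bsub>section_ring R V\<^esub>) [^]\<^bsub>section_ring R V\<^esub> (k :: nat) \<in> sections R (regular_module R) V"
  "P \<in> V \<Longrightarrow> rval (((\<ominus>\<^bsub>section_ring R V\<^esub> \<one>\<^bsub>section_ring R V\<^esub>) [^]\<^bsub>section_ring R V\<^esub> (k :: nat)) P) = (- 1) ^ k"
proof -
  interpret A: cring "section_ring R V" by (rule cring_section_ring)
  have neg: "\<ominus>\<^bsub>section_ring R V\<^esub> \<one>\<^bsub>section_ring R V\<^esub> \<in> sections R (regular_module R) V"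
    using A.a_inv_closed[OF A.one_closed] by (simp only: section_ring_simps(1))
  have closed: "(\<ominus>\<^bsub>section_ring R V\<^esub> \<one>\<^bsub>section_ring R V\<^esub>) [^]\<^bsub>section_ring R V\<^esub> k \<in> sections R (regular_module R) V" for k :: nat
    using A.nat_pow_closed[OF A.a_inv_closed[OF A.one_closed], of k] by (simp only: section_ring_simps(1))
  then show "(\<ominus>\<^bsub>section_ring R V\<^esub> \<one>\<^bsub>section_ring R V\<^esub>) [^]\<^bsub>section_ring R V\<^esub> k \<in> sections R (regular_module R) V" .
  assume P: "P \<in> V"
  have "rval ((\<ominus>\<^bsub>section_ring R V\<^esub> \<one>\<^bsub>section_ring R V\<^esub>) P) = - rval (\<one>\<^bsub>section_ring R V\<^esub> P)"
    by (rule value_uminus[OF A.abelian_group_axioms, where v = "\<lambda>f. rval (f P)"])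
      (simp_all add: section_ring_simps(1) section_ring_value[OF P] section_ring_closed)
  then have neg_val: "rval ((\<ominus>\<^bsub>section_ring R V\<^esub> \<one>\<^bsub>section_ring R V\<^esub>) P) = - 1"
    by (simp add: section_ring_value[OF P])
  show "rval (((\<ominus>\<^bsub>section_ring R V\<^esub> \<one>\<^bsub>section_ring R V\<^esub>) [^]\<^bsub>section_ring R V\<^esub> k) P) = (- 1) ^ k"
  proof (induction k)
    case 0
    then show ?case by (simp add: section_ring_value[OF P])
  next
    case (Suc k)
    then show ?case
      by (simp add: section_ring_value(4)[OF P closed neg] neg_val)
  qed
qed

end

section \<open>Derivations on stalks\<close>

lemma derivations_iff:
  "\<delta> \<in> derivations F R \<longleftrightarrow> \<delta> \<in> B \<rightarrow>\<^sub>E B \<and> (\<forall>a\<in>B. \<forall>b\<in>B. \<delta> (a + b) = \<delta> a + \<delta> b) \<and>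
    (\<forall>c\<in>F. \<forall>a\<in>B. \<delta> (c * a) = c * \<delta> a) \<and> (\<forall>a\<in>B. \<forall>b\<in>B. \<delta> (a * b) = a * \<delta> b + \<delta> a * b)"
  by (simp add: derivations_def)

lemma derivations_D:
  assumes "\<delta> \<in> derivations F R"
  shows "a \<in> B \<Longrightarrow> \<delta> a \<in> B" "a \<in> B \<Longrightarrow> b \<in> B \<Longrightarrow> \<delta> (a + b) = \<delta> a + \<delta> b"
    "c \<in> F \<Longrightarrow> a \<in> B \<Longrightarrow> \<delta> (c * a) = c * \<delta> a"
    "a \<in> B \<Longrightarrow> b \<in> B \<Longrightarrow> \<delta> (a * b) = a * \<delta> b + \<delta> a * b"
  using assms by (auto simp: derivations_iff)

text \<open>
  The quotient rule does not depend on the representatives, as one sees by applying \<open>\<delta>\<close> to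
  \<open>b t' = b' t\<close>.
\<close>

lemma action_cong:
  assumes \<delta>: "\<delta> \<in> derivations F R" and \<delta>': "\<delta>' \<in> derivations F R"
    and B: "b \<in> B" "t \<in> B" "b' \<in> B" "t' \<in> B" and nz: "s \<noteq> 0" "s' \<noteq> 0" "t \<noteq> 0" "t' \<noteq> 0"
    and eq: "\<And>x. x \<in> B \<Longrightarrow> Fract (\<delta> x) s = Fract (\<delta>' x) s'" and bt: "Fract b t = Fract b' t'"
  shows "Fract (t * \<delta> b - b * \<delta> t) (s * (t * t)) = Fract (t' * \<delta>' b' - b' * \<delta>' t') (s' * (t' * t'))"
proof -
  have bt: "b * t' = b' * t" using bt nz by (simp add: eq_fract)
  have e: "\<delta> x * s' = \<delta>' x * s" if "x \<in> B" for x
    using eq[OF that] nz by (simp add: eq_fract)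
  have d: "b * \<delta> t' + \<delta> b * t' = b' * \<delta> t + \<delta> b' * t"
    using arg_cong[OF bt, of \<delta>] B by (simp add: derivations_D[OF \<delta>])
  have d': "\<delta> b * t' = b' * \<delta> t + \<delta> b' * t - b * \<delta> t'"
    using d by (simp add: eq_diff_eq add.commute)
  have "(t * \<delta> b - b * \<delta> t) * (t' * t') = t * t' * (\<delta> b * t') - (b * t') * t' * \<delta> t"
    by (simp add: algebra_simps)
  also have "\<dots> = t * t * t' * \<delta> b' - t * (b * t') * \<delta> t'"
    unfolding d' unfolding bt by (simp add: algebra_simps bt)
  also have "\<dots> = (t' * \<delta> b' - b' * \<delta> t') * (t * t)"
    unfolding bt by (simp add: algebra_simps)
  finally have *: "(t * \<delta> b - b * \<delta> t) * (t' * t') = (t' * \<delta> b' - b' * \<delta> t') * (t * t)" .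
  have "(t * \<delta> b - b * \<delta> t) * (s' * (t' * t')) = s' * ((t * \<delta> b - b * \<delta> t) * (t' * t'))"
    by (simp only: mult_ac)
  also have "\<dots> = (t' * (\<delta> b' * s') - b' * (\<delta> t' * s')) * (t * t)"
    unfolding * by (simp add: algebra_simps)
  also have "\<dots> = (t' * \<delta>' b' - b' * \<delta>' t') * (s * (t * t))"
    unfolding e[OF B(3)] e[OF B(4)] by (simp add: algebra_simps)
  finally show ?thesis using nz by (simp add: eq_fract)
qed

end

locale ring_with_constants = domain_subring B for B :: "'a::idom set" +
  fixes F :: "'a set"
  assumes F: "F \<subseteq> B"
begin

abbreviation D :: "('a, 'a \<Rightarrow> 'a) module" where
  "D \<equiv> derivation_module F R"

lemma D_simps:
  "carrier D = derivations F R" "\<zero>\<^bsub>D\<^esub> = (\<lambda>b\<in>B. 0)"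
  "\<delta> \<oplus>\<^bsub>D\<^esub> \<eta> = (\<lambda>b\<in>B. \<delta> b + \<eta> b)" "a \<odot>\<^bsub>D\<^esub> \<delta> = (\<lambda>b\<in>B. a * \<delta> b)"
  by (simp_all add: derivation_module_def)

text \<open>
  The values of a derivation serve as its coordinates. They are cut off outside \<open>B\<close>, where an extensional
  function is \<open>undefined\<close> and addition would fail to be respected.
\<close>

definition der_emb :: "('a \<Rightarrow> 'a) \<Rightarrow> 'a \<Rightarrow> 'a" where
  "der_emb \<delta> b = (if b \<in> B then \<delta> b else 0)"

lemma derivation_torsion_free: "torsion_free_module B D der_emb"
proof unfold_locales
  show "x = y" if "x \<in> carrier D" "y \<in> carrier D" "\<And>i. der_emb x i = der_emb y i" for x y
  proof (rule extensionalityI[of _ B])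
    show "x \<in> extensional B" "y \<in> extensional B"
      using that(1,2) by (auto simp: D_simps derivations_iff PiE_iff)
    show "x b = y b" if "b \<in> B" for b
      using \<open>der_emb x b = der_emb y b\<close> that by (simp add: der_emb_def)
  qed
qed (use F in \<open>auto simp: D_simps derivations_iff der_emb_def B_closed algebra_simps subset_iff PiE_iff\<close>)

lemma lie_bracket_value:
  assumes "\<delta> \<in> derivations F R" "\<eta> \<in> derivations F R" "b \<in> B"
  shows "lie_bracket R \<delta> \<eta> b = \<delta> (\<eta> b) - \<eta> (\<delta> b)"
  using assms by (simp add: lie_bracket_def R_minus derivations_D[OF assms(1)] derivations_D[OF assms(2)])

lemma lie_bracket_derivation:
  assumes \<delta>: "\<delta> \<in> derivations F R" and \<eta>: "\<eta> \<in> derivations F R"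
  shows "lie_bracket R \<delta> \<eta> \<in> derivations F R"
proof -
  have c: "c \<in> B" if "c \<in> F" for c using F that by blast
  note [simp] = derivations_D(1)[OF \<delta>] derivations_D(1)[OF \<eta>] lie_bracket_value[OF \<delta> \<eta>]
  have diff: "x - y \<in> B" if "x \<in> B" "y \<in> B" for x y
    using B_closed(3)[of x "- y"] B_closed(5) that by simp
  have "lie_bracket R \<delta> \<eta> b \<in> B" if "b \<in> B" for b
    using that by (simp add: diff)
  then have "lie_bracket R \<delta> \<eta> \<in> B \<rightarrow>\<^sub>E B"
    by (auto simp: lie_bracket_def)
  moreover have "lie_bracket R \<delta> \<eta> (a + b) = lie_bracket R \<delta> \<eta> a + lie_bracket R \<delta> \<eta> b" if "a \<in> B" "b \<in> B" for a b
    using that by (simp add: B_closed derivations_D(2)[OF \<delta>] derivations_D(2)[OF \<eta>])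
  moreover have "lie_bracket R \<delta> \<eta> (k * a) = k * lie_bracket R \<delta> \<eta> a" if "k \<in> F" "a \<in> B" for k a
    using that by (simp add: c B_closed derivations_D(3)[OF \<delta>] derivations_D(3)[OF \<eta>] right_diff_distrib)
  moreover have "lie_bracket R \<delta> \<eta> (a * b) = a * lie_bracket R \<delta> \<eta> b + lie_bracket R \<delta> \<eta> a * b" if "a \<in> B" "b \<in> B" for a b
    using that by (simp add: B_closed derivations_D(2,4)[OF \<delta>] derivations_D(2,4)[OF \<eta>] algebra_simps)
  ultimately show ?thesis
    unfolding derivations_iff by blast
qed

lemma stalk_action_frac:
  assumes P: "P \<in> Spec R" and \<delta>: "\<delta> \<in> derivations F R" "s \<in> B - P" and b: "b \<in> B" "t \<in> B - P"
  shows "stalk_action R P (quot D P \<delta> s) (quot (regular_module R) P b t) =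
      quot (regular_module R) P (t * \<delta> b - b * \<delta> t) (s * (t * t))"
    "t * \<delta> b - b * \<delta> t \<in> B" "s * (t * t) \<in> B - P"
proof -
  have minus: "t * \<delta> b \<ominus>\<^bsub>R\<^esub> b * \<delta> t = t * \<delta> b - b * \<delta> t"
    if "\<delta> \<in> derivations F R" "b \<in> B" "t \<in> B" for \<delta> b t
    using that by (simp add: R_minus B_closed derivations_D)
  have closed: "t * \<delta> b \<ominus>\<^bsub>R\<^esub> b * \<delta> t \<in> carrier (regular_module R) \<and> s * (t * t) \<in> B - P"
    if "\<delta> \<in> carrier D" "s \<in> B - P" "b \<in> carrier (regular_module R)" "t \<in> B - P" for \<delta> s b t
  proof -
    have \<delta>: "\<delta> \<in> derivations F R" using that(1) by (simp add: D_simps)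
    have "t * \<delta> b \<in> B" "- (b * \<delta> t) \<in> B"
      using that(2-4) by (auto intro!: B_closed derivations_D(1)[OF \<delta>])
    from B_closed(3)[OF this] show ?thesis
      using Spec_D(4)[OF P] that(2-4) by (simp add: minus[OF \<delta>])
  qed
  have mem: "\<delta> \<in> carrier D" "b \<in> carrier (regular_module R)"
    using \<delta> b by (simp_all add: D_simps)
  have "(\<Union>(\<delta>, s)\<in>quot D P \<delta> s. \<Union>(b, t)\<in>quot (regular_module R) P b t.
        quot (regular_module R) P (t * \<delta> b \<ominus>\<^bsub>R\<^esub> b * \<delta> t) (s * (t * t))) =
      quot (regular_module R) P (t * \<delta> b \<ominus>\<^bsub>R\<^esub> b * \<delta> t) (s * (t * t))"
  proof (rule UN_frac_frac[OF derivation_torsion_free regular_torsion_free regular_torsion_free P closed _ mem(1) \<delta>(2) mem(2) b(2)])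
    fix \<delta> s b t \<delta>' s' b' t' and i :: unit
    assume *: "\<delta> \<in> carrier D" "s \<in> B - P" "b \<in> carrier (regular_module R)" "t \<in> B - P"
      "\<delta>' \<in> carrier D" "s' \<in> B - P" "b' \<in> carrier (regular_module R)" "t' \<in> B - P"
      and eq: "\<And>i. Fract (der_emb \<delta> i) s = Fract (der_emb \<delta>' i) s'" "\<And>i :: unit. Fract b t = Fract b' t'"
    have "Fract (\<delta> x) s = Fract (\<delta>' x) s'" if "x \<in> B" for x
      using eq(1)[of x] that by (simp add: der_emb_def)
    then have "Fract (t * \<delta> b - b * \<delta> t) (s * (t * t)) = Fract (t' * \<delta>' b' - b' * \<delta>' t') (s' * (t' * t'))"
      using * eq(2) Spec_D(5)[OF P] by (intro action_cong[where F = F]) (auto simp: D_simps)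
    then show "Fract (t * \<delta> b \<ominus>\<^bsub>R\<^esub> b * \<delta> t) (s * (t * t)) = Fract (t' * \<delta>' b' \<ominus>\<^bsub>R\<^esub> b' * \<delta>' t') (s' * (t' * t'))"
      using * by (simp add: minus D_simps)
  qed
  then show "stalk_action R P (quot D P \<delta> s) (quot (regular_module R) P b t) =
      quot (regular_module R) P (t * \<delta> b - b * \<delta> t) (s * (t * t))"
    unfolding stalk_action_def using \<delta> b by (simp add: minus)
  show "t * \<delta> b - b * \<delta> t \<in> B" "s * (t * t) \<in> B - P"
    using closed[OF mem(1) \<delta>(2) mem(2) b(2)] \<delta> b by (simp_all add: minus)
qed

lemma stalk_action_value:
  assumes P: "P \<in> Spec R" and \<delta>: "\<delta> \<in> derivations F R" "s \<in> B - P" and b: "b \<in> B" "t \<in> B - P"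
  shows "rval (stalk_action R P (quot D P \<delta> s) (quot (regular_module R) P b t)) =
    Fract (t * \<delta> b - b * \<delta> t) (s * (t * t))"
  unfolding stalk_action_frac(1)[OF assms] by (rule rval_frac[OF P stalk_action_frac(2,3)[OF assms]])

lemma stalk_action_add:
  assumes P: "P \<in> Spec R" and x: "x \<in> carrier (stalk R D P)"
    and a: "a \<in> carrier (stalk_ring R P)" and a': "a' \<in> carrier (stalk_ring R P)"
  shows "rval (stalk_action R P x (a \<oplus>\<^bsub>stalk_ring R P\<^esub> a')) =
    rval (stalk_action R P x a) + rval (stalk_action R P x a')"
proof -
  obtain \<delta> s where \<delta>: "\<delta> \<in> carrier D" "s \<in> B - P" "x = quot D P \<delta> s"
    using x by (rule stalk_cases)
  have d: "\<delta> \<in> derivations F R" using \<delta>(1) by (simp only: D_simps)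
  obtain b t where b: "b \<in> B" "t \<in> B - P" "a = quot (regular_module R) P b t"
    using a unfolding stalk_ring_simps by (rule regular_stalk_cases)
  obtain b' t' where b': "b' \<in> B" "t' \<in> B - P" "a' = quot (regular_module R) P b' t'"
    using a' unfolding stalk_ring_simps by (rule regular_stalk_cases)
  have t: "t \<in> B" "t' \<in> B" using b b' by auto
  have mem: "b \<in> carrier (regular_module R)" "b' \<in> carrier (regular_module R)" using b b' by simp_all
  have sum: "t' * b + t * b' \<in> B" "t * t' \<in> B - P"
    using b b' t Spec_D(4)[OF P] by (simp_all add: B_closed)
  have "a \<oplus>\<^bsub>stalk_ring R P\<^esub> a' = quot (regular_module R) P (t' * b + t * b') (t * t')"
    unfolding b(3) b'(3) stalk_ring_simps
    using torsion_free_module.stalk_add_frac(1)[OF regular_torsion_free P mem(1) b(2) mem(2) b'(2)]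
    by (simp add: regular_module_def)
  then have "rval (stalk_action R P x (a \<oplus>\<^bsub>stalk_ring R P\<^esub> a')) =
      Fract (t * t' * \<delta> (t' * b + t * b') - (t' * b + t * b') * \<delta> (t * t')) (s * (t * t' * (t * t')))"
    unfolding \<delta>(3) using stalk_action_value[OF P d \<delta>(2) sum] by (simp only:)
  also have "\<dots> = Fract (t * \<delta> b - b * \<delta> t) (s * (t * t)) + Fract (t' * \<delta> b' - b' * \<delta> t') (s * (t' * t'))"
    using Spec_D(5)[OF P \<delta>(2)] Spec_D(5)[OF P b(2)] Spec_D(5)[OF P b'(2)] b(1) b'(1) t
    by (simp add: eq_fract derivations_D[OF d] B_closed) (simp add: algebra_simps)
  also have "\<dots> = rval (stalk_action R P x a) + rval (stalk_action R P x a')"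
    unfolding \<delta>(3) b(3) b'(3)
    by (simp only: stalk_action_value[OF P d \<delta>(2) b(1,2)] stalk_action_value[OF P d \<delta>(2) b'(1,2)])
  finally show ?thesis .
qed

section \<open>The bracket on stalks\<close>

definition bracket_num :: "('a \<Rightarrow> 'a) \<Rightarrow> 'a \<Rightarrow> ('a \<Rightarrow> 'a) \<Rightarrow> 'a \<Rightarrow> 'a \<Rightarrow> 'a" where
  "bracket_num \<delta> s \<eta> t =
     ((s \<otimes>\<^bsub>R\<^esub> t) \<odot>\<^bsub>D\<^esub> lie_bracket R \<delta> \<eta> \<ominus>\<^bsub>D\<^esub> (s \<otimes>\<^bsub>R\<^esub> \<delta> t) \<odot>\<^bsub>D\<^esub> \<eta>) \<oplus>\<^bsub>D\<^esub> (t \<otimes>\<^bsub>R\<^esub> \<eta> s) \<odot>\<^bsub>D\<^esub> \<delta>"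

lemma bracket_num:
  assumes \<delta>: "\<delta> \<in> derivations F R" and \<eta>: "\<eta> \<in> derivations F R" and st: "s \<in> B" "t \<in> B"
  shows "bracket_num \<delta> s \<eta> t \<in> derivations F R"
    "b \<in> B \<Longrightarrow> bracket_num \<delta> s \<eta> t b = s * t * (\<delta> (\<eta> b) - \<eta> (\<delta> b)) - s * \<delta> t * \<eta> b + t * \<eta> s * \<delta> b"
proof -
  interpret D: torsion_free_module B D der_emb by (rule derivation_torsion_free)
  have mem: "\<delta> \<in> carrier D" "\<eta> \<in> carrier D" "lie_bracket R \<delta> \<eta> \<in> carrier D"
    using \<delta> \<eta> lie_bracket_derivation[OF \<delta> \<eta>] by (simp_all add: D_simps)
  have B: "s * t \<in> B" "s * \<delta> t \<in> B" "t * \<eta> s \<in> B"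
    using st by (simp_all add: B_closed derivations_D(1)[OF \<delta>] derivations_D(1)[OF \<eta>])
  let ?x = "(s * t) \<odot>\<^bsub>D\<^esub> lie_bracket R \<delta> \<eta>" and ?y = "(s * \<delta> t) \<odot>\<^bsub>D\<^esub> \<eta>" and ?z = "(t * \<eta> s) \<odot>\<^bsub>D\<^esub> \<delta>"
  have xyz: "?x \<in> carrier D" "?y \<in> carrier D" "?z \<in> carrier D"
    using mem B by (simp_all add: D.M_closed)
  have xy: "?x \<ominus>\<^bsub>D\<^esub> ?y \<in> carrier D"
    using xyz(1,2) by (rule D.M_minus_closed)
  have eq: "bracket_num \<delta> s \<eta> t = (?x \<ominus>\<^bsub>D\<^esub> ?y) \<oplus>\<^bsub>D\<^esub> ?z"
    by (simp add: bracket_num_def)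
  have "(?x \<ominus>\<^bsub>D\<^esub> ?y) \<oplus>\<^bsub>D\<^esub> ?z \<in> carrier D"
    using xy xyz(3) by (rule D.M_closed)
  then show "bracket_num \<delta> s \<eta> t \<in> derivations F R"
    unfolding eq D_simps(1) .
  assume b: "b \<in> B"
  have "der_emb (bracket_num \<delta> s \<eta> t) b = der_emb ?x b - der_emb ?y b + der_emb ?z b"
    unfolding eq using xyz xy by (simp add: D.emb D.emb_minus)
  also have "\<dots> = s * t * der_emb (lie_bracket R \<delta> \<eta>) b - s * \<delta> t * der_emb \<eta> b + t * \<eta> s * der_emb \<delta> b"
    using mem B by (simp add: D.emb)
  finally show "bracket_num \<delta> s \<eta> t b = s * t * (\<delta> (\<eta> b) - \<eta> (\<delta> b)) - s * \<delta> t * \<eta> b + t * \<eta> s * \<delta> b"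
    using b by (simp add: der_emb_def lie_bracket_value[OF \<delta> \<eta>])
qed

text \<open>
  The bracket is the difference of two iterated quotient rules, so its independence of representatives
  reduces to that of the action.
\<close>

lemma bracket_num_action:
  assumes \<delta>: "\<delta> \<in> derivations F R" and \<eta>: "\<eta> \<in> derivations F R" and st: "s \<in> B" "t \<in> B" "s \<noteq> 0" "t \<noteq> 0" and b: "b \<in> B"
  shows "Fract (bracket_num \<delta> s \<eta> t b) (s * s * (t * t)) =
    Fract (t * \<delta> (\<eta> b) - \<eta> b * \<delta> t) (s * (t * t)) - Fract (s * \<eta> (\<delta> b) - \<delta> b * \<eta> s) (t * (s * s))"
  using st b by (simp add: bracket_num(2)[OF \<delta> \<eta>] eq_fract) (simp add: algebra_simps)

lemma stalk_bracket_frac: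
  assumes P: "P \<in> Spec R" and \<delta>: "\<delta> \<in> derivations F R" "s \<in> B - P" and \<eta>: "\<eta> \<in> derivations F R" "t \<in> B - P"
  shows "stalk_bracket R D P (quot D P \<delta> s) (quot D P \<eta> t) = quot D P (bracket_num \<delta> s \<eta> t) (s * s * (t * t))"
    "s * s * (t * t) \<in> B - P"
proof -
  have closed: "bracket_num \<delta> s \<eta> t \<in> carrier D \<and> s * s * (t * t) \<in> B - P"
    if "\<delta> \<in> carrier D" "s \<in> B - P" "\<eta> \<in> carrier D" "t \<in> B - P" for \<delta> s \<eta> t
    using that bracket_num(1)[of \<delta> \<eta> s t] Spec_D(4)[OF P] by (simp add: D_simps)
  have mem: "\<delta> \<in> carrier D" "\<eta> \<in> carrier D"
    using \<delta> \<eta> by (simp_all add: D_simps)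
  have "(\<Union>(\<delta>, s)\<in>quot D P \<delta> s. \<Union>(\<eta>, t)\<in>quot D P \<eta> t. quot D P (bracket_num \<delta> s \<eta> t) (s * s * (t * t))) =
      quot D P (bracket_num \<delta> s \<eta> t) (s * s * (t * t))"
  proof (rule UN_frac_frac[OF derivation_torsion_free derivation_torsion_free derivation_torsion_free P closed _ mem(1) \<delta>(2) mem(2) \<eta>(2)])
    fix \<delta> s \<eta> t \<delta>' s' \<eta>' t' b
    assume *: "\<delta> \<in> carrier D" "s \<in> B - P" "\<eta> \<in> carrier D" "t \<in> B - P"
      "\<delta>' \<in> carrier D" "s' \<in> B - P" "\<eta>' \<in> carrier D" "t' \<in> B - P"
      and eq: "\<And>i. Fract (der_emb \<delta> i) s = Fract (der_emb \<delta>' i) s'" "\<And>i. Fract (der_emb \<eta> i) t = Fract (der_emb \<eta>' i) t'"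
    have der: "\<delta> \<in> derivations F R" "\<eta> \<in> derivations F R" "\<delta>' \<in> derivations F R" "\<eta>' \<in> derivations F R"
      using * by (simp_all add: D_simps)
    have st: "s \<in> B" "t \<in> B" "s \<noteq> 0" "t \<noteq> 0" "s' \<in> B" "t' \<in> B" "s' \<noteq> 0" "t' \<noteq> 0"
      using * Spec_D(5)[OF P] by auto
    have e: "Fract (\<delta> x) s = Fract (\<delta>' x) s'" "Fract (\<eta> x) t = Fract (\<eta>' x) t'" if "x \<in> B" for x
      using eq(1)[of x] eq(2)[of x] that by (simp_all add: der_emb_def)
    show "Fract (der_emb (bracket_num \<delta> s \<eta> t) b) (s * s * (t * t)) =
        Fract (der_emb (bracket_num \<delta>' s' \<eta>' t') b) (s' * s' * (t' * t'))"
    proof (cases "b \<in> B")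
      case True
      have "\<delta> b \<in> B" "\<eta> b \<in> B" "\<delta>' b \<in> B" "\<eta>' b \<in> B"
        using True derivations_D(1)[OF der(1)] derivations_D(1)[OF der(2)]
          derivations_D(1)[OF der(3)] derivations_D(1)[OF der(4)] by blast+
      then have "Fract (t * \<delta> (\<eta> b) - \<eta> b * \<delta> t) (s * (t * t)) = Fract (t' * \<delta>' (\<eta>' b) - \<eta>' b * \<delta>' t') (s' * (t' * t'))"
        "Fract (s * \<eta> (\<delta> b) - \<delta> b * \<eta> s) (t * (s * s)) = Fract (s' * \<eta>' (\<delta>' b) - \<delta>' b * \<eta>' s') (t' * (s' * s'))"
        using st e True by (auto intro!: action_cong[where F = F] der)
      then show ?thesis
        using True unfolding der_emb_def
        by (simp only: if_True bracket_num_action[OF der(1,2) st(1-4) True] bracket_num_action[OF der(3,4) st(5-8) True])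
    next
      case False
      then show ?thesis
        using st by (simp add: der_emb_def eq_fract)
    qed
  qed
  then show "stalk_bracket R D P (quot D P \<delta> s) (quot D P \<eta> t) = quot D P (bracket_num \<delta> s \<eta> t) (s * s * (t * t))"
    unfolding stalk_bracket_def bracket_num_def by simp
  show "s * s * (t * t) \<in> B - P"
    using closed[OF mem(1) \<delta>(2) mem(2) \<eta>(2)] by simp
qed

end

section \<open>One-cochains and their differentials\<close>

lemma tuples_1: "gs \<in> tuples 1 X \<longleftrightarrow> (\<exists>g\<in>X. gs = [g])"
  by (auto simp: tuples_def length_Suc_conv)

lemma tuples_2: "gs \<in> tuples 2 X \<longleftrightarrow> (\<exists>g\<in>X. \<exists>h\<in>X. gs = [g, h])"
  by (auto simp: tuples_def length_Suc_conv numeral_2_eq_2)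

lemma ball_tuples_1: "(\<forall>gs\<in>tuples 1 X. Q gs) \<longleftrightarrow> (\<forall>g\<in>X. Q [g])"
  unfolding Ball_def tuples_1 by blast

context ring_with_constants
begin

abbreviation \<O> :: "'a set set \<Rightarrow> 'a fun_section set" where
  "\<O> \<equiv> sections R (regular_module R)"

context
  fixes U :: "'a set set"
begin

lemma opens_in_open: "V \<in> opens_in R U \<Longrightarrow> zariski_open R V"
  by (simp add: opens_in_def)

definition linear_on_sections :: "'a cochain \<Rightarrow> 'a set set \<Rightarrow> bool" where
  "linear_on_sections \<phi> V \<longleftrightarrow> (\<forall>a\<in>\<O> V. \<forall>g\<in>sections R D V. \<forall>h\<in>sections R D V.
     \<phi> V [a \<odot>\<^bsub>section_module R D V\<^esub> g \<oplus>\<^bsub>section_module R D V\<^esub> h] =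
       a \<otimes>\<^bsub>section_ring R V\<^esub> \<phi> V [g] \<oplus>\<^bsub>section_ring R V\<^esub> \<phi> V [h])"

lemma cochains_1_iff:
  "\<phi> \<in> cochains 1 R D U \<longleftrightarrow>
     \<phi> \<in> (\<Pi>\<^sub>E V\<in>opens_in R U. tuples 1 (sections R D V) \<rightarrow>\<^sub>E \<O> V) \<and>
     (\<forall>V\<in>opens_in R U. \<forall>V'\<in>opens_in R V. \<forall>g\<in>sections R D V. \<phi> V' [restrict g V'] = restrict (\<phi> V [g]) V') \<and>
     (\<forall>V\<in>opens_in R U. linear_on_sections \<phi> V)"
proof -
  have restr: "(\<forall>gs\<in>tuples 1 (sections R D V). \<phi> V' (map (\<lambda>g. restrict g V') gs) = restrict (\<phi> V gs) V') \<longleftrightarrow>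
      (\<forall>g\<in>sections R D V. \<phi> V' [restrict g V'] = restrict (\<phi> V [g]) V')" for V V'
    by (simp only: ball_tuples_1 list.map)
  have lin: "(\<forall>gs\<in>tuples 1 (sections R D V). \<forall>i<1. \<forall>a\<in>\<O> V. \<forall>g\<in>sections R D V. \<forall>h\<in>sections R D V.
        \<phi> V (gs[i := a \<odot>\<^bsub>section_module R D V\<^esub> g \<oplus>\<^bsub>section_module R D V\<^esub> h]) =
          a \<otimes>\<^bsub>section_ring R V\<^esub> \<phi> V (gs[i := g]) \<oplus>\<^bsub>section_ring R V\<^esub> \<phi> V (gs[i := h])) \<longleftrightarrow>
      linear_on_sections \<phi> V" for V
    unfolding linear_on_sections_def ball_tuples_1 by auto
  have alt: "\<not> (i < j \<and> j < (1 :: nat) \<and> x)" for i j x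
    by auto
  show ?thesis
    unfolding cochains_def mem_Collect_eq section_ring_simps(1) restr lin alt
    by simp
qed

lemma cochains_1_D:
  assumes "\<phi> \<in> cochains 1 R D U" "V \<in> opens_in R U" "g \<in> sections R D V"
  shows "\<phi> V [g] \<in> \<O> V" "V' \<in> opens_in R V \<Longrightarrow> \<phi> V' [restrict g V'] = restrict (\<phi> V [g]) V'"
    "a \<in> \<O> V \<Longrightarrow> h \<in> sections R D V \<Longrightarrow>
      \<phi> V [a \<odot>\<^bsub>section_module R D V\<^esub> g \<oplus>\<^bsub>section_module R D V\<^esub> h] =
        a \<otimes>\<^bsub>section_ring R V\<^esub> \<phi> V [g] \<oplus>\<^bsub>section_ring R V\<^esub> \<phi> V [h]"
proof -
  note \<phi> = assms(1)[unfolded cochains_1_iff]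
  have "[g] \<in> tuples 1 (sections R D V)"
    using assms(3) tuples_1 by blast
  then show "\<phi> V [g] \<in> \<O> V"
    using \<phi> assms(2) by blast
  show "V' \<in> opens_in R V \<Longrightarrow> \<phi> V' [restrict g V'] = restrict (\<phi> V [g]) V'"
    using \<phi> assms by blast
  show "a \<in> \<O> V \<Longrightarrow> h \<in> sections R D V \<Longrightarrow>
      \<phi> V [a \<odot>\<^bsub>section_module R D V\<^esub> g \<oplus>\<^bsub>section_module R D V\<^esub> h] =
        a \<otimes>\<^bsub>section_ring R V\<^esub> \<phi> V [g] \<oplus>\<^bsub>section_ring R V\<^esub> \<phi> V [h]"
    using \<phi> assms unfolding linear_on_sections_def by blast
qed

lemma cochains_1_outside:
  assumes "\<phi> \<in> cochains 1 R D U"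
  shows "V \<notin> opens_in R U \<Longrightarrow> \<phi> V = undefined"
    "V \<in> opens_in R U \<Longrightarrow> gs \<notin> tuples 1 (sections R D V) \<Longrightarrow> \<phi> V gs = undefined"
proof -
  have \<phi>: "\<phi> \<in> (\<Pi>\<^sub>E V\<in>opens_in R U. tuples 1 (sections R D V) \<rightarrow>\<^sub>E \<O> V)"
    using assms cochains_1_iff by blast
  show "V \<notin> opens_in R U \<Longrightarrow> \<phi> V = undefined"
    using \<phi> by (rule PiE_arb)
  show "V \<in> opens_in R U \<Longrightarrow> gs \<notin> tuples 1 (sections R D V) \<Longrightarrow> \<phi> V gs = undefined"
    using PiE_mem[OF \<phi>] by (auto intro: PiE_arb)
qed

lemma sections_action:
  assumes V: "zariski_open R V" and g: "g \<in> sections R D V" and f: "f \<in> \<O> V"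
  shows "(\<lambda>P\<in>V. stalk_action R P (g P) (f P)) \<in> \<O> V"
proof (rule sections_binary[OF g f, where h = "\<lambda>\<delta> s b t. t * \<delta> b - b * \<delta> t" and k = "\<lambda>s t. s * (t * t)"])
  fix Q \<delta> s b t
  assume Q: "Q \<in> Spec R" and *: "\<delta> \<in> carrier D" "b \<in> carrier (regular_module R)" "s \<in> B - Q" "t \<in> B - Q"
  then have "\<delta> \<in> derivations F R" "b \<in> B"
    by (simp_all add: D_simps)
  from stalk_action_frac[OF Q this(1) *(3) this(2) *(4)]
  show "stalk_action R Q (quot D Q \<delta> s) (quot (regular_module R) Q b t) =
      quot (regular_module R) Q (t * \<delta> b - b * \<delta> t) (s * (t * t)) \<and>
      t * \<delta> b - b * \<delta> t \<in> carrier (regular_module R) \<and> s * (t * t) \<in> B - Q"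
    by simp
qed

definition section_bracket :: "'a set set \<Rightarrow> 'a der_section \<Rightarrow> 'a der_section \<Rightarrow> 'a der_section" where
  "section_bracket V g h = (\<lambda>P\<in>V. stalk_bracket R D P (g P) (h P))"

lemma sections_bracket:
  assumes g: "g \<in> sections R D V" and h: "h \<in> sections R D V"
  shows "section_bracket V g h \<in> sections R D V"
  unfolding section_bracket_def
proof (rule sections_binary[OF g h, where h = "bracket_num" and k = "\<lambda>s t. s * s * (t * t)"])
  fix Q \<delta> s \<eta> t
  assume Q: "Q \<in> Spec R" and *: "\<delta> \<in> carrier D" "\<eta> \<in> carrier D" "s \<in> B - Q" "t \<in> B - Q"
  then have der: "\<delta> \<in> derivations F R" "\<eta> \<in> derivations F R"
    by (simp_all add: D_simps)
  from stalk_bracket_frac[OF Q der(1) *(3) der(2) *(4)] bracket_num(1)[OF der, of s t] *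
  show "stalk_bracket R D Q (quot D Q \<delta> s) (quot D Q \<eta> t) = quot D Q (bracket_num \<delta> s \<eta> t) (s * s * (t * t)) \<and>
      bracket_num \<delta> s \<eta> t \<in> carrier D \<and> s * s * (t * t) \<in> B - Q"
    by (simp add: D_simps)
qed

lemma differential_1:
  assumes \<phi>: "\<phi> \<in> cochains 1 R D U" and V: "V \<in> opens_in R U" and g: "g \<in> sections R D V" and h: "h \<in> sections R D V"
  shows "differential 1 R D U \<phi> V [g, h] \<in> \<O> V"
    "P \<in> V \<Longrightarrow> rval (differential 1 R D U \<phi> V [g, h] P) =
      rval (stalk_action R P (g P) (\<phi> V [h] P)) - rval (stalk_action R P (h P) (\<phi> V [g] P)) -
      rval (\<phi> V [section_bracket V g h] P)"
proof -
  define A where "A = section_ring R V"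
  define sg where "sg k = (\<ominus>\<^bsub>A\<^esub> \<one>\<^bsub>A\<^esub>) [^]\<^bsub>A\<^esub> k" for k :: nat
  define T where "T i = (\<lambda>P\<in>V. stalk_action R P (([g, h] ! i) P) (\<phi> V (nths [g, h] (- {i})) P))" for i
  define S where "S i j = \<phi> V ((\<lambda>P\<in>V. stalk_bracket R D P (([g, h] ! i) P) (([g, h] ! j) P)) # nths [g, h] (- {i, j}))" for i j
  note VO = opens_in_open[OF V]
  have nths: "nths [g, h] (- {0}) = [h]" "nths [g, h] (- {1}) = [g]" "nths [g, h] (- {0, 1}) = []"
    by (simp_all add: nths_Cons)
  have T: "T 0 = (\<lambda>P\<in>V. stalk_action R P (g P) (\<phi> V [h] P))" "T 1 = (\<lambda>P\<in>V. stalk_action R P (h P) (\<phi> V [g] P))"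
    unfolding T_def nths by simp_all
  have S: "S 0 1 = \<phi> V [section_bracket V g h]"
    unfolding S_def nths section_bracket_def by simp
  have Tc: "T i \<in> \<O> V" if "i \<in> {..1}" for i
  proof -
    have "i = 0 \<or> i = 1" using that by auto
    then show ?thesis
      using sections_action[OF VO g cochains_1_D(1)[OF \<phi> V h]] sections_action[OF VO h cochains_1_D(1)[OF \<phi> V g]]
      unfolding T[symmetric] by blast
  qed
  have Sc: "S i j \<in> \<O> V" if "j \<in> {..1}" "i \<in> {..<j}" for i j
  proof -
    have "j = 1" "i = 0" using that by auto
    then show ?thesis
      using cochains_1_D(1)[OF \<phi> V sections_bracket[OF g h]] S by simp
  qed
  have sgc: "sg k \<in> \<O> V" for k
    unfolding sg_def A_def by (rule section_ring_sign(1)[OF VO])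
  have sT: "sg i \<otimes>\<^bsub>A\<^esub> T i \<in> \<O> V" if "i \<in> {..1}" for i
    unfolding A_def by (rule section_ring_closed(4)[OF VO sgc Tc[OF that]])
  have sS: "sg (i + j) \<otimes>\<^bsub>A\<^esub> S i j \<in> \<O> V" if "j \<in> {..1}" "i \<in> {..<j}" for i j
    unfolding A_def by (rule section_ring_closed(4)[OF VO sgc Sc[OF that]])
  let ?X = "\<Oplus>\<^bsub>A\<^esub>i\<in>{..1}. sg i \<otimes>\<^bsub>A\<^esub> T i"
  let ?Y = "\<lambda>j. \<Oplus>\<^bsub>A\<^esub>i\<in>{..<j}. sg (i + j) \<otimes>\<^bsub>A\<^esub> S i j"
  have X: "?X \<in> \<O> V"
    unfolding A_def by (rule section_ring_finsum_closed[OF VO]) (rule sT[unfolded A_def])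
  have Y: "?Y j \<in> \<O> V" if "j \<in> {..1}" for j
    unfolding A_def by (rule section_ring_finsum_closed[OF VO]) (rule sS[unfolded A_def, OF that])
  have YY: "(\<Oplus>\<^bsub>A\<^esub>j\<in>{..1}. ?Y j) \<in> \<O> V"
    unfolding A_def by (rule section_ring_finsum_closed[OF VO]) (rule Y[unfolded A_def])
  have "[g, h] \<in> tuples (Suc 1) (sections R D V)"
    using g h by (simp add: tuples_def)
  then have diff: "differential 1 R D U \<phi> V [g, h] = ?X \<oplus>\<^bsub>A\<^esub> (\<Oplus>\<^bsub>A\<^esub>j\<in>{..1}. ?Y j)"
    using V unfolding differential_def T_def S_def sg_def A_def Let_def by simp
  show "differential 1 R D U \<phi> V [g, h] \<in> \<O> V"
    unfolding diff A_def by (rule section_ring_closed(3)[OF VO X[unfolded A_def] YY[unfolded A_def]])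
  assume P: "P \<in> V"
  have "rval (differential 1 R D U \<phi> V [g, h] P) = rval (?X P) + rval ((\<Oplus>\<^bsub>A\<^esub>j\<in>{..1}. ?Y j) P)"
    unfolding diff A_def by (rule section_ring_value(3)[OF VO P X[unfolded A_def] YY[unfolded A_def]])
  also have "rval (?X P) = (\<Sum>i\<le>1. rval ((sg i \<otimes>\<^bsub>A\<^esub> T i) P))"
    unfolding A_def by (rule section_ring_finsum_value[OF VO P]) (simp, rule sT[unfolded A_def])
  also have "\<dots> = (\<Sum>i\<le>1. (- 1) ^ i * rval (T i P))"
    by (intro sum.cong refl, unfold A_def, subst section_ring_value(4)[OF VO P sgc Tc], assumption)
      (simp add: sg_def A_def section_ring_sign(2)[OF VO P])
  also have "rval ((\<Oplus>\<^bsub>A\<^esub>j\<in>{..1}. ?Y j) P) = (\<Sum>j\<le>1. rval (?Y j P))"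
    unfolding A_def by (rule section_ring_finsum_value[OF VO P]) (simp, rule Y[unfolded A_def])
  also have "\<dots> = (\<Sum>j\<le>1. \<Sum>i<j. (- 1) ^ (i + j) * rval (S i j P))"
  proof (intro sum.cong refl)
    fix j :: nat assume j: "j \<in> {..1}"
    have "rval (?Y j P) = (\<Sum>i<j. rval ((sg (i + j) \<otimes>\<^bsub>A\<^esub> S i j) P))"
      unfolding A_def by (rule section_ring_finsum_value[OF VO P]) (simp, rule sS[unfolded A_def, OF j])
    also have "\<dots> = (\<Sum>i<j. (- 1) ^ (i + j) * rval (S i j P))"
      by (intro sum.cong refl, unfold A_def, subst section_ring_value(4)[OF VO P sgc Sc[OF j]], assumption)
        (simp add: sg_def A_def section_ring_sign(2)[OF VO P])
    finally show "rval (?Y j P) = (\<Sum>i<j. (- 1) ^ (i + j) * rval (S i j P))" .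
  qed
  finally show "rval (differential 1 R D U \<phi> V [g, h] P) =
      rval (stalk_action R P (g P) (\<phi> V [h] P)) - rval (stalk_action R P (h P) (\<phi> V [g] P)) -
      rval (\<phi> V [section_bracket V g h] P)"
    using P T S by (simp add: lessThan_Suc)
qed

lemma cochain_add:
  assumes \<phi>: "\<phi> \<in> cochains 1 R D U" and \<psi>: "\<psi> \<in> cochains 1 R D U"
  defines "\<sigma> \<equiv> \<phi> \<otimes>\<^bsub>cochain_group 1 R D U\<^esub> \<psi>"
  shows "\<sigma> \<in> cochains 1 R D U"
    "V \<in> opens_in R U \<Longrightarrow> g \<in> sections R D V \<Longrightarrow> \<sigma> V [g] = \<phi> V [g] \<oplus>\<^bsub>section_ring R V\<^esub> \<psi> V [g]"
proof -
  have \<sigma>: "\<sigma> = (\<lambda>V\<in>opens_in R U. \<lambda>gs\<in>tuples 1 (sections R D V). \<phi> V gs \<oplus>\<^bsub>section_ring R V\<^esub> \<psi> V gs)"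
    by (simp add: \<sigma>_def cochain_group_def)
  have val: "\<sigma> V [g] = \<phi> V [g] \<oplus>\<^bsub>section_ring R V\<^esub> \<psi> V [g]" if "V \<in> opens_in R U" "g \<in> sections R D V" for V g
  proof -
    have "[g] \<in> tuples 1 (sections R D V)"
      using that(2) tuples_1 by blast
    then show ?thesis
      unfolding \<sigma> by (simp only: restrict_apply' that(1))
  qed
  then show "V \<in> opens_in R U \<Longrightarrow> g \<in> sections R D V \<Longrightarrow> \<sigma> V [g] = \<phi> V [g] \<oplus>\<^bsub>section_ring R V\<^esub> \<psi> V [g]" .
  interpret D: torsion_free_module B D der_emb by (rule derivation_torsion_free)
  have "\<sigma> \<in> (\<Pi>\<^sub>E V\<in>opens_in R U. tuples 1 (sections R D V) \<rightarrow>\<^sub>E \<O> V)"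
  proof -
    have "\<forall>gs\<in>tuples 1 (sections R D V). \<phi> V gs \<oplus>\<^bsub>section_ring R V\<^esub> \<psi> V gs \<in> \<O> V" if V: "V \<in> opens_in R U" for V
      unfolding ball_tuples_1
      using section_ring_closed(3)[OF opens_in_open[OF V] cochains_1_D(1)[OF \<phi> V] cochains_1_D(1)[OF \<psi> V]] by blast
    then show ?thesis
      unfolding \<sigma> by auto
  qed
  moreover have "\<sigma> V' [restrict g V'] = restrict (\<sigma> V [g]) V'"
    if V: "V \<in> opens_in R U" and V': "V' \<in> opens_in R V" and g: "g \<in> sections R D V" for V V' g
  proof -
    have V'U: "V' \<in> opens_in R U" and sub: "V' \<subseteq> V" using V V' by (auto simp: opens_in_def)
    have "restrict g V' \<in> sections R D V'"
      using sections_restrict[OF g] V' by (simp add: opens_in_def)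
    then show ?thesis
      using sub by (auto simp: val[OF V'U] val[OF V g] cochains_1_D(2)[OF \<phi> V g V'] cochains_1_D(2)[OF \<psi> V g V']
        section_ring_simps fun_eq_iff)
  qed
  moreover have "linear_on_sections \<sigma> V" if V: "V \<in> opens_in R U" for V
    unfolding linear_on_sections_def
  proof (intro ballI)
    fix a g h assume a: "a \<in> \<O> V" and g: "g \<in> sections R D V" and h: "h \<in> sections R D V"
    interpret A: cring "section_ring R V" by (rule cring_section_ring[OF opens_in_open[OF V]])
    have "a \<odot>\<^bsub>section_module R D V\<^esub> g \<oplus>\<^bsub>section_module R D V\<^esub> h \<in> sections R D V"
      using a g h by (intro D.sections_add D.sections_smult opens_in_open[OF V])
    moreover have "a \<in> carrier (section_ring R V)" "\<phi> V [g] \<in> carrier (section_ring R V)" "\<phi> V [h] \<in> carrier (section_ring R V)"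
      "\<psi> V [g] \<in> carrier (section_ring R V)" "\<psi> V [h] \<in> carrier (section_ring R V)"
      unfolding section_ring_simps(1)
      using a cochains_1_D(1)[OF \<phi> V g] cochains_1_D(1)[OF \<phi> V h] cochains_1_D(1)[OF \<psi> V g] cochains_1_D(1)[OF \<psi> V h] by auto
    ultimately show "\<sigma> V [a \<odot>\<^bsub>section_module R D V\<^esub> g \<oplus>\<^bsub>section_module R D V\<^esub> h] =
        a \<otimes>\<^bsub>section_ring R V\<^esub> \<sigma> V [g] \<oplus>\<^bsub>section_ring R V\<^esub> \<sigma> V [h]"
      using g h by (simp add: val[OF V] cochains_1_D(3)[OF \<phi> V g a h] cochains_1_D(3)[OF \<psi> V g a h] A.r_distr A.a_ac)
  qed
  ultimately show "\<sigma> \<in> cochains 1 R D U"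
    unfolding cochains_1_iff by blast
qed

lemma cochains_1_eqI:
  assumes \<phi>: "\<phi> \<in> cochains 1 R D U" and \<psi>: "\<psi> \<in> cochains 1 R D U"
    and eq: "\<And>V g P. V \<in> opens_in R U \<Longrightarrow> g \<in> sections R D V \<Longrightarrow> P \<in> V \<Longrightarrow> rval (\<phi> V [g] P) = rval (\<psi> V [g] P)"
  shows "\<phi> = \<psi>"
proof
  fix V
  show "\<phi> V = \<psi> V"
  proof (cases "V \<in> opens_in R U")
    case V: True
    show ?thesis
    proof
      fix gs
      show "\<phi> V gs = \<psi> V gs"
      proof (cases "gs \<in> tuples 1 (sections R D V)")
        case True
        then obtain g where g: "g \<in> sections R D V" "gs = [g]"
          unfolding tuples_1 by blast
        show ?thesis
          unfolding g(2)
          by (rule section_ring_eqI[OF opens_in_open[OF V] cochains_1_D(1)[OF \<phi> V g(1)] cochains_1_D(1)[OF \<psi> V g(1)] eq[OF V g(1)]])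
      qed (simp add: cochains_1_outside(2)[OF \<phi> V] cochains_1_outside(2)[OF \<psi> V])
    qed
  qed (simp add: cochains_1_outside(1)[OF \<phi>] cochains_1_outside(1)[OF \<psi>])
qed

lemma differential_1_eqI:
  assumes X: "X = (\<lambda>V\<in>opens_in R U. \<lambda>gs\<in>tuples 2 (sections R D V). X' V gs)"
    and \<phi>: "\<phi> \<in> cochains 1 R D U"
    and closed: "\<And>V g h. V \<in> opens_in R U \<Longrightarrow> g \<in> sections R D V \<Longrightarrow> h \<in> sections R D V \<Longrightarrow>
      X' V [g, h] \<in> \<O> V"
    and eq: "\<And>V g h P. V \<in> opens_in R U \<Longrightarrow> g \<in> sections R D V \<Longrightarrow> h \<in> sections R D V \<Longrightarrow> P \<in> V \<Longrightarrow>
      rval (differential 1 R D U \<phi> V [g, h] P) = rval (X' V [g, h] P)"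
  shows "differential 1 R D U \<phi> = X"
proof
  fix V
  show "differential 1 R D U \<phi> V = X V"
  proof (cases "V \<in> opens_in R U")
    case V: True
    show ?thesis
    proof
      fix gs
      show "differential 1 R D U \<phi> V gs = X V gs"
      proof (cases "gs \<in> tuples 2 (sections R D V)")
        case True
        then obtain g h where gh: "g \<in> sections R D V" "h \<in> sections R D V" "gs = [g, h]"
          unfolding tuples_2 by blast
        have "differential 1 R D U \<phi> V [g, h] = X' V [g, h]"
          by (rule section_ring_eqI[OF opens_in_open[OF V] differential_1(1)[OF \<phi> V gh(1,2)] closed[OF V gh(1,2)] eq[OF V gh(1,2)]])
        then show ?thesis
          using V True gh(3) by (simp add: X)
      qed (use V in \<open>simp add: X differential_def numeral_2_eq_2\<close>)
    qed
  qed (simp add: X differential_def)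
qed

lemma differential_1_add:
  assumes \<phi>: "\<phi> \<in> cochains 1 R D U" and \<psi>: "\<psi> \<in> cochains 1 R D U"
  shows "differential 1 R D U (\<phi> \<otimes>\<^bsub>cochain_group 1 R D U\<^esub> \<psi>) =
    differential 1 R D U \<phi> \<otimes>\<^bsub>cochain_group 2 R D U\<^esub> differential 1 R D U \<psi>"
proof (rule differential_1_eqI)
  let ?\<sigma> = "\<phi> \<otimes>\<^bsub>cochain_group 1 R D U\<^esub> \<psi>"
  show "differential 1 R D U \<phi> \<otimes>\<^bsub>cochain_group 2 R D U\<^esub> differential 1 R D U \<psi> =
    (\<lambda>V\<in>opens_in R U. \<lambda>gs\<in>tuples 2 (sections R D V).
      differential 1 R D U \<phi> V gs \<oplus>\<^bsub>section_ring R V\<^esub> differential 1 R D U \<psi> V gs)"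
    by (simp add: cochain_group_def)
  show "?\<sigma> \<in> cochains 1 R D U" by (rule cochain_add(1)[OF \<phi> \<psi>])
  fix V g h assume V: "V \<in> opens_in R U" and g: "g \<in> sections R D V" and h: "h \<in> sections R D V"
  note VO = opens_in_open[OF V]
  note d\<phi> = differential_1[OF \<phi> V g h] and d\<psi> = differential_1[OF \<psi> V g h]
    and d\<sigma> = differential_1[OF cochain_add(1)[OF \<phi> \<psi>] V g h]
  show "differential 1 R D U \<phi> V [g, h] \<oplus>\<^bsub>section_ring R V\<^esub> differential 1 R D U \<psi> V [g, h] \<in> \<O> V"
    by (rule section_ring_closed(3)[OF VO d\<phi>(1) d\<psi>(1)])
  fix P assume P: "P \<in> V"
  then have PS: "P \<in> Spec R" using zariski_open_subset[OF VO] by blast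
  have act: "rval (stalk_action R P (g P) (?\<sigma> V [h] P)) =
      rval (stalk_action R P (g P) (\<phi> V [h] P)) + rval (stalk_action R P (g P) (\<psi> V [h] P))"
    if g: "g \<in> sections R D V" and h: "h \<in> sections R D V" for g h
  proof -
    have "?\<sigma> V [h] P = \<phi> V [h] P \<oplus>\<^bsub>stalk_ring R P\<^esub> \<psi> V [h] P"
      unfolding cochain_add(2)[OF \<phi> \<psi> V h] using P by (simp add: section_ring_simps)
    moreover have "\<phi> V [h] P \<in> carrier (stalk_ring R P)" "\<psi> V [h] P \<in> carrier (stalk_ring R P)"
      unfolding stalk_ring_simps
      using sections_carrier[OF cochains_1_D(1)[OF \<phi> V h] P] sections_carrier[OF cochains_1_D(1)[OF \<psi> V h] P] by auto
    ultimately show ?thesis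
      using stalk_action_add[OF PS sections_carrier[OF g P]] by simp
  qed
  note br = sections_bracket[OF g h]
  have "rval (?\<sigma> V [section_bracket V g h] P) =
      rval (\<phi> V [section_bracket V g h] P) + rval (\<psi> V [section_bracket V g h] P)"
    unfolding cochain_add(2)[OF \<phi> \<psi> V br]
    by (rule section_ring_value(3)[OF VO P cochains_1_D(1)[OF \<phi> V br] cochains_1_D(1)[OF \<psi> V br]])
  then show "rval (differential 1 R D U ?\<sigma> V [g, h] P) =
      rval ((differential 1 R D U \<phi> V [g, h] \<oplus>\<^bsub>section_ring R V\<^esub> differential 1 R D U \<psi> V [g, h]) P)"
    unfolding section_ring_value(3)[OF VO P d\<phi>(1) d\<psi>(1)] d\<sigma>(2)[OF P] d\<phi>(2)[OF P] d\<psi>(2)[OF P]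
      act[OF g h] act[OF h g]
    by simp
qed

end

section \<open>Cochains from linear maps on derivations\<close>

definition stalk_map :: "(('a \<Rightarrow> 'a) \<Rightarrow> 'a) \<Rightarrow> 'a set \<Rightarrow> (('a \<Rightarrow> 'a) \<times> 'a) set \<Rightarrow> ('a \<times> 'a) set" where
  "stalk_map \<psi> P x = (\<Union>(\<delta>, s)\<in>x. quot (regular_module R) P (\<psi> \<delta>) s)"

definition induced_cochain :: "(('a \<Rightarrow> 'a) \<Rightarrow> 'a) \<Rightarrow> 'a set set \<Rightarrow> 'a cochain" where
  "induced_cochain \<psi> U = (\<lambda>V\<in>opens_in R U. \<lambda>gs\<in>tuples 1 (sections R D V). \<lambda>P\<in>V. stalk_map \<psi> P ((gs ! 0) P))"

definition linear_functional :: "(('a \<Rightarrow> 'a) \<Rightarrow> 'a) \<Rightarrow> bool" where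
  "linear_functional \<psi> \<longleftrightarrow> (\<forall>\<delta>\<in>derivations F R. \<psi> \<delta> \<in> B) \<and>
     (\<forall>\<delta>\<in>derivations F R. \<forall>\<eta>\<in>derivations F R. \<psi> (\<delta> \<oplus>\<^bsub>D\<^esub> \<eta>) = \<psi> \<delta> + \<psi> \<eta>) \<and>
     (\<forall>a\<in>B. \<forall>\<delta>\<in>derivations F R. \<psi> (a \<odot>\<^bsub>D\<^esub> \<delta>) = a * \<psi> \<delta>)"

context
  fixes \<psi> :: "('a \<Rightarrow> 'a) \<Rightarrow> 'a"
  assumes \<psi>: "linear_functional \<psi>"
begin

interpretation D: torsion_free_module B D der_emb
  by (rule derivation_torsion_free)

lemma \<psi>_D:
  "\<delta> \<in> derivations F R \<Longrightarrow> \<psi> \<delta> \<in> B"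
  "\<delta> \<in> derivations F R \<Longrightarrow> \<eta> \<in> derivations F R \<Longrightarrow> \<psi> (\<delta> \<oplus>\<^bsub>D\<^esub> \<eta>) = \<psi> \<delta> + \<psi> \<eta>"
  "a \<in> B \<Longrightarrow> \<delta> \<in> derivations F R \<Longrightarrow> \<psi> (a \<odot>\<^bsub>D\<^esub> \<delta>) = a * \<psi> \<delta>"
  using \<psi> by (auto simp: linear_functional_def)

lemma \<psi>_zero: "\<psi> \<zero>\<^bsub>D\<^esub> = 0"
proof -
  have z: "\<zero>\<^bsub>D\<^esub> \<in> derivations F R"
    using D.M_closed(1) by (simp only: D_simps(1))
  have "(0 :: 'a) \<odot>\<^bsub>D\<^esub> \<zero>\<^bsub>D\<^esub> = \<zero>\<^bsub>D\<^esub>"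
    by (simp add: D_simps)
  then show ?thesis
    using \<psi>_D(3)[OF B_closed(1) z] by simp
qed

lemma \<psi>_minus:
  assumes "\<delta> \<in> derivations F R" "\<eta> \<in> derivations F R"
  shows "\<psi> (\<delta> \<ominus>\<^bsub>D\<^esub> \<eta>) = \<psi> \<delta> - \<psi> \<eta>"
  by (rule value_minus[OF D.abelian_group_M, where v = \<psi>]) (use assms in \<open>simp_all add: D_simps(1) \<psi>_D(2) \<psi>_zero\<close>)

lemma stalk_map_frac:
  assumes P: "P \<in> Spec R" and \<delta>: "\<delta> \<in> derivations F R" "s \<in> B - P"
  shows "stalk_map \<psi> P (quot D P \<delta> s) = quot (regular_module R) P (\<psi> \<delta>) s"
proof -
  have mem: "\<delta> \<in> carrier D" using \<delta> by (simp add: D_simps)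
  show ?thesis
    unfolding stalk_map_def
  proof (rule D.UN_frac[OF P mem \<delta>(2)])
    fix \<eta> t
    assume \<eta>: "\<eta> \<in> carrier D" "t \<in> B - P" and eq: "\<forall>i. Fract (der_emb \<eta> i) t = Fract (der_emb \<delta> i) s"
    have st: "s \<in> B" "t \<in> B" "s \<noteq> 0" "t \<noteq> 0"
      using \<delta>(2) \<eta>(2) Spec_D(5)[OF P] by auto
    have der: "\<eta> \<in> derivations F R" using \<eta>(1) by (simp only: D_simps)
    have "s \<odot>\<^bsub>D\<^esub> \<eta> = t \<odot>\<^bsub>D\<^esub> \<delta>"
    proof (rule D.emb_inj)
      show "s \<odot>\<^bsub>D\<^esub> \<eta> \<in> carrier D" "t \<odot>\<^bsub>D\<^esub> \<delta> \<in> carrier D"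
        using st mem \<eta> by (simp_all add: D.M_closed)
      show "der_emb (s \<odot>\<^bsub>D\<^esub> \<eta>) i = der_emb (t \<odot>\<^bsub>D\<^esub> \<delta>) i" for i
        using eq st mem \<eta> by (simp add: D.emb eq_fract mult.commute)
    qed
    then have "s * \<psi> \<eta> = t * \<psi> \<delta>"
      using \<psi>_D(3)[OF st(1) der] \<psi>_D(3)[OF st(2) \<delta>(1)] by simp
    then have "Fract (\<psi> \<eta>) t = Fract (\<psi> \<delta>) s"
      using st by (simp add: eq_fract mult.commute)
    moreover have "\<psi> \<eta> \<in> carrier (regular_module R)" "\<psi> \<delta> \<in> carrier (regular_module R)"
      using \<psi>_D(1)[OF der] \<psi>_D(1)[OF \<delta>(1)] by simp_all
    ultimately show "quot (regular_module R) P (\<psi> \<eta>) t = quot (regular_module R) P (\<psi> \<delta>) s"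
      using torsion_free_module.frac_eq_iff[OF regular_torsion_free P _ \<eta>(2) _ \<delta>(2)] by blast
  qed
qed

lemma stalk_map_value:
  assumes P: "P \<in> Spec R" and \<delta>: "\<delta> \<in> derivations F R" "s \<in> B - P"
  shows "rval (stalk_map \<psi> P (quot D P \<delta> s)) = Fract (\<psi> \<delta>) s"
  unfolding stalk_map_frac[OF assms] by (rule rval_frac[OF P \<psi>_D(1)[OF \<delta>(1)] \<delta>(2)])

lemma stalk_map_linear:
  assumes P: "P \<in> Spec R" and a: "a \<in> carrier (stalk R (regular_module R) P)"
    and x: "x \<in> carrier (stalk R D P)" and y: "y \<in> carrier (stalk R D P)"
  shows "rval (stalk_map \<psi> P (a \<odot>\<^bsub>stalk R D P\<^esub> x \<oplus>\<^bsub>stalk R D P\<^esub> y)) =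
    rval a * rval (stalk_map \<psi> P x) + rval (stalk_map \<psi> P y)"
proof -
  obtain b r where b: "b \<in> B" "r \<in> B - P" "a = quot (regular_module R) P b r"
    using a by (rule regular_stalk_cases)
  obtain \<delta> s where \<delta>: "\<delta> \<in> carrier D" "s \<in> B - P" "x = quot D P \<delta> s"
    using x by (rule stalk_cases)
  obtain \<eta> t where \<eta>: "\<eta> \<in> carrier D" "t \<in> B - P" "y = quot D P \<eta> t"
    using y by (rule stalk_cases)
  note sm = D.stalk_smult_frac[OF P b(1,2) \<delta>(1,2)]
  note ad = D.stalk_add_frac[OF P sm(2,3) \<eta>(1,2)]
  have nz: "r \<in> B" "s \<in> B" "t \<in> B" "r \<noteq> 0" "s \<noteq> 0" "t \<noteq> 0"
    using b \<delta> \<eta> Spec_D(5)[OF P] by auto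
  have d: "\<delta> \<in> derivations F R" "\<eta> \<in> derivations F R" "b \<odot>\<^bsub>D\<^esub> \<delta> \<in> derivations F R"
    "t \<odot>\<^bsub>D\<^esub> (b \<odot>\<^bsub>D\<^esub> \<delta>) \<in> derivations F R" "(r * s) \<odot>\<^bsub>D\<^esub> \<eta> \<in> derivations F R"
    "t \<odot>\<^bsub>D\<^esub> (b \<odot>\<^bsub>D\<^esub> \<delta>) \<oplus>\<^bsub>D\<^esub> (r * s) \<odot>\<^bsub>D\<^esub> \<eta> \<in> derivations F R"
    using \<delta>(1) \<eta>(1) b(1) nz unfolding D_simps(1)[symmetric] by (simp_all only: D.M_closed B_closed)
  have "rval (stalk_map \<psi> P (a \<odot>\<^bsub>stalk R D P\<^esub> x \<oplus>\<^bsub>stalk R D P\<^esub> y)) =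
      Fract (\<psi> (t \<odot>\<^bsub>D\<^esub> (b \<odot>\<^bsub>D\<^esub> \<delta>) \<oplus>\<^bsub>D\<^esub> (r * s) \<odot>\<^bsub>D\<^esub> \<eta>)) (r * s * t)"
    unfolding b(3) \<delta>(3) \<eta>(3) sm(1) ad(1) by (rule stalk_map_value[OF P d(6) ad(3)])
  also have "\<dots> = Fract (t * (b * \<psi> \<delta>) + r * s * \<psi> \<eta>) (r * s * t)"
    using d b(1) nz by (simp add: \<psi>_D B_closed)
  also have "\<dots> = Fract b r * Fract (\<psi> \<delta>) s + Fract (\<psi> \<eta>) t"
    using nz by (simp add: eq_fract algebra_simps)
  also have "\<dots> = rval a * rval (stalk_map \<psi> P x) + rval (stalk_map \<psi> P y)"
    unfolding b(3) \<delta>(3) \<eta>(3)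
    by (simp only: rval_frac[OF P b(1,2)] stalk_map_value[OF P d(1) \<delta>(2)] stalk_map_value[OF P d(2) \<eta>(2)])
  finally show ?thesis .
qed

lemma sections_stalk_map:
  assumes g: "g \<in> sections R D V"
  shows "(\<lambda>P\<in>V. stalk_map \<psi> P (g P)) \<in> \<O> V"
proof (rule sections_binary[OF g g, where F = "\<lambda>P x y. stalk_map \<psi> P x" and h = "\<lambda>\<delta> s _ _. \<psi> \<delta>" and k = "\<lambda>s _. s"])
  fix Q \<delta> s
  assume "Q \<in> Spec R" "\<delta> \<in> carrier D" "s \<in> B - Q"
  then show "stalk_map \<psi> Q (quot D Q \<delta> s) = quot (regular_module R) Q (\<psi> \<delta>) s \<and>
      \<psi> \<delta> \<in> carrier (regular_module R) \<and> s \<in> B - Q"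
    using stalk_map_frac[of Q \<delta> s] \<psi>_D(1)[of \<delta>] by (simp add: D_simps)
qed

lemma induced_cochain_apply:
  assumes "V \<in> opens_in R U" "g \<in> sections R D V"
  shows "induced_cochain \<psi> U V [g] = (\<lambda>P\<in>V. stalk_map \<psi> P (g P))"
proof -
  have "[g] \<in> tuples 1 (sections R D V)"
    using assms(2) tuples_1 by blast
  then show ?thesis
    unfolding induced_cochain_def by (simp only: restrict_apply' assms(1) nth_Cons_0)
qed

lemma induced_cochain: "induced_cochain \<psi> U \<in> cochains 1 R D U"
proof -
  have "\<forall>gs\<in>tuples 1 (sections R D V). (\<lambda>P\<in>V. stalk_map \<psi> P ((gs ! 0) P)) \<in> \<O> V" for V
    unfolding ball_tuples_1 nth_Cons_0 using sections_stalk_map by blast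
  then have "induced_cochain \<psi> U \<in> (\<Pi>\<^sub>E V\<in>opens_in R U. tuples 1 (sections R D V) \<rightarrow>\<^sub>E \<O> V)"
    unfolding induced_cochain_def by auto
  moreover have "induced_cochain \<psi> U V' [restrict g V'] = restrict (induced_cochain \<psi> U V [g]) V'"
    if V: "V \<in> opens_in R U" and V': "V' \<in> opens_in R V" and g: "g \<in> sections R D V" for V V' g
  proof -
    have V'U: "V' \<in> opens_in R U" and sub: "V' \<subseteq> V" using V V' by (auto simp: opens_in_def)
    have "restrict g V' \<in> sections R D V'"
      using sections_restrict[OF g] V' by (simp add: opens_in_def)
    then show ?thesis
      using sub by (auto simp: induced_cochain_apply[OF V'U] induced_cochain_apply[OF V g] fun_eq_iff)
  qed
  moreover have "linear_on_sections (induced_cochain \<psi> U) V" if V: "V \<in> opens_in R U" for V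
    unfolding linear_on_sections_def
  proof (intro ballI)
    fix a g h assume a: "a \<in> \<O> V" and g: "g \<in> sections R D V" and h: "h \<in> sections R D V"
    note VO = opens_in_open[OF V]
    have sum: "a \<odot>\<^bsub>section_module R D V\<^esub> g \<oplus>\<^bsub>section_module R D V\<^esub> h \<in> sections R D V"
      using a g h by (intro D.sections_add D.sections_smult VO)
    note \<psi>g = sections_stalk_map[OF g] and \<psi>h = sections_stalk_map[OF h]
    show "induced_cochain \<psi> U V [a \<odot>\<^bsub>section_module R D V\<^esub> g \<oplus>\<^bsub>section_module R D V\<^esub> h] =
        a \<otimes>\<^bsub>section_ring R V\<^esub> induced_cochain \<psi> U V [g] \<oplus>\<^bsub>section_ring R V\<^esub> induced_cochain \<psi> U V [h]"
      unfolding induced_cochain_apply[OF V g] induced_cochain_apply[OF V h] induced_cochain_apply[OF V sum]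
    proof (rule section_ring_eqI[OF VO sections_stalk_map[OF sum]])
      show "a \<otimes>\<^bsub>section_ring R V\<^esub> (\<lambda>P\<in>V. stalk_map \<psi> P (g P)) \<oplus>\<^bsub>section_ring R V\<^esub> (\<lambda>P\<in>V. stalk_map \<psi> P (h P)) \<in> \<O> V"
        by (rule section_ring_closed(3)[OF VO section_ring_closed(4)[OF VO a \<psi>g] \<psi>h])
      fix P assume P: "P \<in> V"
      then have PS: "P \<in> Spec R" using zariski_open_subset[OF VO] by blast
      show "rval ((\<lambda>P\<in>V. stalk_map \<psi> P ((a \<odot>\<^bsub>section_module R D V\<^esub> g \<oplus>\<^bsub>section_module R D V\<^esub> h) P)) P) =
          rval ((a \<otimes>\<^bsub>section_ring R V\<^esub> (\<lambda>P\<in>V. stalk_map \<psi> P (g P)) \<oplus>\<^bsub>section_ring R V\<^esub> (\<lambda>P\<in>V. stalk_map \<psi> P (h P))) P)"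
        unfolding section_ring_value(3)[OF VO P section_ring_closed(4)[OF VO a \<psi>g] \<psi>h] section_ring_value(4)[OF VO P a \<psi>g]
        using stalk_map_linear[OF PS sections_carrier[OF a P] sections_carrier[OF g P] sections_carrier[OF h P]] P
        by (simp add: section_module_simps)
    qed
  qed
  ultimately show ?thesis
    unfolding cochains_1_iff by blast
qed

text \<open>
  The derivatives of the denominators \<open>s\<close> and \<open>t\<close> which come from the action cancel against those in
  the bracket.
\<close>

lemma differential_induced_cochain:
  assumes V: "V \<in> opens_in R U" and g: "g \<in> sections R D V" and h: "h \<in> sections R D V" and P: "P \<in> V"
    and \<delta>: "\<delta> \<in> derivations F R" "s \<in> B - P" "g P = quot D P \<delta> s"
    and \<eta>: "\<eta> \<in> derivations F R" "t \<in> B - P" "h P = quot D P \<eta> t"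
  shows "rval (differential 1 R D U (induced_cochain \<psi> U) V [g, h] P) =
    Fract (\<delta> (\<psi> \<eta>) - \<eta> (\<psi> \<delta>) - \<psi> (lie_bracket R \<delta> \<eta>)) (s * t)"
proof -
  note VO = opens_in_open[OF V]
  have PS: "P \<in> Spec R" using zariski_open_subset[OF VO] P by blast
  have st: "s \<in> B" "t \<in> B" "s \<noteq> 0" "t \<noteq> 0"
    using \<delta>(2) \<eta>(2) Spec_D(5)[OF PS] by auto
  note \<psi>\<delta> = \<psi>_D(1)[OF \<delta>(1)] and \<psi>\<eta> = \<psi>_D(1)[OF \<eta>(1)]
  note num = bracket_num[OF \<delta>(1) \<eta>(1) st(1,2)]
  have 1: "rval (stalk_action R P (g P) (induced_cochain \<psi> U V [h] P)) = Fract (t * \<delta> (\<psi> \<eta>) - \<psi> \<eta> * \<delta> t) (s * (t * t))"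
    unfolding induced_cochain_apply[OF V h] restrict_apply'[OF P] \<delta>(3) \<eta>(3) stalk_map_frac[OF PS \<eta>(1,2)]
    by (rule stalk_action_value[OF PS \<delta>(1,2) \<psi>\<eta> \<eta>(2)])
  have 2: "rval (stalk_action R P (h P) (induced_cochain \<psi> U V [g] P)) = Fract (s * \<eta> (\<psi> \<delta>) - \<psi> \<delta> * \<eta> s) (t * (s * s))"
    unfolding induced_cochain_apply[OF V g] restrict_apply'[OF P] \<delta>(3) \<eta>(3) stalk_map_frac[OF PS \<delta>(1,2)]
    by (rule stalk_action_value[OF PS \<eta>(1,2) \<psi>\<delta> \<delta>(2)])
  have 3: "rval (induced_cochain \<psi> U V [section_bracket V g h] P) = Fract (\<psi> (bracket_num \<delta> s \<eta> t)) (s * s * (t * t))"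
    unfolding induced_cochain_apply[OF V sections_bracket[OF g h]]
    unfolding section_bracket_def restrict_apply'[OF P] \<delta>(3) \<eta>(3)
      stalk_bracket_frac(1)[OF PS \<delta>(1,2) \<eta>(1,2)]
    by (rule stalk_map_value[OF PS num(1) stalk_bracket_frac(2)[OF PS \<delta>(1,2) \<eta>(1,2)]])
  have 4: "\<psi> (bracket_num \<delta> s \<eta> t) = s * t * \<psi> (lie_bracket R \<delta> \<eta>) - s * \<delta> t * \<psi> \<eta> + t * \<eta> s * \<psi> \<delta>"
  proof -
    have br: "lie_bracket R \<delta> \<eta> \<in> derivations F R"
      by (rule lie_bracket_derivation[OF \<delta>(1) \<eta>(1)])
    have B: "s * t \<in> B" "s * \<delta> t \<in> B" "t * \<eta> s \<in> B"
      using st derivations_D(1)[OF \<delta>(1) st(2)] derivations_D(1)[OF \<eta>(1) st(1)] by (simp_all only: B_closed)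
    have smult: "a \<odot>\<^bsub>D\<^esub> \<xi> \<in> derivations F R" if "a \<in> B" "\<xi> \<in> derivations F R" for a \<xi>
      using that D.M_closed(3) by (simp only: D_simps(1))
    have minus: "(s * t) \<odot>\<^bsub>D\<^esub> lie_bracket R \<delta> \<eta> \<ominus>\<^bsub>D\<^esub> (s * \<delta> t) \<odot>\<^bsub>D\<^esub> \<eta> \<in> derivations F R"
      using D.M_minus_closed smult[OF B(1) br] smult[OF B(2) \<eta>(1)] by (simp only: D_simps(1))
    show ?thesis
      unfolding bracket_num_def R_simps
      by (simp only: \<psi>_D(2)[OF minus smult[OF B(3) \<delta>(1)]] \<psi>_minus[OF smult[OF B(1) br] smult[OF B(2) \<eta>(1)]]
          \<psi>_D(3)[OF B(1) br] \<psi>_D(3)[OF B(2) \<eta>(1)] \<psi>_D(3)[OF B(3) \<delta>(1)])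
  qed
  show ?thesis
    unfolding differential_1(2)[OF induced_cochain V g h P] 1 2 3 4
    using st by (simp add: eq_fract) (simp add: algebra_simps)
qed

end

lemma linear_functional_uminus:
  assumes "linear_functional \<psi>"
  shows "linear_functional (\<lambda>\<delta>. - \<psi> \<delta>)"
  using assms by (auto simp: linear_functional_def B_closed)

text \<open>
  The coboundaries are closed under translation by the differential of the induced cochain \<open>p\<close>, and
  this translation is undone by the cochain \<open>q\<close> of the opposite functional.
\<close>

lemma cohomology_class_differential:
  assumes \<psi>: "linear_functional \<psi>"
  shows "cohomology_class 2 R D U (differential 1 R D U (induced_cochain \<psi> U)) = \<one>\<^bsub>cohomology 2 R D U\<^esub>"
proof -
  let ?C = "cochain_group 2 R D U" and ?d = "differential 1 R D U"
  define H where "H = ?d ` cochains 1 R D U"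
  have cob: "coboundaries 2 R D U = H"
    by (simp add: numeral_2_eq_2 H_def)
  have mult: "x \<otimes>\<^bsub>cocycle_group 2 R D U\<^esub> y = x \<otimes>\<^bsub>?C\<^esub> y" for x y
    by (simp add: cocycle_group_def)
  define p where "p = induced_cochain \<psi> U"
  define q where "q = induced_cochain (\<lambda>\<delta>. - \<psi> \<delta>) U"
  have p: "p \<in> cochains 1 R D U" and q: "q \<in> cochains 1 R D U"
    unfolding p_def q_def using \<psi> linear_functional_uminus[OF \<psi>] by (simp_all only: induced_cochain)
  have "{h \<otimes>\<^bsub>?C\<^esub> ?d p | h. h \<in> H} = H"
  proof (intro equalityI subsetI)
    fix x assume "x \<in> {h \<otimes>\<^bsub>?C\<^esub> ?d p | h. h \<in> H}"
    then obtain a where a: "a \<in> cochains 1 R D U" "x = ?d a \<otimes>\<^bsub>?C\<^esub> ?d p"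
      unfolding H_def by blast
    then have "x = ?d (a \<otimes>\<^bsub>cochain_group 1 R D U\<^esub> p)"
      by (simp only: differential_1_add[OF a(1) p])
    then show "x \<in> H"
      unfolding H_def using cochain_add(1)[OF a(1) p] by blast
  next
    fix x assume "x \<in> H"
    then obtain a where a: "a \<in> cochains 1 R D U" "x = ?d a" unfolding H_def by blast
    define b where "b = a \<otimes>\<^bsub>cochain_group 1 R D U\<^esub> q"
    have b: "b \<in> cochains 1 R D U" unfolding b_def by (rule cochain_add(1)[OF a(1) q])
    have "b \<otimes>\<^bsub>cochain_group 1 R D U\<^esub> p = a"
    proof (rule cochains_1_eqI[OF cochain_add(1)[OF b p] a(1)])
      fix V g P assume V: "V \<in> opens_in R U" and g: "g \<in> sections R D V" and P: "P \<in> V"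
      note VO = opens_in_open[OF V]
      have PS: "P \<in> Spec R" using zariski_open_subset[OF VO] P by blast
      obtain \<delta> s where \<delta>: "\<delta> \<in> carrier D" "s \<in> B - P" "g P = quot D P \<delta> s"
        using sections_carrier[OF g P] by (rule stalk_cases)
      then have d: "\<delta> \<in> derivations F R" by (simp add: D_simps)
      have "rval (p V [g] P) = Fract (\<psi> \<delta>) s" "rval (q V [g] P) = Fract (- \<psi> \<delta>) s"
        unfolding p_def q_def induced_cochain_apply[OF \<psi> V g] induced_cochain_apply[OF linear_functional_uminus[OF \<psi>] V g]
          restrict_apply'[OF P] \<delta>(3)
        by (rule stalk_map_value[OF \<psi> PS d \<delta>(2)], rule stalk_map_value[OF linear_functional_uminus[OF \<psi>] PS d \<delta>(2)])
      then have pq: "rval (q V [g] P) + rval (p V [g] P) = 0"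
        by (simp flip: minus_fract)
      have "rval ((b \<otimes>\<^bsub>cochain_group 1 R D U\<^esub> p) V [g] P) = rval (b V [g] P) + rval (p V [g] P)"
        unfolding cochain_add(2)[OF b p V g]
        by (rule section_ring_value(3)[OF VO P cochains_1_D(1)[OF b V g] cochains_1_D(1)[OF p V g]])
      also have "rval (b V [g] P) = rval (a V [g] P) + rval (q V [g] P)"
        unfolding b_def cochain_add(2)[OF a(1) q V g]
        by (rule section_ring_value(3)[OF VO P cochains_1_D(1)[OF a(1) V g] cochains_1_D(1)[OF q V g]])
      finally show "rval ((b \<otimes>\<^bsub>cochain_group 1 R D U\<^esub> p) V [g] P) = rval (a V [g] P)"
        using pq by (simp only: add.assoc add_0_right)
    qed
    then have "x = ?d b \<otimes>\<^bsub>?C\<^esub> ?d p"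
      unfolding a(2) using differential_1_add[OF b p] by (simp only:)
    then show "x \<in> {h \<otimes>\<^bsub>?C\<^esub> ?d p | h. h \<in> H}"
      using b unfolding H_def by blast
  qed
  then show ?thesis
    unfolding cohomology_class_def cohomology_def cob p_def[symmetric]
    by (auto simp: r_coset_def FactGroup_def mult)
qed

end

section \<open>Coordinates in a stalk\<close>

context torsion_free_module
begin

context
  fixes P m and e :: "nat \<Rightarrow> ('m \<times> 'a) set"
  assumes P: "P \<in> Spec R" and basis: "is_basis (stalk_ring R P) (stalk R M P) m e"
begin

lemma basis_coordinates:
  assumes x: "x \<in> carrier (stalk R M P)"
  shows "k < m \<Longrightarrow> coordinates (stalk_ring R P) (stalk R M P) m e x k \<in> carrier (stalk_ring R P)"
    "val x i = (\<Sum>k<m. rval (coordinates (stalk_ring R P) (stalk R M P) m e x k) * val (e k) i)"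
proof -
  let ?c = "coordinates (stalk_ring R P) (stalk R M P) m e x"
  have e: "\<forall>k<m. e k \<in> carrier (stalk R M P)"
    using basis unfolding is_basis_def by blast
  have "\<exists>!c. c \<in> {..<m} \<rightarrow>\<^sub>E carrier (stalk_ring R P) \<and> x = (\<Oplus>\<^bsub>stalk R M P\<^esub>i\<in>{..<m}. c i \<odot>\<^bsub>stalk R M P\<^esub> e i)"
    using bspec[OF conjunct2[OF basis[unfolded is_basis_def]] x] .
  note theI = theI'[OF this, folded coordinates_def]
  then have c: "?c \<in> {..<m} \<rightarrow>\<^sub>E carrier (stalk_ring R P)"
    by (rule conjunct1)
  have c2: "x = (\<Oplus>\<^bsub>stalk R M P\<^esub>i\<in>{..<m}. ?c i \<odot>\<^bsub>stalk R M P\<^esub> e i)"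
    using theI by (rule conjunct2)
  have ck: "\<forall>k<m. ?c k \<in> carrier (stalk_ring R P)" using PiE_mem[OF c] by simp
  then show "k < m \<Longrightarrow> ?c k \<in> carrier (stalk_ring R P)" by blast
  show "val x i = (\<Sum>k<m. rval (?c k) * val (e k) i)"
    using stalk_expansion_iff[OF P x ck e] c2 by blast
qed

lemma basis_independent:
  assumes c: "\<forall>k<m. c k \<in> carrier (stalk_ring R P)" and zero: "\<And>i. (\<Sum>k<m. rval (c k) * val (e k) i) = 0"
    and k: "k < m"
  shows "rval (c k) = 0"
proof -
  let ?z = "\<zero>\<^bsub>stalk R M P\<^esub>"
  define c1 where "c1 = restrict c {..<m}"
  define c0 where "c0 = (\<lambda>k\<in>{..<m}. \<zero>\<^bsub>stalk_ring R P\<^esub>)"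
  have e: "\<forall>k<m. e k \<in> carrier (stalk R M P)"
    using basis unfolding is_basis_def by blast
  note z = stalk_zero_ops(1)[OF P]
  have c1: "\<forall>k<m. c1 k \<in> carrier (stalk_ring R P)" and c0: "\<forall>k<m. c0 k \<in> carrier (stalk_ring R P)"
    using c stalk_ring_zero_one(1)[OF P] by (simp_all add: c1_def c0_def)
  have "\<forall>i. val ?z i = (\<Sum>k<m. rval (c1 k) * val (e k) i)"
    using zero by (simp add: stalk_zero_ops(2)[OF P] c1_def)
  then have 1: "?z = (\<Oplus>\<^bsub>stalk R M P\<^esub>i\<in>{..<m}. c1 i \<odot>\<^bsub>stalk R M P\<^esub> e i)"
    using stalk_expansion_iff[OF P z c1 e] by blast
  have "\<forall>i. val ?z i = (\<Sum>k<m. rval (c0 k) * val (e k) i)"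
    by (simp add: stalk_zero_ops(2)[OF P] c0_def stalk_ring_zero_one(2)[OF P])
  then have 0: "?z = (\<Oplus>\<^bsub>stalk R M P\<^esub>i\<in>{..<m}. c0 i \<odot>\<^bsub>stalk R M P\<^esub> e i)"
    using stalk_expansion_iff[OF P z c0 e] by blast
  have "\<exists>!c. c \<in> {..<m} \<rightarrow>\<^sub>E carrier (stalk_ring R P) \<and> ?z = (\<Oplus>\<^bsub>stalk R M P\<^esub>i\<in>{..<m}. c i \<odot>\<^bsub>stalk R M P\<^esub> e i)"
    using bspec[OF conjunct2[OF basis[unfolded is_basis_def]] z] .
  moreover have "c1 \<in> {..<m} \<rightarrow>\<^sub>E carrier (stalk_ring R P)" "c0 \<in> {..<m} \<rightarrow>\<^sub>E carrier (stalk_ring R P)"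
    using c1 c0 by (auto simp: c1_def c0_def)
  ultimately have "c1 = c0"
    using 0 1 by (metis (no_types, lifting))
  then have "c k = \<zero>\<^bsub>stalk_ring R P\<^esub>"
    using k by (metis c1_def c0_def lessThan_iff restrict_apply')
  then show ?thesis
    by (simp add: stalk_ring_zero_one(2)[OF P])
qed

end

end

lemma Fract_sum:
  fixes d :: "'a::idom"
  assumes d: "d \<noteq> 0"
  shows "(\<Sum>i\<in>I. Fract (f i) d) = Fract (\<Sum>i\<in>I. f i) d"
proof -
  have add: "Fract a d + Fract b d = Fract (a + b) d" for a b
    using d by (simp add: eq_fract algebra_simps)
  have zero: "Fract 0 d = 0"
    by (simp add: fract_collapse)
  show ?thesis
    by (induction I rule: infinite_finite_induct) (simp_all add: add zero)
qed

lemma common_denominator: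
  fixes x :: "'i \<Rightarrow> 'a::idom fract"
  assumes "finite I"
  shows "\<exists>b y. b \<noteq> 0 \<and> (\<forall>i\<in>I. x i = Fract (y i) b)"
proof -
  have "\<exists>a b. x i = Fract a b \<and> b \<noteq> 0" for i
    by (cases "x i") blast
  then obtain p q where pq: "\<And>i. x i = Fract (p i) (q i)" "\<And>i. q i \<noteq> 0"
    by metis
  have nz: "prod q J \<noteq> 0" if "finite J" for J
    using that pq(2) by (simp add: prod_zero_iff)
  have "x i = Fract (p i * prod q (I - {i})) (prod q I)" if "i \<in> I" for i
  proof -
    have "prod q I = q i * prod q (I - {i})"
      by (rule prod.remove[OF assms that])
    then show ?thesis
      unfolding pq(1) using pq(2)[of i] nz[of "I - {i}"] assms by (simp add: eq_fract)
  qed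
  then show ?thesis
    using nz[OF assms] by (intro exI[of _ "prod q I"] exI[of _ "\<lambda>i. p i * prod q (I - {i})"]) blast
qed

section \<open>The module of twisted invariants\<close>

text \<open>
  The entries of the cocycle are constants. Derivations annihilate constants, so that differentiating
  the entries of a vector respects the twisted action.
\<close>

locale twisted_algebra = twisted_action \<G> act n r
  for \<G> :: "('g, 'x) monoid_scheme" (structure) and act :: "'g \<Rightarrow> 'a::idom \<Rightarrow> 'a"
    and n :: nat and r :: "'g \<Rightarrow> 'a mat" +
  fixes F :: "'a set"
  assumes F_invariants: "F \<subseteq> invariants"
    and r_F: "g \<in> carrier \<G> \<Longrightarrow> i < n \<Longrightarrow> j < n \<Longrightarrow> r g $$ (i, j) \<in> F"
begin

sublocale ring_with_constants invariants F
  by unfold_locales (simp_all add: invariants_closed F_invariants)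

definition W :: "('a, 'a vec) module" where
  "W = (module_vec TYPE('a) n)\<lparr>carrier := twisted_invariants\<rparr>"

lemma W_simps [simp]:
  "carrier W = twisted_invariants" "\<zero>\<^bsub>W\<^esub> = 0\<^sub>v n" "add W = (+)" "module.smult W = (\<cdot>\<^sub>v)"
  by (simp_all add: W_def module_vec_def)

text \<open>
  The entries are extended by zero so that all natural numbers index coordinates.
\<close>

definition vec_emb :: "'a vec \<Rightarrow> nat \<Rightarrow> 'a" where
  "vec_emb w i = (if i < n then w $ i else 0)"

lemma W_dim [simp]: "w \<in> twisted_invariants \<Longrightarrow> dim_vec w = n"
  using twisted_invariants_carrier by auto

sublocale W: torsion_free_module invariants W vec_emb
proof unfold_locales
  show "x = y" if "x \<in> carrier W" "y \<in> carrier W" "\<And>i. vec_emb x i = vec_emb y i" for x y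
  proof (rule eq_vecI)
    show "x $ i = y $ i" if "i < dim_vec y" for i
      using \<open>vec_emb x i = vec_emb y i\<close> that \<open>y \<in> carrier W\<close> by (simp add: vec_emb_def)
  qed (use that in simp)
qed (auto simp: twisted_invariants_closed vec_emb_def)

lemma W_minus:
  assumes "v \<in> twisted_invariants" "w \<in> twisted_invariants"
  shows "v \<ominus>\<^bsub>W\<^esub> w = v - w"
proof (rule eq_vecI)
  have c: "v \<ominus>\<^bsub>W\<^esub> w \<in> twisted_invariants"
    using W.M_minus_closed assms by simp
  then show "dim_vec (v \<ominus>\<^bsub>W\<^esub> w) = dim_vec (v - w)"
    using assms by simp
  fix i assume "i < dim_vec (v - w)"
  then have i: "i < n" using assms by simp
  have "vec_emb (v \<ominus>\<^bsub>W\<^esub> w) i = vec_emb v i - vec_emb w i"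
    using assms by (intro W.emb_minus) simp_all
  then show "(v \<ominus>\<^bsub>W\<^esub> w) $ i = (v - w) $ i"
    using i assms by (simp add: vec_emb_def)
qed

lemma W_minus_closed:
  assumes "v \<in> twisted_invariants" "w \<in> twisted_invariants"
  shows "v - w \<in> twisted_invariants"
  using W.M_minus_closed[of v w] assms by (simp add: W_minus)

section \<open>Traces over a stalk and over the field of fractions\<close>

text \<open>
  A basis \<open>e\<close> of the stalk of \<open>W\<close> is also a basis of the space of vectors of length \<open>n\<close> over the field
  of fractions. It generates because the twisted invariants do. It is independent because a relation
  with arbitrary coefficients can be averaged over the group to relations with invariant coefficients,
  and a dual system recovers the coefficients from these averages. So the trace over the local ring
  may be computed in the standard coordinates.
\<close>

context
  fixes P m and e :: "nat \<Rightarrow> ('a vec \<times> 'a) set"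
  assumes P: "P \<in> Spec R" and basis: "is_basis (stalk_ring R P) (stalk R W P) m e"
begin

private definition S where "S i k = W.val (e k) i"

private lemma basis_generates:
  "\<exists>T. \<forall>i<n. \<forall>j<n. (\<Sum>k<m. S i k * T k j) = (if i = j then 1 else 0)"
proof -
  obtain I0 :: "'g set set" and u e0 d where dual: "dual_system I0 u e0 d" and d: "d \<noteq> 0"
    using dual_system_exists by blast
  define q where "q l j = vtransfer (e0 l \<cdot>\<^sub>v unit_vec n j)" for l j
  have q: "q l j \<in> twisted_invariants" for l j
    unfolding q_def by (rule vtransfer_invariant) simp
  have one: "1 \<in> invariants - P"
    using Spec_D(3)[OF P] by (simp add: invariants_closed)
  define x where "x l j = quot W P (q l j) 1" for l j
  have x: "x l j \<in> carrier (stalk R W P)" for l j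
    unfolding x_def using q one by (intro quot_carrier) simp_all
  have x_val: "W.val (x l j) i = Fract (q l j $ i) 1" if "i < n" for l j i
    unfolding x_def using W.frac_val_frac[OF P, of "q l j" 1 i] q one that by (simp add: vec_emb_def)
  define c where "c l j k = rval (coordinates (stalk_ring R P) (stalk R W P) m e (x l j) k)" for l j k
  have c: "W.val (x l j) i = (\<Sum>k<m. c l j k * S i k)" for l j i
    unfolding c_def S_def by (rule W.basis_coordinates(2)[OF P basis x])
  define T where "T k j = (\<Sum>l\<in>I0. Fract (u l) d * c l j k)" for k j
  have "(\<Sum>k<m. S i k * T k j) = (if i = j then 1 else 0)" if i: "i < n" and j: "j < n" for i j
  proof -
    have "(\<Sum>k<m. S i k * T k j) = (\<Sum>l\<in>I0. Fract (u l) d * (\<Sum>k<m. c l j k * S i k))"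
      by (simp add: T_def sum_distrib_left mult_ac) (rule sum.swap)
    also have "\<dots> = (\<Sum>l\<in>I0. Fract (u l * q l j $ i) d)"
      using i by (simp flip: c add: x_val)
    also have "\<dots> = Fract (\<Sum>l\<in>I0. u l * q l j $ i) d"
      by (rule Fract_sum[OF d])
    also have "(\<Sum>l\<in>I0. u l * q l j $ i) = d * unit_vec n j $ i"
      unfolding q_def by (rule dual_expand_vec[OF dual _ i]) simp
    also have "Fract (d * unit_vec n j $ i) d = (if i = j then 1 else 0)"
    proof (cases "i = j")
      case True
      then show ?thesis
        using d i j by (simp add: One_fract_def eq_fract)
    next
      case False
      then show ?thesis
        using i j by (simp add: fract_collapse)
    qed
    finally show ?thesis .
  qed
  then show ?thesis by blast
qed

private lemma basis_independent_fractions: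
  assumes zero: "\<And>i. i < n \<Longrightarrow> (\<Sum>k<m. x k * S i k) = 0" and k: "k < m"
  shows "x k = 0"
proof -
  obtain I0 :: "'g set set" and u e0 d where dual: "dual_system I0 u e0 d" and d: "d \<noteq> 0"
    using dual_system_exists by blast
  have "\<exists>w s. w \<in> twisted_invariants \<and> s \<in> invariants - P \<and> e k = quot W P w s" if "k < m" for k
  proof -
    have "e k \<in> carrier (stalk R W P)"
      using basis that unfolding is_basis_def by blast
    then show ?thesis
      by (rule stalk_cases) auto
  qed
  then obtain w s where ws: "\<And>k. k < m \<Longrightarrow> w k \<in> twisted_invariants \<and> s k \<in> invariants - P \<and> e k = quot W P (w k) (s k)"
    by metis
  have s0: "s k \<noteq> 0" if "k < m" for k
    using Spec_D(5)[OF P] ws[OF that] by blast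
  have S: "S i k = Fract (w k $ i) (s k)" if "k < m" "i < n" for k i
    using ws[OF that(1)] W.frac_val_frac[OF P, of "w k" "s k" i] that(2) by (simp add: S_def vec_emb_def)
  obtain b y where b: "b \<noteq> 0" and y: "\<And>k. k < m \<Longrightarrow> x k * Fract 1 (s k) = Fract (y k) b"
    using common_denominator[of "{..<m}" "\<lambda>k. x k * Fract 1 (s k)"] by auto
  have rel: "(\<Sum>k<m. y k * w k $ i) = 0" if i: "i < n" for i
  proof -
    have "Fract (\<Sum>k<m. y k * w k $ i) b = (\<Sum>k<m. Fract (y k * w k $ i) b)"
      by (rule Fract_sum[OF b, symmetric])
    also have "\<dots> = (\<Sum>k<m. x k * S i k)"
    proof (intro sum.cong refl)
      fix k assume "k \<in> {..<m}"
      then have k: "k < m" by simp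
      have "Fract (y k * w k $ i) b = Fract (y k) b * Fract (w k $ i) 1" by simp
      also have "\<dots> = x k * (Fract 1 (s k) * Fract (w k $ i) 1)"
        by (simp only: y[OF k, symmetric] mult.assoc)
      finally show "Fract (y k * w k $ i) b = x k * S i k"
        by (simp add: S[OF k i])
    qed
    also have "\<dots> = 0" by (rule zero[OF i])
    finally show ?thesis using b by (simp add: Zero_fract_def eq_fract)
  qed
  \<comment> \<open>The relation survives every element of the group, hence also averaging.\<close>
  have rel_act: "(\<Sum>k<m. act g (y k) * w k $ i) = 0" if g: "g \<in> carrier \<G>" and i: "i < n" for g i
  proof -
    have "(\<Sum>k<m. act g (y k) * w k $ i) = (\<Sum>k<m. act g (y k) * (\<Sum>j<n. r g $$ (i, j) * act g (w k $ j)))"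
      using ws twist_nth[OF g twisted_invariants_carrier i] twisted_invariants_twist[OF _ g]
      by (intro sum.cong refl) (metis lessThan_iff)
    also have "\<dots> = (\<Sum>j<n. r g $$ (i, j) * act g (\<Sum>k<m. y k * w k $ j))"
      by (simp add: act_sum[OF g] act_mult[OF g] sum_distrib_left mult_ac) (rule sum.swap)
    also have "\<dots> = 0"
      by (simp add: rel act_0[OF g])
    finally show ?thesis .
  qed
  have tr: "transfer (a * y k) = 0" if k: "k < m" for a k
  proof -
    define c where "c k = quot (regular_module R) P (transfer (a * y k) * s k) 1" for k
    have B: "transfer (a * y k) * s k \<in> invariants" "1 \<in> invariants - P" if "k < m" for k
      using ws[OF that] Spec_D(3)[OF P] by (simp_all add: invariants_closed transfer_invariant)
    have c: "\<forall>k<m. c k \<in> carrier (stalk_ring R P)"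
      unfolding c_def stalk_ring_simps using B by (intro allI impI quot_carrier) simp_all
    have c_val: "rval (c k) = Fract (transfer (a * y k) * s k) 1" if "k < m" for k
      unfolding c_def by (rule rval_frac[OF P B[OF that]])
    have "(\<Sum>k<m. rval (c k) * W.val (e k) i) = 0" for i
    proof (cases "i < n")
      case True
      have "(\<Sum>k<m. rval (c k) * W.val (e k) i) = (\<Sum>k<m. Fract (transfer (a * y k) * w k $ i) 1)"
        using True s0 by (intro sum.cong refl) (simp add: c_val S[unfolded S_def] eq_fract)
      also have "\<dots> = Fract (\<Sum>k<m. transfer (a * y k) * w k $ i) 1"
        by (rule Fract_sum) simp
      also have "(\<Sum>k<m. transfer (a * y k) * w k $ i) = (\<Sum>g\<in>carrier \<G>. act g a * (\<Sum>k<m. act g (y k) * w k $ i))"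
        by (simp add: transfer_def act_mult sum_distrib_left sum_distrib_right mult_ac) (rule sum.swap)
      also have "\<dots> = 0"
        by (simp add: rel_act True)
      finally show ?thesis by (simp add: fract_collapse)
    next
      case False
      then have "W.val (e k) i = 0" if "k < m" for k
        using ws[OF that] W.frac_val_frac[OF P, of "w k" "s k" i] by (simp add: vec_emb_def fract_collapse)
      then show ?thesis by simp
    qed
    from W.basis_independent[OF P basis c this k] show ?thesis
      using s0[OF k] by (simp add: c_val[OF k] Zero_fract_def eq_fract)
  qed
  have "d * y k = 0"
    using tr[OF k] dual_expand[OF dual, of "y k"] by simp
  then have "x k * Fract 1 (s k) = 0"
    using d y[OF k] by (simp add: fract_collapse)
  moreover have "Fract 1 (s k) \<noteq> 0"
    using s0[OF k] by (simp add: Zero_fract_def eq_fract)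
  ultimately show ?thesis by simp
qed

lemma trace_of_coordinates:
  assumes \<phi>: "\<And>z. z \<in> carrier (stalk R W P) \<Longrightarrow> \<phi> z \<in> carrier (stalk R W P)"
    and K: "\<And>z i. z \<in> carrier (stalk R W P) \<Longrightarrow> i < n \<Longrightarrow> W.val (\<phi> z) i = (\<Sum>j<n. K i j * W.val z j)"
  shows "(\<Sum>k<m. rval (coordinates (stalk_ring R P) (stalk R W P) m e (\<phi> (e k)) k)) = (\<Sum>i<n. K i i)"
proof -
  have e: "e k \<in> carrier (stalk R W P)" if "k < m" for k
    using basis that unfolding is_basis_def by blast
  define N where "N l k = rval (coordinates (stalk_ring R P) (stalk R W P) m e (\<phi> (e k)) l)" for l k
  have KS: "(\<Sum>j<n. K i j * S j k) = (\<Sum>l<m. S i l * N l k)" if "i < n" "k < m" for i k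
    using K[OF e[OF that(2)] that(1)] W.basis_coordinates(2)[OF P basis \<phi>[OF e[OF that(2)]], of i]
    unfolding S_def N_def by (simp add: mult.commute)
  obtain T where ST: "\<And>i j. i < n \<Longrightarrow> j < n \<Longrightarrow> (\<Sum>k<m. S i k * T k j) = (if i = j then 1 else 0)"
    using basis_generates by blast
  have TS: "(\<Sum>j<n. T k j * S j l) = (if k = l then 1 else 0)" if k: "k < m" and l: "l < m" for k l
  proof -
    define x where "x k = (\<Sum>j<n. T k j * S j l) - (if k = l then 1 else 0)" for k
    have "(\<Sum>k<m. x k * S i k) = 0" if i: "i < n" for i
    proof -
      have "x k * S i k = (\<Sum>j<n. S i k * T k j * S j l) - (if k = l then S i l else 0)" for k
        by (simp add: x_def sum_distrib_left algebra_simps)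
      then have "(\<Sum>k<m. x k * S i k) = (\<Sum>k<m. \<Sum>j<n. S i k * T k j * S j l) - S i l"
        using l by (simp add: sum_subtractf)
      also have "(\<Sum>k<m. \<Sum>j<n. S i k * T k j * S j l) = (\<Sum>j<n. (\<Sum>k<m. S i k * T k j) * S j l)"
        unfolding sum_distrib_right by (rule sum.swap)
      also have "\<dots> = (\<Sum>j<n. if i = j then S j l else 0)"
        by (rule sum.cong) (simp_all add: ST i)
      also have "\<dots> = S i l"
        using i by simp
      finally show ?thesis by simp
    qed
    from basis_independent_fractions[OF this k] show ?thesis
      by (simp add: x_def)
  qed
  have "(\<Sum>j<n. K i j * (\<Sum>k<m. S j k * T k i)) = K i i" if i: "i < n" for i
  proof -
    have "(\<Sum>j<n. K i j * (\<Sum>k<m. S j k * T k i)) = (\<Sum>j<n. if j = i then K i j else 0)"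
      by (rule sum.cong) (simp_all add: ST i)
    then show ?thesis using i by simp
  qed
  then have "(\<Sum>i<n. K i i) = (\<Sum>i<n. \<Sum>j<n. K i j * (\<Sum>k<m. S j k * T k i))"
    by simp
  also have "\<dots> = (\<Sum>i<n. \<Sum>k<m. (\<Sum>j<n. K i j * S j k) * T k i)"
    unfolding sum_distrib_left sum_distrib_right mult.assoc
    by (rule sum.cong[OF refl], rule sum.swap)
  also have "\<dots> = (\<Sum>i<n. \<Sum>k<m. \<Sum>l<m. N l k * (T k i * S i l))"
    by (rule sum.cong[OF refl], rule sum.cong[OF refl]) (simp add: KS sum_distrib_left ac_simps)
  also have "\<dots> = (\<Sum>k<m. \<Sum>i<n. \<Sum>l<m. N l k * (T k i * S i l))"
    by (rule sum.swap)
  also have "\<dots> = (\<Sum>k<m. \<Sum>l<m. N l k * (\<Sum>i<n. T k i * S i l))"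
    unfolding sum_distrib_left by (rule sum.cong[OF refl], rule sum.swap)
  also have "\<dots> = (\<Sum>k<m. N k k)"
  proof (rule sum.cong[OF refl])
    fix k assume "k \<in> {..<m}"
    then have k: "k < m" by simp
    have "(\<Sum>l<m. N l k * (\<Sum>i<n. T k i * S i l)) = (\<Sum>l<m. if k = l then N l k else 0)"
      by (rule sum.cong) (simp_all add: TS k)
    then show "(\<Sum>l<m. N l k * (\<Sum>i<n. T k i * S i l)) = N k k"
      using k by simp
  qed
  finally show ?thesis by (simp add: N_def)
qed

end

lemma module_trace_value:
  assumes P: "P \<in> locally_free_locus R W"
    and \<phi>: "\<And>z. z \<in> carrier (stalk R W P) \<Longrightarrow> \<phi> z \<in> carrier (stalk R W P)"
    and K: "\<And>z i. z \<in> carrier (stalk R W P) \<Longrightarrow> i < n \<Longrightarrow> W.val (\<phi> z) i = (\<Sum>j<n. K i j * W.val z j)"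
  shows "rval (module_trace (stalk_ring R P) (stalk R W P) \<phi>) = (\<Sum>i<n. K i i)"
    and "module_trace (stalk_ring R P) (stalk R W P) \<phi> \<in> carrier (stalk_ring R P)"
proof -
  obtain V where "zariski_open R V" "P \<in> V"
    using P unfolding locally_free_locus_def by blast
  then have PS: "P \<in> Spec R"
    using zariski_open_subset by blast
  obtain m e where me: "(m, e) = (SOME (m, e). is_basis (stalk_ring R P) (stalk R W P) m e)"
    by (metis surj_pair)
  have "\<exists>me. case me of (m, e) \<Rightarrow> is_basis (stalk_ring R P) (stalk R W P) m e"
    using locally_free_stalk_basis[OF W.torsion_free_module_axioms P] by simp
  from someI_ex[OF this] have basis: "is_basis (stalk_ring R P) (stalk R W P) m e"
    unfolding me[symmetric] by simp
  have e: "e k \<in> carrier (stalk R W P)" if "k < m" for k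
    using basis that unfolding is_basis_def by blast
  have tr: "module_trace (stalk_ring R P) (stalk R W P) \<phi> =
      (\<Oplus>\<^bsub>stalk_ring R P\<^esub>k\<in>{..<m}. coordinates (stalk_ring R P) (stalk R W P) m e (\<phi> (e k)) k)"
    unfolding module_trace_def me[symmetric] by simp
  have c: "coordinates (stalk_ring R P) (stalk R W P) m e (\<phi> (e k)) k \<in> carrier (stalk_ring R P)" if "k \<in> {..<m}" for k
    using W.basis_coordinates(1)[OF PS basis \<phi>[OF e]] that by simp
  show "rval (module_trace (stalk_ring R P) (stalk R W P) \<phi>) = (\<Sum>i<n. K i i)"
  proof -
    have "rval (module_trace (stalk_ring R P) (stalk R W P) \<phi>) =
        (\<Sum>k<m. rval (coordinates (stalk_ring R P) (stalk R W P) m e (\<phi> (e k)) k))"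
      unfolding tr by (rule rval_finsum[OF PS finite_lessThan]) (rule c)
    also have "\<dots> = (\<Sum>i<n. K i i)"
      by (rule trace_of_coordinates[OF PS basis \<phi> K])
    finally show ?thesis .
  qed
  have "abelian_monoid (stalk_ring R P)"
    by (rule abelian_group.axioms(1)[OF ring.axioms(1)[OF cring.axioms(1)[OF cring_stalk_ring[OF PS]]]])
  then show "module_trace (stalk_ring R P) (stalk R W P) \<phi> \<in> carrier (stalk_ring R P)"
    unfolding tr using c by (intro abelian_monoid.finsum_closed) auto
qed

end

context twisted_algebra
begin

section \<open>The flat connection\<close>

context
  fixes \<delta> assumes \<delta>: "\<delta> \<in> derivations F R"
begin

lemma derivation_on_invariants: "derivation_on invariants \<delta>"
  using derivations_D[OF \<delta>] by (simp add: derivation_on_def)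

lemma lift_restrict: "b \<in> invariants \<Longrightarrow> extension \<delta> b = \<delta> b"
  by (rule extension(2)[OF derivation_on_invariants])

lemma lift_add: "extension \<delta> (a + b) = extension \<delta> a + extension \<delta> b"
  and lift_mult: "extension \<delta> (a * b) = a * extension \<delta> b + extension \<delta> a * b"
  using extension(1)[OF derivation_on_invariants] by (simp_all add: derivation_on_def)

lemma lift_act: "g \<in> carrier \<G> \<Longrightarrow> act g (extension \<delta> a) = extension \<delta> (act g a)"
  by (rule extension_act[OF derivation_on_invariants derivations_D(1)[OF \<delta>]])

lemma lift_0: "extension \<delta> 0 = 0"
  using lift_add[of 0 0] by (metis add.right_neutral add_left_cancel)

lemma lift_sum: "extension \<delta> (\<Sum>k\<in>J. f k) = (\<Sum>k\<in>J. extension \<delta> (f k))"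
  by (induction J rule: infinite_finite_induct) (simp_all add: lift_0 lift_add)

lemma lift_const:
  assumes "c \<in> F"
  shows "extension \<delta> c = 0"
proof -
  have c: "c \<in> invariants" using assms F_invariants by blast
  have one: "1 \<in> invariants" by (simp add: invariants_closed)
  have "\<delta> (1 * 1) = \<delta> 1 + \<delta> 1"
    using derivations_D(4)[OF \<delta> one one] by simp
  then have "\<delta> 1 = 0" by (metis add.right_neutral add_left_cancel mult_1)
  then have "\<delta> c = 0"
    using derivations_D(3)[OF \<delta> assms one] by simp
  then show ?thesis by (simp add: lift_restrict[OF c])
qed

end

lemma lift_D_add:
  assumes \<delta>: "\<delta> \<in> derivations F R" and \<eta>: "\<eta> \<in> derivations F R"
  shows "\<delta> \<oplus>\<^bsub>D\<^esub> \<eta> \<in> derivations F R" "extension (\<delta> \<oplus>\<^bsub>D\<^esub> \<eta>) a = extension \<delta> a + extension \<eta> a"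
proof -
  interpret D: torsion_free_module invariants D der_emb by (rule derivation_torsion_free)
  show der: "\<delta> \<oplus>\<^bsub>D\<^esub> \<eta> \<in> derivations F R"
    using D.M_closed(2)[of \<delta> \<eta>] \<delta> \<eta> by (simp add: D_simps(1))
  have "extension (\<delta> \<oplus>\<^bsub>D\<^esub> \<eta>) = (\<lambda>a. extension \<delta> a + extension \<eta> a)"
  proof (rule derivation_eqI)
    show "derivation_on UNIV (extension (\<delta> \<oplus>\<^bsub>D\<^esub> \<eta>))"
      by (rule extension(1)[OF derivation_on_invariants[OF der]])
    show "derivation_on UNIV (\<lambda>a. extension \<delta> a + extension \<eta> a)"
      by (simp add: derivation_on_def lift_add[OF \<delta>] lift_add[OF \<eta>] lift_mult[OF \<delta>] lift_mult[OF \<eta>] algebra_simps)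
    show "extension (\<delta> \<oplus>\<^bsub>D\<^esub> \<eta>) b = extension \<delta> b + extension \<eta> b" if "b \<in> invariants" for b
      unfolding lift_restrict[OF der that] lift_restrict[OF \<delta> that] lift_restrict[OF \<eta> that]
      unfolding D_simps using that by simp
  qed
  then show "extension (\<delta> \<oplus>\<^bsub>D\<^esub> \<eta>) a = extension \<delta> a + extension \<eta> a" by (rule fun_cong)
qed

lemma lift_D_smult:
  assumes \<delta>: "\<delta> \<in> derivations F R" and c: "c \<in> invariants"
  shows "c \<odot>\<^bsub>D\<^esub> \<delta> \<in> derivations F R" "extension (c \<odot>\<^bsub>D\<^esub> \<delta>) a = c * extension \<delta> a"
proof -
  interpret D: torsion_free_module invariants D der_emb by (rule derivation_torsion_free)
  show der: "c \<odot>\<^bsub>D\<^esub> \<delta> \<in> derivations F R"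
    using D.M_closed(3)[of c \<delta>] \<delta> c by (simp add: D_simps(1))
  have "extension (c \<odot>\<^bsub>D\<^esub> \<delta>) = (\<lambda>a. c * extension \<delta> a)"
  proof (rule derivation_eqI)
    show "derivation_on UNIV (extension (c \<odot>\<^bsub>D\<^esub> \<delta>))"
      by (rule extension(1)[OF derivation_on_invariants[OF der]])
    show "derivation_on UNIV (\<lambda>a. c * extension \<delta> a)"
      by (simp add: derivation_on_def lift_add[OF \<delta>] lift_mult[OF \<delta>] algebra_simps)
    show "extension (c \<odot>\<^bsub>D\<^esub> \<delta>) b = c * extension \<delta> b" if "b \<in> invariants" for b
      unfolding lift_restrict[OF der that] lift_restrict[OF \<delta> that]
      unfolding D_simps using that by simp
  qed
  then show "extension (c \<odot>\<^bsub>D\<^esub> \<delta>) a = c * extension \<delta> a" by (rule fun_cong)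
qed

lemma lift_bracket:
  assumes \<delta>: "\<delta> \<in> derivations F R" and \<eta>: "\<eta> \<in> derivations F R"
  shows "extension (lie_bracket R \<delta> \<eta>) a = extension \<delta> (extension \<eta> a) - extension \<eta> (extension \<delta> a)"
proof -
  note der = lie_bracket_derivation[OF \<delta> \<eta>]
  have "extension (lie_bracket R \<delta> \<eta>) = (\<lambda>a. extension \<delta> (extension \<eta> a) - extension \<eta> (extension \<delta> a))"
  proof (rule derivation_eqI)
    show "derivation_on UNIV (extension (lie_bracket R \<delta> \<eta>))"
      by (rule extension(1)[OF derivation_on_invariants[OF der]])
    show "derivation_on UNIV (\<lambda>a. extension \<delta> (extension \<eta> a) - extension \<eta> (extension \<delta> a))"
      by (simp add: derivation_on_def lift_add[OF \<delta>] lift_add[OF \<eta>] lift_mult[OF \<delta>] lift_mult[OF \<eta>] algebra_simps)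
    show "extension (lie_bracket R \<delta> \<eta>) b = extension \<delta> (extension \<eta> b) - extension \<eta> (extension \<delta> b)"
      if b: "b \<in> invariants" for b
      using b derivations_D(1)[OF \<delta> b] derivations_D(1)[OF \<eta> b]
      by (simp add: lift_restrict[OF der] lift_restrict[OF \<delta>] lift_restrict[OF \<eta>] lie_bracket_value[OF \<delta> \<eta>])
  qed
  then show ?thesis by (rule fun_cong)
qed

definition flat_connection :: "('a \<Rightarrow> 'a) \<Rightarrow> 'a vec \<Rightarrow> 'a vec" where
  "flat_connection \<delta> = (\<lambda>w\<in>twisted_invariants. map_vec (extension \<delta>) w)"

lemma flat_connection_nth:
  "w \<in> twisted_invariants \<Longrightarrow> i < n \<Longrightarrow> flat_connection \<delta> w $ i = extension \<delta> (w $ i)"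
  by (simp add: flat_connection_def)

text \<open>
  The extended derivation commutes with the group and kills the entries of the cocycle.
\<close>

lemma flat_connection_closed:
  assumes \<delta>: "\<delta> \<in> derivations F R" and w: "w \<in> twisted_invariants"
  shows "flat_connection \<delta> w \<in> twisted_invariants"
proof -
  note wc = twisted_invariants_carrier[OF w]
  have flat: "flat_connection \<delta> w = map_vec (extension \<delta>) w"
    using w by (simp add: flat_connection_def)
  have "twist g (map_vec (extension \<delta>) w) = map_vec (extension \<delta>) w" if g: "g \<in> carrier \<G>" for g
  proof (rule eq_vecI)
    show "dim_vec (twist g (map_vec (extension \<delta>) w)) = dim_vec (map_vec (extension \<delta>) w)"
      using carrier_vecD[OF twist_carrier[OF g]] carrier_vecD[OF wc] by simp
    fix i assume "i < dim_vec (map_vec (extension \<delta>) w)"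
    then have i: "i < n" using carrier_vecD[OF wc] by simp
    have "twist g (map_vec (extension \<delta>) w) $ i = (\<Sum>j<n. r g $$ (i, j) * act g (map_vec (extension \<delta>) w $ j))"
      by (rule twist_nth[OF g _ i]) (use wc in simp)
    also have "\<dots> = (\<Sum>j<n. extension \<delta> (r g $$ (i, j) * act g (w $ j)))"
    proof (rule sum.cong[OF refl])
      fix j assume "j \<in> {..<n}"
      then have j: "j < n" by simp
      show "r g $$ (i, j) * act g (map_vec (extension \<delta>) w $ j) = extension \<delta> (r g $$ (i, j) * act g (w $ j))"
        using j carrier_vecD[OF wc]
        by (simp add: lift_mult[OF \<delta>] lift_const[OF \<delta> r_F[OF g i j]] lift_act[OF \<delta> g])
    qed
    also have "\<dots> = extension \<delta> (twist g w $ i)"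
      by (simp add: lift_sum[OF \<delta>] twist_nth[OF g wc i])
    also have "\<dots> = map_vec (extension \<delta>) w $ i"
      using i carrier_vecD[OF wc] by (simp add: twisted_invariants_twist[OF w g])
    finally show "twist g (map_vec (extension \<delta>) w) $ i = map_vec (extension \<delta>) w $ i" .
  qed
  then show ?thesis
    unfolding flat using wc by (simp add: twisted_invariants_def)
qed

lemma vec_eqI:
  assumes "v \<in> twisted_invariants" "w \<in> twisted_invariants" "\<And>i. i < n \<Longrightarrow> v $ i = w $ i"
  shows "v = w"
  using assms by (intro eq_vecI) simp_all

lemma flat_connection_leibniz:
  assumes \<delta>: "\<delta> \<in> derivations F R" and b: "b \<in> invariants" and w: "w \<in> twisted_invariants"
  shows "flat_connection \<delta> (b \<cdot>\<^sub>v w) = b \<cdot>\<^sub>v flat_connection \<delta> w + \<delta> b \<cdot>\<^sub>v w"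
proof (rule vec_eqI)
  note c = twisted_invariants_closed flat_connection_closed[OF \<delta>] derivations_D(1)[OF \<delta> b] b w
  show "flat_connection \<delta> (b \<cdot>\<^sub>v w) \<in> twisted_invariants"
    "b \<cdot>\<^sub>v flat_connection \<delta> w + \<delta> b \<cdot>\<^sub>v w \<in> twisted_invariants"
    by (simp_all add: c)
  show "flat_connection \<delta> (b \<cdot>\<^sub>v w) $ i = (b \<cdot>\<^sub>v flat_connection \<delta> w + \<delta> b \<cdot>\<^sub>v w) $ i" if "i < n" for i
    using that by (simp add: c flat_connection_nth lift_mult[OF \<delta>] lift_restrict[OF \<delta> b])
qed

lemma linear_endos_iff:
  "\<phi> \<in> linear_endos F W \<longleftrightarrow> \<phi> \<in> twisted_invariants \<rightarrow>\<^sub>E twisted_invariants \<and>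
     (\<forall>v\<in>twisted_invariants. \<forall>w\<in>twisted_invariants. \<phi> (v + w) = \<phi> v + \<phi> w) \<and>
     (\<forall>c\<in>F. \<forall>w\<in>twisted_invariants. \<phi> (c \<cdot>\<^sub>v w) = c \<cdot>\<^sub>v \<phi> w)"
  by (simp add: linear_endos_def)

lemma linear_endosD:
  assumes "\<phi> \<in> linear_endos F W" "w \<in> twisted_invariants"
  shows "\<phi> w \<in> twisted_invariants" "v \<in> twisted_invariants \<Longrightarrow> \<phi> (v + w) = \<phi> v + \<phi> w"
    "c \<in> F \<Longrightarrow> \<phi> (c \<cdot>\<^sub>v w) = c \<cdot>\<^sub>v \<phi> w"
  using assms by (auto simp: linear_endos_iff PiE_iff)

lemma flat_connection_linear_endo:
  assumes \<delta>: "\<delta> \<in> derivations F R"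
  shows "flat_connection \<delta> \<in> linear_endos F W"
  unfolding linear_endos_iff
proof (intro conjI ballI)
  have "flat_connection \<delta> \<in> extensional twisted_invariants"
    by (simp add: flat_connection_def)
  then show "flat_connection \<delta> \<in> twisted_invariants \<rightarrow>\<^sub>E twisted_invariants"
    using flat_connection_closed[OF \<delta>] by (simp add: PiE_iff)
  note c = twisted_invariants_closed flat_connection_closed[OF \<delta>]
  show "flat_connection \<delta> (v + w) = flat_connection \<delta> v + flat_connection \<delta> w"
    if "v \<in> twisted_invariants" "w \<in> twisted_invariants" for v w
  proof (rule vec_eqI)
    show "flat_connection \<delta> (v + w) $ i = (flat_connection \<delta> v + flat_connection \<delta> w) $ i" if "i < n" for i
      using that \<open>v \<in> _\<close> \<open>w \<in> _\<close> by (simp add: c flat_connection_nth lift_add[OF \<delta>])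
  qed (simp_all add: c that)
  show "flat_connection \<delta> (k \<cdot>\<^sub>v w) = k \<cdot>\<^sub>v flat_connection \<delta> w" if k: "k \<in> F" and w: "w \<in> twisted_invariants" for k w
  proof (rule vec_eqI)
    have k': "k \<in> invariants" using k F_invariants by blast
    then show "flat_connection \<delta> (k \<cdot>\<^sub>v w) \<in> twisted_invariants" "k \<cdot>\<^sub>v flat_connection \<delta> w \<in> twisted_invariants"
      by (simp_all add: c w)
    show "flat_connection \<delta> (k \<cdot>\<^sub>v w) $ i = (k \<cdot>\<^sub>v flat_connection \<delta> w) $ i" if "i < n" for i
      using that w k' by (simp add: c flat_connection_nth lift_mult[OF \<delta>] lift_const[OF \<delta> k])
  qed
qed

section \<open>The Kodaira-Spencer map vanishes\<close>

definition inner_derivation :: "('a vec \<Rightarrow> 'a vec) \<Rightarrow> 'a \<Rightarrow> 'a vec \<Rightarrow> 'a vec" where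
  "inner_derivation \<phi> = (\<lambda>b\<in>invariants. \<lambda>w\<in>twisted_invariants. \<phi> (b \<cdot>\<^sub>v w) - b \<cdot>\<^sub>v \<phi> w)"

lemma inner_derivations_eq: "inner_derivations F R W = inner_derivation ` linear_endos F W"
proof -
  have "(\<lambda>b\<in>carrier R. \<lambda>w\<in>carrier W. \<phi> (b \<odot>\<^bsub>W\<^esub> w) \<ominus>\<^bsub>W\<^esub> b \<odot>\<^bsub>W\<^esub> \<phi> w) = inner_derivation \<phi>"
    if "\<phi> \<in> linear_endos F W" for \<phi>
    unfolding inner_derivation_def R_simps W_simps
    by (intro restrict_ext) (simp add: W_minus twisted_invariants_closed linear_endosD[OF that])
  then show ?thesis
    unfolding inner_derivations_def by (rule image_cong[OF refl])
qed

lemma endo_derivations_mult: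
  "X \<otimes>\<^bsub>endo_derivations F R W\<^esub> Y = (\<lambda>b\<in>invariants. \<lambda>w\<in>twisted_invariants. X b w + Y b w)"
  by (simp add: endo_derivations_def R_simps)

lemma inner_derivation_mult:
  assumes \<phi>: "\<phi> \<in> linear_endos F W" and \<psi>: "\<psi> \<in> linear_endos F W"
  shows "inner_derivation (\<lambda>w\<in>twisted_invariants. \<phi> w + \<psi> w) =
    inner_derivation \<phi> \<otimes>\<^bsub>endo_derivations F R W\<^esub> inner_derivation \<psi>"
  unfolding endo_derivations_mult inner_derivation_def
proof (intro restrict_ext)
  fix b w assume b: "b \<in> invariants" and w: "w \<in> twisted_invariants"
  show "(\<lambda>w\<in>twisted_invariants. \<phi> w + \<psi> w) (b \<cdot>\<^sub>v w) - b \<cdot>\<^sub>v (\<lambda>w\<in>twisted_invariants. \<phi> w + \<psi> w) w =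
      (\<lambda>b\<in>invariants. \<lambda>w\<in>twisted_invariants. \<phi> (b \<cdot>\<^sub>v w) - b \<cdot>\<^sub>v \<phi> w) b w +
      (\<lambda>b\<in>invariants. \<lambda>w\<in>twisted_invariants. \<psi> (b \<cdot>\<^sub>v w) - b \<cdot>\<^sub>v \<psi> w) b w"
    using b w
    by (intro eq_vecI) (simp_all add: twisted_invariants_closed linear_endosD[OF \<phi>] linear_endosD[OF \<psi>] algebra_simps)
qed

lemma linear_endos_add:
  assumes \<phi>: "\<phi> \<in> linear_endos F W" and \<psi>: "\<psi> \<in> linear_endos F W"
  shows "(\<lambda>w\<in>twisted_invariants. \<phi> w + \<psi> w) \<in> linear_endos F W"
    "(\<lambda>w\<in>twisted_invariants. \<phi> w - \<psi> w) \<in> linear_endos F W"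
proof -
  note c = twisted_invariants_closed linear_endosD[OF \<phi>] linear_endosD[OF \<psi>] W_minus_closed
  have k: "k \<in> invariants" if "k \<in> F" for k using that F_invariants by blast
  show "(\<lambda>w\<in>twisted_invariants. \<phi> w + \<psi> w) \<in> linear_endos F W"
    unfolding linear_endos_iff
    by (intro conjI ballI) (simp_all add: c k, (intro vec_eqI, simp_all add: c k algebra_simps)+)
  show "(\<lambda>w\<in>twisted_invariants. \<phi> w - \<psi> w) \<in> linear_endos F W"
    unfolding linear_endos_iff
    by (intro conjI ballI) (simp_all add: c k, (intro vec_eqI, simp_all add: c k algebra_simps)+)
qed

lemma inner_derivation_flat_connection:
  assumes \<delta>: "\<delta> \<in> derivations F R"
  shows "(\<lambda>b\<in>carrier R. \<lambda>w\<in>carrier W. \<delta> b \<odot>\<^bsub>W\<^esub> w) = inner_derivation (flat_connection \<delta>)"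
  unfolding inner_derivation_def R_simps W_simps
proof (intro restrict_ext)
  fix b w assume b: "b \<in> invariants" and w: "w \<in> twisted_invariants"
  show "\<delta> b \<cdot>\<^sub>v w = flat_connection \<delta> (b \<cdot>\<^sub>v w) - b \<cdot>\<^sub>v flat_connection \<delta> w"
    using w flat_connection_closed[OF \<delta> w]
    by (intro eq_vecI) (simp_all add: flat_connection_leibniz[OF \<delta> b w])
qed

text \<open>
  By the Leibniz rule, the class of \<open>\<delta>\<close> is represented by the inner derivation of its flat connection.
\<close>

lemma kodaira_spencer_trivial:
  assumes \<delta>: "\<delta> \<in> derivations F R"
  shows "kodaira_spencer F R W \<delta> = inner_derivations F R W"
proof -
  let ?G = "endo_derivations F R W" and ?\<psi> = "flat_connection \<delta>"
  note \<psi> = flat_connection_linear_endo[OF \<delta>]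
  have "\<exists>\<chi>\<in>linear_endos F W. inner_derivation \<phi> = inner_derivation \<chi> \<otimes>\<^bsub>?G\<^esub> inner_derivation ?\<psi>"
    if \<phi>: "\<phi> \<in> linear_endos F W" for \<phi>
  proof
    let ?\<chi> = "\<lambda>w\<in>twisted_invariants. \<phi> w - ?\<psi> w"
    show \<chi>: "?\<chi> \<in> linear_endos F W" by (rule linear_endos_add(2)[OF \<phi> \<psi>])
    have eq: "(\<lambda>w\<in>twisted_invariants. ?\<chi> w + ?\<psi> w) = \<phi>"
    proof (rule extensionalityI[of _ twisted_invariants])
      show "\<phi> \<in> extensional twisted_invariants"
        using \<phi> by (simp add: linear_endos_iff PiE_iff)
      show "(\<lambda>w\<in>twisted_invariants. ?\<chi> w + ?\<psi> w) w = \<phi> w" if w: "w \<in> twisted_invariants" for w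
        using w linear_endosD(1)[OF \<phi> w] linear_endosD(1)[OF \<psi> w]
        by (intro eq_vecI) simp_all
    qed simp
    show "inner_derivation \<phi> = inner_derivation ?\<chi> \<otimes>\<^bsub>?G\<^esub> inner_derivation ?\<psi>"
      unfolding inner_derivation_mult[OF \<chi> \<psi>, symmetric] eq ..
  qed
  moreover have "\<exists>\<chi>\<in>linear_endos F W. inner_derivation \<phi> \<otimes>\<^bsub>?G\<^esub> inner_derivation ?\<psi> = inner_derivation \<chi>"
    if \<phi>: "\<phi> \<in> linear_endos F W" for \<phi>
    unfolding inner_derivation_mult[OF \<phi> \<psi>, symmetric] using linear_endos_add(1)[OF \<phi> \<psi>] by blast
  ultimately have "(\<Union>X\<in>inner_derivation ` linear_endos F W. {X \<otimes>\<^bsub>?G\<^esub> inner_derivation ?\<psi>}) =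
      inner_derivation ` linear_endos F W"
    by fast
  then show ?thesis
    unfolding kodaira_spencer_def inner_derivation_flat_connection[OF \<delta>] inner_derivations_eq r_coset_def .
qed

lemma linear_lie_rinehart_eq: "linear_lie_rinehart F R W = D"
proof -
  have "Coset.kernel (add_monoid D) (HH1 F R W) (kodaira_spencer F R W) = carrier D"
    by (auto simp: Coset.kernel_def HH1_def FactGroup_def D_simps(1) kodaira_spencer_trivial)
  then show ?thesis by (simp add: linear_lie_rinehart_def)
qed

lemma is_connection_iff:
  "is_connection F R W nabla \<longleftrightarrow> nabla \<in> derivations F R \<rightarrow> linear_endos F W \<and>
     (\<forall>\<delta>\<in>derivations F R. \<forall>\<eta>\<in>derivations F R. \<forall>w\<in>twisted_invariants. nabla (\<delta> \<oplus>\<^bsub>D\<^esub> \<eta>) w = nabla \<delta> w + nabla \<eta> w) \<and>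
     (\<forall>a\<in>invariants. \<forall>\<delta>\<in>derivations F R. \<forall>w\<in>twisted_invariants. nabla (a \<odot>\<^bsub>D\<^esub> \<delta>) w = a \<cdot>\<^sub>v nabla \<delta> w) \<and>
     (\<forall>\<delta>\<in>derivations F R. \<forall>b\<in>invariants. \<forall>w\<in>twisted_invariants.
        nabla \<delta> (b \<cdot>\<^sub>v w) = b \<cdot>\<^sub>v nabla \<delta> w + \<delta> b \<cdot>\<^sub>v w)"
  unfolding is_connection_def linear_lie_rinehart_eq Let_def D_simps(1) R_simps W_simps ..

lemma flat_connection: "is_connection F R W flat_connection"
  unfolding is_connection_iff
proof (intro conjI ballI)
  show "flat_connection \<in> derivations F R \<rightarrow> linear_endos F W"
    using flat_connection_linear_endo by blast
  show "flat_connection (\<delta> \<oplus>\<^bsub>D\<^esub> \<eta>) w = flat_connection \<delta> w + flat_connection \<eta> w"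
    if "\<delta> \<in> derivations F R" "\<eta> \<in> derivations F R" "w \<in> twisted_invariants" for \<delta> \<eta> w
    using that by (intro eq_vecI) (simp_all add: flat_connection_def lift_D_add)
  show "flat_connection (a \<odot>\<^bsub>D\<^esub> \<delta>) w = a \<cdot>\<^sub>v flat_connection \<delta> w"
    if "a \<in> invariants" "\<delta> \<in> derivations F R" "w \<in> twisted_invariants" for a \<delta> w
    using that by (intro eq_vecI) (simp_all add: flat_connection_def lift_D_smult)
qed (rule flat_connection_leibniz)

end

context twisted_algebra
begin

section \<open>Connection matrices\<close>

lemma entries_eqI:
  assumes eq: "\<And>w i. w \<in> twisted_invariants \<Longrightarrow> i < n \<Longrightarrow> (\<Sum>j<n. X i j * w $ j) = (\<Sum>j<n. Y i j * w $ j)"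
    and i: "i < n" and j: "j < n"
  shows "X i j = Y i j"
proof -
  have "mat n n (\<lambda>(i, j). X i j) = mat n n (\<lambda>(i, j). Y i j)"
  proof (rule matrix_eqI)
    fix w assume w: "w \<in> twisted_invariants"
    note wc = twisted_invariants_carrier[OF w]
    have nth: "(mat n n (\<lambda>(i, j). Z i j) *\<^sub>v w) $ i = (\<Sum>j<n. Z i j * w $ j)" if "i < n" for Z i
      by (subst mult_mat_vec_nth[OF _ wc that]) (use that in simp_all)
    show "mat n n (\<lambda>(i, j). X i j) *\<^sub>v w = mat n n (\<lambda>(i, j). Y i j) *\<^sub>v w"
    proof (rule eq_vecI)
      fix i assume "i < dim_vec (mat n n (\<lambda>(i, j). Y i j) *\<^sub>v w)"
      then have i: "i < n" by simp
      show "(mat n n (\<lambda>(i, j). X i j) *\<^sub>v w) $ i = (mat n n (\<lambda>(i, j). Y i j) *\<^sub>v w) $ i"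
        unfolding nth[OF i] by (rule eq[OF w i])
    qed simp
  qed simp_all
  then have "mat n n (\<lambda>(i, j). X i j) $$ (i, j) = mat n n (\<lambda>(i, j). Y i j) $$ (i, j)"
    by simp
  then show ?thesis using i j by simp
qed

text \<open>By the cocycle identity, these are the entries of the inverse of \<open>r g\<close>.\<close>

definition r_inv :: "'g \<Rightarrow> nat \<Rightarrow> nat \<Rightarrow> 'a" where
  "r_inv g i j = act g (r (inv g) $$ (i, j))"

lemma r_inv_mult:
  assumes g: "g \<in> carrier \<G>" and i: "i < n" and j: "j < n"
  shows "(\<Sum>k<n. r_inv g i k * r g $$ (k, j)) = (if i = j then 1 else 0)"
proof -
  have inv: "inv g \<in> carrier \<G>" using g by simp
  have "1\<^sub>m n = r (inv g) * map_mat (act (inv g)) (r g)"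
    using r_mult[OF inv g] g by (simp add: r_one)
  then have "1\<^sub>m n $$ (i, j) = (r (inv g) * map_mat (act (inv g)) (r g)) $$ (i, j)"
    by (rule arg_cong)
  also have "\<dots> = (\<Sum>k<n. r (inv g) $$ (i, k) * act (inv g) (r g $$ (k, j)))"
    using r_carrier[OF inv] r_carrier[OF g] i j by (auto simp: scalar_prod_def lessThan_atLeast0 intro!: sum.cong)
  finally have "act g (1\<^sub>m n $$ (i, j)) = act g (\<Sum>k<n. r (inv g) $$ (i, k) * act (inv g) (r g $$ (k, j)))"
    by (rule arg_cong)
  then show ?thesis
    using i j g by (simp add: act_sum act_mult act_cancel_inv r_inv_def act_0 act_1 split: if_splits)
qed

lemma r_inv_act:
  assumes g: "g \<in> carrier \<G>" and w: "w \<in> twisted_invariants" and j: "j < n"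
  shows "act g (w $ j) = (\<Sum>l<n. r_inv g j l * w $ l)"
proof -
  note wc = twisted_invariants_carrier[OF w]
  have w_nth: "w $ l = (\<Sum>k<n. r g $$ (l, k) * act g (w $ k))" if "l < n" for l
    using twist_nth[OF g wc that] twisted_invariants_twist[OF w g] by simp
  have "(\<Sum>l<n. r_inv g j l * w $ l) = (\<Sum>l<n. \<Sum>k<n. r_inv g j l * r g $$ (l, k) * act g (w $ k))"
    by (rule sum.cong[OF refl], subst w_nth) (simp_all add: sum_distrib_left mult.assoc)
  also have "\<dots> = (\<Sum>k<n. (\<Sum>l<n. r_inv g j l * r g $$ (l, k)) * act g (w $ k))"
    unfolding sum_distrib_right by (rule sum.swap)
  also have "\<dots> = (\<Sum>k<n. if j = k then act g (w $ k) else 0)"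
    by (rule sum.cong[OF refl]) (simp add: r_inv_mult[OF g j])
  finally show ?thesis using j by simp
qed

context
  fixes nabla assumes nabla: "is_connection F R W nabla"
begin

lemma connectionD:
  assumes "\<delta> \<in> derivations F R"
  shows "nabla \<delta> \<in> linear_endos F W"
    "\<eta> \<in> derivations F R \<Longrightarrow> w \<in> twisted_invariants \<Longrightarrow> nabla (\<delta> \<oplus>\<^bsub>D\<^esub> \<eta>) w = nabla \<delta> w + nabla \<eta> w"
    "a \<in> invariants \<Longrightarrow> w \<in> twisted_invariants \<Longrightarrow> nabla (a \<odot>\<^bsub>D\<^esub> \<delta>) w = a \<cdot>\<^sub>v nabla \<delta> w"
    "b \<in> invariants \<Longrightarrow> w \<in> twisted_invariants \<Longrightarrow> nabla \<delta> (b \<cdot>\<^sub>v w) = b \<cdot>\<^sub>v nabla \<delta> w + \<delta> b \<cdot>\<^sub>v w"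
  using nabla assms unfolding is_connection_iff by blast+

lemma connection_closed: "\<delta> \<in> derivations F R \<Longrightarrow> w \<in> twisted_invariants \<Longrightarrow> nabla \<delta> w \<in> twisted_invariants"
  by (rule linear_endosD(1)[OF connectionD(1)])

lemma module_map_difference:
  assumes \<delta>: "\<delta> \<in> derivations F R"
  shows "module_map (\<lambda>w. nabla \<delta> w - flat_connection \<delta> w)"
  unfolding module_map_def
proof (intro conjI ballI)
  note flat = flat_connection_linear_endo[OF \<delta>]
  note c = connection_closed[OF \<delta>] flat_connection_closed[OF \<delta>] twisted_invariants_closed
  note W_minus_closed[OF c(1,2)]
  then show "nabla \<delta> w - flat_connection \<delta> w \<in> carrier_vec n" if "w \<in> twisted_invariants" for w
    using that twisted_invariants_carrier by blast
  show "nabla \<delta> (v + w) - flat_connection \<delta> (v + w) = (nabla \<delta> v - flat_connection \<delta> v) + (nabla \<delta> w - flat_connection \<delta> w)"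
    if v: "v \<in> twisted_invariants" and w: "w \<in> twisted_invariants" for v w
    unfolding linear_endosD(2)[OF connectionD(1)[OF \<delta>] w v] linear_endosD(2)[OF flat w v]
    by (rule eq_vecI) (simp_all add: v w c)
  show "nabla \<delta> (b \<cdot>\<^sub>v w) - flat_connection \<delta> (b \<cdot>\<^sub>v w) = b \<cdot>\<^sub>v (nabla \<delta> w - flat_connection \<delta> w)"
    if b: "b \<in> invariants" and w: "w \<in> twisted_invariants" for b w
    unfolding connectionD(4)[OF \<delta> b w] flat_connection_leibniz[OF \<delta> b w]
    by (rule eq_vecI) (simp_all add: w c algebra_simps)
qed

text \<open>
  Two connections differ by a map that is linear over the invariants, and such a map is a matrix.
\<close>

definition connection_matrix :: "('a \<Rightarrow> 'a) \<Rightarrow> nat \<Rightarrow> nat \<Rightarrow> 'a" where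
  "connection_matrix \<delta> i j =
     (SOME M. M \<in> carrier_mat n n \<and> (\<forall>w\<in>twisted_invariants. M *\<^sub>v w = nabla \<delta> w - flat_connection \<delta> w)) $$ (i, j)"

lemma connection_nth:
  assumes \<delta>: "\<delta> \<in> derivations F R" and w: "w \<in> twisted_invariants" and i: "i < n"
  shows "nabla \<delta> w $ i = extension \<delta> (w $ i) + (\<Sum>j<n. connection_matrix \<delta> i j * w $ j)"
proof -
  define M where "M = (SOME M. M \<in> carrier_mat n n \<and> (\<forall>w\<in>twisted_invariants. M *\<^sub>v w = nabla \<delta> w - flat_connection \<delta> w))"
  have "\<exists>M. M \<in> carrier_mat n n \<and> (\<forall>w\<in>twisted_invariants. M *\<^sub>v w = nabla \<delta> w - flat_connection \<delta> w)"
    using matrix_exists[OF module_map_difference[OF \<delta>]] by blast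
  from someI_ex[OF this, folded M_def]
  have M: "M \<in> carrier_mat n n" "M *\<^sub>v w = nabla \<delta> w - flat_connection \<delta> w"
    using w by blast+
  have "(\<Sum>j<n. connection_matrix \<delta> i j * w $ j) = (M *\<^sub>v w) $ i"
    unfolding mult_mat_vec_nth[OF M(1) twisted_invariants_carrier[OF w] i] connection_matrix_def M_def[symmetric] ..
  also have "\<dots> = nabla \<delta> w $ i - extension \<delta> (w $ i)"
    unfolding M(2) using w i flat_connection_closed[OF \<delta> w] by (simp add: flat_connection_nth)
  finally show ?thesis by simp
qed

text \<open>
  The matrix is determined by the connection, so linear relations between connections pass to their
  matrices.
\<close>

lemma connection_matrix_eqI:
  assumes \<delta>: "\<delta> \<in> derivations F R"
    and eq: "\<And>w i. w \<in> twisted_invariants \<Longrightarrow> i < n \<Longrightarrow>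
      nabla \<delta> w $ i = extension \<delta> (w $ i) + (\<Sum>j<n. X i j * w $ j)"
    and i: "i < n" and j: "j < n"
  shows "connection_matrix \<delta> i j = X i j"
proof (rule entries_eqI[OF _ i j])
  fix w i assume w: "w \<in> twisted_invariants" and i: "i < n"
  show "(\<Sum>j<n. connection_matrix \<delta> i j * w $ j) = (\<Sum>j<n. X i j * w $ j)"
    using eq[OF w i] connection_nth[OF \<delta> w i] by simp
qed

lemma connection_matrix_add:
  assumes \<delta>: "\<delta> \<in> derivations F R" and \<eta>: "\<eta> \<in> derivations F R" and i: "i < n" and j: "j < n"
  shows "connection_matrix (\<delta> \<oplus>\<^bsub>D\<^esub> \<eta>) i j = connection_matrix \<delta> i j + connection_matrix \<eta> i j"
proof (rule connection_matrix_eqI[OF lift_D_add(1)[OF \<delta> \<eta>] _ i j])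
  fix w i assume w: "w \<in> twisted_invariants" and i: "i < n"
  have "nabla (\<delta> \<oplus>\<^bsub>D\<^esub> \<eta>) w $ i = nabla \<delta> w $ i + nabla \<eta> w $ i"
    unfolding connectionD(2)[OF \<delta> \<eta> w] using i connection_closed[OF \<eta> w] by simp
  then show "nabla (\<delta> \<oplus>\<^bsub>D\<^esub> \<eta>) w $ i = extension (\<delta> \<oplus>\<^bsub>D\<^esub> \<eta>) (w $ i) +
      (\<Sum>j<n. (connection_matrix \<delta> i j + connection_matrix \<eta> i j) * w $ j)"
    unfolding connection_nth[OF \<delta> w i] connection_nth[OF \<eta> w i] lift_D_add(2)[OF \<delta> \<eta>]
    by (simp add: distrib_right sum.distrib)
qed

lemma connection_matrix_smult:
  assumes \<delta>: "\<delta> \<in> derivations F R" and c: "c \<in> invariants" and i: "i < n" and j: "j < n"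
  shows "connection_matrix (c \<odot>\<^bsub>D\<^esub> \<delta>) i j = c * connection_matrix \<delta> i j"
proof (rule connection_matrix_eqI[OF lift_D_smult(1)[OF \<delta> c] _ i j])
  fix w i assume w: "w \<in> twisted_invariants" and i: "i < n"
  have "nabla (c \<odot>\<^bsub>D\<^esub> \<delta>) w $ i = c * nabla \<delta> w $ i"
    unfolding connectionD(3)[OF \<delta> c w] using i connection_closed[OF \<delta> w] by simp
  then show "nabla (c \<odot>\<^bsub>D\<^esub> \<delta>) w $ i = extension (c \<odot>\<^bsub>D\<^esub> \<delta>) (w $ i) +
      (\<Sum>j<n. c * connection_matrix \<delta> i j * w $ j)"
    unfolding connection_nth[OF \<delta> w i] lift_D_smult(2)[OF \<delta> c]
    by (simp add: distrib_left sum_distrib_left mult.assoc)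
qed

text \<open>
  Both connections preserve the twisted invariants, so their difference commutes with the twisted
  action. On matrices this is conjugation by the cocycle.
\<close>

lemma connection_matrix_act:
  assumes \<delta>: "\<delta> \<in> derivations F R" and g: "g \<in> carrier \<G>" and i: "i < n" and l: "l < n"
  shows "connection_matrix \<delta> i l =
    (\<Sum>k<n. \<Sum>j<n. r g $$ (i, k) * act g (connection_matrix \<delta> k j) * r_inv g j l)"
proof (rule connection_matrix_eqI[OF \<delta> _ i l])
  fix w i assume w: "w \<in> twisted_invariants" and i: "i < n"
  note wc = twisted_invariants_carrier[OF w]
  let ?A = "connection_matrix \<delta>"
  have c: "nabla \<delta> w \<in> twisted_invariants" by (rule connection_closed[OF \<delta> w])
  have "nabla \<delta> w $ i = (\<Sum>k<n. r g $$ (i, k) * act g (nabla \<delta> w $ k))"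
    using twist_nth[OF g twisted_invariants_carrier[OF c] i] twisted_invariants_twist[OF c g] by simp
  also have "\<dots> = (\<Sum>k<n. r g $$ (i, k) * act g (extension \<delta> (w $ k)) +
      (\<Sum>l<n. (\<Sum>j<n. r g $$ (i, k) * act g (?A k j) * r_inv g j l) * w $ l))"
  proof (rule sum.cong[OF refl])
    fix k assume "k \<in> {..<n}"
    then have k: "k < n" by simp
    have "act g (\<Sum>j<n. ?A k j * w $ j) = (\<Sum>j<n. act g (?A k j) * (\<Sum>l<n. r_inv g j l * w $ l))"
      by (simp add: act_sum[OF g] act_mult[OF g] r_inv_act[OF g w])
    also have "\<dots> = (\<Sum>l<n. (\<Sum>j<n. act g (?A k j) * r_inv g j l) * w $ l)"
      unfolding sum_distrib_left sum_distrib_right mult.assoc by (rule sum.swap)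
    finally show "r g $$ (i, k) * act g (nabla \<delta> w $ k) = r g $$ (i, k) * act g (extension \<delta> (w $ k)) +
        (\<Sum>l<n. (\<Sum>j<n. r g $$ (i, k) * act g (?A k j) * r_inv g j l) * w $ l)"
      unfolding connection_nth[OF \<delta> w k] act_add[OF g]
      by (simp only: distrib_left sum_distrib_left sum_distrib_right mult.assoc)
  qed
  also have "\<dots> = (\<Sum>k<n. r g $$ (i, k) * act g (extension \<delta> (w $ k))) +
      (\<Sum>l<n. (\<Sum>k<n. \<Sum>j<n. r g $$ (i, k) * act g (?A k j) * r_inv g j l) * w $ l)"
  proof -
    define q where "q k l = (\<Sum>j<n. r g $$ (i, k) * act g (?A k j) * r_inv g j l)" for k l
    have "(\<Sum>k<n. \<Sum>l<n. q k l * w $ l) = (\<Sum>l<n. (\<Sum>k<n. q k l) * w $ l)"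
      unfolding sum_distrib_right by (rule sum.swap)
    then show ?thesis unfolding sum.distrib q_def by simp
  qed
  also have "(\<Sum>k<n. r g $$ (i, k) * act g (extension \<delta> (w $ k))) = extension \<delta> (w $ i)"
  proof -
    have c: "flat_connection \<delta> w \<in> twisted_invariants" by (rule flat_connection_closed[OF \<delta> w])
    have "(\<Sum>k<n. r g $$ (i, k) * act g (flat_connection \<delta> w $ k)) = flat_connection \<delta> w $ i"
      using twist_nth[OF g twisted_invariants_carrier[OF c] i] twisted_invariants_twist[OF c g] by simp
    then show ?thesis using w i by (simp add: flat_connection_nth)
  qed
  finally show "nabla \<delta> w $ i = extension \<delta> (w $ i) +
      (\<Sum>l<n. (\<Sum>k<n. \<Sum>j<n. r g $$ (i, k) * act g (?A k j) * r_inv g j l) * w $ l)" .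
qed

definition connection_trace :: "('a \<Rightarrow> 'a) \<Rightarrow> 'a" where
  "connection_trace \<delta> = (\<Sum>i<n. connection_matrix \<delta> i i)"

text \<open>
  Conjugation by the cocycle does not change the trace.
\<close>

lemma connection_trace_invariant:
  assumes \<delta>: "\<delta> \<in> derivations F R"
  shows "connection_trace \<delta> \<in> invariants"
proof -
  let ?A = "connection_matrix \<delta>"
  have "act g (connection_trace \<delta>) = connection_trace \<delta>" if g: "g \<in> carrier \<G>" for g
  proof -
    have "connection_trace \<delta> = (\<Sum>i<n. \<Sum>k<n. \<Sum>j<n. r g $$ (i, k) * act g (?A k j) * r_inv g j i)"
      unfolding connection_trace_def by (rule sum.cong[OF refl], rule connection_matrix_act[OF \<delta> g]) simp_all
    also have "\<dots> = (\<Sum>k<n. \<Sum>i<n. \<Sum>j<n. act g (?A k j) * (r_inv g j i * r g $$ (i, k)))"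
      by (subst sum.swap, intro sum.cong refl) (simp only: mult_ac)
    also have "\<dots> = (\<Sum>k<n. \<Sum>j<n. act g (?A k j) * (\<Sum>i<n. r_inv g j i * r g $$ (i, k)))"
      unfolding sum_distrib_left by (rule sum.cong[OF refl], rule sum.swap)
    also have "\<dots> = (\<Sum>k<n. act g (?A k k))"
    proof (rule sum.cong[OF refl])
      fix k assume "k \<in> {..<n}"
      then have k: "k < n" by simp
      have "(\<Sum>j<n. act g (?A k j) * (\<Sum>i<n. r_inv g j i * r g $$ (i, k))) = (\<Sum>j<n. if j = k then act g (?A k j) else 0)"
        by (rule sum.cong[OF refl]) (simp add: r_inv_mult[OF g _ k])
      then show "(\<Sum>j<n. act g (?A k j) * (\<Sum>i<n. r_inv g j i * r g $$ (i, k))) = act g (?A k k)"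
        using k by simp
    qed
    also have "\<dots> = act g (connection_trace \<delta>)"
      by (simp add: connection_trace_def act_sum[OF g])
    finally show ?thesis by simp
  qed
  then show ?thesis by (simp add: invariants_def)
qed

lemma linear_functional_connection_trace: "linear_functional connection_trace"
  unfolding linear_functional_def connection_trace_def
  using connection_trace_invariant[unfolded connection_trace_def]
  by (simp add: connection_matrix_add connection_matrix_smult sum.distrib sum_distrib_left)

section \<open>The curvature in coordinates\<close>

text \<open>
  The curvature of \<open>d + A\<close>, where \<open>A\<close> is the connection matrix.
\<close>

definition curvature_matrix :: "('a \<Rightarrow> 'a) \<Rightarrow> ('a \<Rightarrow> 'a) \<Rightarrow> nat \<Rightarrow> nat \<Rightarrow> 'a" where
  "curvature_matrix \<delta> \<eta> i j =
     extension \<delta> (connection_matrix \<eta> i j) - extension \<eta> (connection_matrix \<delta> i j) +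
     (\<Sum>k<n. connection_matrix \<delta> i k * connection_matrix \<eta> k j - connection_matrix \<eta> i k * connection_matrix \<delta> k j) -
     connection_matrix (lie_bracket R \<delta> \<eta>) i j"

lemma curvature_closed:
  assumes \<delta>: "\<delta> \<in> derivations F R" and \<eta>: "\<eta> \<in> derivations F R" and w: "w \<in> twisted_invariants"
  shows "curvature R W nabla \<delta> \<eta> w = nabla \<delta> (nabla \<eta> w) - nabla \<eta> (nabla \<delta> w) - nabla (lie_bracket R \<delta> \<eta>) w"
    "curvature R W nabla \<delta> \<eta> w \<in> twisted_invariants"
proof -
  note c = connection_closed[OF \<delta>] connection_closed[OF \<eta>] connection_closed[OF lie_bracket_derivation[OF \<delta> \<eta>]]
  show eq: "curvature R W nabla \<delta> \<eta> w = nabla \<delta> (nabla \<eta> w) - nabla \<eta> (nabla \<delta> w) - nabla (lie_bracket R \<delta> \<eta>) w"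
    unfolding curvature_def using w by (simp add: W_minus W_minus_closed c)
  show "curvature R W nabla \<delta> \<eta> w \<in> twisted_invariants"
    unfolding eq using w by (simp add: W_minus_closed c)
qed

lemma curvature_nth:
  assumes \<delta>: "\<delta> \<in> derivations F R" and \<eta>: "\<eta> \<in> derivations F R" and w: "w \<in> twisted_invariants" and i: "i < n"
  shows "curvature R W nabla \<delta> \<eta> w $ i = (\<Sum>j<n. curvature_matrix \<delta> \<eta> i j * w $ j)"
proof -
  let ?A = "connection_matrix" and ?E = extension
  note br = lie_bracket_derivation[OF \<delta> \<eta>]
  have twice: "nabla \<delta> (nabla \<eta> w) $ i = ?E \<delta> (?E \<eta> (w $ i)) + (\<Sum>j<n. ?A \<eta> i j * ?E \<delta> (w $ j)) +
      (\<Sum>j<n. ?A \<delta> i j * ?E \<eta> (w $ j)) + (\<Sum>j<n. ?E \<delta> (?A \<eta> i j) * w $ j) +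
      (\<Sum>j<n. (\<Sum>k<n. ?A \<delta> i k * ?A \<eta> k j) * w $ j)"
    if \<delta>: "\<delta> \<in> derivations F R" and \<eta>: "\<eta> \<in> derivations F R" for \<delta> \<eta>
  proof -
    have "nabla \<delta> (nabla \<eta> w) $ i = ?E \<delta> (nabla \<eta> w $ i) + (\<Sum>k<n. ?A \<delta> i k * nabla \<eta> w $ k)"
      by (rule connection_nth[OF \<delta> connection_closed[OF \<eta> w] i])
    also have "?E \<delta> (nabla \<eta> w $ i) = ?E \<delta> (?E \<eta> (w $ i)) + (\<Sum>j<n. ?A \<eta> i j * ?E \<delta> (w $ j)) + (\<Sum>j<n. ?E \<delta> (?A \<eta> i j) * w $ j)"
      unfolding connection_nth[OF \<eta> w i] lift_add[OF \<delta>] lift_sum[OF \<delta>] lift_mult[OF \<delta>]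
      by (simp add: sum.distrib)
    also have "(\<Sum>k<n. ?A \<delta> i k * nabla \<eta> w $ k) =
        (\<Sum>k<n. ?A \<delta> i k * ?E \<eta> (w $ k)) + (\<Sum>k<n. \<Sum>j<n. ?A \<delta> i k * ?A \<eta> k j * w $ j)"
      by (simp add: connection_nth[OF \<eta> w] distrib_left sum.distrib sum_distrib_left mult.assoc)
    also have "(\<Sum>k<n. \<Sum>j<n. ?A \<delta> i k * ?A \<eta> k j * w $ j) = (\<Sum>j<n. (\<Sum>k<n. ?A \<delta> i k * ?A \<eta> k j) * w $ j)"
      unfolding sum_distrib_right by (rule sum.swap)
    finally show ?thesis by (simp only: ac_simps)
  qed
  have "curvature R W nabla \<delta> \<eta> w $ i =
      nabla \<delta> (nabla \<eta> w) $ i - nabla \<eta> (nabla \<delta> w) $ i - nabla (lie_bracket R \<delta> \<eta>) w $ i"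
    unfolding curvature_closed(1)[OF \<delta> \<eta> w]
    using i w by (simp add: connection_closed[OF \<delta>] connection_closed[OF \<eta>] connection_closed[OF br])
  also have "\<dots> = (\<Sum>j<n. ?E \<delta> (?A \<eta> i j) * w $ j) - (\<Sum>j<n. ?E \<eta> (?A \<delta> i j) * w $ j) +
      ((\<Sum>j<n. (\<Sum>k<n. ?A \<delta> i k * ?A \<eta> k j) * w $ j) - (\<Sum>j<n. (\<Sum>k<n. ?A \<eta> i k * ?A \<delta> k j) * w $ j)) -
      (\<Sum>j<n. ?A (lie_bracket R \<delta> \<eta>) i j * w $ j)"
    unfolding twice[OF \<delta> \<eta>] twice[OF \<eta> \<delta>] connection_nth[OF br w i] lift_bracket[OF \<delta> \<eta>] by simp
  also have "\<dots> = (\<Sum>j<n. curvature_matrix \<delta> \<eta> i j * w $ j)"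
    by (simp add: curvature_matrix_def sum_subtractf sum.distrib left_diff_distrib distrib_right)
  finally show ?thesis .
qed

text \<open>The commutator of the connection matrices has trace zero.\<close>

lemma curvature_matrix_trace:
  assumes \<delta>: "\<delta> \<in> derivations F R" and \<eta>: "\<eta> \<in> derivations F R"
  shows "(\<Sum>i<n. curvature_matrix \<delta> \<eta> i i) =
    \<delta> (connection_trace \<eta>) - \<eta> (connection_trace \<delta>) - connection_trace (lie_bracket R \<delta> \<eta>)"
proof -
  let ?A = "connection_matrix"
  have "(\<Sum>i<n. \<Sum>k<n. ?A \<delta> i k * ?A \<eta> k i) = (\<Sum>i<n. \<Sum>k<n. ?A \<eta> i k * ?A \<delta> k i)"
    by (subst sum.swap) (simp only: mult.commute)
  moreover have "extension \<delta> (connection_trace \<eta>) = \<delta> (connection_trace \<eta>)"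
    "extension \<eta> (connection_trace \<delta>) = \<eta> (connection_trace \<delta>)"
    by (rule lift_restrict[OF \<delta> connection_trace_invariant[OF \<eta>]] lift_restrict[OF \<eta> connection_trace_invariant[OF \<delta>]])+
  ultimately show ?thesis
    by (simp add: curvature_matrix_def connection_trace_def sum.distrib sum_subtractf lift_sum[OF \<delta>] lift_sum[OF \<eta>])
qed

lemma curvature_matrix_swap:
  assumes \<delta>: "\<delta> \<in> derivations F R" and \<eta>: "\<eta> \<in> derivations F R" and i: "i < n" and j: "j < n"
  shows "curvature_matrix \<eta> \<delta> i j = - curvature_matrix \<delta> \<eta> i j"
proof -
  have m1: "- 1 \<in> invariants" by (simp add: invariants_closed)
  have "lie_bracket R \<eta> \<delta> = (- 1) \<odot>\<^bsub>D\<^esub> lie_bracket R \<delta> \<eta>"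
    unfolding D_simps
  proof (rule extensionalityI[of _ invariants])
    show "lie_bracket R \<eta> \<delta> \<in> extensional invariants" by (simp add: lie_bracket_def R_simps)
    show "lie_bracket R \<eta> \<delta> b = (\<lambda>b\<in>invariants. - 1 * lie_bracket R \<delta> \<eta> b) b" if "b \<in> invariants" for b
      using that by (simp add: lie_bracket_value[OF \<delta> \<eta>] lie_bracket_value[OF \<eta> \<delta>])
  qed simp
  then have "connection_matrix (lie_bracket R \<eta> \<delta>) i j = - connection_matrix (lie_bracket R \<delta> \<eta>) i j"
    using connection_matrix_smult[OF lie_bracket_derivation[OF \<delta> \<eta>] m1 i j] by simp
  then show ?thesis
    by (simp add: curvature_matrix_def sum_subtractf)
qed

text \<open>
  The derivative of the coefficient \<open>b\<close> along \<open>\<eta>\<close> enters through the Leibniz rule and through the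
  bracket, with opposite signs.
\<close>

lemma curvature_matrix_smult:
  assumes \<delta>: "\<delta> \<in> derivations F R" and \<eta>: "\<eta> \<in> derivations F R" and b: "b \<in> invariants" and i: "i < n" and j: "j < n"
  shows "curvature_matrix (b \<odot>\<^bsub>D\<^esub> \<delta>) \<eta> i j = b * curvature_matrix \<delta> \<eta> i j"
proof -
  let ?A = "connection_matrix"
  have c: "- \<eta> b \<in> invariants" using derivations_D(1)[OF \<eta> b] by (simp add: invariants_closed)
  note der = lie_bracket_derivation[OF \<delta> \<eta>] lift_D_smult(1)[OF \<delta> b]
  have "lie_bracket R (b \<odot>\<^bsub>D\<^esub> \<delta>) \<eta> = b \<odot>\<^bsub>D\<^esub> lie_bracket R \<delta> \<eta> \<oplus>\<^bsub>D\<^esub> (- \<eta> b) \<odot>\<^bsub>D\<^esub> \<delta>"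
  proof (rule extensionalityI[of _ invariants])
    show "lie_bracket R (b \<odot>\<^bsub>D\<^esub> \<delta>) \<eta> \<in> extensional invariants" by (simp add: lie_bracket_def R_simps)
    show "b \<odot>\<^bsub>D\<^esub> lie_bracket R \<delta> \<eta> \<oplus>\<^bsub>D\<^esub> (- \<eta> b) \<odot>\<^bsub>D\<^esub> \<delta> \<in> extensional invariants" by (simp add: D_simps)
    fix x assume x: "x \<in> invariants"
    note xs = x derivations_D(1)[OF \<eta> x] derivations_D(1)[OF \<delta> x] b
    have "lie_bracket R (b \<odot>\<^bsub>D\<^esub> \<delta>) \<eta> x = (b \<odot>\<^bsub>D\<^esub> \<delta>) (\<eta> x) - \<eta> ((b \<odot>\<^bsub>D\<^esub> \<delta>) x)"
      by (rule lie_bracket_value[OF der(2) \<eta> x])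
    also have "\<dots> = b * (\<delta> (\<eta> x) - \<eta> (\<delta> x)) - \<eta> b * \<delta> x"
      using xs by (simp add: D_simps derivations_D(4)[OF \<eta>] algebra_simps)
    finally show "lie_bracket R (b \<odot>\<^bsub>D\<^esub> \<delta>) \<eta> x = (b \<odot>\<^bsub>D\<^esub> lie_bracket R \<delta> \<eta> \<oplus>\<^bsub>D\<^esub> (- \<eta> b) \<odot>\<^bsub>D\<^esub> \<delta>) x"
      using x by (simp add: D_simps lie_bracket_value[OF \<delta> \<eta>])
  qed
  then have "?A (lie_bracket R (b \<odot>\<^bsub>D\<^esub> \<delta>) \<eta>) i j = b * ?A (lie_bracket R \<delta> \<eta>) i j - \<eta> b * ?A \<delta> i j"
    by (simp only: connection_matrix_add[OF lift_D_smult(1)[OF der(1) b] lift_D_smult(1)[OF \<delta> c] i j]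
      connection_matrix_smult[OF der(1) b i j] connection_matrix_smult[OF \<delta> c i j]) simp
  then show ?thesis
    unfolding curvature_matrix_def lift_D_smult(2)[OF \<delta> b] connection_matrix_smult[OF \<delta> b i j]
      lift_mult[OF \<eta>] lift_restrict[OF \<eta> b]
    using i j
    by (simp add: connection_matrix_smult[OF \<delta> b] sum_distrib_left algebra_simps)
qed

end

end

section \<open>The trace of the curvature\<close>

context twisted_algebra
begin

context
  fixes nabla assumes nabla: "is_connection F R W nabla"
begin

text \<open>
  The curvature is linear over the invariants in both arguments, so it extends to
  fractions of derivations.
\<close>

lemma curvature_matrix_cong:
  assumes \<delta>: "\<delta> \<in> derivations F R" "\<delta>' \<in> derivations F R" and \<eta>: "\<eta> \<in> derivations F R" "\<eta>' \<in> derivations F R"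
    and s: "s \<in> invariants" "s' \<in> invariants" "s \<noteq> 0" "s' \<noteq> 0" and t: "t \<in> invariants" "t' \<in> invariants" "t \<noteq> 0" "t' \<noteq> 0"
    and eq: "\<And>b. b \<in> invariants \<Longrightarrow> Fract (\<delta> b) s = Fract (\<delta>' b) s'" "\<And>b. b \<in> invariants \<Longrightarrow> Fract (\<eta> b) t = Fract (\<eta>' b) t'"
    and i: "i < n" and j: "j < n"
  shows "Fract (curvature_matrix nabla \<delta> \<eta> i j) (s * t) = Fract (curvature_matrix nabla \<delta>' \<eta>' i j) (s' * t')"
proof -
  let ?\<Omega> = "\<lambda>\<delta> \<eta>. curvature_matrix nabla \<delta> \<eta> i j"
  note swap = curvature_matrix_swap[OF nabla _ _ i j] and smult = curvature_matrix_smult[OF nabla _ _ _ i j]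
  have "s' \<odot>\<^bsub>D\<^esub> \<delta> = s \<odot>\<^bsub>D\<^esub> \<delta>'"
    unfolding D_simps using eq(1) s by (intro restrict_ext) (simp add: eq_fract mult.commute)
  then have 1: "s' * ?\<Omega> \<delta> \<eta> = s * ?\<Omega> \<delta>' \<eta>"
    using smult[OF \<delta>(1) \<eta>(1) s(2)] smult[OF \<delta>(2) \<eta>(1) s(1)] by simp
  have "t' \<odot>\<^bsub>D\<^esub> \<eta> = t \<odot>\<^bsub>D\<^esub> \<eta>'"
    unfolding D_simps using eq(2) t by (intro restrict_ext) (simp add: eq_fract mult.commute)
  then have "t' * ?\<Omega> \<eta> \<delta>' = t * ?\<Omega> \<eta>' \<delta>'"
    using smult[OF \<eta>(1) \<delta>(2) t(2)] smult[OF \<eta>(2) \<delta>(2) t(1)] by simp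
  then have 2: "t' * ?\<Omega> \<delta>' \<eta> = t * ?\<Omega> \<delta>' \<eta>'"
    unfolding swap[OF \<delta>(2) \<eta>(1)] swap[OF \<delta>(2) \<eta>(2)] by simp
  have "?\<Omega> \<delta> \<eta> * (s' * t') = t' * (s' * ?\<Omega> \<delta> \<eta>)" by (simp only: mult_ac)
  also have "\<dots> = s * (t' * ?\<Omega> \<delta>' \<eta>)" unfolding 1 by (simp only: mult_ac)
  also have "\<dots> = ?\<Omega> \<delta>' \<eta>' * (s * t)" unfolding 2 by (simp only: mult_ac)
  finally show ?thesis using s t by (simp add: eq_fract)
qed

lemma curvature_value:
  assumes \<delta>: "\<delta> \<in> derivations F R" and \<eta>: "\<eta> \<in> derivations F R" and w: "w \<in> twisted_invariants"
    and stu: "s \<noteq> 0" "t \<noteq> 0" "u \<noteq> 0" and i: "i < n"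
  shows "Fract (curvature R W nabla \<delta> \<eta> w $ i) (s * t * u) =
    (\<Sum>j<n. Fract (curvature_matrix nabla \<delta> \<eta> i j) (s * t) * Fract (w $ j) u)"
  unfolding curvature_nth[OF nabla \<delta> \<eta> w i] mult_fract
  by (rule Fract_sum[symmetric]) (use stu in simp)

lemma stalk_curvature_frac:
  assumes P: "P \<in> Spec R" and \<delta>: "\<delta> \<in> derivations F R" "s \<in> invariants - P"
    and \<eta>: "\<eta> \<in> derivations F R" "t \<in> invariants - P" and w: "w \<in> twisted_invariants" "u \<in> invariants - P"
  shows "stalk_curvature R W nabla P (quot D P \<delta> s) (quot D P \<eta> t) (quot W P w u) =
    quot W P (curvature R W nabla \<delta> \<eta> w) (s * t * u)"
proof -
  interpret D: torsion_free_module invariants D der_emb by (rule derivation_torsion_free)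
  define C where "C = (\<lambda>(\<delta>, s) (\<eta>, t) (w, u). quot W P (curvature R W nabla \<delta> \<eta> w) (s * t * u))"
  have memD: "\<delta> \<in> carrier D" "\<eta> \<in> carrier D" using \<delta> \<eta> by (simp_all only: D_simps)
  have wW: "w \<in> carrier W" using w by simp
  have z: "quot W P w u \<in> carrier (stalk R W P)"
    by (rule quot_carrier[OF wW w(2)])
  have const: "C x y z = C (\<delta>, s) (\<eta>, t) (w, u)"
    if x: "x \<in> quot D P \<delta> s" and y: "y \<in> quot D P \<eta> t" and z: "z \<in> quot W P w u" for x y z
  proof -
    obtain \<delta>' s' \<eta>' t' w' u' where xyz: "x = (\<delta>', s')" "y = (\<eta>', t')" "z = (w', u')"
      by (metis surj_pair)
    have x': "\<delta>' \<in> derivations F R" "s' \<in> invariants - P" "\<And>b. Fract (der_emb \<delta>' b) s' = Fract (der_emb \<delta> b) s"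
      using x unfolding xyz D.quot_eq[OF P memD(1) \<delta>(2)] by (auto simp: D_simps)
    have y': "\<eta>' \<in> derivations F R" "t' \<in> invariants - P" "\<And>b. Fract (der_emb \<eta>' b) t' = Fract (der_emb \<eta> b) t"
      using y unfolding xyz D.quot_eq[OF P memD(2) \<eta>(2)] by (auto simp: D_simps)
    have z': "w' \<in> twisted_invariants" "u' \<in> invariants - P" "\<And>i. Fract (vec_emb w' i) u' = Fract (vec_emb w i) u"
      using z unfolding xyz W.quot_eq[OF P wW w(2)] by auto
    have nz: "s \<noteq> 0" "t \<noteq> 0" "u \<noteq> 0" "s' \<noteq> 0" "t' \<noteq> 0" "u' \<noteq> 0"
      using Spec_D(5)[OF P] \<delta>(2) \<eta>(2) w(2) x'(2) y'(2) z'(2) by blast+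
    have inv: "s \<in> invariants" "t \<in> invariants" "s' \<in> invariants" "t' \<in> invariants"
      using \<delta>(2) \<eta>(2) x'(2) y'(2) by blast+
    have stu: "s * t * u \<in> invariants - P" "s' * t' * u' \<in> invariants - P"
      using \<delta>(2) \<eta>(2) w(2) x'(2) y'(2) z'(2) Spec_D(4)[OF P] by (auto simp: invariants_closed)
    have cl: "curvature R W nabla \<delta> \<eta> w \<in> carrier W" "curvature R W nabla \<delta>' \<eta>' w' \<in> carrier W"
      using curvature_closed(2)[OF nabla] \<delta> \<eta> w x' y' z' by simp_all
    have eqD: "Fract (\<delta>' b) s' = Fract (\<delta> b) s" "Fract (\<eta>' b) t' = Fract (\<eta> b) t" if "b \<in> invariants" for b
      using x'(3)[of b] y'(3)[of b] that by (simp_all add: der_emb_def)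
    have eqW: "Fract (w' $ j) u' = Fract (w $ j) u" if "j < n" for j
      using z'(3)[of j] that by (simp add: vec_emb_def)
    have "Fract (vec_emb (curvature R W nabla \<delta>' \<eta>' w') i) (s' * t' * u') =
        Fract (vec_emb (curvature R W nabla \<delta> \<eta> w) i) (s * t * u)" for i
    proof (cases "i < n")
      case i: True
      have "Fract (curvature_matrix nabla \<delta>' \<eta>' i j) (s' * t') = Fract (curvature_matrix nabla \<delta> \<eta> i j) (s * t)"
        if j: "j < n" for j
        by (rule curvature_matrix_cong[OF x'(1) \<delta>(1) y'(1) \<eta>(1)]) (assumption | rule eqD inv nz i j)+
      then have "Fract (curvature_matrix nabla \<delta>' \<eta>' i j) (s' * t') * Fract (w' $ j) u' =
          Fract (curvature_matrix nabla \<delta> \<eta> i j) (s * t) * Fract (w $ j) u" if "j < n" for j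
        using that eqW[OF that] by (simp only:)
      then have "Fract (curvature R W nabla \<delta>' \<eta>' w' $ i) (s' * t' * u') = Fract (curvature R W nabla \<delta> \<eta> w $ i) (s * t * u)"
        unfolding curvature_value[OF x'(1) y'(1) z'(1) nz(4-6) i] curvature_value[OF \<delta>(1) \<eta>(1) w(1) nz(1-3) i]
        by (intro sum.cong refl) (simp only: lessThan_iff)
      then show ?thesis using i by (simp add: vec_emb_def)
    qed (simp add: vec_emb_def fract_collapse)
    then show ?thesis
      unfolding xyz C_def using W.frac_eq_iff[OF P cl(2) stu(2) cl(1) stu(1)] by simp
  qed
  have mem: "(\<delta>, s) \<in> quot D P \<delta> s" "(\<eta>, t) \<in> quot D P \<eta> t" "(w, u) \<in> quot W P w u"
    unfolding D.quot_eq[OF P memD(1) \<delta>(2)] D.quot_eq[OF P memD(2) \<eta>(2)] W.quot_eq[OF P wW w(2)]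
    using memD wW \<delta>(2) \<eta>(2) w(2) by blast+
  have "(\<Union>x\<in>quot D P \<delta> s. \<Union>y\<in>quot D P \<eta> t. \<Union>z\<in>quot W P w u. C x y z) = C (\<delta>, s) (\<eta>, t) (w, u)"
    using const mem by blast
  then show ?thesis
    unfolding stalk_curvature_def C_def R_simps using z by (simp add: case_prod_unfold)
qed

lemma trace_curvature_value:
  assumes P: "P \<in> locally_free_locus R W" "P \<in> Spec R" and \<delta>: "\<delta> \<in> derivations F R" "s \<in> invariants - P"
    and \<eta>: "\<eta> \<in> derivations F R" "t \<in> invariants - P"
  defines "T \<equiv> module_trace (stalk_ring R P) (stalk R W P) (stalk_curvature R W nabla P (quot D P \<delta> s) (quot D P \<eta> t))"
  shows "T \<in> carrier (stalk_ring R P)"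
    "rval T = Fract (\<delta> (connection_trace nabla \<eta>) - \<eta> (connection_trace nabla \<delta>) -
      connection_trace nabla (lie_bracket R \<delta> \<eta>)) (s * t)"
proof -
  let ?\<phi> = "stalk_curvature R W nabla P (quot D P \<delta> s) (quot D P \<eta> t)"
  let ?K = "\<lambda>i j. Fract (curvature_matrix nabla \<delta> \<eta> i j) (s * t)"
  have nz: "s \<noteq> 0" "t \<noteq> 0" using Spec_D(5)[OF P(2)] \<delta>(2) \<eta>(2) by blast+
  have "?\<phi> z \<in> carrier (stalk R W P) \<and> (\<forall>i<n. W.val (?\<phi> z) i = (\<Sum>j<n. ?K i j * W.val z j))"
    if z: "z \<in> carrier (stalk R W P)" for z
  proof -
    obtain w u where w: "w \<in> carrier W" "u \<in> invariants - P" "z = quot W P w u"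
      using stalk_cases[OF z] by blast
    have w': "w \<in> twisted_invariants" using w(1) by simp
    have nzu: "u \<noteq> 0" using Spec_D(5)[OF P(2)] w(2) by blast
    have stu: "s * t * u \<in> invariants - P"
      using \<delta>(2) \<eta>(2) w(2) Spec_D(4)[OF P(2)] by (auto simp: invariants_closed)
    have c: "curvature R W nabla \<delta> \<eta> w \<in> carrier W"
      using curvature_closed(2)[OF nabla \<delta>(1) \<eta>(1) w'] by simp
    have \<phi>: "?\<phi> z = quot W P (curvature R W nabla \<delta> \<eta> w) (s * t * u)"
      unfolding w(3) by (rule stalk_curvature_frac[OF P(2) \<delta> \<eta> w' w(2)])
    have "W.val (?\<phi> z) i = (\<Sum>j<n. ?K i j * W.val z j)" if i: "i < n" for i
    proof -
      have "W.val (?\<phi> z) i = Fract (curvature R W nabla \<delta> \<eta> w $ i) (s * t * u)"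
        unfolding \<phi> W.frac_val_frac[OF P(2) c stu] using i by (simp add: vec_emb_def)
      also have "\<dots> = (\<Sum>j<n. ?K i j * Fract (w $ j) u)"
        by (rule curvature_value[OF \<delta>(1) \<eta>(1) w' nz nzu i])
      also have "\<dots> = (\<Sum>j<n. ?K i j * W.val z j)"
        unfolding w(3) W.frac_val_frac[OF P(2) w(1,2)] by (rule sum.cong[OF refl]) (simp add: vec_emb_def)
      finally show ?thesis .
    qed
    then show ?thesis
      unfolding \<phi> using quot_carrier[OF c stu] by blast
  qed
  then have \<phi>: "\<And>z. z \<in> carrier (stalk R W P) \<Longrightarrow> ?\<phi> z \<in> carrier (stalk R W P)"
    and K: "\<And>z i. z \<in> carrier (stalk R W P) \<Longrightarrow> i < n \<Longrightarrow> W.val (?\<phi> z) i = (\<Sum>j<n. ?K i j * W.val z j)"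
    by blast+
  show "T \<in> carrier (stalk_ring R P)"
    unfolding T_def by (rule module_trace_value(2)[OF P(1) \<phi> K])
  have "rval T = (\<Sum>i<n. ?K i i)"
    unfolding T_def by (rule module_trace_value(1)[OF P(1) \<phi> K])
  also have "\<dots> = Fract (\<Sum>i<n. curvature_matrix nabla \<delta> \<eta> i i) (s * t)"
    by (rule Fract_sum) (use nz in simp)
  finally show "rval T = Fract (\<delta> (connection_trace nabla \<eta>) - \<eta> (connection_trace nabla \<delta>) -
      connection_trace nabla (lie_bracket R \<delta> \<eta>)) (s * t)"
    unfolding curvature_matrix_trace[OF nabla \<delta>(1) \<eta>(1)] .
qed

text \<open>
  A primitive of the trace of the curvature is the trace of the connection matrix. It is defined
  globally, because the flat connection is.
\<close>

lemma trace_curvature_exact: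
  "trace_curvature F R W nabla =
    differential 1 R D (locally_free_locus R W) (induced_cochain (connection_trace nabla) (locally_free_locus R W))"
proof (rule differential_1_eqI[symmetric])
  let ?U = "locally_free_locus R W"
  let ?\<phi> = "induced_cochain (connection_trace nabla) ?U"
  define X where "X V gs = (\<lambda>P\<in>V. module_trace (stalk_ring R P) (stalk R W P)
      (stalk_curvature R W nabla P ((gs ! 0) P) ((gs ! 1) P)))" for V and gs :: "'a der_section list"
  note \<psi> = linear_functional_connection_trace[OF nabla]
  show "trace_curvature F R W nabla = (\<lambda>V\<in>opens_in R ?U. \<lambda>gs\<in>tuples 2 (sections R D V). X V gs)"
    unfolding trace_curvature_def linear_lie_rinehart_eq X_def ..
  show \<phi>: "?\<phi> \<in> cochains 1 R D ?U"
    by (rule induced_cochain[OF \<psi>])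
  have val: "X V [g, h] P \<in> carrier (stalk_ring R P) \<and> rval (differential 1 R D ?U ?\<phi> V [g, h] P) = rval (X V [g, h] P)"
    if V: "V \<in> opens_in R ?U" and g: "g \<in> sections R D V" and h: "h \<in> sections R D V" and P: "P \<in> V" for V g h P
  proof -
    have PU: "P \<in> ?U" using V P by (auto simp: opens_in_def)
    have PS: "P \<in> Spec R"
      using zariski_open_subset[OF opens_in_open[OF V]] P by blast
    obtain \<delta> s where \<delta>: "\<delta> \<in> carrier D" "s \<in> invariants - P" "g P = quot D P \<delta> s"
      using stalk_cases[OF sections_carrier[OF g P]] by blast
    obtain \<eta> t where \<eta>: "\<eta> \<in> carrier D" "t \<in> invariants - P" "h P = quot D P \<eta> t"
      using stalk_cases[OF sections_carrier[OF h P]] by blast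
    have der: "\<delta> \<in> derivations F R" "\<eta> \<in> derivations F R" using \<delta>(1) \<eta>(1) by (simp_all only: D_simps)
    have X: "X V [g, h] P = module_trace (stalk_ring R P) (stalk R W P)
        (stalk_curvature R W nabla P (quot D P \<delta> s) (quot D P \<eta> t))"
      using P by (simp add: X_def \<delta>(3) \<eta>(3))
    note T = trace_curvature_value[OF PU PS der(1) \<delta>(2) der(2) \<eta>(2), folded X]
    show ?thesis
      unfolding T(2) differential_induced_cochain[OF \<psi> V g h P der(1) \<delta>(2,3) der(2) \<eta>(2,3)]
      using T(1) by blast
  qed
  show "rval (differential 1 R D ?U ?\<phi> V [g, h] P) = rval (X V [g, h] P)"
    if "V \<in> opens_in R ?U" "g \<in> sections R D V" "h \<in> sections R D V" "P \<in> V" for V g h P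
    using val[OF that] by blast
  show "X V [g, h] \<in> \<O> V" if V: "V \<in> opens_in R ?U" and g: "g \<in> sections R D V" and h: "h \<in> sections R D V" for V g h
  proof -
    note d = differential_1(1)[OF \<phi> V g h]
    have "differential 1 R D ?U ?\<phi> V [g, h] = X V [g, h]"
    proof (rule extensionalityI[of _ V])
      show "differential 1 R D ?U ?\<phi> V [g, h] \<in> extensional V"
        by (rule sections_extensional[OF d])
      show "X V [g, h] \<in> extensional V" by (simp add: X_def)
      fix P assume P: "P \<in> V"
      have PS: "P \<in> Spec R"
        using zariski_open_subset[OF opens_in_open[OF V]] P by blast
      note v = val[OF V g h P]
      show "differential 1 R D ?U ?\<phi> V [g, h] P = X V [g, h] P"
        by (rule rval_inj[OF PS sections_carrier[OF d P] _ conjunct2[OF v]])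
          (use conjunct1[OF v] in \<open>simp only: stalk_ring_simps\<close>)
    qed
    with d show ?thesis by simp
  qed
qed

end

section \<open>The first Chern class\<close>

text \<open>
  Every connection yields the trivial class, so the definite description has exactly one candidate.
\<close>

theorem first_chern_class_trivial:
  "first_chern_class F R W = \<one>\<^bsub>chern_H2 F R W\<^esub>"
  unfolding first_chern_class_def
proof (rule the_equality)
  have eq: "cohomology_class 2 R (linear_lie_rinehart F R W) (locally_free_locus R W) (trace_curvature F R W nabla) =
      \<one>\<^bsub>chern_H2 F R W\<^esub>" if nabla: "is_connection F R W nabla" for nabla
    unfolding linear_lie_rinehart_eq trace_curvature_exact[OF nabla]
    by (rule cohomology_class_differential[OF linear_functional_connection_trace[OF nabla]])
  show "\<exists>nabla. is_connection F R W nabla \<and> \<one>\<^bsub>chern_H2 F R W\<^esub> =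
      cohomology_class 2 R (linear_lie_rinehart F R W) (locally_free_locus R W) (trace_curvature F R W nabla)"
    using flat_connection eq[OF flat_connection] by (intro exI[of _ flat_connection]) simp
  fix c assume "\<exists>nabla. is_connection F R W nabla \<and> c =
      cohomology_class 2 R (linear_lie_rinehart F R W) (locally_free_locus R W) (trace_curvature F R W nabla)"
  then show "c = \<one>\<^bsub>chern_H2 F R W\<^esub>" using eq by blast
qed

end

section \<open>The quotient singularity\<close>

theorem theorem4p2:
  fixes G :: "complex mat set" and n :: nat and \<rho> :: "complex mat \<Rightarrow> complex mat"
  assumes "subgroup G (GL 2)"
    and "finite G"
    and "\<forall>g\<in>G. \<not> pseudo_reflection g"
    and "\<rho> \<in> hom ((GL 2)\<lparr>carrier := G\<rparr>) (GL n)"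
  shows "let F = range const_xy; B = invariant_ring G; W = invariant_module G n \<rho> in
    (\<exists>nabla. is_connection F B W nabla) \<and> first_chern_class F B W = \<one>\<^bsub>chern_H2 F B W\<^esub>"
proof -
  interpret small_group G
    by (rule small_group.intro[OF assms(1-3)])
  have \<rho>: "\<rho> g \<in> carrier (GL n)" if "g \<in> G" for g
    using assms(4) that by (auto simp: hom_def)
  have \<rho>_carrier: "\<rho> g \<in> carrier_mat n n" if "g \<in> G" for g
    using \<rho>[OF that] carrier_GL by blast
  have \<rho>_mult: "\<rho> (g * h) = \<rho> g * \<rho> h" if "g \<in> G" "h \<in> G" for g h
    using assms(4) that by (auto simp: hom_def GL_simps)
  have "group_hom \<G> (GL n) \<rho>"
    by (rule group_hom.intro[OF subgroup.subgroup_is_group[OF subgroup group_GL] group_GL group_hom_axioms.intro[OF assms(4)]])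
  then have \<rho>_one: "\<rho> \<one>\<^bsub>\<G>\<^esub> = 1\<^sub>m n"
    using group_hom.hom_one by (fastforce simp: GL_simps)
  \<comment> \<open>Constant matrices are fixed by the action on polynomials, so a representation is a cocycle.\<close>
  interpret twisted_algebra \<G> act_poly n "\<lambda>g. map_mat const_xy (\<rho> g)" "range const_xy"
  proof unfold_locales
    fix g assume "g \<in> carrier \<G>"
    then have g: "g \<in> G" by simp
    show "map_mat const_xy (\<rho> g) \<in> carrier_mat n n"
      using \<rho>_carrier[OF g] by simp
    show "map_mat const_xy (\<rho> g) $$ (i, j) \<in> range const_xy" if "i < n" "j < n" for i j
      using \<rho>_carrier[OF g] that by simp
    fix h assume "h \<in> carrier \<G>"
    then have h: "h \<in> G" by simp
    show "map_mat const_xy (\<rho> (g \<otimes>\<^bsub>\<G>\<^esub> h)) = map_mat const_xy (\<rho> g) * map_mat (act_poly g) (map_mat const_xy (\<rho> h))"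
    proof (rule eq_matI)
      fix i j assume "i < dim_row (map_mat const_xy (\<rho> g) * map_mat (act_poly g) (map_mat const_xy (\<rho> h)))"
        "j < dim_col (map_mat const_xy (\<rho> g) * map_mat (act_poly g) (map_mat const_xy (\<rho> h)))"
      then have ij: "i < n" "j < n"
        using \<rho>_carrier[OF g] \<rho>_carrier[OF h] by auto
      have "const_xy (\<Sum>k\<in>S. a k * b k) = (\<Sum>k\<in>S. const_xy (a k) * const_xy (b k))" for S :: "nat set" and a b
        by (induction S rule: infinite_finite_induct) simp_all
      then show "map_mat const_xy (\<rho> (g \<otimes>\<^bsub>\<G>\<^esub> h)) $$ (i, j) =
          (map_mat const_xy (\<rho> g) * map_mat (act_poly g) (map_mat const_xy (\<rho> h))) $$ (i, j)"
        using ij \<rho>_carrier[OF g] \<rho>_carrier[OF h] by (simp add: GL_simps \<rho>_mult[OF g h] scalar_prod_def)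
    qed (use \<rho>_carrier[OF g] \<rho>_carrier[OF h] in \<open>simp_all add: GL_simps \<rho>_mult[OF g h]\<close>)
  next
    show "map_mat const_xy (\<rho> \<one>\<^bsub>\<G>\<^esub>) = 1\<^sub>m n"
      unfolding \<rho>_one by (rule eq_matI) simp_all
    show "range const_xy \<subseteq> invariants"
      by (auto simp: invariants_def)
  qed
  have "invariant_ring G = R"
    unfolding invariant_ring_def R_def unfolding invariants_def by simp
  moreover have "invariant_module G n \<rho> = W"
    by (simp add: invariant_module_def W_def twisted_invariants_def twist_def act_tensor_def)
  ultimately show ?thesis
    using flat_connection first_chern_class_trivial unfolding Let_def by auto
qed

end
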